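(* Let $w$ be a function in $C^{1,2}([0,T)\times\mathcal{O})\cap C^0([0,T]\times\bar{\mathcal{O}})$ satisfying the growth condition $$|w(t,\mathbf{x})|\le C(1+q^2)(1+a^{p_1})(1+e^{p_2\epsilon})\qquad\forall (t,\mathbf{x})=(t,a,\epsilon,q)\in[0,T]\times\mathcal{O}$$ for some fixed $p_1,p_2,C>0$. Assume there exists a measurable function $c^*(t,\mathbf{x})$ such that on $[0,T)\times\mathcal{O}$ \begin{align*} &\frac{\partial w}{\partial t}+\mathcal{L}w+\sup_{c\ge 0}\Big[-c\frac{\partial w}{\partial q}+ae^{\epsilon}c-\eta c^2\Big]-\phi_1q^2-\phi_2qae^{\epsilon}-\phi_3qa\\ &\quad=\frac{\partial w}{\partial t}+\mathcal{L}w-c^*\frac{\partial w}{\partial q}+ae^{\epsilon}c^*-\eta(c^* )^2-\phi_1q^2-\phi_2qae^{\epsilon}-\phi_3qa=0, \end{align*} with terminal condition $w(T,a,\epsilon,q)=q(ae^{\epsilon}-\chi q)$ and boundary condition $w(t,a,\epsilon,0)=0$. Assume that, for every initial condition $\mathbf{X}_t=\mathbf{x}$, the SDE $d\mathbf{X}_r=\mu(\mathbf{X}_r,c^*(r,\mathbf{X}_r))dr+\sigma(\mathbf{X}_r)d\mathbf{W}_r$ admits a unique solution, and that $(c^*(r,\mathbf{X}_r))_{r\in[t,T]}\in\mathcal{A}$. Then $w$ coincides with the value function $v$.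
   Context: Fix $T>0$ and a filtered probability space $(\Omega,\mathcal{F},(\mathcal{F}_t)_{t\in[0,T]},\mathbb{P})$ whose filtration is the natural filtration of two independent standard Brownian motions $W^1,W^2$, augmented by the $\mathbb{P}$-null sets; $\mathbf{W}=(W^1,W^2)$. Constants: $\mu_1,\sigma_1,k,\sigma_2>0$, $\rho\in[-1,1]$, $\eta\ge 0$, real constants $\chi,\phi_1,\phi_2,\phi_3$, and $0<q_0<\bar Q_0<\infty$. The state space is $\mathcal{O}=(0,\infty)\times\mathbb{R}\times[0,\bar Q_0)$ with points $\mathbf{x}=(a,\epsilon,q)$. An admissible control is a progressively measurable, non-negative, square-integrable process $c$; $\mathcal{A}$ denotes the set of admissible controls. For $t\in[0,T]$, $\mathbf{x}\in\mathcal{O}$ and $c\in\mathcal{A}$, the state $\mathbf{X}_r=(A_r,\varepsilon_r,Q_r)$, $r\in[t,T]$, solves $d\mathbf{X}_r=\mu(\mathbf{X}_r,c_r)dr+\sigma(\mathbf{X}_r)d\mathbf{W}_r$, $\mathbf{X}_t=\mathbf{x}$, where $\mu(\mathbf{x},c)=(\mu_1a,\,-k\epsilon,\,-c)^\top$ and $\sigma(\mathbf{x})$ is the $3\times2$ matrix with rows $(\sigma_1a,0)$, $(\sigma_2\rho,\sigma_2\sqrt{1-\rho^2})$, $(0,0)$; i.e. $dA_r=\mu_1A_rdr+\sigma_1A_rdW^1_r$, $d\varepsilon_r=-k\varepsilon_rdr+\sigma_2(\rho dW^1_r+\sqrt{1-\rho^2}dW^2_r)$, $dQ_r=-c_rdr$.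 Set $S_r=A_re^{\varepsilon_r}$, $M_r=\int_t^rc_u(S_u-\eta c_u)du$, and $\tau=T\wedge\min\{r\ge t: Q_r=0\}$. With $\mathbb{E}_t$ the expectation given $\mathbf{X}_t=\mathbf{x}$, define $v^c(t,\mathbf{x})=\mathbb{E}_t\big[M_\tau+Q_\tau(S_\tau-\chi Q_\tau)-\phi_1\int_t^\tau Q_r^2dr-\phi_2\int_t^\tau S_rQ_rdr-\phi_3\int_t^\tau A_rQ_rdr\big]$ and the value function $v(t,\mathbf{x})=\sup_{c\in\mathcal{A}}v^c(t,\mathbf{x})$. The operator $\mathcal{L}$ is $\mathcal{L}w=\frac{\sigma_1^2}{2}a^2\frac{\partial^2w}{\partial a^2}+\rho\sigma_1\sigma_2a\frac{\partial^2w}{\partial a\partial\epsilon}+\frac{\sigma_2^2}{2}\frac{\partial^2w}{\partial\epsilon^2}+\mu_1a\frac{\partial w}{\partial a}-k\epsilon\frac{\partial w}{\partial\epsilon}$. *)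

theory Defs
  imports "HOL-Probability.Probability"
begin

type_synonym state = "real \<times> real \<times> real"   (* (a, epsilon, q) *)

definition stateO :: "real \<Rightarrow> state set" where
  "stateO Qbar = {0<..} \<times> UNIV \<times> {0..<Qbar}"

definition stateO_cl :: "real \<Rightarrow> state set" where
  "stateO_cl Qbar = {0..} \<times> UNIV \<times> {0..Qbar}"

definition is_std_BM :: "'w measure \<Rightarrow> real \<Rightarrow> (real \<Rightarrow> 'w \<Rightarrow> real) \<Rightarrow> bool" where
  "is_std_BM M T W \<longleftrightarrow>
     (\<forall>s\<in>{0..T}. W s \<in> borel_measurable M) \<and>
     (\<forall>\<omega>\<in>space M. W 0 \<omega> = 0 \<and> continuous_on {0..T} (\<lambda>s. W s \<omega>)) \<and>
     (\<forall>s t. 0 \<le> s \<and> s < t \<and> t \<le> T \<longrightarrow>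
        distributed M lborel (\<lambda>\<omega>. W t \<omega> - W s \<omega>) (normal_density 0 (sqrt (t - s))) \<and>
        prob_space.indep_set M
          (sets (vimage_algebra (space M) (\<lambda>\<omega>. W t \<omega> - W s \<omega>) borel))
          (sets (vimage_algebra (space M) (\<lambda>\<omega>. restrict (\<lambda>u. W u \<omega>) {0..s}) (PiM {0..s} (\<lambda>_. borel)))))"

definition nat_filt :: "'w measure \<Rightarrow> (real \<Rightarrow> 'w \<Rightarrow> real) \<Rightarrow> (real \<Rightarrow> 'w \<Rightarrow> real) \<Rightarrow> real \<Rightarrow> 'w measure" where
  "nat_filt M W1 W2 s = sigma (space M)
     ((\<Union>u\<in>{0..s}. {W1 u -` B \<inter> space M | B. B \<in> sets borel} \<union>
                   {W2 u -` B \<inter> space M | B. B \<in> sets borel}) \<union> null_sets M)"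

definition progressive :: "(real \<Rightarrow> 'w measure) \<Rightarrow> real \<Rightarrow> real \<Rightarrow> (real \<Rightarrow> 'w \<Rightarrow> 'b::topological_space) \<Rightarrow> bool" where
  "progressive F t T c \<longleftrightarrow>
     (\<forall>s\<in>{t..T}. (\<lambda>(r,\<omega>). c r \<omega>) \<in> measurable (restrict_space borel {t..s} \<Otimes>\<^sub>M F s) borel)"

definition admissible :: "'w measure \<Rightarrow> (real \<Rightarrow> 'w \<Rightarrow> real) \<Rightarrow> (real \<Rightarrow> 'w \<Rightarrow> real) \<Rightarrow> real \<Rightarrow> real
    \<Rightarrow> (real \<Rightarrow> 'w \<Rightarrow> real) \<Rightarrow> bool" where
  "admissible M W1 W2 T t c \<longleftrightarrow>
     progressive (nat_filt M W1 W2) t T c \<and>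
     (\<forall>r\<in>{t..T}. \<forall>\<omega>\<in>space M. 0 \<le> c r \<omega>) \<and>
     (\<integral>\<^sup>+\<omega>. (\<integral>\<^sup>+r. ennreal ((c r \<omega>)\<^sup>2) * indicator {t..T} r \<partial>lborel) \<partial>M) < \<infinity>"

definition riemann_sum :: "(real \<Rightarrow> 'w \<Rightarrow> 'b::real_vector) \<Rightarrow> (real \<Rightarrow> 'w \<Rightarrow> real) \<Rightarrow> real \<Rightarrow> real \<Rightarrow> nat \<Rightarrow> 'w \<Rightarrow> 'b" where
  "riemann_sum H W t r n \<omega> =
     (\<Sum>i<2^n. (W (t + real (Suc i) * (r - t) / 2^n) \<omega> - W (t + real i * (r - t) / 2^n) \<omega>)
                  *\<^sub>R H (t + real i * (r - t) / 2^n) \<omega>)"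

text \<open>I is the Ito integral of the (continuous adapted) integrand H against W over [t,r]:
  the limit in probability of the left-point Riemann sums.\<close>
definition ito_integral :: "'w measure \<Rightarrow> (real \<Rightarrow> 'w \<Rightarrow> 'b::real_normed_vector) \<Rightarrow> (real \<Rightarrow> 'w \<Rightarrow> real)
    \<Rightarrow> real \<Rightarrow> real \<Rightarrow> ('w \<Rightarrow> 'b) \<Rightarrow> bool" where
  "ito_integral M H W t r I \<longleftrightarrow>
     I \<in> borel_measurable M \<and>
     (\<forall>e>0. (\<lambda>n. measure M {\<omega>\<in>space M. e < norm (riemann_sum H W t r n \<omega> - I \<omega>)}) \<longlonglongrightarrow> 0)"

text \<open>Drift mu(x,c) and the two columns of sigma(x).\<close>
definition drift :: "real \<Rightarrow> real \<Rightarrow> state \<Rightarrow> real \<Rightarrow> state" where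
  "drift mu1 k x c = (case x of (a, e, q) \<Rightarrow> (mu1 * a, - k * e, - c))"

definition diff1 :: "real \<Rightarrow> real \<Rightarrow> real \<Rightarrow> state \<Rightarrow> state" where
  "diff1 sig1 sig2 rho x = (case x of (a, e, q) \<Rightarrow> (sig1 * a, sig2 * rho, 0))"

definition diff2 :: "real \<Rightarrow> real \<Rightarrow> state \<Rightarrow> state" where
  "diff2 sig2 rho x = (0, sig2 * sqrt (1 - rho\<^sup>2), 0)"

definition sde_sol :: "'w measure \<Rightarrow> (real \<Rightarrow> 'w \<Rightarrow> real) \<Rightarrow> (real \<Rightarrow> 'w \<Rightarrow> real) \<Rightarrow> real
    \<Rightarrow> real \<Rightarrow> real \<Rightarrow> real \<Rightarrow> real \<Rightarrow> real
    \<Rightarrow> (real \<Rightarrow> 'w \<Rightarrow> real) \<Rightarrow> real \<Rightarrow> state \<Rightarrow> (real \<Rightarrow> 'w \<Rightarrow> state) \<Rightarrow> bool" where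
  "sde_sol M W1 W2 T mu1 sig1 k sig2 rho c t x X \<longleftrightarrow>
     (\<forall>r\<in>{t..T}. X r \<in> measurable (nat_filt M W1 W2 r) borel) \<and>
     (\<forall>\<omega>\<in>space M. X t \<omega> = x \<and> continuous_on {t..T} (\<lambda>r. X r \<omega>)) \<and>
     (\<forall>r\<in>{t..T}. \<exists>I1 I2.
        ito_integral M (\<lambda>u \<omega>. diff1 sig1 sig2 rho (X u \<omega>)) W1 t r I1 \<and>
        ito_integral M (\<lambda>u \<omega>. diff2 sig2 rho (X u \<omega>)) W2 t r I2 \<and>
        (AE \<omega> in M. X r \<omega> = x + (LINT u:{t..r}|lborel. drift mu1 k (X u \<omega>) (c u \<omega>)) + I1 \<omega> + I2 \<omega>))"

definition hit_time :: "real \<Rightarrow> real \<Rightarrow> (real \<Rightarrow> 'w \<Rightarrow> real) \<Rightarrow> 'w \<Rightarrow> real" where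
  "hit_time T t Q \<omega> = (if \<exists>r\<in>{t..T}. Q r \<omega> = 0 then Inf {r\<in>{t..T}. Q r \<omega> = 0} else T)"

definition perf :: "'w measure \<Rightarrow> (real \<Rightarrow> 'w \<Rightarrow> real) \<Rightarrow> (real \<Rightarrow> 'w \<Rightarrow> real) \<Rightarrow> real
    \<Rightarrow> real \<Rightarrow> real \<Rightarrow> real \<Rightarrow> real \<Rightarrow> real
    \<Rightarrow> real \<Rightarrow> real \<Rightarrow> real \<Rightarrow> real \<Rightarrow> real
    \<Rightarrow> (real \<Rightarrow> 'w \<Rightarrow> real) \<Rightarrow> real \<Rightarrow> state \<Rightarrow> real" where
  "perf M W1 W2 T mu1 sig1 k sig2 rho eta chi phi1 phi2 phi3 c t x =
     (let X = (SOME X. sde_sol M W1 W2 T mu1 sig1 k sig2 rho c t x X);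
          A = (\<lambda>r \<omega>. fst (X r \<omega>));
          E = (\<lambda>r \<omega>. fst (snd (X r \<omega>)));
          Q = (\<lambda>r \<omega>. snd (snd (X r \<omega>)));
          S = (\<lambda>r \<omega>. A r \<omega> * exp (E r \<omega>));
          \<tau> = hit_time T t Q
      in \<integral>\<omega>. (LINT u:{t..\<tau> \<omega>}|lborel. c u \<omega> * (S u \<omega> - eta * c u \<omega>))
             + Q (\<tau> \<omega>) \<omega> * (S (\<tau> \<omega>) \<omega> - chi * Q (\<tau> \<omega>) \<omega>)
             - phi1 * (LINT u:{t..\<tau> \<omega>}|lborel. (Q u \<omega>)\<^sup>2)
             - phi2 * (LINT u:{t..\<tau> \<omega>}|lborel. S u \<omega> * Q u \<omega>)
             - phi3 * (LINT u:{t..\<tau> \<omega>}|lborel. A u \<omega> * Q u \<omega>) \<partial>M)"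

definition value_fn :: "'w measure \<Rightarrow> (real \<Rightarrow> 'w \<Rightarrow> real) \<Rightarrow> (real \<Rightarrow> 'w \<Rightarrow> real) \<Rightarrow> real
    \<Rightarrow> real \<Rightarrow> real \<Rightarrow> real \<Rightarrow> real \<Rightarrow> real
    \<Rightarrow> real \<Rightarrow> real \<Rightarrow> real \<Rightarrow> real \<Rightarrow> real
    \<Rightarrow> real \<Rightarrow> state \<Rightarrow> ereal" where
  "value_fn M W1 W2 T mu1 sig1 k sig2 rho eta chi phi1 phi2 phi3 t x =
     (SUP c\<in>{c. admissible M W1 W2 T t c}.
        ereal (perf M W1 W2 T mu1 sig1 k sig2 rho eta chi phi1 phi2 phi3 c t x))"

text \<open>w is C^{1,2} on I x O with time derivative wt, space derivative Dw, second space derivative D2w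
  (all continuous on I x O; one-sided where I, O are not open).\<close>
definition C12_on :: "real set \<Rightarrow> state set \<Rightarrow> (real \<Rightarrow> state \<Rightarrow> real) \<Rightarrow> (real \<Rightarrow> state \<Rightarrow> real)
    \<Rightarrow> (real \<Rightarrow> state \<Rightarrow> state \<Rightarrow>\<^sub>L real) \<Rightarrow> (real \<Rightarrow> state \<Rightarrow> state \<Rightarrow>\<^sub>L (state \<Rightarrow>\<^sub>L real)) \<Rightarrow> bool" where
  "C12_on I U w wt Dw D2w \<longleftrightarrow>
     (\<forall>t\<in>I. \<forall>x\<in>U.
        ((\<lambda>s. w s x) has_real_derivative wt t x) (at t within I) \<and>
        (w t has_derivative blinfun_apply (Dw t x)) (at x within U) \<and>
        (Dw t has_derivative blinfun_apply (D2w t x)) (at x within U)) \<and>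
     continuous_on (I \<times> U) (\<lambda>(t,x). wt t x) \<and>
     continuous_on (I \<times> U) (\<lambda>(t,x). Dw t x) \<and>
     continuous_on (I \<times> U) (\<lambda>(t,x). D2w t x)"

text \<open>Partial derivatives read off from the Frechet derivatives.\<close>
definition d1 :: "(state \<Rightarrow>\<^sub>L real) \<Rightarrow> state \<Rightarrow> real" where
  "d1 D v = blinfun_apply D v"
definition d2 :: "(state \<Rightarrow>\<^sub>L (state \<Rightarrow>\<^sub>L real)) \<Rightarrow> state \<Rightarrow> state \<Rightarrow> real" where
  "d2 D v u = blinfun_apply (blinfun_apply D v) u"

definition ea :: state where "ea = (1, 0, 0)"
definition ee :: state where "ee = (0, 1, 0)"
definition eq :: state where "eq = (0, 0, 1)"

definition op_L :: "real \<Rightarrow> real \<Rightarrow> real \<Rightarrow> real \<Rightarrow> real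
    \<Rightarrow> (state \<Rightarrow>\<^sub>L real) \<Rightarrow> (state \<Rightarrow>\<^sub>L (state \<Rightarrow>\<^sub>L real)) \<Rightarrow> state \<Rightarrow> real" where
  "op_L mu1 sig1 k sig2 rho Dw D2w x = (case x of (a, e, q) \<Rightarrow>
      sig1\<^sup>2 / 2 * a\<^sup>2 * d2 D2w ea ea + rho * sig1 * sig2 * a * d2 D2w ea ee
      + sig2\<^sup>2 / 2 * d2 D2w ee ee + mu1 * a * d1 Dw ea - k * e * d1 Dw ee)"

end

theory Submission
  imports Defs
begin

text \<open>Along any controlled path, Ito's formula and the HJB inequality make \<open>w\<close> plus the accumulated running reward a
  supermartingale up to the depletion time, and a martingale under \<open>c\<^sup>*\<close>; the growth condition and the exponential
  moments of \<open>sup |W|\<close> allow the passage to the terminal time.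

  No stochastic calculus is presupposed. The Ito integrals only enter through two facts. First, the equation for \<open>A\<close>
  has the geometric Brownian motion as its only solution: the difference of two solutions obeys an \<open>L\<^sup>2\<close> Gronwall
  inequality. Second, \<open>\<epsilon>\<close> and \<open>Q\<close> have constant diffusion coefficients and solve pathwise equations. So the state is
  a smooth function of explicit Gaussian increments and of finite variation terms, and the expectation of
  \<open>w(T, X\<^sub>T) - w(t, x)\<close> is computed along a dyadic grid: in each cell the finite variation part is treated
  pathwise, and the Gaussian increment, being independent of the past, is averaged with a second order Taylor
  expansion. This requires compactly controlled derivatives, so \<open>w\<close> is first composed with a \<open>C\<^sup>2\<close>
  truncation in \<open>ln a\<close> and \<open>\<epsilon>\<close> and the path is stopped when it leaves the range where the truncation is the identity.

  Since the noise does not act on the inventory, every admissible control admits a solution, obtained from the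
  closed-loop one by changing \<open>Q\<close> alone.\<close>

section \<open>Real analysis\<close>

text \<open>Three obstacles shape the argument. An Ito integral is given only as a limit in
  probability of left Riemann sums on dyadic grids, so every property of it has to be read off
  explicit sums. The function \<open>w\<close> is differentiable only before \<open>T\<close> and
  for inventories in \<open>[0, Qbar)\<close>, one-sidedly at 0, while the state equation lets the
  inventory become negative; hence the inventory is replaced by its positive part and the control is
  switched off after depletion. Finally, a control is merely square integrable in time, so inventory
  increments stay exact integrals over each grid cell, with the derivatives of the test function
  frozen there. In each cell the noise moves first, from the adapted state at the left end, and can
  be averaged; then time, drift and inventory move, which is a mean value estimate along the path.
  Since \<open>perf\<close> evaluates whatever solution \<open>SOME\<close> picks, one needs a
  solution for every admissible control, and agreement of the picked one with the closed-loop
  solution for the optimal control.\<close>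

lemma path_bounded:
  fixes f :: "real \<Rightarrow> real"
  assumes "continuous_on {t..T} f"
  obtains B where "0 \<le> B" "\<And>u. u \<in> {t..T} \<Longrightarrow> \<bar>f u\<bar> \<le> B"
proof -
  have "compact (f ` {t..T})" by (rule compact_continuous_image[OF assms]) simp
  then obtain B where "\<And>u. u \<in> {t..T} \<Longrightarrow> \<bar>f u\<bar> \<le> B"
    using compact_imp_bounded bounded_iff by (metis image_eqI real_norm_def)
  then show ?thesis using that[of "max 0 B"] by force
qed

lemma integrable_restrict:
  fixes f :: "real \<Rightarrow> real"
  shows "integrable lborel f \<Longrightarrow> A \<in> sets borel \<Longrightarrow> set_integrable lborel A f"
  unfolding set_integrable_def by (rule integrable_mult_indicator) simp_all

text \<open>Weighting with \<open>exp (- (2 * C * (u - t)))\<close> makes the integral term at most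
  half of the supremum \<open>S\<close> of the weighted function, so
  \<open>S \<le> \<alpha> + S / 2\<close>; the bound \<open>K\<close> makes \<open>S\<close> finite.
  The price is a factor 2 in the constant and in the exponent. The argument covers functions that
  are merely bounded and integrable, such as second moments of stopped processes.\<close>

lemma gronwall_bounded:
  fixes \<phi> :: "real \<Rightarrow> real"
  assumes C: "C > 0" and \<alpha>: "\<alpha> \<ge> 0" and r: "r \<in> {t..T}"
    and bd: "\<And>u. u \<in> {t..T} \<Longrightarrow> 0 \<le> \<phi> u \<and> \<phi> u \<le> K"
    and int: "set_integrable lborel {t..T} \<phi>"
    and ineq: "\<And>r. r \<in> {t..T} \<Longrightarrow> \<phi> r \<le> \<alpha> + C * (LBINT u:{t..r}. \<phi> u)"
  shows "\<phi> r \<le> 2 * \<alpha> * exp (2 * C * (r - t))"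
proof -
  define g where "g u = exp (- (2 * C * (u - t))) * \<phi> u" for u
  have gK: "g u \<le> K" if "u \<in> {t..T}" for u
  proof -
    have "g u \<le> 1 * \<phi> u"
      unfolding g_def using bd[OF that] C that by (intro mult_right_mono) auto
    with bd[OF that] show ?thesis by simp
  qed
  have bdd: "bdd_above (g ` {t..T})" using gK by (rule bdd_aboveI2)
  define S where "S = (SUP u\<in>{t..T}. g u)"
  have gS: "g u \<le> S" if "u \<in> {t..T}" for u
    unfolding S_def using bdd that by (rule cSUP_upper2) simp_all
  have S0: "0 \<le> S" using gS[OF r] bd[OF r] unfolding g_def
    by (meson exp_ge_zero mult_nonneg_nonneg order_trans)
  have \<phi>S: "\<phi> u \<le> S * exp (2 * C * (u - t))" if "u \<in> {t..T}" for u
    using gS[OF that] by (simp add: g_def exp_minus divide_simps mult.commute)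
  have g2: "g u \<le> \<alpha> + S / 2" if u: "u \<in> {t..T}" for u
  proof -
    have tu: "t \<le> u" using u by simp
    have i1: "set_integrable lborel {t..u} \<phi>"
      by (rule set_integrable_subset[OF int]) (use u in auto)
    have fi: "set_integrable lborel {t..u} (\<lambda>v. S * exp (2 * C * (v - t)))"
      by (intro borel_integrable_atLeastAtMost' continuous_intros)
    have "(LBINT v:{t..u}. \<phi> v) \<le> (LBINT v:{t..u}. S * exp (2 * C * (v - t)))"
      by (rule set_integral_mono[OF i1 fi]) (use \<phi>S u in auto)
    also have "\<dots> = S * exp (2 * C * (u - t)) / (2 * C) - S * exp (2 * C * (t - t)) / (2 * C)"
      unfolding set_lebesgue_integral_def
      by (rule integral_FTC_atLeastAtMost)
         (use C tu in \<open>auto intro!: derivative_eq_intros continuous_intros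
            simp: has_real_derivative_iff_has_vector_derivative[symmetric]\<close>)
    also have "\<dots> \<le> S * exp (2 * C * (u - t)) / (2 * C)" using S0 C by simp
    finally have "C * (LBINT v:{t..u}. \<phi> v) \<le> S / 2 * exp (2 * C * (u - t))"
      using C by (simp add: field_simps)
    moreover have "\<alpha> \<le> \<alpha> * exp (2 * C * (u - t))"
      using \<alpha> C tu mult_left_mono[of 1 "exp (2 * C * (u - t))" \<alpha>] by simp
    ultimately have "\<phi> u \<le> (\<alpha> + S / 2) * exp (2 * C * (u - t))"
      using ineq[OF u] by (simp add: algebra_simps)
    then show ?thesis by (simp add: g_def exp_minus divide_simps mult.commute)
  qed
  have "S \<le> \<alpha> + S / 2"
    unfolding S_def by (rule cSUP_least) (use r g2[unfolded S_def] in auto)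
  then have "S \<le> 2 * \<alpha>" by simp
  then have "S * exp (2 * C * (r - t)) \<le> 2 * \<alpha> * exp (2 * C * (r - t))"
    by (intro mult_right_mono) auto
  with \<phi>S[OF r] show ?thesis by linarith
qed

section \<open>Symmetry of continuous second derivatives\<close>

lemma mixed_difference:
  fixes f :: "'a::real_normed_vector \<Rightarrow> real"
  assumes h: "h > 0"
    and U: "\<And>a b. a \<in> {0..h} \<Longrightarrow> b \<in> {0..h} \<Longrightarrow> x + a *\<^sub>R u + b *\<^sub>R v \<in> S"
    and f: "\<And>y. y \<in> S \<Longrightarrow> (f has_derivative blinfun_apply (D y)) (at y)"
    and D: "\<And>y. y \<in> S \<Longrightarrow> (D has_derivative blinfun_apply (D2 y)) (at y)"
  shows "\<exists>a\<in>{0..h}. \<exists>b\<in>{0..h}.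
     f (x + h *\<^sub>R u + h *\<^sub>R v) - f (x + h *\<^sub>R u) - f (x + h *\<^sub>R v) + f x
      = h * h * blinfun_apply (blinfun_apply (D2 (x + a *\<^sub>R u + b *\<^sub>R v)) v) u"
proof -
  define \<phi> where "\<phi> s = f (x + s *\<^sub>R u + h *\<^sub>R v) - f (x + s *\<^sub>R u)" for s
  have d: "((\<lambda>s. f (x + s *\<^sub>R u + b *\<^sub>R v)) has_derivative
      (\<lambda>k. k * blinfun_apply (D (x + s *\<^sub>R u + b *\<^sub>R v)) u)) (at s within {0..h})"
    if "s \<in> {0..h}" "b \<in> {0..h}" for s b
  proof -
    have "((\<lambda>s. x + s *\<^sub>R u + b *\<^sub>R v) has_derivative (\<lambda>k. k *\<^sub>R u)) (at s within {0..h})"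
      by (auto intro!: derivative_eq_intros)
    from has_derivative_compose[OF this f[OF U[OF that]]]
    show ?thesis by (simp add: blinfun.scaleR_right)
  qed
  have "\<exists>a\<in>{0..h}. \<phi> h - \<phi> 0 = (\<lambda>k. k * (blinfun_apply (D (x + a *\<^sub>R u + h *\<^sub>R v)) u
         - blinfun_apply (D (x + a *\<^sub>R u + 0 *\<^sub>R v)) u)) (h - 0)"
  proof (rule mvt_very_simple)
    fix s assume "0 \<le> s" "s \<le> h"
    then show "(\<phi> has_derivative (\<lambda>k. k * (blinfun_apply (D (x + s *\<^sub>R u + h *\<^sub>R v)) u
         - blinfun_apply (D (x + s *\<^sub>R u + 0 *\<^sub>R v)) u))) (at s within {0..h})"
      unfolding \<phi>_def using has_derivative_diff[OF d[of s h] d[of s 0]] h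
      by (simp add: algebra_simps)
  qed (use h in auto)
  then obtain a where a: "a \<in> {0..h}"
    and e1: "\<phi> h - \<phi> 0 = h * (blinfun_apply (D (x + a *\<^sub>R u + h *\<^sub>R v)) u
         - blinfun_apply (D (x + a *\<^sub>R u + 0 *\<^sub>R v)) u)" by auto
  have "\<exists>b\<in>{0..h}. blinfun_apply (D (x + a *\<^sub>R u + h *\<^sub>R v)) u - blinfun_apply (D (x + a *\<^sub>R u + 0 *\<^sub>R v)) u
     = (\<lambda>k. k * blinfun_apply (blinfun_apply (D2 (x + a *\<^sub>R u + b *\<^sub>R v)) v) u) (h - 0)"
  proof (rule mvt_very_simple)
    fix s assume "0 \<le> s" "s \<le> h"
    then have s: "s \<in> {0..h}" by simp
    have "((\<lambda>s. x + a *\<^sub>R u + s *\<^sub>R v) has_derivative (\<lambda>k. k *\<^sub>R v)) (at s within {0..h})"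
      by (auto intro!: derivative_eq_intros)
    from has_derivative_compose[OF this D[OF U[OF a s]]]
    have "((\<lambda>s. D (x + a *\<^sub>R u + s *\<^sub>R v)) has_derivative
       (\<lambda>k. k *\<^sub>R blinfun_apply (D2 (x + a *\<^sub>R u + s *\<^sub>R v)) v)) (at s within {0..h})"
      by (simp add: blinfun.scaleR_right)
    from bounded_linear.has_derivative[OF blinfun.bounded_linear_left this, of u]
    show "((\<lambda>s. blinfun_apply (D (x + a *\<^sub>R u + s *\<^sub>R v)) u) has_derivative
       (\<lambda>k. k * blinfun_apply (blinfun_apply (D2 (x + a *\<^sub>R u + s *\<^sub>R v)) v) u)) (at s within {0..h})"
      by (simp add: blinfun.scaleR_left)
  qed (use h in auto)
  then obtain b where b: "b \<in> {0..h}" and e2: "blinfun_apply (D (x + a *\<^sub>R u + h *\<^sub>R v)) u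
     - blinfun_apply (D (x + a *\<^sub>R u + 0 *\<^sub>R v)) u
     = h * blinfun_apply (blinfun_apply (D2 (x + a *\<^sub>R u + b *\<^sub>R v)) v) u" by auto
  show ?thesis
    by (rule bexI[OF _ a], rule bexI[OF _ b])
       (use e1 e2 in \<open>simp add: \<phi>_def algebra_simps\<close>)
qed

text \<open>By \<open>mixed_difference\<close> the mixed difference over a small parallelogram is,
  up to the factor \<open>h * h\<close>, a second derivative at some point of it, for either order
  of the directions. The two points differ, but by continuity both values lie within
  \<open>e\<close> of those at \<open>x\<close>, which is impossible if these are
  \<open>2 * e\<close> apart. Symmetry matters because \<open>op_L\<close> has one mixed term where
  the Taylor expansion has both orders.\<close>

lemma second_derivative_symmetric:
  fixes f :: "'a::real_normed_vector \<Rightarrow> real"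
  assumes S: "open S" "x \<in> S"
    and f: "\<And>y. y \<in> S \<Longrightarrow> (f has_derivative blinfun_apply (D y)) (at y)"
    and D: "\<And>y. y \<in> S \<Longrightarrow> (D has_derivative blinfun_apply (D2 y)) (at y)"
    and c: "continuous_on S D2"
  shows "blinfun_apply (blinfun_apply (D2 x) u) v = blinfun_apply (blinfun_apply (D2 x) v) u"
proof (rule ccontr)
  let ?F = "\<lambda>y u v. blinfun_apply (blinfun_apply (D2 y) u) v"
  assume ne: "?F x u v \<noteq> ?F x v u"
  define e where "e = \<bar>?F x u v - ?F x v u\<bar> / 2"
  have e: "e > 0" using ne by (simp add: e_def)
  have cF: "isCont (\<lambda>y. ?F y u v) x" for u v
    using c S by (auto simp: continuous_on_eq_continuous_at intro!: continuous_intros)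
  from cF[of u v] obtain d1 where d1: "d1 > 0" "\<And>y. dist y x < d1 \<Longrightarrow> \<bar>?F y u v - ?F x u v\<bar> < e"
    using e unfolding continuous_at_eps_delta dist_real_def by blast
  from cF[of v u] obtain d2 where d2: "d2 > 0" "\<And>y. dist y x < d2 \<Longrightarrow> \<bar>?F y v u - ?F x v u\<bar> < e"
    using e unfolding continuous_at_eps_delta dist_real_def by blast
  from S obtain d3 where d3: "d3 > 0" "ball x d3 \<subseteq> S" using open_contains_ball by blast
  define d where "d = min d1 (min d2 d3)"
  have d: "d > 0" using d1 d2 d3 by (simp add: d_def)
  \<comment> \<open>Small enough that the whole parallelogram lies within \<open>d\<close> of
    \<open>x\<close>; the 1 covers the case that both directions are zero.\<close>
  define h where "h = d / (2 * (norm u + norm v + 1))"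
  have np: "norm u + norm v + 1 > 0" by (simp add: add_nonneg_pos)
  have h: "h > 0" using d np by (simp add: h_def)
  have small: "dist (x + a *\<^sub>R u' + b *\<^sub>R v') x < d" if "a \<in> {0..h}" "b \<in> {0..h}"
    "norm u' + norm v' = norm u + norm v" for a b u' v'
  proof -
    have "dist (x + a *\<^sub>R u' + b *\<^sub>R v') x = norm (a *\<^sub>R u' + b *\<^sub>R v')" by (simp add: dist_norm algebra_simps)
    also have "\<dots> \<le> norm (a *\<^sub>R u') + norm (b *\<^sub>R v')" by (rule norm_triangle_ineq)
    also have "\<dots> \<le> h * norm u' + h * norm v'" using that by (intro add_mono) (auto intro!: mult_right_mono)
    also have "\<dots> = h * (norm u + norm v)" unfolding that(3)[symmetric] by (rule distrib_left[symmetric])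
    also have "\<dots> < h * (2 * (norm u + norm v + 1))" using h np by (intro mult_strict_left_mono) auto
    also have "\<dots> = d" using np by (simp add: h_def)
    finally show ?thesis .
  qed
  have inS: "x + a *\<^sub>R u' + b *\<^sub>R v' \<in> S" if "a \<in> {0..h}" "b \<in> {0..h}"
    "norm u' + norm v' = norm u + norm v" for a b u' v'
    using small[OF that] d3(2) by (auto simp: d_def dist_commute)
  obtain a b where ab: "a \<in> {0..h}" "b \<in> {0..h}"
    and 1: "f (x + h *\<^sub>R u + h *\<^sub>R v) - f (x + h *\<^sub>R u) - f (x + h *\<^sub>R v) + f x
      = h * h * ?F (x + a *\<^sub>R u + b *\<^sub>R v) v u"
    using mixed_difference[OF h, of x u v S f D D2] inS f D by auto
  obtain a' b' where ab': "a' \<in> {0..h}" "b' \<in> {0..h}"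
    and 2: "f (x + h *\<^sub>R v + h *\<^sub>R u) - f (x + h *\<^sub>R v) - f (x + h *\<^sub>R u) + f x
      = h * h * ?F (x + a' *\<^sub>R v + b' *\<^sub>R u) u v"
    using mixed_difference[OF h, of x v u S f D D2] inS[of _ _ v u] f D by (auto simp: add.commute)
  have "h * h * ?F (x + a *\<^sub>R u + b *\<^sub>R v) v u = h * h * ?F (x + a' *\<^sub>R v + b' *\<^sub>R u) u v"
    using 1 2 by (simp add: algebra_simps)
  then have eq: "?F (x + a *\<^sub>R u + b *\<^sub>R v) v u = ?F (x + a' *\<^sub>R v + b' *\<^sub>R u) u v" using h by simp
  have "\<bar>?F (x + a *\<^sub>R u + b *\<^sub>R v) v u - ?F x v u\<bar> < e"
    by (rule d2(2)) (use small[OF ab, of u v] in \<open>simp add: d_def\<close>)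
  moreover have "\<bar>?F (x + a' *\<^sub>R v + b' *\<^sub>R u) u v - ?F x u v\<bar> < e"
    by (rule d1(2)) (use small[OF ab', of v u] in \<open>simp add: d_def add.commute\<close>)
  ultimately show False using eq unfolding e_def by (auto simp: abs_if field_simps split: if_splits)
qed

section \<open>A twice differentiable truncation of the identity\<close>

definition pos_ext :: "(real \<Rightarrow> real) \<Rightarrow> real \<Rightarrow> real" where
  "pos_ext F x = (if x \<le> 0 then 0 else F x)"

text \<open>At 0 the difference quotient is 0 on the left and that of \<open>F\<close> on the right,
  and \<open>F 0 = F' 0 = 0\<close> makes both tend to 0. It is used twice, once for each order of
  derivative of \<open>trunc\<close>.\<close>

lemma pos_ext_DERIV:
  assumes d: "\<And>x. (F has_real_derivative F' x) (at x)" and 0: "F 0 = 0" "F' 0 = 0"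
  shows "(pos_ext F has_real_derivative pos_ext F' x) (at x)"
proof (cases x "0::real" rule: linorder_cases)
  case less
  have "((\<lambda>_. 0) has_real_derivative pos_ext F' x) (at x)" using less by (simp add: pos_ext_def)
  then show ?thesis
    by (rule has_field_derivative_transform_within_open[where S="{..<0}"])
       (use less in \<open>auto simp: pos_ext_def\<close>)
next
  case greater
  have "(F has_real_derivative pos_ext F' x) (at x)" using greater d by (simp add: pos_ext_def)
  then show ?thesis
    by (rule has_field_derivative_transform_within_open[where S="{0<..}"])
       (use greater in \<open>auto simp: pos_ext_def\<close>)
next
  case equal
  have "((\<lambda>h. F h / h) \<longlongrightarrow> 0) (at 0)"
    using d[of 0] 0 by (simp add: DERIV_def)
  then have "((\<lambda>h. pos_ext F h / h) \<longlongrightarrow> 0) (at 0)"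
    by (rule tendsto_0_le[where K=1]) (intro always_eventually allI, auto simp: pos_ext_def simp del: abs_divide norm_divide)
  then show ?thesis using equal by (simp add: DERIV_def pos_ext_def[of _ 0])
qed

lemma pos_ext_continuous:
  assumes "continuous_on UNIV F" "F 0 = 0"
  shows "continuous_on UNIV (pos_ext F)"
proof -
  have "pos_ext F = (\<lambda>x. F (max 0 x))" using assms by (auto simp: pos_ext_def fun_eq_iff max_def)
  then show ?thesis
    using assms(1) by (auto intro!: continuous_on_compose2[OF assms(1)] continuous_intros)
qed

text \<open>A twice continuously differentiable bounded function that is the identity on \<open>[-N, N]\<close>: it
  continues as \<open>N + sin (b - N)\<close> to the right and symmetrically to the left.\<close>

definition trunc :: "real \<Rightarrow> real \<Rightarrow> real" where
  "trunc N b = b + pos_ext (\<lambda>x. sin x - x) (b - N) - pos_ext (\<lambda>x. sin x - x) (- b - N)"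

definition trunc' :: "real \<Rightarrow> real \<Rightarrow> real" where
  "trunc' N b = 1 + pos_ext (\<lambda>x. cos x - 1) (b - N) + pos_ext (\<lambda>x. cos x - 1) (- b - N)"

definition trunc'' :: "real \<Rightarrow> real \<Rightarrow> real" where
  "trunc'' N b = pos_ext (\<lambda>x. - sin x) (b - N) - pos_ext (\<lambda>x. - sin x) (- b - N)"

lemma trunc_DERIV: "(trunc N has_real_derivative trunc' N b) (at b)"
proof -
  have *: "(pos_ext (\<lambda>x. sin x - x) has_real_derivative pos_ext (\<lambda>x. cos x - 1) x) (at x)" for x
    by (rule pos_ext_DERIV) (auto intro!: derivative_eq_intros)
  show ?thesis unfolding trunc_def[abs_def] trunc'_def
    by (auto intro!: derivative_eq_intros DERIV_chain2[OF *])
qed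

lemma trunc'_DERIV: "(trunc' N has_real_derivative trunc'' N b) (at b)"
proof -
  have *: "(pos_ext (\<lambda>x. cos x - 1) has_real_derivative pos_ext (\<lambda>x. - sin x) x) (at x)" for x
    by (rule pos_ext_DERIV) (auto intro!: derivative_eq_intros)
  show ?thesis unfolding trunc'_def[abs_def] trunc''_def
    by (auto intro!: derivative_eq_intros DERIV_chain2[OF *])
qed

lemma trunc_cont: "continuous_on UNIV (trunc N)" "continuous_on UNIV (trunc' N)"
  "continuous_on UNIV (trunc'' N)"
proof -
  show "continuous_on UNIV (trunc N)" "continuous_on UNIV (trunc' N)"
    using trunc_DERIV trunc'_DERIV DERIV_isCont by (blast intro: continuous_at_imp_continuous_on)+
  have "continuous_on UNIV (pos_ext (\<lambda>x. - sin x))"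
    by (rule pos_ext_continuous) (auto intro!: continuous_intros)
  then show "continuous_on UNIV (trunc'' N)"
    unfolding trunc''_def[abs_def]
    by (auto intro!: continuous_intros continuous_on_compose2[of UNIV "pos_ext (\<lambda>x. - sin x)"])
qed

lemma trunc_id: "\<bar>b\<bar> \<le> N \<Longrightarrow> trunc N b = b" "\<bar>b\<bar> \<le> N \<Longrightarrow> trunc' N b = 1" "\<bar>b\<bar> \<le> N \<Longrightarrow> trunc'' N b = 0"
  by (auto simp: trunc_def trunc'_def trunc''_def pos_ext_def abs_le_iff)

lemma trunc_cases:
  assumes N: "N \<ge> 0"
  shows "b > N \<Longrightarrow> trunc N b = N + sin (b - N) \<and> trunc' N b = cos (b - N) \<and> trunc'' N b = - sin (b - N)"
    and "b < - N \<Longrightarrow> trunc N b = - N - sin (- b - N) \<and> trunc' N b = cos (- b - N) \<and> trunc'' N b = sin (- b - N)"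
  using N by (auto simp: trunc_def trunc'_def trunc''_def pos_ext_def)

lemma trunc_bound:
  assumes N: "N \<ge> 0"
  shows "\<bar>trunc N b\<bar> \<le> N + 1" "\<bar>trunc' N b\<bar> \<le> 1" "\<bar>trunc'' N b\<bar> \<le> 1"
proof -
  have *: "sin x \<le> 1" "- 1 \<le> sin x" "\<bar>cos x\<bar> \<le> 1" "\<bar>sin x\<bar> \<le> 1" for x :: real by simp_all
  consider "b > N" | "b < - N" | "\<bar>b\<bar> \<le> N" by linarith
  then have "\<bar>trunc N b\<bar> \<le> N + 1 \<and> \<bar>trunc' N b\<bar> \<le> 1 \<and> \<bar>trunc'' N b\<bar> \<le> 1"
  proof cases
    case 1
    then show ?thesis using N trunc_cases(1)[OF N 1] *(1,2)[of "b - N"] by (auto intro!: abs_leI simp del: sin_le_one sin_ge_minus_one)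
  next
    case 2
    then show ?thesis using N trunc_cases(2)[OF N 2] *(1,2)[of "- b - N"] by (auto intro!: abs_leI simp del: sin_le_one sin_ge_minus_one)
  qed (use N in \<open>simp add: trunc_id\<close>)
  then show "\<bar>trunc N b\<bar> \<le> N + 1" "\<bar>trunc' N b\<bar> \<le> 1" "\<bar>trunc'' N b\<bar> \<le> 1" by simp_all
qed

text \<open>Beyond \<open>N\<close> the value \<open>N + sin (b - N)\<close> is nonnegative because
  \<open>N \<ge> 1\<close>, and at most \<open>b\<close> because \<open>sin x \<le> x\<close>. Since
  truncation moves no point away from the origin, bounds in terms of the size of the path also cover
  the truncated state.\<close>

lemma trunc_abs_le:
  assumes N: "N \<ge> 1" shows "\<bar>trunc N b\<bar> \<le> \<bar>b\<bar>"
proof -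
  have N0: "N \<ge> 0" using N by simp
  have s: "sin x \<le> x" if "x \<ge> 0" for x :: real using that by (rule sin_x_le_x)
  consider "b > N" | "b < - N" | "\<bar>b\<bar> \<le> N" by linarith
  then show ?thesis
  proof cases
    case 1
    show ?thesis using N 1 trunc_cases(1)[OF N0 1] s[of "b - N"] sin_ge_minus_one[of "b - N"]
      by linarith
  next
    case 2
    show ?thesis using N 2 trunc_cases(2)[OF N0 2] s[of "- b - N"] sin_ge_minus_one[of "- b - N"]
      by linarith
  qed (simp add: trunc_id)
qed

section \<open>Uniform partitions\<close>

definition gp :: "real \<Rightarrow> real \<Rightarrow> nat \<Rightarrow> nat \<Rightarrow> real" where
  "gp t r n i = t + real i * (r - t) / real n"

text \<open>Index of the half-open cell that contains \<open>u\<close>. It is meaningful for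
  \<open>t \<le> u < r\<close> only, which is why integrals below are cut to
  \<open>{t..<r}\<close>.\<close>

definition ix :: "real \<Rightarrow> real \<Rightarrow> nat \<Rightarrow> real \<Rightarrow> nat" where
  "ix t r n u = nat \<lfloor>(u - t) * real n / (r - t)\<rfloor>"

lemma gp_0 [simp]: "gp t r n 0 = t" and gp_n: "n > 0 \<Longrightarrow> gp t r n n = r"
  by (simp_all add: gp_def)

lemma gp_Suc: "gp t r n (Suc i) = gp t r n i + (r - t) / real n"
  by (simp add: gp_def ring_distribs add_divide_distrib diff_divide_distrib)

lemma gp_mono: "t \<le> r \<Longrightarrow> i \<le> j \<Longrightarrow> gp t r n i \<le> gp t r n j"
  by (simp add: gp_def divide_right_mono mult_right_mono)

lemma gp_in: "t \<le> r \<Longrightarrow> i \<le> n \<Longrightarrow> gp t r n i \<in> {t..r}"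
proof (cases "n = 0")
  case False
  assume "t \<le> r" "i \<le> n"
  then show ?thesis using gp_mono[of t r 0 i n] gp_mono[of t r i n n] False by (simp add: gp_n)
qed (simp add: gp_def)

lemma ix_cell:
  assumes "t < r" "n > 0" "u \<in> {t..<r}"
  shows "ix t r n u < n" "gp t r n (ix t r n u) \<le> u" "u < gp t r n (Suc (ix t r n u))"
proof -
  let ?x = "(u - t) * real n / (r - t)"
  have x0: "0 \<le> ?x" using assms by simp
  then have *: "real (ix t r n u) \<le> ?x" "?x < real (ix t r n u) + 1"
    unfolding ix_def using floor_correct[of ?x] by (auto simp: of_nat_nat)
  have "?x < real n" using assms by (simp add: field_simps)
  with * show "ix t r n u < n" by linarith
  show "gp t r n (ix t r n u) \<le> u" "u < gp t r n (Suc (ix t r n u))"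
    using * assms by (auto simp: gp_def field_simps)
qed

lemma ix_unique:
  assumes "t < r" "n > 0" "gp t r n i \<le> u" "u < gp t r n (Suc i)"
  shows "ix t r n u = i"
proof -
  have "real i \<le> (u - t) * real n / (r - t)" "(u - t) * real n / (r - t) < real i + 1"
    using assms by (auto simp: gp_def field_simps)
  then have "\<lfloor>(u - t) * real n / (r - t)\<rfloor> = int i" by linarith
  then show ?thesis by (simp add: ix_def)
qed

lemma step_tendsto: "(\<lambda>n. (r - t) / real n) \<longlonglongrightarrow> 0"
  by (rule tendsto_divide_0[OF tendsto_const]) (rule filterlim_at_top_imp_at_infinity[OF filterlim_real_sequentially])

lemma gp_ix_tendsto:
  assumes "t < r" "u \<in> {t..<r}"
  shows "(\<lambda>n. gp t r n (ix t r n u)) \<longlonglongrightarrow> u"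
    and "(\<lambda>n. gp t r n (Suc (ix t r n u))) \<longlonglongrightarrow> u"
proof -
  have 1: "\<forall>\<^sub>F n in sequentially. \<bar>gp t r n (ix t r n u) - u\<bar> \<le> (r - t) / real n"
    using eventually_gt_at_top[of "0::nat"]
  proof eventually_elim
    case (elim n)
    from ix_cell[OF assms(1) elim assms(2)] show ?case by (simp add: gp_Suc)
  qed
  have 2: "\<forall>\<^sub>F n in sequentially. \<bar>gp t r n (Suc (ix t r n u)) - u\<bar> \<le> (r - t) / real n"
    using eventually_gt_at_top[of "0::nat"]
  proof eventually_elim
    case (elim n)
    from ix_cell[OF assms(1) elim assms(2)] show ?case by (simp add: gp_Suc)
  qed
  show "(\<lambda>n. gp t r n (ix t r n u)) \<longlonglongrightarrow> u"
    by (rule LIM_zero_cancel, rule Lim_null_comparison[OF _ step_tendsto]) (use 1 in simp)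
  show "(\<lambda>n. gp t r n (Suc (ix t r n u))) \<longlonglongrightarrow> u"
    by (rule LIM_zero_cancel, rule Lim_null_comparison[OF _ step_tendsto]) (use 2 in simp)
qed

text \<open>Exactly one half-open cell contains \<open>u\<close>, so only the term of index
  \<open>ix t r n u\<close> survives. This turns a sum of cell integrals into a single
  integral.\<close>

lemma cell_sum:
  assumes "t < r" "n > 0"
  shows "(\<Sum>i<n. indicator {gp t r n i..<gp t r n (Suc i)} u * F i u) =
    (indicator {t..<r} u * F (ix t r n u) u :: real)"
proof (cases "u \<in> {t..<r}")
  case True
  note c = ix_cell[OF assms True]
  have "(\<Sum>i<n. indicator {gp t r n i..<gp t r n (Suc i)} u * F i u) =
     (\<Sum>i\<in>{ix t r n u}. indicator {gp t r n i..<gp t r n (Suc i)} u * F i u)"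
  proof (rule sum.mono_neutral_right)
    show "\<forall>i\<in>{..<n} - {ix t r n u}. indicator {gp t r n i..<gp t r n (Suc i)} u * F i u = 0"
    proof
      fix i assume "i \<in> {..<n} - {ix t r n u}"
      then have "i \<noteq> ix t r n u" by simp
      with ix_unique[OF assms, of i u] have "u \<notin> {gp t r n i..<gp t r n (Suc i)}" by fastforce
      then show "indicator {gp t r n i..<gp t r n (Suc i)} u * F i u = 0" by simp
    qed
  qed (use c in auto)
  also have "\<dots> = F (ix t r n u) u" using c by simp
  finally show ?thesis using True by simp
next
  case False
  have "indicator {gp t r n i..<gp t r n (Suc i)} u = (0::real)" if "i < n" for i
    using gp_in[of t r i n] gp_in[of t r "Suc i" n] that assms False by (auto simp: indicator_def)
  then show ?thesis using False by simp
qed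

lemma LINT_Icc_Ico:
  fixes f :: "real \<Rightarrow> real"
  assumes [measurable]: "f \<in> borel_measurable borel"
  shows "(LBINT u:{a..b}. f u) = (LBINT u. indicator {a..<b} u * f u)"
  unfolding set_lebesgue_integral_def
  by (rule integral_cong_AE) (use AE_lborel_singleton[of b] in \<open>auto simp: indicator_def\<close>)

lemma LINT_Icc_split:
  fixes f :: "real \<Rightarrow> real"
  assumes i: "set_integrable lborel {a..c} f" and "a \<le> b" "b \<le> c"
  shows "(LBINT u:{a..c}. f u) = (LBINT u:{a..b}. f u) + (LBINT u:{b..c}. f u)"
proof -
  have "{a..c} = {a..b} \<union> {b..c}" using assms by auto
  moreover have "(LBINT u:{a..b} \<union> {b..c}. f u) = (LBINT u:{a..b}. f u) + (LBINT u:{b..c}. f u)"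
    by (rule set_integral_Un_AE) (use AE_lborel_singleton[of b] assms in \<open>auto intro: set_integrable_subset[OF i]\<close>)
  ultimately show ?thesis by simp
qed

lemma LINT_continuous:
  fixes f :: "real \<Rightarrow> real"
  assumes i: "set_integrable lborel {a..c} f"
  shows "continuous_on {a..c} (\<lambda>x. LBINT u:{a..x}. f u)"
proof -
  have "f integrable_on {a..c}" by (rule set_borel_integral_eq_integral(1)[OF i])
  then have "continuous_on {a..c} (\<lambda>x. integral {a..x} f)" by (rule indefinite_integral_continuous_1)
  moreover have "(LBINT u:{a..x}. f u) = integral {a..x} f" if "x \<in> {a..c}" for x
    by (rule set_borel_integral_eq_integral(2), rule set_integrable_subset[OF i]) (use that in auto)
  ultimately show ?thesis using continuous_on_cong[OF refl, of "{a..c}" "\<lambda>x. LBINT u:{a..x}. f u" "\<lambda>x. integral {a..x} f"] by blast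
qed

text \<open>The sum of cell integrals is the integral of the one function \<open>s n\<close>, so
  dominated convergence applies. The integrand may still vary with \<open>u\<close> inside its cell:
  this admits factors such as a control that is merely integrable in time, for which sampling at
  grid points would be meaningless.\<close>

lemma riemann_limit:
  fixes F :: "nat \<Rightarrow> nat \<Rightarrow> real \<Rightarrow> real"
  assumes tr: "t < r"
    and F[measurable]: "\<And>n i. F n i \<in> borel_measurable borel" and G[measurable]: "G \<in> borel_measurable borel"
    and w: "set_integrable lborel {t..r} w"
    and bound: "\<And>n u. n > 0 \<Longrightarrow> u \<in> {t..<r} \<Longrightarrow> \<bar>F n (ix t r n u) u\<bar> \<le> w u"
    and conv: "AE u in lborel. u \<in> {t..<r} \<longrightarrow> (\<lambda>n. F n (ix t r n u) u) \<longlonglongrightarrow> G u"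
  shows "(\<lambda>n. \<Sum>i<n. LBINT u. indicator {gp t r n i..<gp t r n (Suc i)} u * F n i u) \<longlonglongrightarrow> (LBINT u:{t..r}. G u)"
    and "set_integrable lborel {t..r} G"
    and "\<And>n. n > 0 \<Longrightarrow> \<bar>\<Sum>i<n. LBINT u. indicator {gp t r n i..<gp t r n (Suc i)} u * F n i u\<bar> \<le> (LBINT u:{t..r}. w u)"
proof -
  define W where "W u = indicator {t..r} u * w u" for u
  have W: "integrable lborel W" using w by (simp add: set_integrable_def W_def[abs_def])
  define s where "s n u = (\<Sum>i<n. indicator {gp t r n i..<gp t r n (Suc i)} u * F n i u)" for n u
  have s_meas[measurable]: "s n \<in> borel_measurable lborel" for n unfolding s_def by measurable
  have s_eq: "s n u = indicator {t..<r} u * F n (ix t r n u) u" if "n > 0" for n u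
    unfolding s_def by (rule cell_sum[OF tr that])
  have W0: "0 \<le> w u" if "u \<in> {t..<r}" for u using bound[OF _ that, of 1] by linarith
  \<comment> \<open>The majorant is known to be nonnegative on \<open>{t..<r}\<close> only; the
    right end point is split off as a null set.\<close>
  have s_bd: "norm (s n u) \<le> W u \<or> u = r" for n u
  proof (cases "n = 0 \<or> u \<notin> {t..<r}")
    case True
    then have "s n u = 0" using s_eq[of n u] by (cases "n = 0") (auto simp: s_def)
    moreover have "u = r \<or> 0 \<le> W u" using W0[of u] by (cases "u = r") (auto simp: W_def indicator_def)
    ultimately show ?thesis by auto
  next
    case False
    then show ?thesis using bound[of n u] s_eq[of n u] by (auto simp: W_def)
  qed
  have s_bd': "AE u in lborel. norm (s n u) \<le> W u" for n
    using AE_lborel_singleton[of r] by eventually_elim (use s_bd[of n] in auto)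
  have c_int: "integrable lborel (\<lambda>u. indicator {gp t r n i..<gp t r n (Suc i)} u * F n i u)" if "i < n" for n i
  proof (rule Bochner_Integration.integrable_bound[OF W])
    have n: "n > 0" using that by simp
    have "norm (indicator {gp t r n i..<gp t r n (Suc i)} u * F n i u) \<le> norm (W u)" for u
    proof (cases "u \<in> {gp t r n i..<gp t r n (Suc i)}")
      case True
      then have "ix t r n u = i" using ix_unique[OF tr n] by simp
      moreover have "u \<in> {t..<r}" using True gp_in[of t r i n] gp_in[of t r "Suc i" n] tr that by auto
      ultimately show ?thesis using True bound[OF n, of u] by (auto simp: W_def)
    qed simp
    then show "AE u in lborel. norm (indicator {gp t r n i..<gp t r n (Suc i)} u * F n i u) \<le> norm (W u)" by simp
  qed simp
  have sum_eq: "(\<Sum>i<n. LBINT u. indicator {gp t r n i..<gp t r n (Suc i)} u * F n i u) = integral\<^sup>L lborel (s n)" for n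
    unfolding s_def by (rule Bochner_Integration.integral_sum[symmetric]) (use c_int in auto)
  have lim: "AE u in lborel. (\<lambda>n. s n u) \<longlonglongrightarrow> indicator {t..<r} u * G u"
    using conv
  proof eventually_elim
    case (elim u)
    show ?case
    proof (cases "u \<in> {t..<r}")
      case True
      then have "(\<lambda>n. F n (ix t r n u) u) \<longlonglongrightarrow> indicator {t..<r} u * G u" using elim by simp
      then show ?thesis
        by (rule Lim_transform_eventually)
           (use s_eq True in \<open>auto intro!: eventually_mono[OF eventually_gt_at_top[of 0]]\<close>)
    next
      case False
      have "\<forall>\<^sub>F n in sequentially. s n u = 0"
        using eventually_gt_at_top[of 0] by eventually_elim (use s_eq False in auto)
      then show ?thesis using False by (auto intro: tendsto_eventually)
    qed
  qed
  have G': "(LBINT u:{t..r}. G u) = (LBINT u. indicator {t..<r} u * G u)"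
    by (rule LINT_Icc_Ico) simp
  show "(\<lambda>n. \<Sum>i<n. LBINT u. indicator {gp t r n i..<gp t r n (Suc i)} u * F n i u) \<longlonglongrightarrow> (LBINT u:{t..r}. G u)"
    unfolding sum_eq G' by (rule integral_dominated_convergence[OF _ s_meas W lim s_bd']) simp
  have gi: "integrable lborel (\<lambda>u. indicator {t..<r} u * G u)"
    by (rule integrable_dominated_convergence[OF _ s_meas W lim s_bd']) simp
  show "set_integrable lborel {t..r} G"
    unfolding set_integrable_def
    by (rule integrable_cong_AE_imp[OF gi])
       (use AE_lborel_singleton[of r] in \<open>auto simp: indicator_def elim!: eventually_mono\<close>)
  fix n :: nat assume n: "n > 0"
  have si: "integrable lborel (s n)" by (rule Bochner_Integration.integrable_bound[OF W s_meas]) (use s_bd'[of n] in \<open>auto elim!: eventually_mono\<close>)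
  have "\<bar>integral\<^sup>L lborel (s n)\<bar> \<le> (LBINT u. norm (s n u))"
    using integral_norm_bound[of lborel "s n"] by simp
  also have "\<dots> \<le> integral\<^sup>L lborel W" by (rule integral_mono_AE) (use si W s_bd'[of n] in auto)
  finally show "\<bar>\<Sum>i<n. LBINT u. indicator {gp t r n i..<gp t r n (Suc i)} u * F n i u\<bar> \<le> (LBINT u:{t..r}. w u)"
    unfolding sum_eq by (simp add: set_lebesgue_integral_def W_def[abs_def])
qed

lemma cell_const:
  assumes "t \<le> r" "n > 0"
  shows "(LBINT u. indicator {gp t r n i..<gp t r n (Suc i)} u * c) = (r - t) / real n * c"
proof -
  have "gp t r n i \<le> gp t r n (Suc i)" using assms by (simp add: gp_Suc)
  then show ?thesis by (simp add: gp_Suc)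
qed

lemma riemann_limit_step:
  fixes \<phi> :: "nat \<Rightarrow> nat \<Rightarrow> real"
  assumes tr: "t < r" and G[measurable]: "G \<in> borel_measurable borel"
    and bound: "\<And>n i. n > 0 \<Longrightarrow> i < n \<Longrightarrow> \<bar>\<phi> n i\<bar> \<le> K"
    and conv: "AE u in lborel. u \<in> {t..<r} \<longrightarrow> (\<lambda>n. \<phi> n (ix t r n u)) \<longlonglongrightarrow> G u"
  shows "(\<lambda>n. \<Sum>i<n. (r - t) / real n * \<phi> n i) \<longlonglongrightarrow> (LBINT u:{t..r}. G u)"
    and "set_integrable lborel {t..r} G"
    and "\<And>n. n > 0 \<Longrightarrow> \<bar>\<Sum>i<n. (r - t) / real n * \<phi> n i\<bar> \<le> (r - t) * K"
proof -
  have eq: "(\<Sum>i<n. LBINT u. indicator {gp t r n i..<gp t r n (Suc i)} u * \<phi> n i) = (\<Sum>i<n. (r - t) / real n * \<phi> n i)" for n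
    by (cases "n = 0") (use tr in \<open>auto simp only: cell_const intro!: sum.cong\<close>)
  have K: "set_integrable lborel {t..r} (\<lambda>_. K)" by (rule borel_integrable_atLeastAtMost') simp
  note R = riemann_limit[where F="\<lambda>n i _. \<phi> n i", OF tr _ G K _ conv, unfolded eq]
  show "(\<lambda>n. \<Sum>i<n. (r - t) / real n * \<phi> n i) \<longlonglongrightarrow> (LBINT u:{t..r}. G u)"
    by (rule R(1)) (use bound ix_cell[OF tr] in auto)
  show "set_integrable lborel {t..r} G"
    by (rule R(2)) (use bound ix_cell[OF tr] in auto)
  show "\<bar>\<Sum>i<n. (r - t) / real n * \<phi> n i\<bar> \<le> (r - t) * K" if "n > 0" for n
  proof -
    have "\<bar>\<Sum>i<n. (r - t) / real n * \<phi> n i\<bar> \<le> (LBINT u:{t..r}. K)"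
      by (rule R(3)) (use bound ix_cell[OF tr] that in auto)
    also have "\<dots> = (r - t) * K" using tr by (simp add: set_lebesgue_integral_def)
    finally show ?thesis .
  qed
qed

lemma riemann_limit_continuous:
  assumes tr: "t < r" and g: "continuous_on {t..r} g"
  shows "(\<lambda>n. \<Sum>i<n. (r - t) / real n * g (gp t r n i)) \<longlonglongrightarrow> (LBINT u:{t..r}. g u)"
proof -
  define G where "G u = indicator {t..r} u * g u" for u
  have G: "G \<in> borel_measurable borel"
    using borel_measurable_continuous_on_indicator[OF _ g] by (simp add: G_def[abs_def])
  obtain K where K: "\<And>u. u \<in> {t..r} \<Longrightarrow> \<bar>g u\<bar> \<le> K" by (rule path_bounded[OF g]) blast
  have "(\<lambda>n. \<Sum>i<n. (r - t) / real n * g (gp t r n i)) \<longlonglongrightarrow> (LBINT u:{t..r}. G u)"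
  proof (rule riemann_limit_step(1)[OF tr G])
    show "\<bar>g (gp t r n i)\<bar> \<le> K" if "n > 0" "i < n" for n i
      by (rule K, rule gp_in) (use that tr in auto)
    show "AE u in lborel. u \<in> {t..<r} \<longrightarrow> (\<lambda>n. g (gp t r n (ix t r n u))) \<longlonglongrightarrow> G u"
    proof (intro AE_I2 impI)
      fix u assume u: "u \<in> {t..<r}"
      have "(\<lambda>n. g (gp t r n (ix t r n u))) \<longlonglongrightarrow> g u"
        by (rule continuous_on_tendsto_compose[OF g gp_ix_tendsto(1)[OF tr u]])
           (use u ix_cell[OF tr _ u] gp_in[of t r] tr in
             \<open>auto intro!: eventually_mono[OF eventually_gt_at_top[of 0]] simp: less_imp_le\<close>)
      then show "(\<lambda>n. g (gp t r n (ix t r n u))) \<longlonglongrightarrow> G u" using u by (simp add: G_def)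
    qed
  qed
  also have "(LBINT u:{t..r}. G u) = (LBINT u:{t..r}. g u)"
    by (rule set_lebesgue_integral_cong) (auto simp: G_def)
  finally show ?thesis .
qed

text \<open>A stopping rule along one path, kept as a 0-1 weight that drops at \<tau>. The value at
  \<tau> is left open: a weight that waits for an exit from \<open>[-N, N]\<close> is still 1 at the
  last admissible time, whereas a weight that asks for positive inventory is already 0 at
  depletion.\<close>

definition stop_weight :: "real \<Rightarrow> real \<Rightarrow> (real \<Rightarrow> real) \<Rightarrow> real \<Rightarrow> bool" where
  "stop_weight t r lam \<tau> \<longleftrightarrow> \<tau> \<in> {t..r} \<and> (\<forall>u\<in>{t..r}. lam u \<in> {0, 1}) \<and>
     (\<forall>u\<in>{t..r}. u < \<tau> \<longrightarrow> lam u = 1) \<and> (\<forall>u\<in>{t..r}. \<tau> < u \<longrightarrow> lam u = 0)"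

lemma antimono_stop_weight:
  assumes "t \<le> r" and l: "\<And>u. u \<in> {t..r} \<Longrightarrow> lam u \<in> {0, 1::real}"
    and anti: "\<And>u v. t \<le> u \<Longrightarrow> u \<le> v \<Longrightarrow> v \<le> r \<Longrightarrow> lam v \<le> lam u"
  shows "\<exists>\<tau>. stop_weight t r lam \<tau>"
proof -
  \<comment> \<open>\<open>t\<close> is inserted so that the supremum exists, and equals
    \<open>t\<close>, when the weight is 0 throughout.\<close>
  define S where "S = insert t {u\<in>{t..r}. lam u = 1}"
  have b: "bdd_above S" "S \<noteq> {}" using assms(1) by (auto simp: S_def intro!: bdd_aboveI[of _ r])
  have "Sup S \<in> {t..r}"
    using cSup_upper[of t S] b assms(1) by (auto intro!: cSup_least simp: S_def)
  moreover have "lam u = 1" if u: "u \<in> {t..r}" "u < Sup S" for u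
  proof -
    obtain v where v: "v \<in> S" "u < v" using less_cSup_iff[OF b(2,1)] u by auto
    then have "v \<in> {t..r}" "lam v = 1" using u by (auto simp: S_def)
    then show ?thesis using anti[of u v] l[OF u(1)] v u by auto
  qed
  moreover have "lam u = 0" if u: "u \<in> {t..r}" "Sup S < u" for u
  proof (rule ccontr)
    assume "lam u \<noteq> 0"
    then have "u \<in> S" using l[OF u(1)] u(1) by (auto simp: S_def)
    then show False using cSup_upper[OF _ b(1)] u by fastforce
  qed
  ultimately show ?thesis using l unfolding stop_weight_def by blast
qed

lemma stop_weight_tendsto:
  assumes s: "stop_weight t r lam \<tau>" and tr: "t < r" and u: "u \<in> {t..<r}" "u \<noteq> \<tau>"
  shows "(\<lambda>n. lam (gp t r n (ix t r n u))) \<longlonglongrightarrow> lam u"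
proof (rule tendsto_eventually)
  have in1: "\<forall>\<^sub>F n in sequentially. gp t r n (ix t r n u) \<in> {t..r} \<and> gp t r n (ix t r n u) \<le> u"
    using eventually_gt_at_top[of 0]
    by eventually_elim (use ix_cell[OF tr _ u(1)] gp_in[of t r] tr in \<open>auto simp: less_imp_le\<close>)
  show "\<forall>\<^sub>F n in sequentially. lam (gp t r n (ix t r n u)) = lam u"
  proof (cases "u < \<tau>")
    case True
    from in1 show ?thesis
    proof eventually_elim
      case (elim n)
      then show ?case using s True u(1) unfolding stop_weight_def
        by (metis atLeastAtMost_iff atLeastLessThan_iff le_less_trans less_imp_le)
    qed
  next
    case False
    then have lt: "\<tau> < u" using u by simp
    have "\<forall>\<^sub>F n in sequentially. \<tau> < gp t r n (ix t r n u)"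
      using order_tendstoD(1)[OF gp_ix_tendsto(1)[OF tr u(1)] lt] .
    with in1 show ?thesis
    proof eventually_elim
      case (elim n)
      then show ?case using s lt u(1) unfolding stop_weight_def by auto
    qed
  qed
qed

text \<open>The weighted increments telescope up to the first grid index \<open>k n\<close> of
  weight 0. That grid point overshoots \<tau> by at most one mesh width, because its predecessor
  still has weight 1, and continuity of \<open>H\<close> gives the limit. All of this is read off a
  single path.\<close>

lemma stop_weight_sum:
  fixes H :: "real \<Rightarrow> real"
  assumes s: "stop_weight t r lam \<tau>" and tr: "t < r" and H: "continuous_on {t..r} H"
  shows "(\<lambda>n. \<Sum>i<n. lam (gp t r n i) * (H (gp t r n (Suc i)) - H (gp t r n i))) \<longlonglongrightarrow> H \<tau> - H t"
    and "\<And>n. \<exists>v\<in>{t..r}. (\<Sum>i<n. lam (gp t r n i) * (H (gp t r n (Suc i)) - H (gp t r n i))) = H v - H t"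
proof -
  \<comment> \<open>The alternative \<open>i \<ge> n\<close> caps \<open>k n\<close> at
    \<open>n\<close>, for paths whose weight never drops on the grid.\<close>
  define k where "k n = (LEAST i. i \<ge> n \<or> lam (gp t r n i) = 0)" for n
  have kP: "k n \<ge> n \<or> lam (gp t r n (k n)) = 0" for n unfolding k_def by (rule LeastI[of _ n]) simp
  have kn: "k n \<le> n" for n unfolding k_def by (rule Least_le) simp
  have k1: "lam (gp t r n i) = 1" if "i < k n" for n i
  proof -
    have "\<not> (i \<ge> n \<or> lam (gp t r n i) = 0)" using that unfolding k_def by (rule not_less_Least)
    moreover have "gp t r n i \<in> {t..r}" by (rule gp_in) (use that kn[of n] tr in auto)
    ultimately show ?thesis using s unfolding stop_weight_def by blast
  qed
  have k0: "lam (gp t r n i) * x = 0 * x" if i: "k n < i" "i < n" for n i x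
  proof -
    have l0: "lam (gp t r n (k n)) = 0" using kP[of n] i by auto
    have a: "gp t r n (k n) \<in> {t..r}" "gp t r n i \<in> {t..r}" using gp_in[of t r "k n" n] gp_in[of t r i n] i tr by auto
    have "\<not> gp t r n (k n) < \<tau>" using l0 s a(1) unfolding stop_weight_def by auto
    moreover have "gp t r n (k n) < gp t r n i" using i tr by (simp add: gp_def divide_strict_right_mono)
    ultimately show ?thesis using s a unfolding stop_weight_def by auto
  qed
  have sum: "(\<Sum>i<n. lam (gp t r n i) * (H (gp t r n (Suc i)) - H (gp t r n i))) = H (gp t r n (k n)) - H t" for n
  proof -
    have "(\<Sum>i<n. lam (gp t r n i) * (H (gp t r n (Suc i)) - H (gp t r n i)))
       = (\<Sum>i<k n. lam (gp t r n i) * (H (gp t r n (Suc i)) - H (gp t r n i)))"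
    proof (rule sum.mono_neutral_right)
      show "\<forall>i\<in>{..<n} - {..<k n}. lam (gp t r n i) * (H (gp t r n (Suc i)) - H (gp t r n i)) = 0"
      proof
        fix i assume i: "i \<in> {..<n} - {..<k n}"
        show "lam (gp t r n i) * (H (gp t r n (Suc i)) - H (gp t r n i)) = 0"
        proof (cases "i = k n")
          case True
          then show ?thesis using kP[of n] i by auto
        next
          case False
          then show ?thesis using k0[of n i] i by (auto simp: not_less)
        qed
      qed
    qed (use kn[of n] in auto)
    also have "\<dots> = (\<Sum>i<k n. H (gp t r n (Suc i)) - H (gp t r n i))" by (rule sum.cong) (auto simp: k1)
    also have "\<dots> = H (gp t r n (k n)) - H t" using sum_lessThan_telescope[of "\<lambda>i. H (gp t r n i)" "k n"] by simp
    finally show ?thesis .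
  qed
  have close: "\<bar>gp t r n (k n) - \<tau>\<bar> \<le> (r - t) / real n" if n: "n > 0" for n
  proof -
    have kin: "gp t r n (k n) \<in> {t..r}" using gp_in[of t r "k n" n] kn tr by auto
    have lo: "\<tau> \<le> gp t r n (k n)"
    proof (cases "k n = n")
      case True then show ?thesis using s n by (auto simp: stop_weight_def gp_n)
    next
      case False
      then have "lam (gp t r n (k n)) = 0" using kP[of n] kn[of n] by auto
      then have "\<not> gp t r n (k n) < \<tau>" using s kin unfolding stop_weight_def by auto
      then show ?thesis by simp
    qed
    have up: "gp t r n (k n) \<le> \<tau> + (r - t) / real n"
    proof (cases "k n")
      case 0 then show ?thesis using s tr by (auto simp: stop_weight_def intro: add_increasing2)
    next
      case (Suc j)
      have "gp t r n j \<in> {t..r}" by (rule gp_in) (use Suc kn[of n] tr in auto)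
      moreover have "lam (gp t r n j) = 1" using k1[of j n] Suc by simp
      ultimately have "gp t r n j \<le> \<tau>" using s unfolding stop_weight_def by force
      then show ?thesis using Suc by (simp add: gp_Suc)
    qed
    show ?thesis using lo up by simp
  qed
  have "(\<lambda>n. gp t r n (k n)) \<longlonglongrightarrow> \<tau>"
    by (rule LIM_zero_cancel, rule Lim_null_comparison[OF _ step_tendsto[of r t]])
       (use close in \<open>auto intro!: eventually_mono[OF eventually_gt_at_top[of 0]]\<close>)
  then have "(\<lambda>n. H (gp t r n (k n))) \<longlonglongrightarrow> H \<tau>"
    by (rule continuous_on_tendsto_compose[OF H])
       (use s gp_in[of t r] kn tr in \<open>auto simp: stop_weight_def\<close>)
  then show "(\<lambda>n. \<Sum>i<n. lam (gp t r n i) * (H (gp t r n (Suc i)) - H (gp t r n i))) \<longlonglongrightarrow> H \<tau> - H t"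
    unfolding sum by (intro tendsto_diff tendsto_const)
  show "\<exists>v\<in>{t..r}. (\<Sum>i<n. lam (gp t r n i) * (H (gp t r n (Suc i)) - H (gp t r n i))) = H v - H t" for n
    unfolding sum using gp_in[of t r "k n" n] kn[of n] tr by auto
qed

section \<open>The standard Gaussian law in the plane\<close>

definition gauss1 :: "real measure" where "gauss1 = density lborel std_normal_density"
definition gauss2 :: "(real \<times> real) measure" where "gauss2 = gauss1 \<Otimes>\<^sub>M gauss1"

lemma sets_gauss1 [simp, measurable_cong]: "sets gauss1 = sets borel"
  and space_gauss1 [simp]: "space gauss1 = UNIV"
  by (simp_all add: gauss1_def)

lemma sets_gauss2 [simp, measurable_cong]: "sets gauss2 = sets (borel \<Otimes>\<^sub>M borel)"
  and space_gauss2 [simp]: "space gauss2 = UNIV"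
  by (auto simp add: gauss2_def space_pair_measure intro!: sets_pair_measure_cong)

interpretation gauss1: prob_space gauss1
  unfolding gauss1_def by (rule prob_space_normal_density) simp

interpretation gauss11: pair_prob_space gauss1 gauss1 ..

interpretation gauss2: prob_space gauss2
  unfolding gauss2_def by (rule gauss11.prob_space_axioms)

lemma gauss1_moments:
  "has_bochner_integral gauss1 (\<lambda>x. x) 0" "has_bochner_integral gauss1 (\<lambda>x. x\<^sup>2) 1"
  "integrable gauss1 (\<lambda>x. \<bar>x\<bar>)"
proof -
  show "has_bochner_integral gauss1 (\<lambda>x. x) 0"
    unfolding gauss1_def by (rule has_bochner_integral_density) (use std_normal_moment_odd[of 0] in auto)
  show "has_bochner_integral gauss1 (\<lambda>x. x\<^sup>2) 1"
    unfolding gauss1_def by (rule has_bochner_integral_density) (use std_normal_moment_even[of 1] in auto)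
  then show "integrable gauss1 (\<lambda>x. \<bar>x\<bar>)"
    using \<open>has_bochner_integral gauss1 (\<lambda>x. x) 0\<close> by (auto dest: integrable.intros)
qed

lemma gauss2_product:
  fixes f g :: "real \<Rightarrow> real"
  assumes f: "integrable gauss1 f" and g: "integrable gauss1 g"
  shows "has_bochner_integral gauss2 (\<lambda>z. f (fst z) * g (snd z)) ((LINT x|gauss1. f x) * (LINT x|gauss1. g x))"
proof -
  have [measurable]: "f \<in> borel_measurable borel" "g \<in> borel_measurable borel"
    using f g borel_measurable_integrable by (auto simp: measurable_cong_sets[OF sets_gauss1 refl])
  have i: "integrable (gauss1 \<Otimes>\<^sub>M gauss1) (\<lambda>z. f (fst z) * g (snd z))"
    by (rule gauss11.Fubini_integrable) (use f g in \<open>auto simp: abs_mult\<close>)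
  moreover have "(LINT z|(gauss1 \<Otimes>\<^sub>M gauss1). f (fst z) * g (snd z)) = (LINT x|gauss1. f x) * (LINT x|gauss1. g x)"
    using gauss11.integral_fst'[OF i] by simp
  ultimately show ?thesis unfolding gauss2_def by (simp add: has_bochner_integral_iff)
qed

lemma gauss2_moments:
  "has_bochner_integral gauss2 (\<lambda>z. fst z) 0" "has_bochner_integral gauss2 (\<lambda>z. snd z) 0"
  "has_bochner_integral gauss2 (\<lambda>z. (fst z)\<^sup>2) 1" "has_bochner_integral gauss2 (\<lambda>z. (snd z)\<^sup>2) 1"
  "has_bochner_integral gauss2 (\<lambda>z. fst z * snd z) 0"
proof -
  note m = gauss1_moments(1,2)[THEN has_bochner_integral_iff[THEN iffD1]]
  have c: "integrable gauss1 (\<lambda>_. 1::real)" by simp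
  have p: "(LINT x|gauss1. 1::real) = 1" using gauss1.prob_space by simp
  show "has_bochner_integral gauss2 (\<lambda>z. fst z) 0" using gauss2_product[OF m(1)[THEN conjunct1] c] m by simp
  show "has_bochner_integral gauss2 (\<lambda>z. snd z) 0" using gauss2_product[OF c m(1)[THEN conjunct1]] m by simp
  show "has_bochner_integral gauss2 (\<lambda>z. (fst z)\<^sup>2) 1" using gauss2_product[OF m(2)[THEN conjunct1] c] m p by simp
  show "has_bochner_integral gauss2 (\<lambda>z. (snd z)\<^sup>2) 1" using gauss2_product[OF c m(2)[THEN conjunct1]] m p by simp
  show "has_bochner_integral gauss2 (\<lambda>z. fst z * snd z) 0"
    using gauss2_product[OF m(1)[THEN conjunct1] m(1)[THEN conjunct1]] m by simp
qed

section \<open>Expansion of a test function along a grid\<close>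

text \<open>The coordinates are time, log-price, \<epsilon> and inventory; in log-price all noise
  coefficients are constant. Second derivatives are stored as coefficients of a quadratic form in
  \<open>(\<alpha>, \<beta>)\<close>, so \<open>fye\<close> collects both mixed derivatives and no
  factor 2 appears. Differentiation is within \<open>{t..r}\<close> in time and within
  \<open>{0..qb}\<close> in the inventory, since it is one-sided at the ends.\<close>

locale test_fun =
  fixes t r qb K :: real and f ft fy fe fq fyy fye fee :: "real \<Rightarrow> real \<Rightarrow> real \<Rightarrow> real \<Rightarrow> real"
  assumes tr: "t < r"
    and cont: "\<And>g. g \<in> {f, ft, fy, fe, fq, fyy, fye, fee} \<Longrightarrow> continuous_on UNIV (\<lambda>(u, y, e, q). g u y e q)"
    and bd: "\<And>g u y e q. g \<in> {f, ft, fy, fe, fq, fyy, fye, fee} \<Longrightarrow> \<bar>g u y e q\<bar> \<le> K"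
    and d_t: "\<And>u y e q. u \<in> {t..r} \<Longrightarrow> q \<in> {0..qb} \<Longrightarrow>
       ((\<lambda>s. f s y e q) has_real_derivative ft u y e q) (at u within {t..r})"
    and d_x: "\<And>u y e q s \<alpha> \<beta> \<gamma>. u \<in> {t..r} \<Longrightarrow> q + s * \<gamma> \<in> {0..qb} \<Longrightarrow>
       ((\<lambda>s. f u (y + s * \<alpha>) (e + s * \<beta>) (q + s * \<gamma>)) has_real_derivative
          \<alpha> * fy u (y + s * \<alpha>) (e + s * \<beta>) (q + s * \<gamma>) + \<beta> * fe u (y + s * \<alpha>) (e + s * \<beta>) (q + s * \<gamma>)
          + \<gamma> * fq u (y + s * \<alpha>) (e + s * \<beta>) (q + s * \<gamma>)) (at s within {s. q + s * \<gamma> \<in> {0..qb}})"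
    and d_xx: "\<And>u y e q s \<alpha> \<beta>. u \<in> {t..r} \<Longrightarrow> q \<in> {0..qb} \<Longrightarrow>
       ((\<lambda>s. \<alpha> * fy u (y + s * \<alpha>) (e + s * \<beta>) q + \<beta> * fe u (y + s * \<alpha>) (e + s * \<beta>) q) has_real_derivative
          \<alpha>\<^sup>2 * fyy u (y + s * \<alpha>) (e + s * \<beta>) q + \<alpha> * \<beta> * fye u (y + s * \<alpha>) (e + s * \<beta>) q
          + \<beta>\<^sup>2 * fee u (y + s * \<alpha>) (e + s * \<beta>) q) (at s)"
begin

lemma tendsto_test:
  assumes g: "g \<in> {f, ft, fy, fe, fq, fyy, fye, fee}"
    and "u \<longlonglongrightarrow> u'" "y \<longlonglongrightarrow> y'" "e \<longlonglongrightarrow> e'" "q \<longlonglongrightarrow> q'"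
  shows "(\<lambda>n. g (u n) (y n) (e n) (q n)) \<longlonglongrightarrow> g u' y' e' q'"
proof -
  have "isCont (\<lambda>(u, y, e, q). g u y e q) (u', y', e', q')"
    using cont[OF g] by (simp add: continuous_on_eq_continuous_at)
  moreover have "(\<lambda>n. (u n, y n, e n, q n)) \<longlonglongrightarrow> (u', y', e', q')"
    using assms(2-) by (intro tendsto_Pair)
  ultimately have "(\<lambda>n. (\<lambda>(u, y, e, q). g u y e q) (u n, y n, e n, q n)) \<longlonglongrightarrow> (\<lambda>(u, y, e, q). g u y e q) (u', y', e', q')"
    by (rule isCont_tendsto_compose)
  then show ?thesis by simp
qed

lemma test_measurable:
  assumes g: "g \<in> {f, ft, fy, fe, fq, fyy, fye, fee}"
    and [measurable]: "u \<in> borel_measurable M" "y \<in> borel_measurable M" "e \<in> borel_measurable M" "q \<in> borel_measurable M"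
  shows "(\<lambda>x. g (u x) (y x) (e x) (q x)) \<in> borel_measurable M"
proof -
  have "(\<lambda>(u, y, e, q). g u y e q) \<in> borel_measurable borel"
    by (rule borel_measurable_continuous_onI[OF cont[OF g]])
  moreover have "(\<lambda>x. (u x, y x, e x, q x)) \<in> M \<rightarrow>\<^sub>M borel" by measurable
  ultimately have "(\<lambda>x. (\<lambda>(u, y, e, q). g u y e q) (u x, y x, e x, q x)) \<in> borel_measurable M" by measurable
  then show ?thesis by simp
qed

lemma test_continuous:
  assumes g: "g \<in> {f, ft, fy, fe, fq, fyy, fye, fee}"
    and "continuous_on S u" "continuous_on S y" "continuous_on S e" "continuous_on S q"
  shows "continuous_on S (\<lambda>x. g (u x) (y x) (e x) (q x))"
proof -
  have "continuous_on S (\<lambda>x. (u x, y x, e x, q x))" using assms(2-) by (intro continuous_on_Pair)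
  from continuous_on_compose2[OF cont[OF g] this] show ?thesis by simp
qed

lemma test_bounds:
  "\<bar>f u y e q\<bar> \<le> K" "\<bar>ft u y e q\<bar> \<le> K" "\<bar>fy u y e q\<bar> \<le> K" "\<bar>fe u y e q\<bar> \<le> K"
  "\<bar>fq u y e q\<bar> \<le> K" "\<bar>fyy u y e q\<bar> \<le> K" "\<bar>fye u y e q\<bar> \<le> K" "\<bar>fee u y e q\<bar> \<le> K"
  using bd[of f] bd[of ft] bd[of fy] bd[of fe] bd[of fq] bd[of fyy] bd[of fye] bd[of fee] by simp_all

lemma K_nonneg: "0 \<le> K" using bd[of f t t t t] by simp

text \<open>Two legs with one mean value each: time moves at the new position, the segment in space
  is run at the old time. The segment keeps the inventory in \<open>{0..qb}\<close> by
  convexity.\<close>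

lemma drift_step:
  assumes u: "u0 \<in> {t..r}" "u1 \<in> {t..r}" "u0 \<le> u1" and q: "q0 \<in> {0..qb}" "q1 \<in> {0..qb}"
  shows "\<exists>\<xi> s. \<xi> \<in> {u0..u1} \<and> s \<in> {0..1} \<and>
    f u1 y1 e1 q1 - f u0 (y1 - dy) (e1 - de) q0 = (u1 - u0) * ft \<xi> y1 e1 q1
     + dy * fy u0 (y1 - dy + s * dy) (e1 - de + s * de) (q0 + s * (q1 - q0))
     + de * fe u0 (y1 - dy + s * dy) (e1 - de + s * de) (q0 + s * (q1 - q0))
     + (q1 - q0) * fq u0 (y1 - dy + s * dy) (e1 - de + s * de) (q0 + s * (q1 - q0))"
proof -
  have "\<exists>\<xi>\<in>{u0..u1}. f u1 y1 e1 q1 - f u0 y1 e1 q1 = (\<lambda>k. ft \<xi> y1 e1 q1 * k) (u1 - u0)"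
  proof (rule mvt_very_simple[OF u(3)])
    fix v assume v: "u0 \<le> v" "v \<le> u1"
    have "((\<lambda>s. f s y1 e1 q1) has_real_derivative ft v y1 e1 q1) (at v within {u0..u1})"
      by (rule has_field_derivative_subset[OF d_t]) (use u v q in auto)
    then show "((\<lambda>s. f s y1 e1 q1) has_derivative (\<lambda>k. ft v y1 e1 q1 * k)) (at v within {u0..u1})"
      by (simp add: has_field_derivative_def)
  qed
  then obtain \<xi> where \<xi>: "\<xi> \<in> {u0..u1}" "f u1 y1 e1 q1 - f u0 y1 e1 q1 = (u1 - u0) * ft \<xi> y1 e1 q1"
    by (auto simp: mult.commute)
  let ?P = "\<lambda>g s. g u0 (y1 - dy + s * dy) (e1 - de + s * de) (q0 + s * (q1 - q0))"
  have qs: "q0 + s * (q1 - q0) \<in> {0..qb}" if "s \<in> {0..1}" for s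
  proof -
    have eq: "q0 + s * (q1 - q0) = (1 - s) * q0 + s * q1" by (simp add: algebra_simps)
    have "(1 - s) * q0 + s * q1 \<le> (1 - s) * qb + s * qb" using q that by (intro add_mono mult_left_mono) auto
    moreover have "0 \<le> (1 - s) * q0 + s * q1" using q that by auto
    ultimately show ?thesis unfolding eq by (simp add: algebra_simps)
  qed
  have "\<exists>s\<in>{0..1}. ?P f 1 - ?P f 0 = (\<lambda>k. (dy * ?P fy s + de * ?P fe s + (q1 - q0) * ?P fq s) * k) (1 - 0)"
  proof (rule mvt_very_simple)
    fix s :: real assume s: "0 \<le> s" "s \<le> 1"
    have s1: "s \<in> {0..1}" using s by simp
    have sub: "{0..1} \<subseteq> {s. q0 + s * (q1 - q0) \<in> {0..qb}}" using qs by blast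
    have "((\<lambda>s. ?P f s) has_real_derivative (dy * ?P fy s + de * ?P fe s + (q1 - q0) * ?P fq s)) (at s within {0..1})"
      by (rule has_field_derivative_subset[OF d_x[OF u(1), where q=q0 and \<gamma>="q1 - q0" and s=s and y="y1 - dy" and e="e1 - de" and \<alpha>=dy and \<beta>=de, OF qs[OF s1]] sub])
    then show "((\<lambda>s. ?P f s) has_derivative (\<lambda>k. (dy * ?P fy s + de * ?P fe s + (q1 - q0) * ?P fq s) * k)) (at s within {0..1})"
      by (simp add: has_field_derivative_def)
  qed simp
  then obtain s where s: "s \<in> {0..1}" "?P f 1 - ?P f 0 = dy * ?P fy s + de * ?P fe s + (q1 - q0) * ?P fq s"
    by auto
  show ?thesis
  proof (intro exI conjI)
    have "?P f 1 = f u0 y1 e1 q1" "?P f 0 = f u0 (y1 - dy) (e1 - de) q0" by simp_all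
    with \<xi>(2) s(2) show "f u1 y1 e1 q1 - f u0 (y1 - dy) (e1 - de) q0 = (u1 - u0) * ft \<xi> y1 e1 q1
      + dy * ?P fy s + de * ?P fe s + (q1 - q0) * ?P fq s"
      by linarith
  qed (fact \<xi> s)+
qed

text \<open>\<open>X n\<close> collects the moves from the point reached after the noise of a cell
  to the state at its right end. The changes of \<open>U\<close> and \<open>Q\<close> are integrals
  of \<open>b\<close> and \<open>- c\<close>, so each move is exactly a cell integral with frozen
  derivatives, and \<open>riemann_limit\<close> applies with a majorant linear in
  \<open>\<bar>b u\<bar>\<close> and \<open>\<bar>c u\<bar>\<close>.\<close>

lemma drift_sum:
  assumes Y: "continuous_on {t..r} Y" and E: "continuous_on {t..r} E" and Q: "continuous_on {t..r} Q"
    and U: "continuous_on {t..r} U" and Qb: "\<And>u. u \<in> {t..r} \<Longrightarrow> Q u \<in> {0..qb}"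
    and [measurable]: "b \<in> borel_measurable borel" "c \<in> borel_measurable borel" "G \<in> borel_measurable borel"
    and bi: "set_integrable lborel {t..r} b" and ci: "set_integrable lborel {t..r} c"
    and Ub: "\<And>u v. t \<le> u \<Longrightarrow> u \<le> v \<Longrightarrow> v \<le> r \<Longrightarrow> U v - U u = (LBINT x:{u..v}. b x)"
    and Qc: "\<And>u v. t \<le> u \<Longrightarrow> u \<le> v \<Longrightarrow> v \<le> r \<Longrightarrow> Q v - Q u = - (LBINT x:{u..v}. c x)"
    and lam: "stop_weight t r lam \<tau>"
    and G: "\<And>u. u \<in> {t..<r} \<Longrightarrow> G u = lam u * (ft u (Y u) (E u) (Q u) + m * fy u (Y u) (E u) (Q u)
                + b u * fe u (Y u) (E u) (Q u) - c u * fq u (Y u) (E u) (Q u))"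
    and X: "\<And>n. X n = (\<Sum>i<n. lam (gp t r n i) *
       (f (gp t r n (Suc i)) (Y (gp t r n (Suc i))) (E (gp t r n (Suc i))) (Q (gp t r n (Suc i)))
        - f (gp t r n i) (Y (gp t r n (Suc i)) - m * ((r - t) / real n))
            (E (gp t r n (Suc i)) - (U (gp t r n (Suc i)) - U (gp t r n i))) (Q (gp t r n i))))"
  shows "X \<longlonglongrightarrow> (LBINT u:{t..r}. G u)" and "set_integrable lborel {t..r} G"
    and "\<And>n. \<bar>X n\<bar> \<le> (LBINT u:{t..r}. K * (1 + \<bar>m\<bar> + \<bar>b u\<bar> + \<bar>c u\<bar>))"
proof -
  let ?g = "gp t r"
  let ?h = "\<lambda>n. (r - t) / real n"
  define W where "W u = K * (1 + \<bar>m\<bar> + \<bar>b u\<bar> + \<bar>c u\<bar>)" for u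
  have Wi: "set_integrable lborel {t..r} W"
  proof -
    have c: "set_integrable lborel {t..r} (\<lambda>_. 1 + \<bar>m\<bar>)" by (rule borel_integrable_atLeastAtMost') simp
    show ?thesis unfolding W_def
      by (intro set_integrable_mult_right) (rule set_integral_add(1)[OF set_integral_add(1)[OF c set_integrable_abs[OF bi]] set_integrable_abs[OF ci]])
  qed
  have gin: "?g n i \<in> {t..r}" if "i \<le> n" for n i by (rule gp_in) (use that tr in auto)
  have gle: "?g n i \<le> ?g n (Suc i)" for n i using tr by (intro gp_mono) auto
  define dU where "dU n i = U (?g n (Suc i)) - U (?g n i)" for n i
  define dQ where "dQ n i = Q (?g n (Suc i)) - Q (?g n i)" for n i
  \<comment> \<open>The guard \<open>i < n\<close> makes the statement satisfiable for every index,
    so that \<xi> and \<open>s\<close> can be chosen as total functions.\<close>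
  define PP where "PP n i \<xi> s \<longleftrightarrow> (i < n \<longrightarrow> \<xi> \<in> {?g n i..?g n (Suc i)} \<and> s \<in> {0..1} \<and>
     f (?g n (Suc i)) (Y (?g n (Suc i))) (E (?g n (Suc i))) (Q (?g n (Suc i)))
        - f (?g n i) (Y (?g n (Suc i)) - m * ?h n) (E (?g n (Suc i)) - dU n i) (Q (?g n i))
      = (?g n (Suc i) - ?g n i) * ft \<xi> (Y (?g n (Suc i))) (E (?g n (Suc i))) (Q (?g n (Suc i)))
     + (m * ?h n) * fy (?g n i) (Y (?g n (Suc i)) - m * ?h n + s * (m * ?h n)) (E (?g n (Suc i)) - dU n i + s * dU n i) (Q (?g n i) + s * dQ n i)
     + dU n i * fe (?g n i) (Y (?g n (Suc i)) - m * ?h n + s * (m * ?h n)) (E (?g n (Suc i)) - dU n i + s * dU n i) (Q (?g n i) + s * dQ n i)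
     + dQ n i * fq (?g n i) (Y (?g n (Suc i)) - m * ?h n + s * (m * ?h n)) (E (?g n (Suc i)) - dU n i + s * dU n i) (Q (?g n i) + s * dQ n i))" for n i \<xi> s
  have "\<exists>\<xi> s. PP n i \<xi> s" for n i
  proof (cases "i < n")
    case True
    show ?thesis
      unfolding PP_def dQ_def
      using drift_step[OF gin gin gle Qb[OF gin] Qb[OF gin], of i n i n "Suc i" n "Y (?g n (Suc i))" "E (?g n (Suc i))" "m * ?h n" "dU n i"] True
      by (simp add: Suc_le_eq)
  qed (auto simp: PP_def)
  then obtain \<xi> s where "\<And>n i. PP n i (\<xi> n i) (s n i)" by metis
  note P = this[unfolded PP_def]
  define py where "py n i = Y (?g n (Suc i)) - m * ?h n + s n i * (m * ?h n)" for n i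
  define pe where "pe n i = E (?g n (Suc i)) - dU n i + s n i * dU n i" for n i
  define pq where "pq n i = Q (?g n i) + s n i * dQ n i" for n i
  define F where "F n i u = lam (?g n i) * (ft (\<xi> n i) (Y (?g n (Suc i))) (E (?g n (Suc i))) (Q (?g n (Suc i)))
     + m * fy (?g n i) (py n i) (pe n i) (pq n i) + b u * fe (?g n i) (py n i) (pe n i) (pq n i)
     - c u * fq (?g n i) (py n i) (pe n i) (pq n i))" for n i u
  have F_meas: "F n i \<in> borel_measurable borel" for n i unfolding F_def by measurable
  have cell: "(LBINT u. indicator {?g n i..<?g n (Suc i)} u * F n i u) = lam (?g n i) *
       (f (?g n (Suc i)) (Y (?g n (Suc i))) (E (?g n (Suc i))) (Q (?g n (Suc i)))
        - f (?g n i) (Y (?g n (Suc i)) - m * ?h n) (E (?g n (Suc i)) - dU n i) (Q (?g n i)))" if i: "i < n" for n i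
  proof -
    have sub: "{?g n i..?g n (Suc i)} \<subseteq> {t..r}" using gin[of i n] gin[of "Suc i" n] i by auto
    have bI: "set_integrable lborel {?g n i..?g n (Suc i)} b" by (rule set_integrable_subset[OF bi _ sub]) simp
    have cI: "set_integrable lborel {?g n i..?g n (Suc i)} c" by (rule set_integrable_subset[OF ci _ sub]) simp
    define A where "A = ft (\<xi> n i) (Y (?g n (Suc i))) (E (?g n (Suc i))) (Q (?g n (Suc i))) + m * fy (?g n i) (py n i) (pe n i) (pq n i)"
    have aI: "set_integrable lborel {?g n i..?g n (Suc i)} (\<lambda>_. A)" by (rule borel_integrable_atLeastAtMost') simp
    have "(LBINT u. indicator {?g n i..<?g n (Suc i)} u * F n i u) = (LBINT u:{?g n i..?g n (Suc i)}. F n i u)"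
      by (rule LINT_Icc_Ico[symmetric]) (rule F_meas)
    also have "\<dots> = lam (?g n i) * (LBINT u:{?g n i..?g n (Suc i)}. (A + b u * fe (?g n i) (py n i) (pe n i) (pq n i))
         - c u * fq (?g n i) (py n i) (pe n i) (pq n i))"
      unfolding F_def A_def by simp
    also have "(LBINT u:{?g n i..?g n (Suc i)}. (A + b u * fe (?g n i) (py n i) (pe n i) (pq n i))
         - c u * fq (?g n i) (py n i) (pe n i) (pq n i)) = ((?g n (Suc i) - ?g n i) * A + dU n i * fe (?g n i) (py n i) (pe n i) (pq n i))
         + dQ n i * fq (?g n i) (py n i) (pe n i) (pq n i)"
    proof -
      have "dU n i = (LBINT u:{?g n i..?g n (Suc i)}. b u)" "dQ n i = - (LBINT u:{?g n i..?g n (Suc i)}. c u)"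
        unfolding dU_def dQ_def using sub gle[of n i] by (auto intro!: Ub Qc)
      moreover have "(LBINT u:{?g n i..?g n (Suc i)}. A) = (?g n (Suc i) - ?g n i) * A"
        using gle[of n i] by (simp add: set_lebesgue_integral_def)
      ultimately show ?thesis
        using bI cI aI by (simp add: set_integral_diff set_integral_add)
    qed
    also have "((?g n (Suc i) - ?g n i) * A + dU n i * fe (?g n i) (py n i) (pe n i) (pq n i))
         + dQ n i * fq (?g n i) (py n i) (pe n i) (pq n i)
      = f (?g n (Suc i)) (Y (?g n (Suc i))) (E (?g n (Suc i))) (Q (?g n (Suc i)))
        - f (?g n i) (Y (?g n (Suc i)) - m * ?h n) (E (?g n (Suc i)) - dU n i) (Q (?g n i))"
    proof -
      define fa fb fc fd where "fa = ft (\<xi> n i) (Y (?g n (Suc i))) (E (?g n (Suc i))) (Q (?g n (Suc i)))"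
        and "fb = fy (?g n i) (py n i) (pe n i) (pq n i)"
        and "fc = fe (?g n i) (py n i) (pe n i) (pq n i)" and "fd = fq (?g n i) (py n i) (pe n i) (pq n i)"
      have "f (?g n (Suc i)) (Y (?g n (Suc i))) (E (?g n (Suc i))) (Q (?g n (Suc i)))
        - f (?g n i) (Y (?g n (Suc i)) - m * ?h n) (E (?g n (Suc i)) - dU n i) (Q (?g n i))
        = (?g n (Suc i) - ?g n i) * fa + m * ?h n * fb + dU n i * fc + dQ n i * fd"
        using P[of i n] i unfolding fa_def fb_def fc_def fd_def py_def pe_def pq_def by blast
      moreover have "A = fa + m * fb" by (simp add: A_def fa_def fb_def)
      moreover have "?g n (Suc i) - ?g n i = ?h n" by (simp add: gp_Suc)
      ultimately show ?thesis unfolding fc_def[symmetric] fd_def[symmetric]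
        by (simp only: distrib_left mult.assoc mult.left_commute)
    qed
    finally show ?thesis .
  qed
  have X': "X n = (\<Sum>i<n. LBINT u. indicator {?g n i..<?g n (Suc i)} u * F n i u)" for n
    unfolding X by (rule sum.cong) (auto simp: cell dU_def)
  have bound: "\<bar>F n i u\<bar> \<le> W u" if "i < n" for n i u
  proof -
    have l: "\<bar>lam (?g n i)\<bar> \<le> 1"
    proof -
      have "lam (?g n i) \<in> {0, 1}" using lam gin[of i n] that unfolding stop_weight_def by simp
      then show ?thesis by auto
    qed
    define fa fb fc fd where "fa = ft (\<xi> n i) (Y (?g n (Suc i))) (E (?g n (Suc i))) (Q (?g n (Suc i)))"
      and "fb = fy (?g n i) (py n i) (pe n i) (pq n i)"
      and "fc = fe (?g n i) (py n i) (pe n i) (pq n i)" and "fd = fq (?g n i) (py n i) (pe n i) (pq n i)"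
    have B: "\<bar>fa\<bar> \<le> K" "\<bar>fb\<bar> \<le> K" "\<bar>fc\<bar> \<le> K" "\<bar>fd\<bar> \<le> K"
      unfolding fa_def fb_def fc_def fd_def by (rule test_bounds)+
    have "\<bar>fa + m * fb + b u * fc - c u * fd\<bar> \<le> \<bar>fa\<bar> + \<bar>m * fb\<bar> + \<bar>b u * fc\<bar> + \<bar>c u * fd\<bar>" by linarith
    also have "\<dots> \<le> K + \<bar>m\<bar> * K + \<bar>b u\<bar> * K + \<bar>c u\<bar> * K"
      unfolding abs_mult using B by (intro add_mono mult_left_mono) auto
    also have "\<dots> = W u" by (simp add: W_def algebra_simps)
    finally have *: "\<bar>fa + m * fb + b u * fc - c u * fd\<bar> \<le> W u" .
    have "\<bar>F n i u\<bar> = \<bar>lam (?g n i)\<bar> * \<bar>fa + m * fb + b u * fc - c u * fd\<bar>"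
      unfolding F_def fa_def fb_def fc_def fd_def by (simp add: abs_mult)
    also have "\<dots> \<le> 1 * W u" using l * by (intro mult_mono) auto
    finally show ?thesis by simp
  qed
  \<comment> \<open>The weight may jump at \<tau>, so this single time is left out.\<close>
  have conv: "AE u in lborel. u \<in> {t..<r} \<longrightarrow> (\<lambda>n. F n (ix t r n u) u) \<longlonglongrightarrow> G u"
    using AE_lborel_singleton[of \<tau>]
  proof eventually_elim
    case (elim u)
    show ?case
    proof
      assume u: "u \<in> {t..<r}"
      let ?i = "\<lambda>n. ix t r n u"
      note g0 = gp_ix_tendsto(1)[OF tr u] and g1 = gp_ix_tendsto(2)[OF tr u]
      have ur: "u \<in> {t..r}" using u by auto
      have ev: "\<forall>\<^sub>F n in sequentially. ?i n < n"
        using eventually_gt_at_top[of 0] by eventually_elim (use ix_cell[OF tr _ u] in auto)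
      have in0: "\<forall>\<^sub>F n in sequentially. ?g n (?i n) \<in> {t..r}" "\<forall>\<^sub>F n in sequentially. ?g n (Suc (?i n)) \<in> {t..r}"
        using ev by (eventually_elim, use gin in simp)+
      have comp: "(\<lambda>n. Z (?g n (?i n))) \<longlonglongrightarrow> Z u" "(\<lambda>n. Z (?g n (Suc (?i n)))) \<longlonglongrightarrow> Z u"
        if "continuous_on {t..r} Z" for Z :: "real \<Rightarrow> real"
        by (rule continuous_on_tendsto_compose[OF that _ ur]; fact g0 g1 in0)+
      have dU: "(\<lambda>n. dU n (?i n)) \<longlonglongrightarrow> 0" unfolding dU_def
        using tendsto_diff[OF comp(2)[OF U] comp(1)[OF U]] by simp
      have dQ: "(\<lambda>n. dQ n (?i n)) \<longlonglongrightarrow> 0" unfolding dQ_def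
        using tendsto_diff[OF comp(2)[OF Q] comp(1)[OF Q]] by simp
      have sb: "\<forall>\<^sub>F n in sequentially. \<bar>s n (?i n)\<bar> \<le> 1"
        using ev by eventually_elim (use P in auto)
      have sz: "(\<lambda>n. s n (?i n) * z n) \<longlonglongrightarrow> 0" if "z \<longlonglongrightarrow> 0" for z
        by (rule Lim_null_comparison[OF _ tendsto_rabs_zero[OF that]])
           (use sb in eventually_elim, simp add: abs_mult mult_left_le_one_le)
      have mh: "(\<lambda>n. m * ?h n) \<longlonglongrightarrow> 0" using tendsto_mult_right_zero[OF step_tendsto] .
      have py: "(\<lambda>n. py n (?i n)) \<longlonglongrightarrow> Y u" unfolding py_def
        using tendsto_add[OF tendsto_diff[OF comp(2)[OF Y] mh] sz[OF mh]] by simp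
      have pe: "(\<lambda>n. pe n (?i n)) \<longlonglongrightarrow> E u" unfolding pe_def
        using tendsto_add[OF tendsto_diff[OF comp(2)[OF E] dU] sz[OF dU]] by simp
      have pq: "(\<lambda>n. pq n (?i n)) \<longlonglongrightarrow> Q u" unfolding pq_def
        using tendsto_add[OF comp(1)[OF Q] sz[OF dQ]] by simp
      have xi: "(\<lambda>n. \<xi> n (?i n)) \<longlonglongrightarrow> u"
        by (rule tendsto_sandwich[OF _ _ g0 g1]) (use ev in eventually_elim, use P in auto)+
      have l: "(\<lambda>n. lam (?g n (?i n))) \<longlonglongrightarrow> lam u" by (rule stop_weight_tendsto[OF lam tr u elim])
      show "(\<lambda>n. F n (?i n) u) \<longlonglongrightarrow> G u"
        unfolding F_def G[OF u]
        by (intro tendsto_mult tendsto_add tendsto_diff tendsto_const l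
             tendsto_test[OF _ xi comp(2)[OF Y] comp(2)[OF E] comp(2)[OF Q]] tendsto_test[OF _ g0 py pe pq]) auto
    qed
  qed
  note R = riemann_limit[OF tr F_meas _ Wi _ conv]
  show "X \<longlonglongrightarrow> (LBINT u:{t..r}. G u)"
    unfolding X'[abs_def] by (rule R(1)) (use bound ix_cell[OF tr] in auto)
  show "set_integrable lborel {t..r} G" by (rule R(2)) (use bound ix_cell[OF tr] in auto)
  show "\<bar>X n\<bar> \<le> (LBINT u:{t..r}. K * (1 + \<bar>m\<bar> + \<bar>b u\<bar> + \<bar>c u\<bar>))" for n
  proof (cases "n = 0")
    case False
    have "\<bar>X n\<bar> \<le> (LBINT u:{t..r}. W u)"
      unfolding X' by (rule R(3)) (use bound ix_cell[OF tr] False in auto)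
    then show ?thesis by (simp add: W_def[abs_def])
  next
    case True
    then show ?thesis unfolding X set_lebesgue_integral_def
      using K_nonneg by (auto intro!: integral_nonneg_AE AE_I2)
  qed
qed

end

text \<open>Mean change of \<open>f\<close> over a Gaussian step of variance \<open>h\<close>, per
  unit of time; as \<open>h\<close> tends to 0 it becomes the second-order part of the generator.
  \<alpha> and \<beta> map two standard normals to the noises of log-price and \<epsilon>.\<close>

definition noise_gen :: "(real \<Rightarrow> real \<Rightarrow> real \<Rightarrow> real \<Rightarrow> real) \<Rightarrow> (real \<times> real \<Rightarrow> real) \<Rightarrow> (real \<times> real \<Rightarrow> real) \<Rightarrow>
    real \<Rightarrow> real \<Rightarrow> real \<Rightarrow> real \<Rightarrow> real \<Rightarrow> real" where
  "noise_gen f \<alpha> \<beta> h u y e q = (LINT z|gauss2. f u (y + sqrt h * \<alpha> z) (e + sqrt h * \<beta> z) q - f u y e q) / h"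

context test_fun
begin

context
  fixes a1 a2 b1 b2 :: real and \<alpha> \<beta> :: "real \<times> real \<Rightarrow> real"
  defines "\<alpha> \<equiv> \<lambda>z. a1 * fst z + a2 * snd z" and "\<beta> \<equiv> \<lambda>z. b1 * fst z + b2 * snd z"
begin

text \<open>The first-order term has Gaussian mean zero, yet it is of size \<open>sqrt h\<close> and
  would blow up after division by \<open>h\<close>. Subtracting it beforehand leaves a remainder
  with a quadratic majorant independent of \<open>h\<close>.\<close>

definition noise_rem :: "real \<Rightarrow> real \<Rightarrow> real \<Rightarrow> real \<Rightarrow> real \<Rightarrow> real \<times> real \<Rightarrow> real" where
  "noise_rem h u y e q z = (f u (y + sqrt h * \<alpha> z) (e + sqrt h * \<beta> z) q - f u y e q
      - sqrt h * (\<alpha> z * fy u y e q + \<beta> z * fe u y e q)) / h"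

text \<open>Second-order Taylor formula on a segment; the two factors \<open>sqrt h\<close> in each
  quadratic term cancel the division by \<open>h\<close>.\<close>

lemma noise_taylor:
  assumes u: "u \<in> {t..r}" and q: "q \<in> {0..qb}" and h: "h > 0"
  shows "\<exists>s\<in>{0..1}. noise_rem h u y e q z =
    ((\<alpha> z)\<^sup>2 * fyy u (y + s * (sqrt h * \<alpha> z)) (e + s * (sqrt h * \<beta> z)) q
      + \<alpha> z * \<beta> z * fye u (y + s * (sqrt h * \<alpha> z)) (e + s * (sqrt h * \<beta> z)) q
      + (\<beta> z)\<^sup>2 * fee u (y + s * (sqrt h * \<alpha> z)) (e + s * (sqrt h * \<beta> z)) q) / 2"
proof -
  let ?a = "sqrt h * \<alpha> z" and ?b = "sqrt h * \<beta> z"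
  define d where "d k s = (if k = (0::nat) then f u (y + s * ?a) (e + s * ?b) q
    else if k = 1 then ?a * fy u (y + s * ?a) (e + s * ?b) q + ?b * fe u (y + s * ?a) (e + s * ?b) q
    else ?a\<^sup>2 * fyy u (y + s * ?a) (e + s * ?b) q + ?a * ?b * fye u (y + s * ?a) (e + s * ?b) q
      + ?b\<^sup>2 * fee u (y + s * ?a) (e + s * ?b) q)" for k s
  have D: "DERIV (d k) s :> d (Suc k) s" if "k < 2" for k s
  proof -
    have "k = 0 \<or> k = 1" using that by auto
    then consider "k = 0" | "k = 1" by blast
    then show ?thesis
    proof cases
      case 1
      have UNIV: "{s. q + s * 0 \<in> {0..qb}} = (UNIV :: real set)" using q by auto
      show ?thesis using d_x[OF u, where q=q and \<gamma>=0 and \<alpha>="?a" and \<beta>="?b" and y=y and e=e and s=s] q 1 unfolding UNIV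
        by (simp add: d_def[abs_def])
    next
      case 2
      show ?thesis using d_xx[OF u q, where \<alpha>="?a" and \<beta>="?b" and y=y and e=e and s=s] 2 by (simp add: d_def[abs_def])
    qed
  qed
  have "\<exists>s>0. s < 1 \<and> f u (y + 1 * ?a) (e + 1 * ?b) q = (\<Sum>m<2. d m 0 / fact m * 1 ^ m) + d 2 s / fact 2 * 1 ^ 2"
    by (rule Maclaurin[where f="\<lambda>s. f u (y + s * ?a) (e + s * ?b) q" and diff=d and h=1 and n=2])
       (use D in \<open>auto simp: d_def[abs_def]\<close>)
  then obtain s where s: "0 < s" "s < 1" and e: "f u (y + ?a) (e + ?b) q = d 0 0 + d 1 0 + d 2 s / 2"
    by (auto simp: numeral_2_eq_2)
  have h2: "sqrt h * sqrt h = h" using h by simp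
  have "f u (y + ?a) (e + ?b) q - f u y e q - sqrt h * (\<alpha> z * fy u y e q + \<beta> z * fe u y e q) = d 2 s / 2"
    using e by (simp add: d_def algebra_simps)
  also have "d 2 s = h * ((\<alpha> z)\<^sup>2 * fyy u (y + s * ?a) (e + s * ?b) q
      + \<alpha> z * \<beta> z * fye u (y + s * ?a) (e + s * ?b) q + (\<beta> z)\<^sup>2 * fee u (y + s * ?a) (e + s * ?b) q)"
    using h by (simp add: d_def power_mult_distrib algebra_simps)
  finally show ?thesis
    using s h by (intro bexI[of _ s]) (auto simp: noise_rem_def)
qed

text \<open>Three quadratic terms, each at most \<open>S * S * K\<close>, are halved and the factor
  3/2 is rounded up to 2; another 2 comes from \<open>(\<bar>x\<bar> + \<bar>y\<bar>)\<^sup>2 \<le>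
  2 * (x\<^sup>2 + y\<^sup>2)\<close>.\<close>

definition noise_bd :: "real \<times> real \<Rightarrow> real" where
  "noise_bd z = K * ((\<bar>a1\<bar> + \<bar>a2\<bar> + \<bar>b1\<bar> + \<bar>b2\<bar>)\<^sup>2 * 4 * ((fst z)\<^sup>2 + (snd z)\<^sup>2))"

lemma noise_bd_integrable: "integrable gauss2 noise_bd"
  unfolding noise_bd_def using gauss2_moments(3,4) by (auto simp: has_bochner_integral_iff)

lemma noise_rem_bound:
  assumes u: "u \<in> {t..r}" and q: "q \<in> {0..qb}" and h: "h > 0"
  shows "\<bar>noise_rem h u y e q z\<bar> \<le> noise_bd z"
proof -
  obtain s where e: "noise_rem h u y e q z =
    ((\<alpha> z)\<^sup>2 * fyy u (y + s * (sqrt h * \<alpha> z)) (e + s * (sqrt h * \<beta> z)) q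
      + \<alpha> z * \<beta> z * fye u (y + s * (sqrt h * \<alpha> z)) (e + s * (sqrt h * \<beta> z)) q
      + (\<beta> z)\<^sup>2 * fee u (y + s * (sqrt h * \<alpha> z)) (e + s * (sqrt h * \<beta> z)) q) / 2" (is "_ = (_ * ?A + _ * ?B + _ * ?C) / 2")
    using noise_taylor[OF assms] by blast
  have B: "\<bar>?A\<bar> \<le> K" "\<bar>?B\<bar> \<le> K" "\<bar>?C\<bar> \<le> K" by (rule test_bounds)+
  define S where "S = (\<bar>a1\<bar> + \<bar>a2\<bar> + \<bar>b1\<bar> + \<bar>b2\<bar>) * (\<bar>fst z\<bar> + \<bar>snd z\<bar>)"
  have ab: "\<bar>\<alpha> z\<bar> \<le> S" "\<bar>\<beta> z\<bar> \<le> S"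
  proof -
    have "\<bar>\<alpha> z\<bar> \<le> \<bar>a1\<bar> * \<bar>fst z\<bar> + \<bar>a2\<bar> * \<bar>snd z\<bar>" unfolding \<alpha>_def abs_mult[symmetric] by linarith
    also have "\<dots> \<le> S" by (simp add: S_def algebra_simps)
    finally show "\<bar>\<alpha> z\<bar> \<le> S" .
    have "\<bar>\<beta> z\<bar> \<le> \<bar>b1\<bar> * \<bar>fst z\<bar> + \<bar>b2\<bar> * \<bar>snd z\<bar>" unfolding \<beta>_def abs_mult[symmetric] by linarith
    also have "\<dots> \<le> S" by (simp add: S_def algebra_simps)
    finally show "\<bar>\<beta> z\<bar> \<le> S" .
  qed
  have "\<bar>(\<alpha> z)\<^sup>2 * ?A + \<alpha> z * \<beta> z * ?B + (\<beta> z)\<^sup>2 * ?C\<bar> \<le> \<bar>(\<alpha> z)\<^sup>2 * ?A\<bar> + \<bar>\<alpha> z * \<beta> z * ?B\<bar> + \<bar>(\<beta> z)\<^sup>2 * ?C\<bar>" by linarith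
  also have "\<dots> \<le> (S * S) * K + (S * S) * K + (S * S) * K"
    unfolding abs_mult power2_eq_square using ab B by (intro add_mono mult_mono) auto
  finally have "\<bar>noise_rem h u y e q z\<bar> \<le> 2 * (S * S * K)" unfolding e using K_nonneg zero_le_square[of S] mult_nonneg_nonneg[of "S * S" K] by (simp add: algebra_simps)
  also have "2 * (S * S * K) \<le> noise_bd z"
  proof -
    have sq: "(\<bar>fst z\<bar> + \<bar>snd z\<bar>)\<^sup>2 \<le> 2 * ((fst z)\<^sup>2 + (snd z)\<^sup>2)"
      using sum_squares_bound[of "\<bar>fst z\<bar>" "\<bar>snd z\<bar>"] by (simp add: power2_sum)
    have c: "0 \<le> (\<bar>a1\<bar> + \<bar>a2\<bar> + \<bar>b1\<bar> + \<bar>b2\<bar>)\<^sup>2 * 2" by simp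
    have "K * ((\<bar>a1\<bar> + \<bar>a2\<bar> + \<bar>b1\<bar> + \<bar>b2\<bar>)\<^sup>2 * 2 * (\<bar>fst z\<bar> + \<bar>snd z\<bar>)\<^sup>2)
       \<le> K * ((\<bar>a1\<bar> + \<bar>a2\<bar> + \<bar>b1\<bar> + \<bar>b2\<bar>)\<^sup>2 * 2 * (2 * ((fst z)\<^sup>2 + (snd z)\<^sup>2)))"
      by (rule mult_left_mono[OF mult_left_mono[OF sq c] K_nonneg])
    moreover have "2 * (S * S * K) = K * ((\<bar>a1\<bar> + \<bar>a2\<bar> + \<bar>b1\<bar> + \<bar>b2\<bar>)\<^sup>2 * 2 * (\<bar>fst z\<bar> + \<bar>snd z\<bar>)\<^sup>2)"
      unfolding S_def power2_eq_square by (simp only: mult_ac)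
    moreover have "noise_bd z = K * ((\<bar>a1\<bar> + \<bar>a2\<bar> + \<bar>b1\<bar> + \<bar>b2\<bar>)\<^sup>2 * 2 * (2 * ((fst z)\<^sup>2 + (snd z)\<^sup>2)))"
      unfolding noise_bd_def by simp
    ultimately show ?thesis by (simp only:)
  qed
  finally show ?thesis .
qed

lemma noise_rem_measurable [measurable]: "noise_rem h u y e q \<in> borel_measurable (borel \<Otimes>\<^sub>M borel)"
proof -
  have [measurable]: "\<alpha> \<in> borel_measurable (borel \<Otimes>\<^sub>M borel)" "\<beta> \<in> borel_measurable (borel \<Otimes>\<^sub>M borel)"
    unfolding \<alpha>_def \<beta>_def by measurable
  have "(\<lambda>z. f u (y + sqrt h * \<alpha> z) (e + sqrt h * \<beta> z) q) \<in> borel_measurable (borel \<Otimes>\<^sub>M borel)"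
    by (rule test_measurable[of f]) (simp, measurable)
  then show ?thesis unfolding noise_rem_def by measurable
qed

lemma noise_gen_eq:
  assumes u: "u \<in> {t..r}" and q: "q \<in> {0..qb}" and h: "h > 0"
  shows "noise_gen f \<alpha> \<beta> h u y e q = (LINT z|gauss2. noise_rem h u y e q z)"
proof -
  have [measurable]: "\<alpha> \<in> borel_measurable (borel \<Otimes>\<^sub>M borel)" "\<beta> \<in> borel_measurable (borel \<Otimes>\<^sub>M borel)"
    unfolding \<alpha>_def \<beta>_def by measurable
  have 1: "has_bochner_integral gauss2 (\<lambda>z. \<alpha> z * fy u y e q + \<beta> z * fe u y e q)
     ((a1 * 0 + a2 * 0) * fy u y e q + (b1 * 0 + b2 * 0) * fe u y e q)"
    unfolding \<alpha>_def \<beta>_def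
    by (intro has_bochner_integral_add has_bochner_integral_mult_left has_bochner_integral_mult_right) (use gauss2_moments in auto)
  have fm: "(\<lambda>z. f u (y + sqrt h * \<alpha> z) (e + sqrt h * \<beta> z) q) \<in> borel_measurable (borel \<Otimes>\<^sub>M borel)"
    by (rule test_measurable[of f]) (simp, measurable)
  have i: "integrable gauss2 (\<lambda>z. f u (y + sqrt h * \<alpha> z) (e + sqrt h * \<beta> z) q - f u y e q)"
    by (intro Bochner_Integration.integrable_diff gauss2.integrable_const_bound[where B=K] AE_I2)
       (use bd[of f] fm in auto)
  have "(LINT z|gauss2. noise_rem h u y e q z) = ((LINT z|gauss2. f u (y + sqrt h * \<alpha> z) (e + sqrt h * \<beta> z) q - f u y e q)
     - sqrt h * (LINT z|gauss2. \<alpha> z * fy u y e q + \<beta> z * fe u y e q)) / h"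
    unfolding noise_rem_def using i 1[THEN has_bochner_integral_iff[THEN iffD1, THEN conjunct1]] by (simp only: integral_divide_zero Bochner_Integration.integral_diff integrable_mult_right integral_mult_right_zero)
  then show ?thesis using 1[THEN has_bochner_integral_integral_eq] by (simp add: noise_gen_def)
qed

lemma noise_gen_bound:
  assumes u: "u \<in> {t..r}" and q: "q \<in> {0..qb}" and h: "h > 0"
  shows "\<bar>noise_gen f \<alpha> \<beta> h u y e q\<bar> \<le> (LINT z|gauss2. noise_bd z)"
proof -
  have "\<bar>LINT z|gauss2. noise_rem h u y e q z\<bar> \<le> (LINT z|gauss2. \<bar>noise_rem h u y e q z\<bar>)"
    using integral_norm_bound[of gauss2 "noise_rem h u y e q"] by simp
  also have "\<dots> \<le> (LINT z|gauss2. noise_bd z)"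
    using noise_rem_bound[OF assms]
    by (intro integral_mono noise_bd_integrable integrable_abs Bochner_Integration.integrable_bound[OF noise_bd_integrable])
       (auto intro!: AE_I2 order_trans[OF _ abs_ge_self])
  finally show ?thesis unfolding noise_gen_eq[OF assms] .
qed

text \<open>Dominated convergence under the Gaussian law, along moving base points. Variances are 1
  and the mixed moment is 0, so the limit sees the rows \<open>(a1, a2)\<close> and
  \<open>(b1, b2)\<close> only through their inner products.\<close>

lemma noise_gen_tendsto:
  assumes dom: "\<And>n. u n \<in> {t..r}" "\<And>n. q n \<in> {0..qb}" "\<And>n. h n > 0"
    and lim: "h \<longlonglongrightarrow> 0" "u \<longlonglongrightarrow> u'" "y \<longlonglongrightarrow> y'" "e \<longlonglongrightarrow> e'" "q \<longlonglongrightarrow> q'"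
  shows "(\<lambda>n. noise_gen f \<alpha> \<beta> (h n) (u n) (y n) (e n) (q n)) \<longlonglongrightarrow>
     ((a1\<^sup>2 + a2\<^sup>2) * fyy u' y' e' q' + (a1 * b1 + a2 * b2) * fye u' y' e' q' + (b1\<^sup>2 + b2\<^sup>2) * fee u' y' e' q') / 2"
proof -
  let ?L = "\<lambda>z. ((\<alpha> z)\<^sup>2 * fyy u' y' e' q' + \<alpha> z * \<beta> z * fye u' y' e' q' + (\<beta> z)\<^sup>2 * fee u' y' e' q') / 2"
  have [measurable]: "\<alpha> \<in> borel_measurable (borel \<Otimes>\<^sub>M borel)" "\<beta> \<in> borel_measurable (borel \<Otimes>\<^sub>M borel)"
    unfolding \<alpha>_def \<beta>_def by measurable
  have Lm: "?L \<in> borel_measurable gauss2" by measurable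
  have "(\<lambda>n. LINT z|gauss2. noise_rem (h n) (u n) (y n) (e n) (q n) z) \<longlonglongrightarrow> (LINT z|gauss2. ?L z)"
  proof (rule integral_dominated_convergence[OF Lm _ noise_bd_integrable])
    show "AE z in gauss2. (\<lambda>n. noise_rem (h n) (u n) (y n) (e n) (q n) z) \<longlonglongrightarrow> ?L z"
    proof (rule AE_I2)
      fix z
      have "\<forall>n. \<exists>s\<in>{0..1}. noise_rem (h n) (u n) (y n) (e n) (q n) z =
         ((\<alpha> z)\<^sup>2 * fyy (u n) (y n + s * (sqrt (h n) * \<alpha> z)) (e n + s * (sqrt (h n) * \<beta> z)) (q n)
      + \<alpha> z * \<beta> z * fye (u n) (y n + s * (sqrt (h n) * \<alpha> z)) (e n + s * (sqrt (h n) * \<beta> z)) (q n)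
      + (\<beta> z)\<^sup>2 * fee (u n) (y n + s * (sqrt (h n) * \<alpha> z)) (e n + s * (sqrt (h n) * \<beta> z)) (q n)) / 2"
        using noise_taylor dom by blast
      then obtain s where s: "\<And>n. s n \<in> {0..1}" and eq: "\<And>n. noise_rem (h n) (u n) (y n) (e n) (q n) z =
         ((\<alpha> z)\<^sup>2 * fyy (u n) (y n + s n * (sqrt (h n) * \<alpha> z)) (e n + s n * (sqrt (h n) * \<beta> z)) (q n)
      + \<alpha> z * \<beta> z * fye (u n) (y n + s n * (sqrt (h n) * \<alpha> z)) (e n + s n * (sqrt (h n) * \<beta> z)) (q n)
      + (\<beta> z)\<^sup>2 * fee (u n) (y n + s n * (sqrt (h n) * \<alpha> z)) (e n + s n * (sqrt (h n) * \<beta> z)) (q n)) / 2"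
        by metis
      have sq: "(\<lambda>n. sqrt (h n) * c) \<longlonglongrightarrow> 0" for c
        using tendsto_mult_right[OF tendsto_real_sqrt[OF lim(1)], of c] by simp
      have sz: "(\<lambda>n. s n * (sqrt (h n) * c)) \<longlonglongrightarrow> 0" for c
        by (rule Lim_null_comparison[OF _ tendsto_rabs_zero[OF sq[of c]]])
           (use s in \<open>auto intro!: always_eventually simp: abs_mult mult_left_le_one_le\<close>)
      have 1: "(\<lambda>n. y n + s n * (sqrt (h n) * \<alpha> z)) \<longlonglongrightarrow> y'" "(\<lambda>n. e n + s n * (sqrt (h n) * \<beta> z)) \<longlonglongrightarrow> e'"
        using tendsto_add[OF lim(3) sz[of "\<alpha> z"]] tendsto_add[OF lim(4) sz[of "\<beta> z"]] by simp_all
      show "(\<lambda>n. noise_rem (h n) (u n) (y n) (e n) (q n) z) \<longlonglongrightarrow> ?L z"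
        unfolding eq by (intro tendsto_divide tendsto_add tendsto_mult tendsto_const tendsto_test[OF _ lim(2) 1 lim(5)]) auto
    qed
    show "\<And>n. AE z in gauss2. norm (noise_rem (h n) (u n) (y n) (e n) (q n) z) \<le> noise_bd z"
      using noise_rem_bound dom by simp
  qed simp
  moreover have "(LINT z|gauss2. ?L z) = ((a1\<^sup>2 + a2\<^sup>2) * fyy u' y' e' q' + (a1 * b1 + a2 * b2) * fye u' y' e' q'
      + (b1\<^sup>2 + b2\<^sup>2) * fee u' y' e' q') / 2"
  proof (rule has_bochner_integral_integral_eq)
    define A B C where "A = fyy u' y' e' q'" and "B = fye u' y' e' q'" and "C = fee u' y' e' q'"
    have "has_bochner_integral gauss2 (\<lambda>z. (a1\<^sup>2 * A + a1 * b1 * B + b1\<^sup>2 * C) / 2 * (fst z)\<^sup>2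
       + (a2\<^sup>2 * A + a2 * b2 * B + b2\<^sup>2 * C) / 2 * (snd z)\<^sup>2
       + (2 * a1 * a2 * A + (a1 * b2 + a2 * b1) * B + 2 * b1 * b2 * C) / 2 * (fst z * snd z))
       ((a1\<^sup>2 * A + a1 * b1 * B + b1\<^sup>2 * C) / 2 * 1 + (a2\<^sup>2 * A + a2 * b2 * B + b2\<^sup>2 * C) / 2 * 1
        + (2 * a1 * a2 * A + (a1 * b2 + a2 * b1) * B + 2 * b1 * b2 * C) / 2 * 0)"
      by (intro has_bochner_integral_add has_bochner_integral_mult_right) (use gauss2_moments in auto)
    then show "has_bochner_integral gauss2 ?L (((a1\<^sup>2 + a2\<^sup>2) * fyy u' y' e' q' + (a1 * b1 + a2 * b2) * fye u' y' e' q'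
      + (b1\<^sup>2 + b2\<^sup>2) * fee u' y' e' q') / 2)"
      unfolding A_def[symmetric] B_def[symmetric] C_def[symmetric] \<alpha>_def \<beta>_def
      by (rule back_subst[of "\<lambda>x. x"]) (rule arg_cong2[where f="has_bochner_integral gauss2"], auto simp: fun_eq_iff power2_eq_square field_simps)
  qed
  ultimately show ?thesis using noise_gen_eq[OF dom] by simp
qed

end

end

section \<open>Brownian motion\<close>

lemma gauss1_exp: "has_bochner_integral gauss1 (\<lambda>z. exp (a * z)) (exp (a\<^sup>2 / 2))"
  and gauss1_zexp: "has_bochner_integral gauss1 (\<lambda>z. z * exp (a * z)) (a * exp (a\<^sup>2 / 2))"
proof -
  \<comment> \<open>Completing the square: an exponential tilt of the standard normal density is a
    shifted normal density.\<close>
  have shift: "std_normal_density z * exp (a * z) = exp (a\<^sup>2 / 2) * normal_density a 1 z" for z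
    by (simp add: normal_density_def exp_add[symmetric] power2_eq_square field_simps)
  have "has_bochner_integral lborel (\<lambda>z. exp (a\<^sup>2 / 2) * normal_density a 1 z) (exp (a\<^sup>2 / 2) * 1)"
    by (intro has_bochner_integral_mult_right) (simp add: has_bochner_integral_iff)
  then show "has_bochner_integral gauss1 (\<lambda>z. exp (a * z)) (exp (a\<^sup>2 / 2))"
    unfolding gauss1_def by (intro has_bochner_integral_density) (auto simp: shift)
  have "has_bochner_integral lborel (\<lambda>z. exp (a\<^sup>2 / 2) * (normal_density a 1 z * z)) (exp (a\<^sup>2 / 2) * a)"
    by (intro has_bochner_integral_mult_right normal_moment_nz_1) simp
  moreover have "exp (a\<^sup>2 / 2) * (normal_density a 1 z * z) = std_normal_density z * (z * exp (a * z))" for z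
    using shift[of z] by (simp add: algebra_simps)
  ultimately have "has_bochner_integral lborel (\<lambda>z. std_normal_density z * (z * exp (a * z))) (a * exp (a\<^sup>2 / 2))"
    by (simp only: mult.commute[of "exp (a\<^sup>2 / 2)" a])
  then show "has_bochner_integral gauss1 (\<lambda>z. z * exp (a * z)) (a * exp (a\<^sup>2 / 2))"
    unfolding gauss1_def by (intro has_bochner_integral_density) auto
qed

locale bm2 = prob_space M for M :: "'w measure" +
  fixes W1 W2 :: "real \<Rightarrow> 'w \<Rightarrow> real" and T :: real
  assumes BM1: "is_std_BM M T W1" and BM2: "is_std_BM M T W2"
    and indepW: "indep_var (PiM {0..T} (\<lambda>_. borel)) (\<lambda>om. restrict (\<lambda>u. W1 u om) {0..T})
                   (PiM {0..T} (\<lambda>_. borel)) (\<lambda>om. restrict (\<lambda>u. W2 u om) {0..T})"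
    and T_pos: "T > 0"
begin

abbreviation F :: "real \<Rightarrow> 'w measure" where "F \<equiv> nat_filt M W1 W2"

definition is_W :: "(real \<Rightarrow> 'w \<Rightarrow> real) \<Rightarrow> bool" where "is_W W \<longleftrightarrow> W = W1 \<or> W = W2"

lemma is_W [simp]: "is_W W1" "is_W W2" by (simp_all add: is_W_def)

lemma W_BM: "is_W W \<Longrightarrow> is_std_BM M T W" using BM1 BM2 by (auto simp: is_W_def)

lemma W_meas: "is_W W \<Longrightarrow> s \<in> {0..T} \<Longrightarrow> W s \<in> borel_measurable M"
  using W_BM by (auto simp: is_std_BM_def)

lemma W_0: "is_W W \<Longrightarrow> om \<in> space M \<Longrightarrow> W 0 om = 0"
  and W_cont: "is_W W \<Longrightarrow> om \<in> space M \<Longrightarrow> continuous_on {0..T} (\<lambda>s. W s om)"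
  using W_BM by (auto simp: is_std_BM_def)

lemma W_incr: "is_W W \<Longrightarrow> 0 \<le> s \<Longrightarrow> s < r \<Longrightarrow> r \<le> T \<Longrightarrow>
    distributed M lborel (\<lambda>om. W r om - W s om) (normal_density 0 (sqrt (r - s)))"
  using W_BM by (auto simp: is_std_BM_def)

lemma space_F [simp]: "space (F s) = space M"
  unfolding nat_filt_def by (rule space_measure_of_conv)

lemma sets_F: "sets (F s) = sigma_sets (space M)
     ((\<Union>u\<in>{0..s}. {W1 u -` B \<inter> space M | B. B \<in> sets borel} \<union>
                   {W2 u -` B \<inter> space M | B. B \<in> sets borel}) \<union> null_sets M)"
  unfolding nat_filt_def
  by (rule sets_measure_of) (auto simp: null_sets_def dest: sets.sets_into_space)

lemma F_sub: "s \<le> T \<Longrightarrow> sets (F s) \<subseteq> sets M"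
  unfolding sets_F using W_meas
  by (intro sets.sigma_sets_subset) (auto intro!: measurable_sets simp: null_sets_def)

lemma F_measurable_M: "s \<le> T \<Longrightarrow> X \<in> measurable (F s) N \<Longrightarrow> X \<in> measurable M N"
  by (rule measurable_from_subalg[of M "F s"]) (auto simp: subalgebra_def F_sub)

lemma F_mono: "s \<le> s' \<Longrightarrow> sets (F s) \<subseteq> sets (F s')"
  unfolding sets_F by (intro sigma_sets_mono' Un_mono UN_mono subset_refl) (simp add: subset_iff)

lemma F_measurable_mono: "s \<le> s' \<Longrightarrow> X \<in> measurable (F s) N \<Longrightarrow> X \<in> measurable (F s') N"
  by (rule measurable_from_subalg[of "F s'" "F s"]) (auto simp: subalgebra_def F_mono)

lemma null_F: "A \<in> null_sets M \<Longrightarrow> A \<in> sets (F s)"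
  unfolding sets_F by (rule sigma_sets.Basic) simp

lemma W_F: "is_W W \<Longrightarrow> 0 \<le> u \<Longrightarrow> u \<le> s \<Longrightarrow> W u \<in> borel_measurable (F s)"
proof (rule measurableI)
  fix A :: "real set" assume "is_W W" "0 \<le> u" "u \<le> s" "A \<in> sets borel"
  then show "W u -` A \<inter> space (F s) \<in> sets (F s)"
    unfolding sets_F space_F by (intro sigma_sets.Basic) (auto simp: is_W_def)
qed simp

abbreviation path :: "(real \<Rightarrow> 'w \<Rightarrow> real) \<Rightarrow> real \<Rightarrow> 'w measure" where
  "path W s \<equiv> vimage_algebra (space M) (\<lambda>om. restrict (\<lambda>u. W u om) {0..s}) (PiM {0..s} (\<lambda>_. borel))"

abbreviation incr :: "(real \<Rightarrow> 'w \<Rightarrow> real) \<Rightarrow> real \<Rightarrow> real \<Rightarrow> 'w measure" where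
  "incr W s r \<equiv> vimage_algebra (space M) (\<lambda>om. W r om - W s om) borel"

lemma path_measurable: "(\<lambda>om. restrict (\<lambda>u. W u om) {0..s}) \<in> measurable (path W s) (PiM {0..s} (\<lambda>_. borel))"
  by (rule measurable_vimage_algebra1) (auto simp: space_PiM)

lemma W_path: "0 \<le> u \<Longrightarrow> u \<le> s \<Longrightarrow> W u \<in> borel_measurable (path W s)"
  using measurable_compose[OF path_measurable[of W s], of "\<lambda>f. f u" borel]
  by (auto intro!: measurable_component_singleton)

lemma vimage_sub: "f \<in> measurable N L \<Longrightarrow> space N = X \<Longrightarrow> sets (vimage_algebra X f L) \<subseteq> sets N"
  by (rule sets_image_in_sets) auto

lemma path_mono: "s \<le> T \<Longrightarrow> sets (path W s) \<subseteq> sets (path W T)"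
  by (rule vimage_sub) (auto intro!: measurable_restrict W_path)

lemma incr_path: "0 \<le> s \<Longrightarrow> s < r \<Longrightarrow> r \<le> T \<Longrightarrow> sets (incr W s r) \<subseteq> sets (path W T)"
  by (rule vimage_sub) (auto intro!: borel_measurable_diff W_path)

lemma path_indep: "indep_set (sets (path W1 T)) (sets (path W2 T))"
  using indepW[unfolded indep_var_eq] by (auto simp: sets_vimage_algebra)

text \<open>On events that are intersections of one event per Brownian motion, probabilities factor
  first between the two motions, over all of \<open>[0, T]\<close>, and then within each motion
  between past and increment; regrouping gives independence from the joint past. Stability under
  intersection carries this to the generated \<sigma>-algebras.\<close>

lemma pair_indep:
  assumes s: "0 \<le> s" "s < r" "r \<le> T"
  shows "indep_set (sets (F s)) (sets (vimage_algebra (space M)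
      (\<lambda>om. (W1 r om - W1 s om, W2 r om - W2 s om)) (borel \<Otimes>\<^sub>M borel)))"
proof -
  \<comment> \<open>Null sets are adjoined because the filtration is augmented; an intersection with
    a null set is null, so the family stays stable.\<close>
  define G where "G = {A \<inter> B | A B. A \<in> sets (path W1 s) \<and> B \<in> sets (path W2 s)} \<union> null_sets M"
  define H where "H = {A \<inter> B | A B. A \<in> sets (incr W1 s r) \<and> B \<in> sets (incr W2 s r)}"
  have i1: "indep_set (sets (incr W1 s r)) (sets (path W1 s))" "indep_set (sets (incr W2 s r)) (sets (path W2 s))"
    using BM1 BM2 s unfolding is_std_BM_def by blast+
  note ev = i1[THEN indep_setD_ev1] i1[THEN indep_setD_ev2]
  have sT: "s \<le> T" using s by simp
  have pT: "prob (A \<inter> B) = prob A * prob B" if "A \<in> sets (path W1 T)" "B \<in> sets (path W2 T)" for A B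
    by (rule indep_setD[OF path_indep that])
  have "indep_set G H"
  proof (rule indep_setI)
    show "G \<subseteq> events" "H \<subseteq> events" using ev by (auto simp: G_def H_def null_sets_def)
    fix a b assume a: "a \<in> G" and b: "b \<in> H"
    from b obtain D1 D2 where D: "b = D1 \<inter> D2" "D1 \<in> sets (incr W1 s r)" "D2 \<in> sets (incr W2 s r)"
      by (auto simp: H_def)
    show "prob (a \<inter> b) = prob a * prob b"
    proof (cases "a \<in> null_sets M")
      case True
      have "b \<in> events" using D ev by auto
      then have "a \<inter> b \<in> null_sets M" by (rule null_set_Int2[OF True])
      then show ?thesis using True by (simp add: null_sets_def measure_def)
    next
      case False
      with a obtain A1 A2 where A: "a = A1 \<inter> A2" "A1 \<in> sets (path W1 s)" "A2 \<in> sets (path W2 s)"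
        by (auto simp: G_def)
      have AT: "A1 \<in> sets (path W1 T)" "A2 \<in> sets (path W2 T)" using A path_mono[OF sT] by blast+
      have DT: "D1 \<in> sets (path W1 T)" "D2 \<in> sets (path W2 T)" using D incr_path[OF s] by blast+
      \<comment> \<open>Regroup by Brownian motion instead of by past and increment.\<close>
      have "a \<inter> b = (D1 \<inter> A1) \<inter> (D2 \<inter> A2)" using A D by auto
      then have "prob (a \<inter> b) = prob (D1 \<inter> A1) * prob (D2 \<inter> A2)"
        using pT[of "D1 \<inter> A1" "D2 \<inter> A2"] AT DT by auto
      also have "\<dots> = (prob D1 * prob A1) * (prob D2 * prob A2)"
        using indep_setD[OF i1(1) D(2) A(2)] indep_setD[OF i1(2) D(3) A(3)] by simp
      also have "\<dots> = prob a * prob b" using pT[OF AT] pT[OF DT] A D by simp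
      finally show ?thesis .
    qed
  qed
  moreover have "Int_stable H"
  proof (rule Int_stableI)
    fix a b assume "a \<in> H" "b \<in> H"
    then obtain A B A' B' where "a = A \<inter> B" "b = A' \<inter> B'" "A \<in> sets (incr W1 s r)" "A' \<in> sets (incr W1 s r)"
      "B \<in> sets (incr W2 s r)" "B' \<in> sets (incr W2 s r)" by (auto simp: H_def)
    then have "a \<inter> b = (A \<inter> A') \<inter> (B \<inter> B')" "A \<inter> A' \<in> sets (incr W1 s r)" "B \<inter> B' \<in> sets (incr W2 s r)" by auto
    then show "a \<inter> b \<in> H" unfolding H_def by blast
  qed
  moreover have "Int_stable G"
  proof (rule Int_stableI)
    fix a b assume ab: "a \<in> G" "b \<in> G"
    have e: "a \<in> events" "b \<in> events" using ab ev by (auto simp: G_def null_sets_def)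
    show "a \<inter> b \<in> G"
    proof (cases "a \<in> null_sets M \<or> b \<in> null_sets M")
      case True
      then have "a \<inter> b \<in> null_sets M" using e null_set_Int2[of a M b] null_set_Int1[of b M a] by auto
      then show ?thesis by (simp add: G_def)
    next
      case False
      with ab obtain A B A' B' where "a = A \<inter> B" "b = A' \<inter> B'" "A \<in> sets (path W1 s)" "A' \<in> sets (path W1 s)"
        "B \<in> sets (path W2 s)" "B' \<in> sets (path W2 s)" by (auto simp: G_def)
      then have "a \<inter> b = (A \<inter> A') \<inter> (B \<inter> B')" "A \<inter> A' \<in> sets (path W1 s)" "B \<inter> B' \<in> sets (path W2 s)" by auto
      then show "a \<inter> b \<in> G" unfolding G_def by blast
    qed
  qed
  ultimately have ind: "indep_set (sigma_sets (space M) G) (sigma_sets (space M) H)"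
    by (intro indep_set_sigma_sets)
  have 1: "sets (F s) \<subseteq> sigma_sets (space M) G"
    unfolding sets_F
  proof (rule sigma_sets_mono, rule subsetI)
    fix a assume "a \<in> (\<Union>u\<in>{0..s}. {W1 u -` B \<inter> space M | B. B \<in> sets borel} \<union>
                   {W2 u -` B \<inter> space M | B. B \<in> sets borel}) \<union> null_sets M"
    then consider "a \<in> null_sets M" | u B where "u \<in> {0..s}" "B \<in> sets borel" "a = W1 u -` B \<inter> space M"
      | u B where "u \<in> {0..s}" "B \<in> sets borel" "a = W2 u -` B \<inter> space M" by auto
    then have "a \<in> G"
    proof cases
      case 1 then show ?thesis by (simp add: G_def)
    next
      case 2
      have "a \<in> sets (path W1 s)" using measurable_sets[OF W_path[of u s W1], of B] 2 by simp
      moreover have "space M \<in> sets (path W2 s)" using sets.top[of "path W2 s"] by simp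
      moreover have "a = a \<inter> space M" using 2 by auto
      ultimately show ?thesis unfolding G_def by blast
    next
      case 3
      have "a \<in> sets (path W2 s)" using measurable_sets[OF W_path[of u s W2], of B] 3 by simp
      moreover have "space M \<in> sets (path W1 s)" using sets.top[of "path W1 s"] by simp
      moreover have "a = space M \<inter> a" using 3 by auto
      ultimately show ?thesis unfolding G_def by blast
    qed
    then show "a \<in> sigma_sets (space M) G" by (rule sigma_sets.Basic)
  qed
  let ?N = "sigma (space M) H"
  have HP: "H \<subseteq> Pow (space M)" using ev sets.sets_into_space by (fastforce simp: H_def)
  have "(\<lambda>om. (W1 r om - W1 s om, W2 r om - W2 s om)) \<in> ?N \<rightarrow>\<^sub>M borel \<Otimes>\<^sub>M borel"
  proof (rule measurable_Pair)
    show "(\<lambda>om. W1 r om - W1 s om) \<in> borel_measurable ?N"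
    proof (rule measurableI)
      fix A :: "real set" assume A: "A \<in> sets borel"
      have "(\<lambda>om. W1 r om - W1 s om) -` A \<inter> space M \<in> sets (incr W1 s r)" by (rule in_vimage_algebra[OF A])
      moreover have "space M \<in> sets (incr W2 s r)" using sets.top[of "incr W2 s r"] by simp
      ultimately have "((\<lambda>om. W1 r om - W1 s om) -` A \<inter> space M) \<inter> space M \<in> H" unfolding H_def by blast
      then show "(\<lambda>om. W1 r om - W1 s om) -` A \<inter> space ?N \<in> sets ?N"
        using HP by (simp add: space_measure_of_conv Int_assoc)
    qed simp
    show "(\<lambda>om. W2 r om - W2 s om) \<in> borel_measurable ?N"
    proof (rule measurableI)
      fix A :: "real set" assume A: "A \<in> sets borel"
      have "(\<lambda>om. W2 r om - W2 s om) -` A \<inter> space M \<in> sets (incr W2 s r)" by (rule in_vimage_algebra[OF A])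
      moreover have "space M \<in> sets (incr W1 s r)" using sets.top[of "incr W1 s r"] by simp
      ultimately have "space M \<inter> ((\<lambda>om. W2 r om - W2 s om) -` A \<inter> space M) \<in> H" unfolding H_def by blast
      moreover have "space M \<inter> ((\<lambda>om. W2 r om - W2 s om) -` A \<inter> space M) = (\<lambda>om. W2 r om - W2 s om) -` A \<inter> space M" by auto
      ultimately show "(\<lambda>om. W2 r om - W2 s om) -` A \<inter> space ?N \<in> sets ?N"
        using HP by (simp add: space_measure_of_conv)
    qed simp
  qed
  from vimage_sub[OF this] have 2: "sets (vimage_algebra (space M)
      (\<lambda>om. (W1 r om - W1 s om, W2 r om - W2 s om)) (borel \<Otimes>\<^sub>M borel)) \<subseteq> sigma_sets (space M) H"
    using HP by (simp add: space_measure_of_conv)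
  show ?thesis
    by (rule indep_setI)
       (use 1 2 indep_setD[OF ind] indep_setD_ev1[OF ind] indep_setD_ev2[OF ind] in blast)+
qed

definition noise :: "real \<Rightarrow> real \<Rightarrow> 'w \<Rightarrow> real \<times> real" where
  "noise s r om = ((W1 r om - W1 s om) / sqrt (r - s), (W2 r om - W2 s om) / sqrt (r - s))"

lemma noise_measurable: "0 \<le> s \<Longrightarrow> s < r \<Longrightarrow> r \<le> T \<Longrightarrow> noise s r \<in> M \<rightarrow>\<^sub>M borel \<Otimes>\<^sub>M borel"
  unfolding noise_def using W_meas[of W1] W_meas[of W2]
  by (intro measurable_Pair borel_measurable_divide borel_measurable_diff) auto

lemma noise_sigma:
  assumes s: "0 \<le> s" "s < r" "r \<le> T"
  shows "noise s r \<in> vimage_algebra (space M) (\<lambda>om. (W1 r om - W1 s om, W2 r om - W2 s om)) (borel \<Otimes>\<^sub>M borel)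
    \<rightarrow>\<^sub>M borel \<Otimes>\<^sub>M borel" (is "_ \<in> ?V \<rightarrow>\<^sub>M _")
proof -
  have "(\<lambda>om. (W1 r om - W1 s om, W2 r om - W2 s om)) \<in> ?V \<rightarrow>\<^sub>M borel \<Otimes>\<^sub>M borel"
    by (rule measurable_vimage_algebra1) (simp add: space_pair_measure)
  then show ?thesis
    using measurable_compose[of _ ?V "borel \<Otimes>\<^sub>M borel" "\<lambda>z. (fst z / sqrt (r - s), snd z / sqrt (r - s))" "borel \<Otimes>\<^sub>M borel"]
    unfolding noise_def[abs_def] by simp
qed

lemma noise_prob:
  assumes s: "0 \<le> s" "s < r" "r \<le> T" and X: "X \<in> measurable (F s) S" and A: "A \<in> sets S" and B: "B \<in> sets (borel \<Otimes>\<^sub>M borel)"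
  shows "prob ((X -` A \<inter> space M) \<inter> (noise s r -` B \<inter> space M)) = prob (X -` A \<inter> space M) * prob (noise s r -` B \<inter> space M)"
  using indep_setD[OF pair_indep[OF s] measurable_sets[OF X A] measurable_sets[OF noise_sigma[OF s] B]] by simp

lemma noise_indep:
  assumes s: "0 \<le> s" "s < r" "r \<le> T" and X: "X \<in> borel_measurable (F s)" and g: "g \<in> borel_measurable (borel \<Otimes>\<^sub>M borel)"
  shows "indep_var borel (X :: _ \<Rightarrow> real) borel (\<lambda>om. g (noise s r om))"
proof -
  let ?V = "vimage_algebra (space M) (\<lambda>om. (W1 r om - W1 s om, W2 r om - W2 s om)) (borel \<Otimes>\<^sub>M borel)"
  note ind = pair_indep[OF s]
  have X': "X \<in> borel_measurable M" using F_measurable_M[OF _ X] s by simp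
  have gM: "(\<lambda>om. g (noise s r om)) \<in> borel_measurable M" by (rule measurable_compose[OF noise_measurable[OF s] g])
  have 1: "sigma_sets (space M) {X -` A \<inter> space M |A. A \<in> sets borel} \<subseteq> sets (F s)"
    using vimage_sub[OF X, of "space M"] by (simp add: sets_vimage_algebra)
  have 2: "sigma_sets (space M) {(\<lambda>om. g (noise s r om)) -` A \<inter> space M |A. A \<in> sets borel} \<subseteq> sets ?V"
    using vimage_sub[OF measurable_compose[OF noise_sigma[OF s] g], of "space M"] by (simp add: sets_vimage_algebra)
  show ?thesis
    unfolding indep_var_eq
  proof (intro conjI X' gM indep_setI)
    fix a b assume "a \<in> sigma_sets (space M) {X -` A \<inter> space M |A. A \<in> sets borel}"
      "b \<in> sigma_sets (space M) {(\<lambda>om. g (noise s r om)) -` A \<inter> space M |A. A \<in> sets borel}"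
    then show "prob (a \<inter> b) = prob a * prob b" using 1 2 indep_setD[OF ind] by blast
  qed (use 1 2 indep_setD_ev1[OF ind] indep_setD_ev2[OF ind] in blast)+
qed

lemma W_distr:
  assumes W: "is_W W" and s: "0 \<le> s" "s < r" "r \<le> T"
  shows "distr M borel (\<lambda>om. (W r om - W s om) / sqrt (r - s)) = gauss1"
proof -
  have "distributed M lborel (\<lambda>om. ((W r om - W s om) - 0) / sqrt (r - s)) std_normal_density"
    by (subst normal_standard_normal_convert[symmetric]) (use W_incr[OF W s] s in auto)
  then have "distr M lborel (\<lambda>om. (W r om - W s om) / sqrt (r - s)) = gauss1"
    by (simp add: distributed_def gauss1_def)
  then show ?thesis by (simp cong: distr_cong)
qed

lemma noise_distr:
  assumes s: "0 \<le> s" "s < r" "r \<le> T"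
  shows "distr M (borel \<Otimes>\<^sub>M borel) (noise s r) = gauss2"
proof -
  have "indep_var borel (\<lambda>om. (W1 r om - W1 s om) / sqrt (r - s)) borel (\<lambda>om. (W2 r om - W2 s om) / sqrt (r - s))"
    using indep_var_compose[OF indepW, of "\<lambda>f. (f r - f s) / sqrt (r - s)" borel "\<lambda>f. (f r - f s) / sqrt (r - s)" borel] s
    by (auto simp: comp_def)
  then show ?thesis
    unfolding indep_var_distribution_eq W_distr[OF is_W(1) s] W_distr[OF is_W(2) s]
    by (simp add: gauss2_def noise_def[abs_def])
qed

text \<open>The joint law of an adapted \<open>X\<close> and the normalised increment is a product
  with \<open>gauss2\<close>, so Fubini integrates the noise out with the state held fixed. This
  takes the place of conditional expectations.\<close>

lemma noise_expectation:
  assumes s: "0 \<le> s" "s < r" "r \<le> T" and X: "X \<in> measurable (F s) S"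
    and \<psi>[measurable]: "\<psi> \<in> borel_measurable (S \<Otimes>\<^sub>M (borel \<Otimes>\<^sub>M borel))" and bd: "\<And>x z. \<bar>\<psi> (x, z)\<bar> \<le> (B::real)"
  shows "(LINT om|M. \<psi> (X om, noise s r om)) = (LINT om|M. LINT z|gauss2. \<psi> (X om, z))"
proof -
  have X'[measurable]: "X \<in> measurable M S" using F_measurable_M[OF _ X] s by simp
  have n[measurable]: "noise s r \<in> M \<rightarrow>\<^sub>M borel \<Otimes>\<^sub>M borel" by (rule noise_measurable[OF s])
  let ?D = "distr M S X"
  have ind: "?D \<Otimes>\<^sub>M gauss2 = distr M (S \<Otimes>\<^sub>M (borel \<Otimes>\<^sub>M borel)) (\<lambda>om. (X om, noise s r om))"
  proof (rule pair_measure_eqI)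
    fix A B assume A: "A \<in> sets ?D" and B: "B \<in> sets gauss2"
    have A': "A \<in> sets S" and B': "B \<in> sets (borel \<Otimes>\<^sub>M borel)" using A B by simp_all
    have "emeasure gauss2 B = emeasure M (noise s r -` B \<inter> space M)"
      unfolding noise_distr[OF s, symmetric] by (rule emeasure_distr) (use B' in simp_all)
    then have "emeasure ?D A * emeasure gauss2 B = ennreal (prob (X -` A \<inter> space M) * prob (noise s r -` B \<inter> space M))"
      using A' by (simp add: emeasure_distr emeasure_eq_measure ennreal_mult)
    also have "\<dots> = ennreal (prob ((X -` A \<inter> space M) \<inter> (noise s r -` B \<inter> space M)))"
      by (simp only: noise_prob[OF s X A' B'])
    also have "(X -` A \<inter> space M) \<inter> (noise s r -` B \<inter> space M) = (\<lambda>om. (X om, noise s r om)) -` (A \<times> B) \<inter> space M" by auto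
    also have "ennreal (prob \<dots>) = emeasure (distr M (S \<Otimes>\<^sub>M (borel \<Otimes>\<^sub>M borel)) (\<lambda>om. (X om, noise s r om))) (A \<times> B)"
      using A' B' by (simp add: emeasure_distr emeasure_eq_measure)
    finally show "emeasure ?D A * emeasure gauss2 B = emeasure (distr M (S \<Otimes>\<^sub>M (borel \<Otimes>\<^sub>M borel)) (\<lambda>om. (X om, noise s r om))) (A \<times> B)" .
  qed (use gauss2.sigma_finite_measure_axioms in \<open>auto intro!: prob_space_imp_sigma_finite prob_space_distr sets_pair_measure_cong\<close>)
  interpret D: prob_space ?D by (rule prob_space_distr) simp
  interpret P: pair_prob_space ?D gauss2 ..
  have sets_eq: "sets (?D \<Otimes>\<^sub>M gauss2) = sets (S \<Otimes>\<^sub>M (borel \<Otimes>\<^sub>M borel))"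
    by (rule sets_pair_measure_cong) simp_all
  have \<psi>m: "\<psi> \<in> borel_measurable (?D \<Otimes>\<^sub>M gauss2)" using \<psi> unfolding measurable_cong_sets[OF sets_eq refl] .
  have i: "integrable (?D \<Otimes>\<^sub>M gauss2) \<psi>"
    by (rule P.integrable_const_bound[where B=B]) (use bd \<psi>m in auto)
  have "(LINT om|M. \<psi> (X om, noise s r om)) = integral\<^sup>L (distr M (S \<Otimes>\<^sub>M (borel \<Otimes>\<^sub>M borel)) (\<lambda>om. (X om, noise s r om))) \<psi>"
    by (rule integral_distr[symmetric]) simp_all
  also have "\<dots> = integral\<^sup>L (?D \<Otimes>\<^sub>M gauss2) \<psi>" unfolding ind ..
  also have "\<dots> = (LINT x|?D. LINT z|gauss2. \<psi> (x, z))" by (rule P.integral_fst'[OF i, symmetric])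
  also have "\<dots> = (LINT om|M. LINT z|gauss2. \<psi> (X om, z))"
    by (rule integral_distr) (auto intro!: gauss2.borel_measurable_lebesgue_integral simp: measurable_cong_sets[OF sets_eq refl, symmetric] split_def)
  finally show ?thesis .
qed

text \<open>Moment computations involve unbounded factors such as exponentials and squares, which
  the averaging of bounded functions does not reach; here products are factored directly by
  independence.\<close>

lemma W_mult:
  assumes W: "is_W W" and s: "0 \<le> s" "s < r" "r \<le> T" and X: "X \<in> borel_measurable (F s)" and Xi: "integrable M X"
    and \<phi>[measurable]: "\<phi> \<in> borel_measurable borel" and \<phi>i: "integrable gauss1 (\<lambda>z. \<phi> (sqrt (r - s) * z))"
  shows "integrable M (\<lambda>om. X om * \<phi> (W r om - W s om) :: real)"
    and "(LINT om|M. X om * \<phi> (W r om - W s om)) = (LINT om|M. X om) * (LINT z|gauss1. \<phi> (sqrt (r - s) * z))"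
    and "integrable M (\<lambda>om. \<phi> (W r om - W s om))"
    and "(LINT om|M. \<phi> (W r om - W s om)) = (LINT z|gauss1. \<phi> (sqrt (r - s) * z))"
proof -
  define Z where "Z om = (W r om - W s om) / sqrt (r - s)" for om
  have Zm[measurable]: "Z \<in> borel_measurable M" unfolding Z_def using W_meas[OF W] s by (intro borel_measurable_divide borel_measurable_diff) auto
  have Zd: "distr M borel Z = gauss1" unfolding Z_def by (rule W_distr[OF W s])
  have eq: "\<phi> (W r om - W s om) = \<phi> (sqrt (r - s) * Z om)" for om using s by (simp add: Z_def)
  have "indep_var borel X borel (\<lambda>om. \<phi> (sqrt (r - s) * Z om))"
  proof -
    have "indep_var borel X borel Z"
    proof -
      have "(\<lambda>om. fst (noise s r om)) = Z \<or> (\<lambda>om. snd (noise s r om)) = Z"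
        using W by (auto simp: is_W_def noise_def Z_def fun_eq_iff)
      then show ?thesis
        using noise_indep[OF s X, of fst] noise_indep[OF s X, of snd] by auto
    qed
    from indep_var_compose[OF this, of "\<lambda>x. x" borel "\<lambda>z. \<phi> (sqrt (r - s) * z)" borel]
    show ?thesis by (simp add: comp_def)
  qed
  note ind = this
  have i2: "integrable M (\<lambda>om. \<phi> (sqrt (r - s) * Z om))"
    using \<phi>i unfolding Zd[symmetric] by (subst (asm) integrable_distr_eq) auto
  have e2: "(LINT om|M. \<phi> (sqrt (r - s) * Z om)) = (LINT z|gauss1. \<phi> (sqrt (r - s) * z))"
    unfolding Zd[symmetric] by (subst integral_distr) auto
  show "integrable M (\<lambda>om. X om * \<phi> (W r om - W s om))" unfolding eq by (rule indep_var_integrable[OF ind Xi i2])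
  show "(LINT om|M. X om * \<phi> (W r om - W s om)) = (LINT om|M. X om) * (LINT z|gauss1. \<phi> (sqrt (r - s) * z))"
    unfolding eq indep_var_lebesgue_integral[OF ind Xi i2] e2 ..
  show "integrable M (\<lambda>om. \<phi> (W r om - W s om))" unfolding eq by (rule i2)
  show "(LINT om|M. \<phi> (W r om - W s om)) = (LINT z|gauss1. \<phi> (sqrt (r - s) * z))" unfolding eq by (rule e2)
qed

end

section \<open>Running maxima and exponential moments of the Brownian supremum\<close>

primrec rmax :: "(nat \<Rightarrow> real) \<Rightarrow> nat \<Rightarrow> real" where
  "rmax s 0 = s 0" | "rmax s (Suc n) = max (rmax s n) (s (Suc n))"

lemma rmax_ge: "i \<le> n \<Longrightarrow> s i \<le> rmax s n"
  by (induction n) (auto simp: le_Suc_eq)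

lemma rmax_attained: "\<exists>i\<le>n. rmax s n = s i"
  by (induction n) (auto simp: max_def le_Suc_eq)

lemma rmax_measurable: "(\<And>i. i \<le> n \<Longrightarrow> (\<lambda>x. s x i) \<in> borel_measurable M) \<Longrightarrow> (\<lambda>x. rmax (s x) n) \<in> borel_measurable M"
  by (induction n) auto

text \<open>Doob's \<open>L\<^sup>2\<close> inequality follows by taking expectations along a martingale, which removes the sum.\<close>

lemma rmax_doob: "(rmax s n)\<^sup>2 + 4 * (\<Sum>i<n. rmax s i * (s (Suc i) - s i)) \<le> 4 * (s n)\<^sup>2"
proof -
  have *: "(\<Sum>i<n. rmax s i * (s (Suc i) - s i)) \<le> rmax s n * s n - (rmax s n)\<^sup>2 / 2"
  proof (induction n)
    case 0
    then show ?case by (simp add: power2_eq_square)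
  next
    case (Suc n)
    have "rmax s n * s (Suc n) - (rmax s n)\<^sup>2 / 2 \<le> rmax s (Suc n) * s (Suc n) - (rmax s (Suc n))\<^sup>2 / 2"
    proof (cases "s (Suc n) \<le> rmax s n")
      case True
      then show ?thesis by (simp add: max_def)
    next
      case False
      then show ?thesis using zero_le_power2[of "s (Suc n) - rmax s n"]
        by (simp add: max_def power2_eq_square algebra_simps)
    qed
    then show ?case using Suc by (simp add: algebra_simps)
  qed
  have "4 * (rmax s n * s n - (rmax s n)\<^sup>2 / 2) + (rmax s n)\<^sup>2 \<le> 4 * (s n)\<^sup>2"
    using zero_le_power2[of "2 * s n - rmax s n"] by (simp add: power2_eq_square algebra_simps)
  with * show ?thesis by simp
qed

text \<open>The supremum is attained at some \<open>v\<close>, and the left neighbours of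
  \<open>v\<close> on the grids converge to it.\<close>

lemma rmax_grid_tendsto:
  assumes tr: "t < r" and g: "continuous_on {t..r} g"
  shows "(\<lambda>n. rmax (\<lambda>i. g (gp t r n i)) n) \<longlonglongrightarrow> (SUP u\<in>{t..r}. g u)"
proof -
  have "compact (g ` {t..r})" using g by (rule compact_continuous_image) simp
  then have bdd: "bdd_above (g ` {t..r})" by (auto dest: compact_imp_bounded simp: bounded_imp_bdd_above)
  obtain v where v: "v \<in> {t..r}" "\<And>u. u \<in> {t..r} \<Longrightarrow> g u \<le> g v"
    using continuous_attains_sup[OF _ _ g] tr by auto
  have S: "(SUP u\<in>{t..r}. g u) = g v"
    by (rule antisym) (use v tr bdd in \<open>auto intro!: cSUP_least cSUP_upper\<close>)
  \<comment> \<open>\<open>ix\<close> is not meaningful at the right end point, so a maximum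
    attained there is caught by the last grid point.\<close>
  define k where "k n = (if v = r then n else ix t r n v)" for n
  have k: "k n \<le> n" if "n > 0" for n
    using ix_cell(1)[OF tr that, of v] v tr by (auto simp: k_def less_imp_le)
  have gk: "(\<lambda>n. gp t r n (k n)) \<longlonglongrightarrow> v"
  proof (cases "v = r")
    case True
    have "\<forall>\<^sub>F n in sequentially. gp t r n (k n) = v"
      using eventually_gt_at_top[of 0] by eventually_elim (simp add: k_def True gp_n)
    then show ?thesis by (rule tendsto_eventually)
  next
    case False
    then show ?thesis using gp_ix_tendsto(1)[OF tr, of v] v by (simp add: k_def)
  qed
  have ev: "\<forall>\<^sub>F n in sequentially. gp t r n (k n) \<in> {t..r}"
    using eventually_gt_at_top[of 0] by eventually_elim (use gp_in[of t r] k tr in auto)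
  have lo: "(\<lambda>n. g (gp t r n (k n))) \<longlonglongrightarrow> g v"
    by (rule continuous_on_tendsto_compose[OF g gk v(1) ev])
  show ?thesis unfolding S
  proof (rule tendsto_sandwich[OF _ _ lo tendsto_const[of "g v"]])
    show "\<forall>\<^sub>F n in sequentially. g (gp t r n (k n)) \<le> rmax (\<lambda>i. g (gp t r n i)) n"
      using eventually_gt_at_top[of 0] by eventually_elim (use k in \<open>auto intro: rmax_ge[where s="\<lambda>i. g (gp t r _ i)"]\<close>)
    show "\<forall>\<^sub>F n in sequentially. rmax (\<lambda>i. g (gp t r n i)) n \<le> g v"
    proof (rule always_eventually, rule allI)
      fix n
      obtain i where "i \<le> n" "rmax (\<lambda>i. g (gp t r n i)) n = g (gp t r n i)" using rmax_attained by blast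
      then show "rmax (\<lambda>i. g (gp t r n i)) n \<le> g v" using v(2) gp_in[of t r i n] tr by auto
    qed
  qed
qed

context bm2
begin

lemma W_exp:
  assumes W: "is_W W" and s: "0 \<le> s" "s < r" "r \<le> T"
  shows "integrable M (\<lambda>om. exp (a * (W r om - W s om)))"
    and "(LINT om|M. exp (a * (W r om - W s om))) = exp (a\<^sup>2 * (r - s) / 2)"
proof -
  have g: "has_bochner_integral gauss1 (\<lambda>z. exp (a * (sqrt (r - s) * z))) (exp (a\<^sup>2 * (r - s) / 2))"
    using gauss1_exp[of "a * sqrt (r - s)"] s by (simp add: power_mult_distrib mult.assoc)
  note m = W_mult[OF W s, of "\<lambda>_. 1" "\<lambda>x. exp (a * x)"]
  show "integrable M (\<lambda>om. exp (a * (W r om - W s om)))"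
    by (rule m(3)) (use g in \<open>auto simp: has_bochner_integral_iff\<close>)
  show "(LINT om|M. exp (a * (W r om - W s om))) = exp (a\<^sup>2 * (r - s) / 2)"
    by (subst m(4)) (use g in \<open>auto simp: has_bochner_integral_iff\<close>)
qed

lemma W_exp0:
  assumes W: "is_W W" and r: "r \<in> {0..T}"
  shows "integrable M (\<lambda>om. exp (a * W r om))"
    and "(LINT om|M. exp (a * W r om)) = exp (a\<^sup>2 * r / 2)"
proof -
  have "integrable M (\<lambda>om. exp (a * W r om)) \<and> (LINT om|M. exp (a * W r om)) = exp (a\<^sup>2 * r / 2)"
  proof (cases "r = 0")
    case True
    have 1: "integrable M (\<lambda>om. exp (a * W 0 om)) = integrable M (\<lambda>om. 1 :: real)"
      by (rule Bochner_Integration.integrable_cong) (auto simp: W_0[OF W])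
    have 2: "(LINT om|M. exp (a * W 0 om)) = (LINT om|M. 1)"
      by (rule Bochner_Integration.integral_cong) (auto simp: W_0[OF W])
    show ?thesis using 1 2 prob_space True by simp
  next
    case False
    then have r': "0 < r" "r \<le> T" using r by auto
    have 1: "integrable M (\<lambda>om. exp (a * W r om)) = integrable M (\<lambda>om. exp (a * (W r om - W 0 om)))"
      by (rule Bochner_Integration.integrable_cong) (auto simp: W_0[OF W])
    have 2: "(LINT om|M. exp (a * W r om)) = (LINT om|M. exp (a * (W r om - W 0 om)))"
      by (rule Bochner_Integration.integral_cong) (auto simp: W_0[OF W])
    show ?thesis unfolding 1 2 using W_exp[OF W order_refl r', of a] by simp
  qed
  then show "integrable M (\<lambda>om. exp (a * W r om))" "(LINT om|M. exp (a * W r om)) = exp (a\<^sup>2 * r / 2)" by auto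
qed

text \<open>The exponentials form a submartingale: weighted with the adapted running maximum, each
  increment has expectation \<open>E (S Z)\<close> times the excess of an exponential moment over 1,
  hence nonnegative. Dropping these terms from \<open>rmax_doob\<close> leaves 4 times the second
  moment at \<open>T\<close>.\<close>

lemma W_doob:
  fixes a :: real and n :: nat
  assumes W: "is_W W" and n: "n > 0"
  defines "S \<equiv> \<lambda>i om. rmax (\<lambda>j. exp (a * W (gp 0 T n j) om)) i"
  shows "integrable M (\<lambda>om. (S n om)\<^sup>2)" and "(LINT om|M. (S n om)\<^sup>2) \<le> 4 * exp (2 * a\<^sup>2 * T)"
proof -
  define Z where "Z i om = exp (a * W (gp 0 T n i) om)" for i om
  have gin: "gp 0 T n i \<in> {0..T}" if "i \<le> n" for i by (rule gp_in) (use that T_pos in auto)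
  have Z2: "(Z i om)\<^sup>2 = exp ((2 * a) * W (gp 0 T n i) om)" for i om by (simp add: Z_def exp_double[symmetric] mult.assoc)
  have Z2i: "integrable M (\<lambda>om. (Z i om)\<^sup>2)" if "i \<le> n" for i
    unfolding Z2 by (rule W_exp0(1)[OF W gin[OF that]])
  have Zm: "Z i \<in> borel_measurable M" if "i \<le> n" for i
    using W_meas[OF W gin[OF that]] unfolding Z_def by measurable
  have SZ: "S = (\<lambda>i om. rmax (\<lambda>j. Z j om) i)" by (simp add: S_def Z_def)
  have Sm: "S i \<in> borel_measurable M" if "i \<le> n" for i
    unfolding SZ by (rule rmax_measurable) (use Zm that in auto)
  have Zpos: "0 < Z i om" for i om by (simp add: Z_def)
  have Spos: "0 < S i om" for i om using rmax_attained[of i "\<lambda>j. Z j om"] Zpos by (auto simp: SZ)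
  have S2i: "integrable M (\<lambda>om. (S i om)\<^sup>2)" if i: "i \<le> n" for i
  proof (rule Bochner_Integration.integrable_bound)
    show "integrable M (\<lambda>om. \<Sum>j\<le>i. (Z j om)\<^sup>2)" using Z2i i by (intro Bochner_Integration.integrable_sum) auto
    show "(\<lambda>om. (S i om)\<^sup>2) \<in> borel_measurable M" using Sm[OF i] by simp
    show "AE om in M. norm ((S i om)\<^sup>2) \<le> norm (\<Sum>j\<le>i. (Z j om)\<^sup>2)"
    proof (rule AE_I2)
      fix om
      obtain j where j: "j \<le> i" "S i om = Z j om" using rmax_attained[of i "\<lambda>j. Z j om"] by (auto simp: SZ)
      have "(S i om)\<^sup>2 \<le> (\<Sum>j\<le>i. (Z j om)\<^sup>2)" unfolding j(2) by (rule member_le_sum) (use j in auto)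
      then show "norm ((S i om)\<^sup>2) \<le> norm (\<Sum>j\<le>i. (Z j om)\<^sup>2)" by (simp add: sum_nonneg)
    qed
  qed
  show "integrable M (\<lambda>om. (S n om)\<^sup>2)" by (rule S2i) simp
  have SZi: "integrable M (\<lambda>om. S i om * Z j om)" if ij: "i \<le> n" "j \<le> n" for i j
  proof (rule Bochner_Integration.integrable_bound)
    show "integrable M (\<lambda>om. (S i om)\<^sup>2 + (Z j om)\<^sup>2)" using S2i Z2i ij by auto
    show "(\<lambda>om. S i om * Z j om) \<in> borel_measurable M" using Sm[OF ij(1)] Zm[OF ij(2)] by simp
    have "S i om * Z j om \<le> (S i om)\<^sup>2 + (Z j om)\<^sup>2" for om
      using sum_squares_bound[of "S i om" "Z j om"] mult_pos_pos[OF Spos[of i om] Zpos[of j om]] by linarith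
    then show "AE om in M. norm (S i om * Z j om) \<le> norm ((S i om)\<^sup>2 + (Z j om)\<^sup>2)"
      using Spos Zpos by (auto simp: abs_mult less_imp_le)
  qed
  have pos: "0 \<le> (LINT om|M. S i om * (Z (Suc i) om - Z i om))" if i: "i < n" for i
  proof -
    let ?s = "gp 0 T n i" and ?r = "gp 0 T n (Suc i)"
    have sr: "0 \<le> ?s" "?s < ?r" "?r \<le> T" using gin[of i] gin[of "Suc i"] i n T_pos by (auto simp: gp_Suc)
    have ZF: "Z j \<in> borel_measurable (F ?s)" if "j \<le> i" for j
    proof -
      have "W (gp 0 T n j) \<in> borel_measurable (F ?s)" by (rule W_F[OF W]) (use that gin[of j] i T_pos in \<open>auto intro: gp_mono\<close>)
      then show ?thesis unfolding Z_def by measurable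
    qed
    have SF: "S i \<in> borel_measurable (F ?s)" unfolding SZ by (rule rmax_measurable) (rule ZF)
    have XF: "(\<lambda>om. S i om * Z i om) \<in> borel_measurable (F ?s)" using SF ZF[of i] by simp
    have g: "has_bochner_integral gauss1 (\<lambda>z. exp (a * (sqrt (?r - ?s) * z))) (exp (a\<^sup>2 * (?r - ?s) / 2))"
      using gauss1_exp[of "a * sqrt (?r - ?s)"] sr by (simp add: power_mult_distrib mult.assoc)
    have Xi: "integrable M (\<lambda>om. S i om * Z i om)" using SZi i by auto
    have step: "S i om * (Z (Suc i) om - Z i om) = (S i om * Z i om) * exp (a * (W ?r om - W ?s om)) - S i om * Z i om" for om
      by (simp add: Z_def algebra_simps exp_add[symmetric])
    note m = W_mult[OF W sr XF Xi, of "\<lambda>x. exp (a * x)"]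
    have "(LINT om|M. S i om * (Z (Suc i) om - Z i om)) = (LINT om|M. S i om * Z i om) * exp (a\<^sup>2 * (?r - ?s) / 2) - (LINT om|M. S i om * Z i om)"
      unfolding step using m(1,2) g Xi by (subst Bochner_Integration.integral_diff) (auto simp: has_bochner_integral_iff)
    also have "\<dots> = (LINT om|M. S i om * Z i om) * (exp (a\<^sup>2 * (?r - ?s) / 2) - 1)" by (simp add: algebra_simps)
    also have "0 \<le> \<dots>"
      using sr Spos Zpos by (intro mult_nonneg_nonneg integral_nonneg_AE AE_I2) (auto simp: less_imp_le)
    finally show ?thesis .
  qed
  have inti: "integrable M (\<lambda>om. S i om * (Z (Suc i) om - Z i om))" if "i < n" for i
    using SZi[of i "Suc i"] SZi[of i i] that by (simp add: right_diff_distrib)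
  have "(LINT om|M. (S n om)\<^sup>2 + 4 * (\<Sum>i<n. S i om * (Z (Suc i) om - Z i om))) \<le> (LINT om|M. 4 * (Z n om)\<^sup>2)"
  proof (rule integral_mono)
    show "integrable M (\<lambda>om. (S n om)\<^sup>2 + 4 * (\<Sum>i<n. S i om * (Z (Suc i) om - Z i om)))"
      using S2i inti by (intro Bochner_Integration.integrable_add integrable_mult_right Bochner_Integration.integrable_sum) auto
    show "integrable M (\<lambda>om. 4 * (Z n om)\<^sup>2)" using Z2i by simp
    show "(S n om)\<^sup>2 + 4 * (\<Sum>i<n. S i om * (Z (Suc i) om - Z i om)) \<le> 4 * (Z n om)\<^sup>2" for om
      using rmax_doob[of "\<lambda>j. Z j om" n] by (simp add: SZ)
  qed
  also have "(LINT om|M. (S n om)\<^sup>2 + 4 * (\<Sum>i<n. S i om * (Z (Suc i) om - Z i om)))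
     = (LINT om|M. (S n om)\<^sup>2) + 4 * (\<Sum>i<n. LINT om|M. S i om * (Z (Suc i) om - Z i om))"
    using S2i inti by (subst Bochner_Integration.integral_add) auto
  also have "(LINT om|M. 4 * (Z n om)\<^sup>2) = 4 * exp (2 * a\<^sup>2 * T)"
    using W_exp0(2)[OF W gin[of n], of "2 * a"] n unfolding Z2 by (simp add: gp_n power_mult_distrib)
  finally show "(LINT om|M. (S n om)\<^sup>2) \<le> 4 * exp (2 * a\<^sup>2 * T)"
    using sum_nonneg[of "{..<n}" "\<lambda>i. LINT om|M. S i om * (Z (Suc i) om - Z i om)"] pos by auto
qed

definition supW :: "(real \<Rightarrow> 'w \<Rightarrow> real) \<Rightarrow> 'w \<Rightarrow> real" where
  "supW W om = (SUP u\<in>{0..T}. \<bar>W u om\<bar>)"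

lemma supW_tendsto:
  "is_W W \<Longrightarrow> om \<in> space M \<Longrightarrow> (\<lambda>n. rmax (\<lambda>i. \<bar>W (gp 0 T n i) om\<bar>) n) \<longlonglongrightarrow> supW W om"
  unfolding supW_def by (rule rmax_grid_tendsto[OF T_pos, of "\<lambda>u. \<bar>W u om\<bar>"]) (intro continuous_intros W_cont)

lemma supW_measurable: assumes W: "is_W W" shows "supW W \<in> borel_measurable M"
  by (rule borel_measurable_LIMSEQ_real[OF supW_tendsto[OF W]])
     (use T_pos in \<open>auto intro!: rmax_measurable borel_measurable_abs W_meas[OF W] gp_in\<close>)

lemma supW_ge:
  assumes W: "is_W W" and om: "om \<in> space M" and u: "u \<in> {0..T}"
  shows "\<bar>W u om\<bar> \<le> supW W om"
proof -
  have "compact ((\<lambda>u. \<bar>W u om\<bar>) ` {0..T})"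
    by (rule compact_continuous_image) (auto intro!: continuous_intros W_cont[OF W om])
  then have "bdd_above ((\<lambda>u. \<bar>W u om\<bar>) ` {0..T})" by (auto dest: compact_imp_bounded simp: bounded_imp_bdd_above)
  then show ?thesis unfolding supW_def using u by (auto intro: cSUP_upper)
qed

lemma supW_nonneg: "is_W W \<Longrightarrow> om \<in> space M \<Longrightarrow> 0 \<le> supW W om"
  using supW_ge[of W om 0] T_pos by auto

text \<open>With \<open>a = P / 2\<close>, the exponential of the grid maximum of
  \<open>\<bar>W\<bar>\<close> is at most the sum of the squared maxima of
  \<open>exp (a * W)\<close> and \<open>exp (- a * W)\<close>. Doob's inequality bounds both
  uniformly in the grid, whence \<open>8 = 2 * 4\<close>, and Fatou passes to the supremum over all
  times. Negative \<open>p\<close> are compared with \<open>P = 0\<close>.\<close>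

lemma supW_exp_integrable:
  assumes W: "is_W W"
  shows "integrable M (\<lambda>om. exp (p * supW W om))"
proof -
  have [measurable]: "supW W \<in> borel_measurable M" by (rule supW_measurable[OF W])
  define P where "P = max p 0"
  define a where "a = P / 2"
  have P0: "0 \<le> P" "p \<le> P" by (auto simp: P_def)
  define m where "m n om = rmax (\<lambda>i. \<bar>W (gp 0 T n i) om\<bar>) n" for n om
  have mm[measurable]: "m n \<in> borel_measurable M" for n
    unfolding m_def by (use T_pos in \<open>auto intro!: rmax_measurable borel_measurable_abs W_meas[OF W] gp_in\<close>)
  have bnd: "(\<integral>\<^sup>+om. ennreal (exp (P * m (Suc n) om)) \<partial>M) \<le> ennreal (8 * exp (2 * a\<^sup>2 * T))" for n
  proof -
    define S where "S b om = rmax (\<lambda>j. exp (b * W (gp 0 T (Suc n) j) om)) (Suc n)" for b om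
    have d: "integrable M (\<lambda>om. (S b om)\<^sup>2)" "(LINT om|M. (S b om)\<^sup>2) \<le> 4 * exp (2 * b\<^sup>2 * T)" for b
      unfolding S_def by (rule W_doob[OF W]; simp)+
    have le: "exp (P * m (Suc n) om) \<le> (S a om)\<^sup>2 + (S (- a) om)\<^sup>2" for om
    proof -
      obtain i where i: "i \<le> Suc n" "m (Suc n) om = \<bar>W (gp 0 T (Suc n) i) om\<bar>"
        unfolding m_def using rmax_attained by blast
      have ge: "exp (b * W (gp 0 T (Suc n) i) om) \<le> S b om" for b
        unfolding S_def using rmax_ge[OF i(1), of "\<lambda>j. exp (b * W (gp 0 T (Suc n) j) om)"] by simp
      have sq: "exp (2 * b * W (gp 0 T (Suc n) i) om) \<le> (S b om)\<^sup>2" for b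
        using power_mono[OF ge[of b], of 2] by (simp add: exp_double[symmetric] mult.assoc)
      have "exp (P * m (Suc n) om) = exp (2 * a * W (gp 0 T (Suc n) i) om) \<or> exp (P * m (Suc n) om) = exp (2 * (- a) * W (gp 0 T (Suc n) i) om)"
        using i(2) by (auto simp: a_def abs_if)
      then show ?thesis using sq[of a] sq[of "- a"] zero_le_power2[of "S a om"] zero_le_power2[of "S (- a) om"] by (elim disjE) linarith+
    qed
    have "(\<integral>\<^sup>+om. ennreal (exp (P * m (Suc n) om)) \<partial>M) \<le> (\<integral>\<^sup>+om. ennreal ((S a om)\<^sup>2 + (S (- a) om)\<^sup>2) \<partial>M)"
      by (intro nn_integral_mono ennreal_leI le)
    also have "\<dots> = ennreal (LINT om|M. (S a om)\<^sup>2 + (S (- a) om)\<^sup>2)"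
      by (rule nn_integral_eq_integral) (use d(1) in auto)
    also have "\<dots> \<le> ennreal (8 * exp (2 * a\<^sup>2 * T))"
      using d(1)[of a] d(1)[of "-a"] d(2)[of a] d(2)[of "-a"] by (intro ennreal_leI) simp
    finally show ?thesis .
  qed
  have lim: "liminf (\<lambda>n. ennreal (exp (P * m (Suc n) om))) = ennreal (exp (P * supW W om))" if "om \<in> space M" for om
  proof -
    have "(\<lambda>n. m (Suc n) om) \<longlonglongrightarrow> supW W om" unfolding m_def using supW_tendsto[OF W that] by (rule LIMSEQ_Suc)
    then have "(\<lambda>n. ennreal (exp (P * m (Suc n) om))) \<longlonglongrightarrow> ennreal (exp (P * supW W om))"
      by (intro tendsto_intros)
    then show ?thesis by (rule lim_imp_Liminf[OF trivial_limit_sequentially])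
  qed
  have "(\<integral>\<^sup>+om. ennreal (exp (P * supW W om)) \<partial>M) = (\<integral>\<^sup>+om. liminf (\<lambda>n. ennreal (exp (P * m (Suc n) om))) \<partial>M)"
    by (rule nn_integral_cong) (simp add: lim)
  also have "\<dots> \<le> liminf (\<lambda>n. \<integral>\<^sup>+om. ennreal (exp (P * m (Suc n) om)) \<partial>M)" by (rule nn_integral_liminf) simp
  also have "\<dots> \<le> liminf (\<lambda>n. ennreal (8 * exp (2 * a\<^sup>2 * T)))" by (rule Liminf_mono) (simp add: bnd)
  also have "\<dots> < \<infinity>" by (simp add: Liminf_const)
  finally have "integrable M (\<lambda>om. exp (P * supW W om))" by (intro integrableI_bounded) auto
  then show ?thesis
    by (rule Bochner_Integration.integrable_bound) (use supW_nonneg[OF W] P0 in \<open>auto intro!: AE_I2 mult_right_mono\<close>)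
qed

end

section \<open>Convergence in probability\<close>

abbreviation jointly :: "'a measure \<Rightarrow> (real \<Rightarrow> 'a \<Rightarrow> real) \<Rightarrow> bool" where
  "jointly M g \<equiv> (\<lambda>(u, om). g u om) \<in> borel_measurable (borel \<Otimes>\<^sub>M M)"

text \<open>Convergence in probability. Measurability is part of it because \<open>prob\<close> of a
  non-measurable set is 0 by convention, which would make the limit vacuous.\<close>

definition (in prob_space) cip :: "(nat \<Rightarrow> 'a \<Rightarrow> real) \<Rightarrow> ('a \<Rightarrow> real) \<Rightarrow> bool" where
  "cip S I \<longleftrightarrow> (\<forall>n. S n \<in> borel_measurable M) \<and> I \<in> borel_measurable M \<and>
     (\<forall>e>0. (\<lambda>n. prob {om\<in>space M. e < \<bar>S n om - I om\<bar>}) \<longlonglongrightarrow> 0)"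

context prob_space
begin

lemma cip_add:
  assumes "cip S I" "cip S' I'"
  shows "cip (\<lambda>n om. S n om + S' n om) (\<lambda>om. I om + I' om)"
proof -
  have [measurable]: "S n \<in> borel_measurable M" "I \<in> borel_measurable M" "S' n \<in> borel_measurable M" "I' \<in> borel_measurable M" for n
    using assms by (auto simp: cip_def)
  show ?thesis unfolding cip_def
  proof (intro conjI allI impI)
    fix e :: real assume e: "e > 0"
    have "(\<lambda>n. prob {om\<in>space M. e / 2 < \<bar>S n om - I om\<bar>} + prob {om\<in>space M. e / 2 < \<bar>S' n om - I' om\<bar>}) \<longlonglongrightarrow> 0 + 0"
      using assms half_gt_zero[OF e] unfolding cip_def by (intro tendsto_add) blast+
    then have lim: "(\<lambda>n. prob {om\<in>space M. e / 2 < \<bar>S n om - I om\<bar>} + prob {om\<in>space M. e / 2 < \<bar>S' n om - I' om\<bar>}) \<longlonglongrightarrow> 0" by simp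
    show "(\<lambda>n. prob {om\<in>space M. e < \<bar>S n om + S' n om - (I om + I' om)\<bar>}) \<longlonglongrightarrow> 0"
    proof (rule tendsto_sandwich[OF _ _ tendsto_const lim]; intro always_eventually allI)
      fix n
      have "prob {om\<in>space M. e < \<bar>S n om + S' n om - (I om + I' om)\<bar>}
        \<le> prob ({om\<in>space M. e / 2 < \<bar>S n om - I om\<bar>} \<union> {om\<in>space M. e / 2 < \<bar>S' n om - I' om\<bar>})"
      proof (rule finite_measure_mono)
        have "e / 2 < \<bar>a\<bar> \<or> e / 2 < \<bar>b\<bar>" if "e < \<bar>a + b\<bar>" for a b :: real using that by linarith
        from this[of "S n _ - I _" "S' n _ - I' _"]
        show "{om\<in>space M. e < \<bar>S n om + S' n om - (I om + I' om)\<bar>} \<subseteq>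
          {om\<in>space M. e / 2 < \<bar>S n om - I om\<bar>} \<union> {om\<in>space M. e / 2 < \<bar>S' n om - I' om\<bar>}"
          by (auto simp only: add_diff_add mem_Collect_eq Un_iff)
      qed simp
      also have "\<dots> \<le> prob {om\<in>space M. e / 2 < \<bar>S n om - I om\<bar>} + prob {om\<in>space M. e / 2 < \<bar>S' n om - I' om\<bar>}"
        by (rule measure_Un_le) auto
      finally show "prob {om\<in>space M. e < \<bar>S n om + S' n om - (I om + I' om)\<bar>} \<le> \<dots>" .
    qed simp
  qed simp_all
qed

lemma cip_uminus: "cip S I \<Longrightarrow> cip (\<lambda>n om. - S n om) (\<lambda>om. - I om)"
  by (auto simp: cip_def abs_minus_commute)

lemma cip_diff: "cip S I \<Longrightarrow> cip S' I' \<Longrightarrow> cip (\<lambda>n om. S n om - S' n om) (\<lambda>om. I om - I' om)"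
  using cip_add[OF _ cip_uminus, of S I S' I'] by simp

lemma cip_subseq: "cip S I \<Longrightarrow> strict_mono k \<Longrightarrow> cip (\<lambda>n. S (k n)) I"
  unfolding cip_def using LIMSEQ_subseq_LIMSEQ[unfolded comp_def] by fast

lemma cip_AE:
  assumes [measurable]: "\<And>n. S n \<in> borel_measurable M" "I \<in> borel_measurable M"
    and lim: "AE om in M. (\<lambda>n. S n om) \<longlonglongrightarrow> I om"
  shows "cip S I"
  unfolding cip_def
proof (intro conjI allI impI)
  fix e :: real assume e: "e > 0"
  let ?A = "\<lambda>n. {om\<in>space M. e < \<bar>S n om - I om\<bar>}"
  have "(\<lambda>n. LINT om|M. indicator (?A n) om :: real) \<longlonglongrightarrow> (LINT om|M. 0)"
  proof (rule integral_dominated_convergence[where w="\<lambda>_. 1"])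
    show "AE om in M. (\<lambda>n. indicator (?A n) om :: real) \<longlonglongrightarrow> 0"
      using lim
    proof eventually_elim
      case (elim om)
      have "\<forall>\<^sub>F n in sequentially. dist (S n om) (I om) < e" using tendstoD[OF elim e] .
      then have "\<forall>\<^sub>F n in sequentially. indicator (?A n) om = (0::real)"
        by eventually_elim (auto simp: dist_real_def indicator_def)
      then show ?case by (rule tendsto_eventually)
    qed
  qed (auto simp: indicator_def)
  moreover have "(LINT om|M. indicator (?A n) om :: real) = prob (?A n)" for n by simp
  ultimately show "(\<lambda>n. prob (?A n)) \<longlonglongrightarrow> 0" by simp
qed simp_all

lemma cip_L2:
  assumes [measurable]: "\<And>n. S n \<in> borel_measurable M" and i: "\<And>n. integrable M (\<lambda>om. (S n om)\<^sup>2)"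
    and lim: "(\<lambda>n. LINT om|M. (S n om)\<^sup>2) \<longlonglongrightarrow> 0"
  shows "cip S (\<lambda>_. 0)"
  unfolding cip_def
proof (intro conjI allI impI)
  fix e :: real assume e: "e > 0"
  have l: "(\<lambda>n. (LINT om|M. (S n om)\<^sup>2) / e\<^sup>2) \<longlonglongrightarrow> 0" using tendsto_divide[OF lim tendsto_const[of "e\<^sup>2"]] e by simp
  show "(\<lambda>n. prob {om\<in>space M. e < \<bar>S n om - 0\<bar>}) \<longlonglongrightarrow> 0"
  proof (rule tendsto_sandwich[OF _ _ tendsto_const l]; intro always_eventually allI)
    fix n
    have "prob {om\<in>space M. e < \<bar>S n om - 0\<bar>} \<le> prob {om\<in>space M. e\<^sup>2 \<le> (S n om)\<^sup>2}"
    proof (rule finite_measure_mono)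
      show "{om\<in>space M. e < \<bar>S n om - 0\<bar>} \<subseteq> {om\<in>space M. e\<^sup>2 \<le> (S n om)\<^sup>2}"
        using e power_mono[of e "\<bar>S n _\<bar>" 2] by auto
    qed simp
    also have "\<dots> \<le> (LINT om|M. (S n om)\<^sup>2) / e\<^sup>2"
      by (rule integral_Markov_inequality_measure[OF i, where A="{}"]) (use e in auto)
    finally show "prob {om\<in>space M. e < \<bar>S n om - 0\<bar>} \<le> (LINT om|M. (S n om)\<^sup>2) / e\<^sup>2" .
  qed simp
qed simp_all

text \<open>The truncated distance \<open>min 1 \<bar>S n om - I om\<bar>\<close> tends to 0 in
  mean, hence almost everywhere along a subsequence; where it is below 1 it is the distance
  itself.\<close>

lemma cip_AE_subseq:
  assumes c: "cip S I"
  shows "\<exists>k. strict_mono k \<and> (AE om in M. (\<lambda>n. S (k n) om) \<longlonglongrightarrow> I om)"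
proof -
  have [measurable]: "S n \<in> borel_measurable M" "I \<in> borel_measurable M" for n using c by (auto simp: cip_def)
  define D where "D n om = min 1 \<bar>S n om - I om\<bar>" for n om
  have Dm[measurable]: "D n \<in> borel_measurable M" for n unfolding D_def by measurable
  have Di: "integrable M (D n)" for n by (rule integrable_const_bound[where B=1]) (auto simp: D_def)
  have "(\<lambda>n. LINT om|M. norm (D n om)) \<longlonglongrightarrow> 0"
  proof (rule LIMSEQ_I)
    fix e :: real assume e: "e > 0"
    let ?A = "\<lambda>n. {om\<in>space M. e / 2 < \<bar>S n om - I om\<bar>}"
    have "\<forall>\<^sub>F n in sequentially. dist (prob (?A n)) 0 < e / 2"
      by (rule tendstoD) (use c half_gt_zero[OF e] in \<open>unfold cip_def, blast+\<close>)
    then obtain N where N: "\<And>n. n \<ge> N \<Longrightarrow> prob (?A n) < e / 2" by (auto simp: eventually_sequentially)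
    have "norm ((LINT om|M. norm (D n om)) - 0) < e" if n: "n \<ge> N" for n
    proof -
      have "(LINT om|M. norm (D n om)) \<le> (LINT om|M. e / 2 + indicator (?A n) om)"

      proof (rule integral_mono)
        show "integrable M (\<lambda>om. norm (D n om))" using Di[of n] by simp
        show "integrable M (\<lambda>om. e / 2 + indicator (?A n) om)"
          by (intro Bochner_Integration.integrable_add integrable_real_indicator) (auto simp: less_top[symmetric])
        show "norm (D n om) \<le> e / 2 + indicator (?A n) om" if "om \<in> space M" for om
        proof (cases "e / 2 < \<bar>S n om - I om\<bar>")
          case True
          have "norm (D n om) \<le> 1" by (simp add: D_def)
          moreover have "indicator (?A n) om = (1::real)" using True that by simp
          ultimately show ?thesis using e by linarith
        next
          case False
          have "norm (D n om) \<le> \<bar>S n om - I om\<bar>" by (simp add: D_def)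
          moreover have "0 \<le> (indicator (?A n) om :: real)" by simp
          ultimately show ?thesis using False by linarith
        qed
      qed
      also have "\<dots> = e / 2 + prob (?A n)"
      proof -
        have "integrable M (\<lambda>om. indicator (?A n) om :: real)"
          by (intro integrable_real_indicator) (auto simp: less_top[symmetric])
        then have "(LINT om|M. e / 2 + indicator (?A n) om) = (LINT om|M. e / 2) + (LINT om|M. indicator (?A n) om)"
          by (intro Bochner_Integration.integral_add) simp_all
        then show ?thesis by (simp add: prob_space)
      qed
      also have "\<dots> < e" using N[OF n] by simp
      finally show ?thesis using integral_nonneg_AE[of "\<lambda>om. norm (D n om)" M] by simp
    qed
    then show "\<exists>no. \<forall>n\<ge>no. norm ((LINT om|M. norm (D n om)) - 0) < e" by blast
  qed
  from tendsto_L1_AE_subseq[OF Di this] obtain k where k: "strict_mono k" "AE om in M. (\<lambda>n. D (k n) om) \<longlonglongrightarrow> 0" by blast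
  have "AE om in M. (\<lambda>n. S (k n) om) \<longlonglongrightarrow> I om"
    using k(2)
  proof eventually_elim
    case (elim om)
    have "\<forall>\<^sub>F n in sequentially. D (k n) om < 1" using order_tendstoD(2)[OF elim, of 1] by simp
    then have ev: "\<forall>\<^sub>F n in sequentially. D (k n) om = \<bar>S (k n) om - I om\<bar>"
      by eventually_elim (auto simp: D_def)
    have "(\<lambda>n. \<bar>S (k n) om - I om\<bar>) \<longlonglongrightarrow> 0" by (rule Lim_transform_eventually[OF elim ev])
    then show ?case using tendsto_rabs_zero_iff LIM_zero_cancel by blast
  qed
  with k(1) show ?thesis by blast
qed

lemma cip_unique:
  assumes "cip S I" "cip S J"
  shows "AE om in M. I om = J om"
proof -
  obtain k where k: "strict_mono k" "AE om in M. (\<lambda>n. S (k n) om) \<longlonglongrightarrow> I om" using cip_AE_subseq[OF assms(1)] by blast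
  obtain l where l: "strict_mono l" "AE om in M. (\<lambda>n. S (k (l n)) om) \<longlonglongrightarrow> J om"
    using cip_AE_subseq[OF cip_subseq[OF assms(2) k(1)]] by blast
  from k(2) l(2) show ?thesis
  proof eventually_elim
    case (elim om)
    show ?case using LIMSEQ_unique[OF LIMSEQ_subseq_LIMSEQ[OF elim(1) l(1), unfolded comp_def] elim(2)] .
  qed
qed

text \<open>The exceptional sets at rational times unite to one null set, and continuity extends the
  equality to all times. An interval with empty interior has no such rationals and is treated
  apart.\<close>

lemma AE_all_times:
  fixes f g :: "real \<Rightarrow> 'a \<Rightarrow> real"
  assumes eq: "\<And>r. r \<in> {t..T} \<Longrightarrow> AE om in M. f r om = g r om"
    and f: "AE om in M. continuous_on {t..T} (\<lambda>r. f r om)" and g: "AE om in M. continuous_on {t..T} (\<lambda>r. g r om)"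
  shows "AE om in M. \<forall>r\<in>{t..T}. f r om = g r om"
proof (cases "t < T")
  case False
  then have s: "{t..T} \<subseteq> {T}" by auto
  show ?thesis
  proof (cases "T \<in> {t..T}")
    case True
    from eq[OF True] show ?thesis by eventually_elim (use s in auto)
  qed (use s in auto)
next
  case True
  have "AE om in M. \<forall>r\<in>{t<..<T} \<inter> \<rat>. f r om = g r om"
    by (subst AE_ball_countable) (auto intro!: eq countable_rat countable_Int2)
  then show ?thesis using f g
  proof eventually_elim
    case (elim om)
    have cl: "closure ({t<..<T} \<inter> \<rat>) = {t..T}"
      using closure_open_Int_superset[of "{t<..<T}" "\<rat>"] True by (simp add: Rats_closure_real)
    show ?case
    proof
      fix r assume r: "r \<in> {t..T}"
      have "continuous_on (closure ({t<..<T} \<inter> \<rat>)) (\<lambda>r. f r om - g r om)"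
        unfolding cl using elim by (intro continuous_on_diff) auto
      from continuous_constant_on_closure[OF this, of 0 r] have "f r om - g r om = 0"
        using elim r cl by auto
      then show "f r om = g r om" by simp
    qed
  qed
qed

end

text \<open>Left-point step functions are jointly measurable, hence so is their limit. Convergence
  from the left along the grids is enough, so first-exit weights qualify as well as continuous
  processes.\<close>

lemma joint_measurable:
  fixes Z :: "real \<Rightarrow> 'a \<Rightarrow> real"
  assumes tr: "t < r" and Z: "\<And>u. u \<in> {t..r} \<Longrightarrow> Z u \<in> borel_measurable M"
    and lim: "\<And>u om. u \<in> {t..<r} \<Longrightarrow> om \<in> space M \<Longrightarrow> (\<lambda>n. Z (gp t r n (ix t r n u)) om) \<longlonglongrightarrow> Z u om"
  shows "jointly M (\<lambda>u om. indicator {t..<r} u * Z u om :: real)"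
proof -
  define s :: "nat \<Rightarrow> real \<times> 'a \<Rightarrow> real" where "s n x = (\<Sum>i<n. indicator {gp t r n i..<gp t r n (Suc i)} (fst x) * Z (gp t r n i) (snd x))" for n x
  have s_meas: "s n \<in> borel_measurable (borel \<Otimes>\<^sub>M M)" for n
    unfolding s_def
  proof (rule borel_measurable_sum)
    fix i assume "i \<in> {..<n}"
    then have [measurable]: "Z (gp t r n i) \<in> borel_measurable M" using tr by (intro Z gp_in) auto
    show "(\<lambda>x :: real \<times> 'a. indicator {gp t r n i..<gp t r n (Suc i)} (fst x) * Z (gp t r n i) (snd x)) \<in> borel_measurable (borel \<Otimes>\<^sub>M M)"
      by measurable
  qed
  have "(\<lambda>x :: real \<times> 'a. indicator {t..<r} (fst x) * Z (fst x) (snd x)) \<in> borel_measurable (borel \<Otimes>\<^sub>M M)"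
  proof (rule borel_measurable_LIMSEQ_real[OF _ s_meas])
    fix x :: "real \<times> 'a" assume x: "x \<in> space (borel \<Otimes>\<^sub>M M)"
    have eq: "\<forall>\<^sub>F n in sequentially. indicator {t..<r} (fst x) * Z (gp t r n (ix t r n (fst x))) (snd x) = s n x"
      using eventually_gt_at_top[of 0]
    proof eventually_elim
      case (elim n)
      show ?case unfolding s_def by (rule cell_sum[OF tr elim, where F="\<lambda>i _. Z (gp t r n i) (snd x)", symmetric])
    qed
    have "(\<lambda>n. indicator {t..<r} (fst x) * Z (gp t r n (ix t r n (fst x))) (snd x)) \<longlonglongrightarrow> indicator {t..<r} (fst x) * Z (fst x) (snd x)"
      using lim[of "fst x" "snd x"] x by (cases "fst x \<in> {t..<r}") (auto simp: space_pair_measure)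
    then show "(\<lambda>n. s n x) \<longlonglongrightarrow> indicator {t..<r} (fst x) * Z (fst x) (snd x)"
      by (rule Lim_transform_eventually[OF _ eq])
  qed
  then show ?thesis by (simp add: split_def)
qed

lemma grid_left_tendsto:
  fixes z :: "real \<Rightarrow> 'a::topological_space"
  assumes "t < r" "continuous_on {t..r} z" "u \<in> {t..<r}"
  shows "(\<lambda>n. z (gp t r n (ix t r n u))) \<longlonglongrightarrow> z u"
  by (rule continuous_on_tendsto_compose[OF assms(2) gp_ix_tendsto(1)[OF assms(1,3)]])
     (use assms ix_cell[OF assms(1) _ assms(3)] gp_in[of t r] in
       \<open>auto intro!: eventually_mono[OF eventually_gt_at_top[of 0]] simp: less_imp_le\<close>)

lemma joint_measurable_continuous:
  fixes Z :: "real \<Rightarrow> 'a \<Rightarrow> real"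
  assumes tr: "t < r" and Z: "\<And>u. u \<in> {t..r} \<Longrightarrow> Z u \<in> borel_measurable M"
    and c: "\<And>om. om \<in> space M \<Longrightarrow> continuous_on {t..r} (\<lambda>u. Z u om)"
  shows "jointly M (\<lambda>u om. indicator {t..<r} u * Z u om :: real)"
  by (rule joint_measurable[OF tr Z]) (use grid_left_tendsto[OF tr c] in auto)

text \<open>The running supremum of a continuous path is a limit of maxima over finitely many times,
  hence measurable for the same \<sigma>-algebra. This is what makes first-exit weights
  adapted.\<close>

lemma running_bound_sets:
  fixes Y :: "real \<Rightarrow> 'a \<Rightarrow> real"
  assumes tu: "t \<le> u" and Y: "\<And>s. s \<in> {t..u} \<Longrightarrow> Y s \<in> borel_measurable N"
    and c: "\<And>om. om \<in> space N \<Longrightarrow> continuous_on {t..u} (\<lambda>s. Y s om)"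
  shows "{om\<in>space N. \<forall>s\<in>{t..u}. \<bar>Y s om\<bar> \<le> R} \<in> sets N"
proof (cases "t = u")
  case True
  have [measurable]: "Y t \<in> borel_measurable N" using Y tu by auto
  have "{om\<in>space N. \<forall>s\<in>{t..u}. \<bar>Y s om\<bar> \<le> R} = {om\<in>space N. \<bar>Y t om\<bar> \<le> R}" using True by auto
  then show ?thesis by simp
next
  case False
  then have tu: "t < u" using tu by simp
  have c': "continuous_on {t..u} (\<lambda>s. \<bar>Y s om\<bar>)" if "om \<in> space N" for om using c[OF that] by (intro continuous_intros)
  define m where "m om = (SUP s\<in>{t..u}. \<bar>Y s om\<bar>)" for om
  have [measurable]: "m \<in> borel_measurable N"
    unfolding m_def
    by (rule borel_measurable_LIMSEQ_real[OF rmax_grid_tendsto[OF tu c']])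
       (use tu in \<open>auto intro!: rmax_measurable borel_measurable_abs Y gp_in\<close>)
  have "(\<forall>s\<in>{t..u}. \<bar>Y s om\<bar> \<le> R) \<longleftrightarrow> m om \<le> R" if "om \<in> space N" for om
  proof -
    have "compact ((\<lambda>s. \<bar>Y s om\<bar>) ` {t..u})" by (rule compact_continuous_image[OF c'[OF that]]) simp
    then have "bdd_above ((\<lambda>s. \<bar>Y s om\<bar>) ` {t..u})" by (auto dest: compact_imp_bounded simp: bounded_imp_bdd_above)
    then show ?thesis unfolding m_def using tu by (subst cSUP_le_iff) auto
  qed
  then have "{om\<in>space N. \<forall>s\<in>{t..u}. \<bar>Y s om\<bar> \<le> R} = {om\<in>space N. m om \<le> R}" by auto
  then show ?thesis by simp
qed

lemma (in prob_space) fubini_bounded: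
  fixes f :: "real \<Rightarrow> 'a \<Rightarrow> real"
  assumes f[measurable]: "jointly M f"
    and bd: "\<And>u om. \<bar>f u om\<bar> \<le> B * indicator {t..r} u"
  shows "(LINT om|M. LINT u|lborel. f u om) = (LBINT u. LINT om|M. f u om)"
    and "integrable M (\<lambda>om. LBINT u. f u om)"
    and "integrable lborel (\<lambda>u. LINT om|M. f u om)"
proof -
  interpret P: pair_sigma_finite lborel M ..
  have sets_eq: "sets (lborel \<Otimes>\<^sub>M M) = sets (borel \<Otimes>\<^sub>M M)" by (rule sets_pair_measure_cong) simp_all
  have fm: "(\<lambda>(u, om). f u om) \<in> borel_measurable (lborel \<Otimes>\<^sub>M M)" using f unfolding measurable_cong_sets[OF sets_eq refl] .
  have fu: "f u \<in> borel_measurable M" for u using measurable_compose[OF measurable_Pair1' f, of u] by simp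
  have fui: "integrable M (f u)" for u
    by (rule integrable_const_bound[where B="B * indicator {t..r} u"]) (use bd fu in auto)
  have Bi: "integrable lborel (\<lambda>u. B * indicator {t..r} u)" by (rule integrable_mult_right) (simp add: emeasure_lborel_Icc_eq)
  have i: "integrable (lborel \<Otimes>\<^sub>M M) (\<lambda>(u, om). f u om)"
  proof (rule P.Fubini_integrable[OF fm])
    show "integrable lborel (\<lambda>x. LINT y|M. norm (case (x, y) of (u, om) \<Rightarrow> f u om))"
    proof (rule Bochner_Integration.integrable_bound[OF Bi])
      show "(\<lambda>x. LINT y|M. norm (case (x, y) of (u, om) \<Rightarrow> f u om)) \<in> borel_measurable lborel"
        by (rule borel_measurable_lebesgue_integral) (use fm in \<open>simp add: split_def\<close>)
      show "AE x in lborel. norm (LINT y|M. norm (case (x, y) of (u, om) \<Rightarrow> f u om)) \<le> norm (B * indicator {t..r} x)"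
      proof (rule AE_I2)
        fix x
        have "(LINT y|M. \<bar>f x y\<bar>) \<le> (LINT y|M. B * indicator {t..r} x)"
          by (rule integral_mono) (use fui bd in auto)
        moreover have "0 \<le> (LINT y|M. \<bar>f x y\<bar>)" by (rule integral_nonneg_AE) simp
        ultimately show "norm (LINT y|M. norm (case (x, y) of (u, om) \<Rightarrow> f u om)) \<le> norm (B * indicator {t..r} x)"
          by (simp add: prob_space)
      qed
    qed
  qed (use fui in simp)
  show "(LINT om|M. LINT u|lborel. f u om) = (LBINT u. LINT om|M. f u om)" by (rule P.Fubini_integral[OF i])
  show "integrable M (\<lambda>om. LBINT u. f u om)" by (rule P.integrable_snd[OF i])
  show "integrable lborel (\<lambda>u. LINT om|M. f u om)" using P.integrable_fst[OF i] by simp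
qed

text \<open>Cauchy-Schwarz, from the nonnegative integral of \<open>(y u - m)\<^sup>2\<close> with
  \<open>m\<close> the mean of \<open>y\<close> over the interval.\<close>

lemma LINT_square_le:
  fixes y :: "real \<Rightarrow> real"
  assumes tr: "t < r" and y: "set_integrable lborel {t..r} y" and y2: "set_integrable lborel {t..r} (\<lambda>u. (y u)\<^sup>2)"
  shows "(LBINT u:{t..r}. y u)\<^sup>2 \<le> (r - t) * (LBINT u:{t..r}. (y u)\<^sup>2)"
proof -
  define I where "I = (LBINT u:{t..r}. y u)"
  define m where "m = I / (r - t)"
  have c: "set_integrable lborel {t..r} (\<lambda>_. m\<^sup>2)" by (rule borel_integrable_atLeastAtMost') simp
  have eq: "(y u - m)\<^sup>2 = ((y u)\<^sup>2 - (2 * m) * y u) + m\<^sup>2" for u by (simp add: power2_eq_square algebra_simps)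
  have "0 \<le> (LBINT u:{t..r}. (y u - m)\<^sup>2)"
    unfolding set_lebesgue_integral_def by (intro integral_nonneg_AE AE_I2) simp
  also have "\<dots> = ((LBINT u:{t..r}. (y u)\<^sup>2) - 2 * m * I) + (r - t) * m\<^sup>2"
  proof -
    have my: "set_integrable lborel {t..r} (\<lambda>u. (2 * m) * y u)" by (rule set_integrable_mult_right) (use y in simp)
    have "(LBINT u:{t..r}. m\<^sup>2) = (r - t) * m\<^sup>2" using tr by (simp add: set_lebesgue_integral_def)
    then show ?thesis unfolding eq I_def using set_integral_add(2)[OF set_integral_diff(1)[OF y2 my] c] set_integral_diff(2)[OF y2 my] by simp
  qed
  finally have "0 \<le> (LBINT u:{t..r}. (y u)\<^sup>2) - 2 * m * I + (r - t) * m\<^sup>2" .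
  then have "0 \<le> (r - t) * ((LBINT u:{t..r}. (y u)\<^sup>2) - 2 * m * I + (r - t) * m\<^sup>2)" using tr by simp
  also have "\<dots> = (r - t) * (LBINT u:{t..r}. (y u)\<^sup>2) - 2 * ((r - t) * m) * I + ((r - t) * m)\<^sup>2"
    by (simp add: power2_eq_square algebra_simps)
  also have "(r - t) * m = I" using tr by (simp add: m_def)
  finally show ?thesis by (simp add: I_def power2_eq_square)
qed

section \<open>The geometric Brownian motion\<close>

lemma integrable_mult_L2:
  fixes X Y :: "'a \<Rightarrow> real"
  assumes [measurable]: "X \<in> borel_measurable M" "Y \<in> borel_measurable M"
    and "integrable M (\<lambda>om. (X om)\<^sup>2)" "integrable M (\<lambda>om. (Y om)\<^sup>2)"
  shows "integrable M (\<lambda>om. X om * Y om)"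
proof (rule Bochner_Integration.integrable_bound)
  show "integrable M (\<lambda>om. (X om)\<^sup>2 + (Y om)\<^sup>2)" using assms by auto
  have "\<bar>X om * Y om\<bar> \<le> (X om)\<^sup>2 + (Y om)\<^sup>2" for om
    using sum_squares_bound[of "\<bar>X om\<bar>" "\<bar>Y om\<bar>"] mult_nonneg_nonneg[OF abs_ge_zero abs_ge_zero, of "X om" "Y om"]
    unfolding abs_mult power2_abs by linarith
  then show "AE om in M. norm (X om * Y om) \<le> norm ((X om)\<^sup>2 + (Y om)\<^sup>2)" by simp
qed simp

lemma DERIV_ratio_tendsto:
  assumes d: "(g has_real_derivative D) (at 0)" and g0: "g 0 = 0" and h: "h \<longlonglongrightarrow> 0" "\<And>n. h n > (0::real)"
  shows "(\<lambda>n. g (h n) / h n) \<longlonglongrightarrow> D"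
proof -
  have "((\<lambda>h. g h / h) \<longlongrightarrow> D) (at 0)" using d g0 by (simp add: DERIV_def)
  moreover have "filterlim h (at 0) sequentially"
    using h by (auto simp: filterlim_at intro!: always_eventually less_imp_neq[symmetric])
  ultimately show ?thesis by (rule filterlim_compose)
qed

lemma seq_pow2: "(f \<longlonglongrightarrow> l) \<Longrightarrow> (\<lambda>n. f (2 ^ n :: nat)) \<longlonglongrightarrow> l"
  using LIMSEQ_subseq_LIMSEQ[of f l "\<lambda>n. 2 ^ n"] by (simp add: comp_def strict_mono_def)

context bm2
begin

text \<open>Discrete Ito isometry: \<phi> of an increment is centred and independent of the past, so
  the cross term with the earlier sum vanishes. A general \<phi> covers both the identity and the
  compensated exponential of \<open>gbm_ito\<close>.\<close>

lemma transform_L2: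
  fixes \<phi> :: "real \<Rightarrow> real" and n :: nat and t r v :: real
  assumes W: "is_W W" and tr: "0 \<le> t" "t < r" "r \<le> T" and n: "n > 0"
    and X: "\<And>i. i < n \<Longrightarrow> X i \<in> borel_measurable (F (gp t r n i))"
    and X2: "\<And>i. i < n \<Longrightarrow> integrable M (\<lambda>om. (X i om)\<^sup>2)"
    and \<phi>[measurable]: "\<phi> \<in> borel_measurable borel"
    and \<phi>1: "has_bochner_integral gauss1 (\<lambda>z. \<phi> (sqrt ((r - t) / real n) * z)) 0"
    and \<phi>2: "has_bochner_integral gauss1 (\<lambda>z. (\<phi> (sqrt ((r - t) / real n) * z))\<^sup>2) v"
  defines "S \<equiv> \<lambda>k om. \<Sum>i<k. X i om * \<phi> (W (gp t r n (Suc i)) om - W (gp t r n i) om)"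
  shows "k \<le> n \<Longrightarrow> S k \<in> borel_measurable (F (gp t r n k)) \<and> integrable M (\<lambda>om. (S k om)\<^sup>2)
    \<and> (LINT om|M. (S k om)\<^sup>2) = v * (\<Sum>i<k. LINT om|M. (X i om)\<^sup>2)"
proof (induction k)
  case 0
  then show ?case by (simp add: S_def)
next
  case (Suc k)
  let ?s = "gp t r n k" and ?u = "gp t r n (Suc k)"
  have k: "k < n" using Suc by simp
  have su: "0 \<le> ?s" "?s < ?u" "?u \<le> T"
    using gp_in[of t r k n] gp_in[of t r "Suc k" n] k tr n by (auto simp: gp_Suc)
  have h: "?u - ?s = (r - t) / real n" by (simp add: gp_Suc)
  have IH: "S k \<in> borel_measurable (F ?s)" "integrable M (\<lambda>om. (S k om)\<^sup>2)"
    "(LINT om|M. (S k om)\<^sup>2) = v * (\<Sum>i<k. LINT om|M. (X i om)\<^sup>2)" using Suc by auto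
  define D where "D om = W ?u om - W ?s om" for om
  have DF: "D \<in> borel_measurable (F ?u)" unfolding D_def using su
    by (intro borel_measurable_diff W_F[OF W]) auto
  have SM: "S k \<in> borel_measurable M" "X k \<in> borel_measurable M"
    using F_measurable_M[OF _ IH(1)] F_measurable_M[OF _ X[OF k]] su by auto
  have S_Suc: "S (Suc k) om = S k om + X k om * \<phi> (D om)" for om by (simp add: S_def D_def)
  have sq: "(S (Suc k) om)\<^sup>2 = ((S k om)\<^sup>2 + 2 * ((S k om * X k om) * \<phi> (D om))) + (X k om)\<^sup>2 * (\<phi> (D om))\<^sup>2" for om
    unfolding S_Suc by (simp add: power2_eq_square algebra_simps)
  have i1: "integrable M (\<lambda>om. S k om * X k om)" by (rule integrable_mult_L2[OF SM IH(2) X2[OF k]])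
  have m1: "(\<lambda>om. S k om * X k om) \<in> borel_measurable (F ?s)" using IH(1) X[OF k] by simp
  have m2: "(\<lambda>om. (X k om)\<^sup>2) \<in> borel_measurable (F ?s)" using X[OF k] by simp
  note a = W_mult[OF W su m1 i1 \<phi>, unfolded h, folded D_def] and b = W_mult[OF W su m2 X2[OF k], of "\<lambda>x. (\<phi> x)\<^sup>2", unfolded h, folded D_def]
  have a': "integrable M (\<lambda>om. (S k om * X k om) * \<phi> (D om))" "(LINT om|M. (S k om * X k om) * \<phi> (D om)) = 0"
    using a(1,2) \<phi>1 by (auto simp: has_bochner_integral_iff)
  have b': "integrable M (\<lambda>om. (X k om)\<^sup>2 * (\<phi> (D om))\<^sup>2)" "(LINT om|M. (X k om)\<^sup>2 * (\<phi> (D om))\<^sup>2) = (LINT om|M. (X k om)\<^sup>2) * v"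
    using b(1,2) \<phi>2 by (auto simp: has_bochner_integral_iff)
  have i2: "integrable M (\<lambda>om. (S k om)\<^sup>2 + 2 * ((S k om * X k om) * \<phi> (D om)))"
    using IH(2) a'(1) by (intro Bochner_Integration.integrable_add integrable_mult_right)
  have "integrable M (\<lambda>om. (S (Suc k) om)\<^sup>2)" unfolding sq using i2 b'(1) by (rule Bochner_Integration.integrable_add)
  moreover have "(LINT om|M. (S (Suc k) om)\<^sup>2) = v * (\<Sum>i<Suc k. LINT om|M. (X i om)\<^sup>2)"
    unfolding sq Bochner_Integration.integral_add[OF i2 b'(1)]
      Bochner_Integration.integral_add[OF IH(2) integrable_mult_right[OF a'(1)]] integral_mult_right_zero a'(2) b'(2) IH(3)
    by (simp add: algebra_simps)
  moreover have "S (Suc k) \<in> borel_measurable (F ?u)"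
  proof -
    have "S k \<in> borel_measurable (F ?u)" "X k \<in> borel_measurable (F ?u)"
      using F_measurable_mono[OF _ IH(1)] F_measurable_mono[OF _ X[OF k]] su by auto
    then show ?thesis unfolding S_Suc[abs_def] using DF by measurable
  qed
  ultimately show ?case by blast
qed

definition gbm :: "(real \<Rightarrow> 'w \<Rightarrow> real) \<Rightarrow> real \<Rightarrow> real \<Rightarrow> real \<Rightarrow> real \<Rightarrow> real \<Rightarrow> 'w \<Rightarrow> real" where
  "gbm W \<mu> \<sigma> a t u om = a * exp ((\<mu> - \<sigma>\<^sup>2 / 2) * (u - t) + \<sigma> * (W u om - W t om))"

lemma gbm_F: "is_W W \<Longrightarrow> 0 \<le> t \<Longrightarrow> t \<le> u \<Longrightarrow> gbm W \<mu> \<sigma> a t u \<in> borel_measurable (F u)"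
proof -
  assume W: "is_W W" "0 \<le> t" "t \<le> u"
  have [measurable]: "W u \<in> borel_measurable (F u)" "W t \<in> borel_measurable (F u)" using W_F[OF W(1)] W by auto
  show ?thesis unfolding gbm_def by measurable
qed

lemma gbm_cont: "is_W W \<Longrightarrow> 0 \<le> t \<Longrightarrow> om \<in> space M \<Longrightarrow> continuous_on {t..T} (\<lambda>u. gbm W \<mu> \<sigma> a t u om)"
  unfolding gbm_def by (intro continuous_intros continuous_on_subset[OF W_cont]) auto

lemma gbm_bound:
  assumes W: "is_W W" and t: "0 \<le> t" "t \<le> u" "u \<le> T" and om: "om \<in> space M"
  shows "\<bar>gbm W \<mu> \<sigma> a t u om\<bar> \<le> \<bar>a\<bar> * exp (\<bar>\<mu> - \<sigma>\<^sup>2 / 2\<bar> * T) * exp (2 * \<bar>\<sigma>\<bar> * supW W om)"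
proof -
  have "(\<mu> - \<sigma>\<^sup>2 / 2) * (u - t) \<le> \<bar>\<mu> - \<sigma>\<^sup>2 / 2\<bar> * T" using t by (intro mult_mono) auto
  moreover have "\<sigma> * (W u om - W t om) \<le> \<bar>\<sigma>\<bar> * (2 * supW W om)"
  proof -
    have "\<sigma> * (W u om - W t om) \<le> \<bar>\<sigma>\<bar> * \<bar>W u om - W t om\<bar>" by (simp add: abs_mult[symmetric])
    also have "\<dots> \<le> \<bar>\<sigma>\<bar> * (2 * supW W om)"
      using supW_ge[OF W om, of u] supW_ge[OF W om, of t] t by (intro mult_left_mono) auto
    finally show ?thesis .
  qed
  ultimately have "exp ((\<mu> - \<sigma>\<^sup>2 / 2) * (u - t) + \<sigma> * (W u om - W t om)) \<le> exp (\<bar>\<mu> - \<sigma>\<^sup>2 / 2\<bar> * T + 2 * \<bar>\<sigma>\<bar> * supW W om)" by simp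
  then show ?thesis unfolding gbm_def abs_mult by (simp add: exp_add mult_left_mono mult.assoc)
qed

lemma gbm_square_integrable:
  assumes W: "is_W W" and t: "0 \<le> t"
  shows "\<exists>C. \<forall>u\<in>{t..T}. integrable M (\<lambda>om. (gbm W \<mu> \<sigma> a t u om)\<^sup>2) \<and> (LINT om|M. (gbm W \<mu> \<sigma> a t u om)\<^sup>2) \<le> C"
proof -
  define B where "B = (\<bar>a\<bar> * exp (\<bar>\<mu> - \<sigma>\<^sup>2 / 2\<bar> * T))\<^sup>2"
  define D where "D om = B * exp (4 * \<bar>\<sigma>\<bar> * supW W om)" for om
  have Di: "integrable M D" unfolding D_def by (intro integrable_mult_right supW_exp_integrable[OF W])
  have bd: "(gbm W \<mu> \<sigma> a t u om)\<^sup>2 \<le> D om" if "u \<in> {t..T}" "om \<in> space M" for u om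
  proof -
    have "(gbm W \<mu> \<sigma> a t u om)\<^sup>2 \<le> (\<bar>a\<bar> * exp (\<bar>\<mu> - \<sigma>\<^sup>2 / 2\<bar> * T) * exp (2 * \<bar>\<sigma>\<bar> * supW W om))\<^sup>2"
      using gbm_bound[OF W t _ _ that(2), of u \<mu> \<sigma> a] that by (intro abs_le_square_iff[THEN iffD1]) simp
    also have "\<dots> = D om" by (simp add: D_def B_def power_mult_distrib exp_double[symmetric] mult.assoc)
    finally show ?thesis .
  qed
  have gm: "gbm W \<mu> \<sigma> a t u \<in> borel_measurable M" if "u \<in> {t..T}" for u
    using F_measurable_M[OF _ gbm_F[OF W t]] that by auto
  have i: "integrable M (\<lambda>om. (gbm W \<mu> \<sigma> a t u om)\<^sup>2)" if "u \<in> {t..T}" for u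
    by (rule Bochner_Integration.integrable_bound[OF Di]) (use gm[OF that] bd[OF that] in \<open>auto intro!: AE_I2 order_trans[OF _ abs_ge_self]\<close>)
  show ?thesis
    by (rule exI[of _ "integral\<^sup>L M D"]) (use i bd Di in \<open>auto intro!: integral_mono\<close>)
qed

text \<open>Over a cell the process is multiplied by \<open>exp (m * h + \<sigma> * D)\<close>,
  where \<open>D\<close> is the increment of \<open>W\<close>. This factor splits into 1, the noise
  \<open>\<sigma> * D\<close> of the Riemann sum, the drift \<open>\<mu> * h\<close>, a
  deterministic defect \<kappa> and a centred remainder \<phi>. The defect and the variance of the
  remainder are \<open>o(h)\<close>, so both disappear in the sum: the first pathwise, the second in
  mean square by orthogonality.\<close>

lemma gbm_ito:
  fixes \<mu> \<sigma> a :: real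
  assumes W: "is_W W" and tr: "0 \<le> t" "t < r" "r \<le> T"
  defines "G \<equiv> gbm W \<mu> \<sigma> a t"
  shows "cip (\<lambda>n om. \<Sum>i<2^n. (W (gp t r (2^n) (Suc i)) om - W (gp t r (2^n) i) om) * (\<sigma> * G (gp t r (2^n) i) om))
      (\<lambda>om. G r om - a - \<mu> * (LBINT u:{t..r}. G u om))"
proof -
  define m where "m = \<mu> - \<sigma>\<^sup>2 / 2"
  define h where "h n = (r - t) / real (2 ^ n)" for n :: nat
  have h0: "h n > 0" for n using tr by (simp add: h_def)
  have hlim: "h \<longlonglongrightarrow> 0" unfolding h_def by (rule seq_pow2[OF step_tendsto])
  \<comment> \<open>\<open>exp (\<mu> * h n)\<close> is the mean of the exponential: the
    \<open>- \<sigma>\<^sup>2 / 2\<close> in \<open>m\<close> cancels the Gaussian moment.\<close>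
  define \<phi> where "\<phi> n x = exp (m * h n + \<sigma> * x) - exp (\<mu> * h n) - \<sigma> * x" for n x
  \<comment> \<open>Second moment of \<phi> as a function of the step; it vanishes at 0 together
    with its derivative.\<close>
  define v where "v x = exp (2 * \<mu> * x) * (exp (\<sigma>\<^sup>2 * x) - 1) + \<sigma>\<^sup>2 * x - 2 * \<sigma>\<^sup>2 * x * exp (\<mu> * x)" for x
  define \<kappa> where "\<kappa> x = exp (\<mu> * x) - 1 - \<mu> * x" for x
  let ?g = "\<lambda>n. gp t r (2 ^ n)"
  let ?D = "\<lambda>n i om. W (?g n (Suc i)) om - W (?g n i) om"
  have gin: "?g n i \<in> {t..r}" if "i \<le> 2 ^ n" for n i by (rule gp_in) (use that tr in auto)
  have gT: "?g n i \<in> {t..T}" if "i \<le> 2 ^ n" for n i using gin[OF that] tr by auto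
  have GF: "G u \<in> borel_measurable (F u)" if "t \<le> u" for u unfolding G_def by (rule gbm_F[OF W tr(1) that])
  have GM: "G u \<in> borel_measurable M" if "u \<in> {t..T}" for u using F_measurable_M[OF _ GF] that by auto
  have WM: "W u \<in> borel_measurable M" if "u \<in> {t..T}" for u using W_meas[OF W] that tr by auto
  have Gc: "continuous_on {t..r} (\<lambda>u. G u om)" if "om \<in> space M" for om
    unfolding G_def using gbm_cont[OF W tr(1) that] by (rule continuous_on_subset) (use tr in auto)
  define Z where "Z n om = (\<Sum>i<2^n. G (?g n i) om * \<phi> n (?D n i om))" for n om
  define R where "R n om = (\<Sum>i<2^n. h n * G (?g n i) om)" for n om
  have G_t: "G t om = a" for om by (simp add: G_def gbm_def)
  have G_step: "G (?g n (Suc i)) om = G (?g n i) om * exp (m * h n + \<sigma> * ?D n i om)" for n i om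
    unfolding G_def gbm_def m_def[symmetric] h_def
    by (simp add: gp_Suc mult.assoc exp_add[symmetric]) (simp add: algebra_simps)
  have decomp: "(\<Sum>i<2^n. ?D n i om * (\<sigma> * G (?g n i) om))
      = (G r om - a - \<mu> * R n om - \<kappa> (h n) / h n * R n om) - Z n om" for n om
  proof -
    have "G r om - a = (\<Sum>i<2^n. G (?g n (Suc i)) om - G (?g n i) om)"
      using sum_lessThan_telescope[of "\<lambda>i. G (?g n i) om" "2 ^ n"] by (simp add: gp_n G_t)
    also have "\<dots> = (\<Sum>i<2^n. ?D n i om * (\<sigma> * G (?g n i) om)
        + G (?g n i) om * \<phi> n (?D n i om)
        + \<mu> * (h n * G (?g n i) om) + \<kappa> (h n) / h n * (h n * G (?g n i) om))"
    proof (rule sum.cong)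
      fix i
      have "\<kappa> (h n) / h n * (h n * G (?g n i) om) = \<kappa> (h n) * G (?g n i) om" using h0[of n] by simp
      then show "G (?g n (Suc i)) om - G (?g n i) om = ?D n i om * (\<sigma> * G (?g n i) om)
        + G (?g n i) om * \<phi> n (?D n i om)
        + \<mu> * (h n * G (?g n i) om) + \<kappa> (h n) / h n * (h n * G (?g n i) om)"
        unfolding G_step \<phi>_def \<kappa>_def by (simp add: algebra_simps)
    qed simp
    also have "\<dots> = (\<Sum>i<2^n. ?D n i om * (\<sigma> * G (?g n i) om)) + Z n om + \<mu> * R n om + \<kappa> (h n) / h n * R n om"
      unfolding Z_def R_def sum.distrib sum_distrib_left ..
    finally show ?thesis by simp
  qed
  obtain C where C: "\<And>u. u \<in> {t..T} \<Longrightarrow> integrable M (\<lambda>om. (G u om)\<^sup>2)" "\<And>u. u \<in> {t..T} \<Longrightarrow> (LINT om|M. (G u om)\<^sup>2) \<le> C"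
    using gbm_square_integrable[OF W tr(1), of \<mu> \<sigma> a] unfolding G_def by blast
  have mom: "has_bochner_integral gauss1 (\<lambda>z. \<phi> n (sqrt (h n) * z)) 0"
    "has_bochner_integral gauss1 (\<lambda>z. (\<phi> n (sqrt (h n) * z))\<^sup>2) (v (h n))" for n
  proof -
    define b where "b = \<sigma> * sqrt (h n)"
    define d where "d = exp (m * h n)"
    define c where "c = exp (\<mu> * h n)"
    have b2: "b\<^sup>2 = \<sigma>\<^sup>2 * h n" using h0[of n] by (simp add: b_def power_mult_distrib)
    have dc: "d * exp (b\<^sup>2 / 2) = c" unfolding d_def c_def b2 m_def exp_add[symmetric] by (simp add: algebra_simps)
    have ph: "\<phi> n (sqrt (h n) * z) = d * exp (b * z) - c * 1 - b * z" for z
      by (simp add: \<phi>_def d_def c_def b_def exp_add mult.assoc)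
    have 1: "has_bochner_integral gauss1 (\<lambda>z. 1 :: real) 1" using gauss1.prob_space by (simp add: has_bochner_integral_iff)
    have "has_bochner_integral gauss1 (\<lambda>z. d * exp (b * z) - c * 1 - b * z) (d * exp (b\<^sup>2 / 2) - c * 1 - b * 0)"
      by (intro has_bochner_integral_diff has_bochner_integral_mult_right gauss1_exp gauss1_moments(1) 1)
    then show "has_bochner_integral gauss1 (\<lambda>z. \<phi> n (sqrt (h n) * z)) 0" unfolding ph dc by simp
    have sq: "(d * exp (b * z) - c * 1 - b * z)\<^sup>2 = d\<^sup>2 * exp ((2 * b) * z) + c\<^sup>2 * 1 + b\<^sup>2 * z\<^sup>2 - 2 * c * d * exp (b * z)
        - 2 * b * d * (z * exp (b * z)) + 2 * c * b * z" for z
    proof -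
      have e: "exp ((2 * b) * z) = exp (b * z) * exp (b * z)" by (simp add: exp_add[symmetric])
      show ?thesis unfolding e by (simp add: power2_eq_square algebra_simps)
    qed
    have "has_bochner_integral gauss1 (\<lambda>z. d\<^sup>2 * exp ((2 * b) * z) + c\<^sup>2 * 1 + b\<^sup>2 * z\<^sup>2 - 2 * c * d * exp (b * z)
        - 2 * b * d * (z * exp (b * z)) + 2 * c * b * z)
       (d\<^sup>2 * exp ((2 * b)\<^sup>2 / 2) + c\<^sup>2 * 1 + b\<^sup>2 * 1 - 2 * c * d * exp (b\<^sup>2 / 2) - 2 * b * d * (b * exp (b\<^sup>2 / 2)) + 2 * c * b * 0)"
      by (intro has_bochner_integral_diff has_bochner_integral_add has_bochner_integral_mult_right gauss1_exp gauss1_zexp gauss1_moments 1)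
    moreover have "d\<^sup>2 * exp ((2 * b)\<^sup>2 / 2) + c\<^sup>2 * 1 + b\<^sup>2 * 1 - 2 * c * d * exp (b\<^sup>2 / 2) - 2 * b * d * (b * exp (b\<^sup>2 / 2)) + 2 * c * b * 0 = v (h n)"
    proof -
      have e1: "d\<^sup>2 * exp ((2 * b)\<^sup>2 / 2) = c\<^sup>2 * exp (b\<^sup>2)"
        unfolding dc[symmetric] power_mult_distrib exp_double[symmetric] by (simp add: exp_add[symmetric] mult.assoc)
      have c2: "c\<^sup>2 = exp (2 * \<mu> * h n)" by (simp add: c_def exp_double[symmetric] mult.assoc)
      have "d\<^sup>2 * exp ((2 * b)\<^sup>2 / 2) + c\<^sup>2 * 1 + b\<^sup>2 * 1 - 2 * c * d * exp (b\<^sup>2 / 2) - 2 * b * d * (b * exp (b\<^sup>2 / 2)) + 2 * c * b * 0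
        = c\<^sup>2 * exp (b\<^sup>2) + c\<^sup>2 + b\<^sup>2 - 2 * c * (d * exp (b\<^sup>2 / 2)) - 2 * b\<^sup>2 * (d * exp (b\<^sup>2 / 2))"
        unfolding e1 by (simp add: power2_eq_square algebra_simps)
      also have "\<dots> = c\<^sup>2 * (exp (b\<^sup>2) - 1) + b\<^sup>2 - 2 * b\<^sup>2 * c"
        unfolding dc by (simp add: power2_eq_square algebra_simps)
      also have "\<dots> = v (h n)" unfolding v_def c2[symmetric] b2 c_def[symmetric] by (simp add: mult.assoc)
      finally show ?thesis .
    qed
    ultimately show "has_bochner_integral gauss1 (\<lambda>z. (\<phi> n (sqrt (h n) * z))\<^sup>2) (v (h n))" unfolding ph sq by simp
  qed
  have Z2: "Z n \<in> borel_measurable M \<and> integrable M (\<lambda>om. (Z n om)\<^sup>2) \<and> (LINT om|M. (Z n om)\<^sup>2) = v (h n) * (\<Sum>i<2^n. LINT om|M. (G (?g n i) om)\<^sup>2)" for n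
  proof -
    have [measurable]: "\<phi> n \<in> borel_measurable borel" unfolding \<phi>_def by measurable
    have "0 < (2::nat) ^ n" by simp
    from transform_L2[OF W tr this, of "\<lambda>i. G (?g n i)" "\<phi> n" "v (h n)" "2 ^ n", OF GF C(1)] mom[of n]
    have "Z n \<in> borel_measurable (F (?g n (2^n))) \<and> integrable M (\<lambda>om. (Z n om)\<^sup>2) \<and> (LINT om|M. (Z n om)\<^sup>2) = v (h n) * (\<Sum>i<2^n. LINT om|M. (G (?g n i) om)\<^sup>2)"
      unfolding Z_def h_def using gT[of _ n] by (force simp: less_imp_le)
    moreover have "?g n (2^n) = r" by (rule gp_n) simp
    ultimately show ?thesis using F_measurable_M[OF tr(3), of "Z n" borel] by metis
  qed
  have v0: "0 \<le> v (h n)" for n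
  proof -
    have "v (h n) = (LINT z|gauss1. (\<phi> n (sqrt (h n) * z))\<^sup>2)" using mom(2)[of n] by (simp add: has_bochner_integral_iff)
    then show ?thesis by (simp add: integral_nonneg_AE)
  qed
  have "cip Z (\<lambda>_. 0)"
  proof (rule cip_L2)
    have dv: "(v has_real_derivative 0) (at 0)" unfolding v_def by (auto intro!: derivative_eq_intros)
    have "(\<lambda>n. v (h n) / h n) \<longlonglongrightarrow> 0" by (rule DERIV_ratio_tendsto[OF dv _ hlim h0]) (simp add: v_def)
    then have l: "(\<lambda>n. v (h n) / h n * ((r - t) * C)) \<longlonglongrightarrow> 0" by (rule tendsto_mult_left_zero)
    show "(\<lambda>n. LINT om|M. (Z n om)\<^sup>2) \<longlonglongrightarrow> 0"
    proof (rule tendsto_sandwich[OF _ _ tendsto_const l]; intro always_eventually allI)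
      fix n
      show "0 \<le> (LINT om|M. (Z n om)\<^sup>2)" by (simp add: integral_nonneg_AE)
      have "(\<Sum>i<2^n. LINT om|M. (G (?g n i) om)\<^sup>2) \<le> (\<Sum>i<(2::nat)^n. C)"
        by (rule sum_mono) (use C(2) gT in auto)
      then have "(LINT om|M. (Z n om)\<^sup>2) \<le> v (h n) * (2 ^ n * C)"
        using Z2[of n] v0[of n] by (simp add: mult_left_mono)
      also have "\<dots> = v (h n) / h n * ((r - t) * C)" using tr by (simp add: h_def field_simps)
      finally show "(LINT om|M. (Z n om)\<^sup>2) \<le> v (h n) / h n * ((r - t) * C)" .
    qed
  qed (use Z2 in auto)
  moreover have "cip (\<lambda>n om. G r om - a - \<mu> * R n om - \<kappa> (h n) / h n * R n om)
     (\<lambda>om. G r om - a - \<mu> * (LBINT u:{t..r}. G u om))"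
  proof -
    have lim: "(\<lambda>n. R n om) \<longlonglongrightarrow> (LBINT u:{t..r}. G u om)" if "om \<in> space M" for om
      unfolding R_def h_def by (rule seq_pow2[OF riemann_limit_continuous[OF tr(2) Gc[OF that]]])
    have Rm[measurable]: "R n \<in> borel_measurable M" for n
      unfolding R_def by (intro borel_measurable_sum borel_measurable_times GM gT) auto
    have [measurable]: "(\<lambda>om. LBINT u:{t..r}. G u om) \<in> borel_measurable M"
      by (rule borel_measurable_LIMSEQ_real[OF lim Rm])
    have [measurable]: "G r \<in> borel_measurable M" using GM tr by auto
    have dk: "(\<kappa> has_real_derivative 0) (at 0)" unfolding \<kappa>_def by (auto intro!: derivative_eq_intros)
    have k: "(\<lambda>n. \<kappa> (h n) / h n) \<longlonglongrightarrow> 0" by (rule DERIV_ratio_tendsto[OF dk _ hlim h0]) (simp add: \<kappa>_def)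
    show ?thesis
    proof (rule cip_AE)
      show "AE om in M. (\<lambda>n. G r om - a - \<mu> * R n om - \<kappa> (h n) / h n * R n om) \<longlonglongrightarrow> G r om - a - \<mu> * (LBINT u:{t..r}. G u om)"
      proof (rule AE_I2)
        fix om assume w: "om \<in> space M"
        have "(\<lambda>n. G r om - a - \<mu> * R n om - \<kappa> (h n) / h n * R n om) \<longlonglongrightarrow> G r om - a - \<mu> * (LBINT u:{t..r}. G u om) - 0 * (LBINT u:{t..r}. G u om)"
          by (intro tendsto_diff tendsto_mult tendsto_const lim[OF w] k)
        then show "(\<lambda>n. G r om - a - \<mu> * R n om - \<kappa> (h n) / h n * R n om) \<longlonglongrightarrow> G r om - a - \<mu> * (LBINT u:{t..r}. G u om)" by simp
      qed
    qed measurable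
  qed
  ultimately show ?thesis unfolding decomp using cip_diff by fastforce
qed

end

section \<open>First-exit weights and uniqueness for the linear equation\<close>

definition run_ind :: "real \<Rightarrow> (real \<Rightarrow> 'a \<Rightarrow> real) \<Rightarrow> real \<Rightarrow> real \<Rightarrow> 'a \<Rightarrow> real" where
  "run_ind t V R u om = (if \<forall>s\<in>{t..u}. \<bar>V s om\<bar> \<le> R then 1 else 0)"

lemma run_ind_measurable:
  assumes "t \<le> u" "\<And>s. s \<in> {t..u} \<Longrightarrow> V s \<in> borel_measurable N" "\<And>om. om \<in> space N \<Longrightarrow> continuous_on {t..u} (\<lambda>s. V s om)"
  shows "run_ind t V R u \<in> borel_measurable N"
  unfolding run_ind_def using running_bound_sets[OF assms, of R]
  by (intro measurable_If) auto

text \<open>A violation before \<open>u\<close> is eventually passed by the grid points; a violation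
  at \<open>u\<close> itself is a strict inequality, hence by continuity shared by nearby grid
  points.\<close>

lemma run_ind_left:
  assumes tr: "t < r" and c: "continuous_on {t..r} (\<lambda>s. V s om)" and u: "u \<in> {t..<r}"
  shows "(\<lambda>n. run_ind t V R (gp t r n (ix t r n u)) om) \<longlonglongrightarrow> run_ind t V R u om"
proof (rule tendsto_eventually)
  let ?k = "\<lambda>n. gp t r n (ix t r n u)"
  have ku: "\<forall>\<^sub>F n in sequentially. ?k n \<le> u \<and> ?k n \<in> {t..r}"
    using eventually_gt_at_top[of 0] by eventually_elim (use ix_cell[OF tr _ u] gp_in[of t r] tr in \<open>auto simp: less_imp_le\<close>)
  show "\<forall>\<^sub>F n in sequentially. run_ind t V R (?k n) om = run_ind t V R u om"
  proof (cases "\<forall>s\<in>{t..u}. \<bar>V s om\<bar> \<le> R")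
    case True
    from ku show ?thesis by eventually_elim (use True in \<open>auto simp: run_ind_def\<close>)
  next
    case False
    then obtain s where s: "s \<in> {t..u}" "\<bar>V s om\<bar> > R" by (auto simp: not_le)
    show ?thesis
    proof (cases "s = u")
      case True
      have "(\<lambda>n. \<bar>V (?k n) om\<bar>) \<longlonglongrightarrow> \<bar>V u om\<bar>" by (intro tendsto_rabs grid_left_tendsto[OF tr c u])
      then have "\<forall>\<^sub>F n in sequentially. \<bar>V (?k n) om\<bar> > R" using s True by (auto dest: order_tendstoD(1))
      with ku show ?thesis
      proof eventually_elim
        case (elim n)
        then have "\<not> (\<forall>s\<in>{t..?k n}. \<bar>V s om\<bar> \<le> R)" by (auto simp: not_le intro!: bexI[of _ "?k n"])
        with False show ?case by (simp add: run_ind_def)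
      qed
    next
      case ne: False
      then have "s < u" using s by simp
      then have "\<forall>\<^sub>F n in sequentially. s < ?k n" using gp_ix_tendsto(1)[OF tr u] by (auto dest: order_tendstoD(1))
      then show ?thesis
      proof eventually_elim
        case (elim n)
        then have "\<not> (\<forall>s\<in>{t..?k n}. \<bar>V s om\<bar> \<le> R)" using s by (auto simp: not_le intro!: bexI[of _ s])
        with False show ?case by (simp add: run_ind_def)
      qed
    qed
  qed
qed

context bm2
begin

text \<open>The difference \<open>Y\<close> of two solutions, stopped when it leaves \<open>[-R, R]\<close>, has a second moment that
  satisfies a homogeneous Gronwall inequality.\<close>

lemma linear_sde_zero:
  fixes Y :: "real \<Rightarrow> 'w \<Rightarrow> real"
  assumes W: "is_W W" and t: "0 \<le> t" "t < T"
    and Y: "\<And>u. u \<in> {t..T} \<Longrightarrow> Y u \<in> borel_measurable (F u)"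
    and Yc: "\<And>om. om \<in> space M \<Longrightarrow> continuous_on {t..T} (\<lambda>u. Y u om)"
    and eq: "\<And>r. t < r \<Longrightarrow> r \<le> T \<Longrightarrow> \<exists>J. cip (\<lambda>n om. \<Sum>i<2^n. (W (gp t r (2^n) (Suc i)) om - W (gp t r (2^n) i) om) * (\<sigma> * Y (gp t r (2^n) i) om)) J
        \<and> (AE om in M. Y r om = \<mu> * (LBINT u:{t..r}. Y u om) + J om)"
    and Y0: "\<And>om. om \<in> space M \<Longrightarrow> Y t om = 0"
  shows "AE om in M. \<forall>r\<in>{t..T}. Y r om = 0"
proof -
  have YM: "Y u \<in> borel_measurable M" if "u \<in> {t..T}" for u using F_measurable_M[OF _ Y[OF that]] that by auto
  have Yc': "continuous_on {t..r} (\<lambda>u. Y u om)" if "om \<in> space M" "r \<le> T" for om r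
    by (rule continuous_on_subset[OF Yc[OF that(1)]]) (use that in auto)
  \<comment> \<open>The event that the path has not left \<open>[-R, R]\<close> up to
    \<open>u\<close>. It shrinks as \<open>u\<close> grows, so on \<open>A R r\<close> all earlier
    cut-offs are inactive.\<close>
  define A where "A R u = {om\<in>space M. \<forall>s\<in>{t..u}. \<bar>Y s om\<bar> \<le> R}" for R u
  define Z where "Z R u om = indicator (A R u) om * Y u om" for R u om
  have AF: "A R u \<in> sets (F u)" if "u \<in> {t..T}" for R u
  proof -
    have "{om\<in>space (F u). \<forall>s\<in>{t..u}. \<bar>Y s om\<bar> \<le> R} \<in> sets (F u)"
    proof (rule running_bound_sets)
      show "Y s \<in> borel_measurable (F u)" if s: "s \<in> {t..u}" for s
        by (rule F_measurable_mono[OF _ Y]) (use s \<open>u \<in> {t..T}\<close> in auto)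
    qed (use that Yc' in auto)
    then show ?thesis by (simp add: A_def)
  qed
  have ZF: "Z R u \<in> borel_measurable (F u)" if "u \<in> {t..T}" for R u
    unfolding Z_def using AF[OF that] Y[OF that] by measurable
  have ZM: "Z R u \<in> borel_measurable M" if "u \<in> {t..T}" for R u using F_measurable_M[OF _ ZF[OF that]] that by auto
  have Z2M: "(\<lambda>om. (Z R u om)\<^sup>2) \<in> borel_measurable M" if "u \<in> {t..T}" for R u using ZM[OF that] by measurable
  have Zbd: "(Z R u om)\<^sup>2 \<le> R\<^sup>2" if "t \<le> u" for R u om
  proof (cases "om \<in> A R u")
    case True
    then have "\<bar>Y u om\<bar> \<le> R" using that by (auto simp: A_def)
    then show ?thesis using True by (simp add: Z_def abs_le_square_iff[symmetric])
  qed (simp add: Z_def)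
  have Z2i: "integrable M (\<lambda>om. (Z R u om)\<^sup>2)" if "u \<in> {t..T}" for R u
    by (rule integrable_const_bound[where B="R\<^sup>2"]) (use Z2M[OF that] Zbd that in auto)
  have chi_mono: "om \<in> A R u" if "om \<in> A R v" "u \<le> v" for R u v om using that by (auto simp: A_def)
  have Zlim: "(\<lambda>n. (Z R (gp t r n (ix t r n u)) om)\<^sup>2) \<longlonglongrightarrow> (Z R u om)\<^sup>2"
    if w: "om \<in> space M" and r: "t < r" "r \<le> T" and u: "u \<in> {t..<r}" for R r u om
  proof -
    let ?k = "\<lambda>n. gp t r n (ix t r n u)"
    have Yl: "(\<lambda>n. Y (?k n) om) \<longlonglongrightarrow> Y u om" by (rule grid_left_tendsto[OF r(1) Yc'[OF w r(2)] u])
    have "indicator (A R v) om = run_ind t Y R v om" for v using w by (simp add: A_def run_ind_def)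
    then have il: "(\<lambda>n. indicator (A R (?k n)) om :: real) \<longlonglongrightarrow> indicator (A R u) om"
      using run_ind_left[where V=Y and R=R, OF r(1) Yc'[OF w r(2)] u] by simp
    show ?thesis unfolding Z_def by (intro tendsto_intros il Yl)
  qed
  define f where "f R r u om = indicator {t..<r} u * (Z R u om)\<^sup>2" for R r u om
  have f_meas: "jointly M (\<lambda>u om. f R r u om)" if "t < r" "r \<le> T" for R r
    unfolding f_def by (rule joint_measurable[OF that(1) Z2M Zlim]) (use that in auto)
  have f_bd: "\<bar>f R r u om\<bar> \<le> R\<^sup>2 * indicator {t..r} u" for R r u om
    using Zbd[of u R om] by (auto simp: f_def indicator_def)
  define g where "g R u = (LINT om|M. (Z R u om)\<^sup>2)" for R u
  have g_bd: "0 \<le> g R u \<and> g R u \<le> R\<^sup>2" if "u \<in> {t..T}" for R u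
  proof -
    have "g R u \<le> (LINT om|M. R\<^sup>2)" unfolding g_def by (rule integral_mono) (use Z2i[OF that] Zbd that in auto)
    then show ?thesis by (simp add: g_def prob_space integral_nonneg_AE)
  qed
  have fubini: "(LINT om|M. LINT u|lborel. f R r u om) = (LBINT u. indicator {t..<r} u * g R u)"
    "integrable lborel (\<lambda>u. indicator {t..<r} u * g R u)" "integrable M (\<lambda>om. LBINT u. f R r u om)" if r: "t < r" "r \<le> T" for R r
    using fubini_bounded[OF f_meas[OF r] f_bd[of R r]] unfolding f_def g_def by simp_all
  have split_r: "indicator {t..r} u * g R u = indicator {t..<r} u * g R u + indicator {r} u * g R r" if "t < r" for r u R
    using that by (auto simp: indicator_def)
  have ir: "integrable lborel (\<lambda>u. indicator {r} u * (c::real))" "(LBINT u. indicator {r} u * (c::real)) = 0" for r c :: real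
    by (auto intro!: integrable_mult_left)
  have g_int: "set_integrable lborel {t..r} (g R)"
    and g_eq: "(LBINT u:{t..r}. g R u) = (LBINT u. indicator {t..<r} u * g R u)" if r: "t < r" "r \<le> T" for R r
    using fubini(2)[OF r, of R] ir[of r "g R r"]
    unfolding set_integrable_def set_lebesgue_integral_def real_scaleR_def split_r[OF r(1)]
    by (auto intro: Bochner_Integration.integrable_add)
  \<comment> \<open>From \<open>(x + y)\<^sup>2 \<le> 2 * x\<^sup>2 + 2 * y\<^sup>2\<close>: the
    drift contributes \<open>2 * \<mu>\<^sup>2 * T\<close> by Cauchy-Schwarz, the noise
    \<open>2 * \<sigma>\<^sup>2\<close> by the isometry, and the 1 keeps \<open>C\<close>
    positive.\<close>
  define C where "C = 2 * \<mu>\<^sup>2 * T + 2 * \<sigma>\<^sup>2 + 1"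
  have C0: "C > 0" using T_pos by (simp add: C_def add_nonneg_pos)
  have key: "g R r \<le> 0 + C * (LBINT u:{t..r}. g R u)" if r: "r \<in> {t..T}" for R r
  proof (cases "r = t")
    case True
    have "g R t = (LINT om|M. 0)" unfolding g_def by (rule Bochner_Integration.integral_cong) (auto simp: Z_def Y0)
    then have "g R t = 0" by simp
    moreover have "0 \<le> (LBINT u:{t..t}. g R u)"
      unfolding set_lebesgue_integral_def by (intro integral_nonneg_AE AE_I2) (use g_bd t in \<open>auto simp: indicator_def\<close>)
    ultimately show ?thesis using True C0 by simp
  next
    case False
    then have r: "t < r" "r \<le> T" using r by auto
    have tr: "0 \<le> t" "t < r" "r \<le> T" using t r by auto
    let ?g = "\<lambda>n. gp t r (2 ^ n)"
    let ?D = "\<lambda>n i om. W (?g n (Suc i)) om - W (?g n i) om"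
    let ?I = "LBINT u:{t..r}. g R u"
    have gin: "?g n i \<in> {t..r}" if "i \<le> 2 ^ n" for n i by (rule gp_in) (use that r in auto)
    have gT: "?g n i \<in> {t..T}" if "i \<le> 2 ^ n" for n i using gin[OF that] r by auto
    define h where "h n = (r - t) / real (2 ^ n)" for n :: nat
    have h0: "h n > 0" for n using r by (simp add: h_def)
    define S where "S n om = (\<Sum>i<2^n. ?D n i om * (\<sigma> * Y (?g n i) om))" for n om
    obtain J where J: "cip S J" "AE om in M. Y r om = \<mu> * (LBINT u:{t..r}. Y u om) + J om"
      using eq[OF r] unfolding S_def by blast
    have Jm[measurable]: "J \<in> borel_measurable M" and Sm[measurable]: "\<And>n. S n \<in> borel_measurable M" using J(1) by (auto simp: cip_def)
    have Am[measurable]: "A R r \<in> sets M" using AF[of r R] F_sub[of r] r by auto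
    \<comment> \<open>On \<open>A R r\<close> the sum does not change when each integrand is cut off
      at its own time. The cut-off integrands are adapted and bounded, so the isometry gives the
      second moment exactly.\<close>
    define S' where "S' n om = (\<Sum>i<2^n. (\<sigma> * Z R (?g n i) om) * ?D n i om)" for n om
    have SS': "S n om = S' n om" if "om \<in> A R r" for n om
      unfolding S_def S'_def
    proof (rule sum.cong)
      fix i assume "i \<in> {..<(2::nat)^n}"
      then have "?g n i \<le> r" using gin[of i n] by auto
      then have "om \<in> A R (?g n i)" using chi_mono[OF that] by auto
      then show "?D n i om * (\<sigma> * Y (?g n i) om) = (\<sigma> * Z R (?g n i) om) * ?D n i om"
        by (simp add: Z_def)
    qed simp
    have S'2: "integrable M (\<lambda>om. (S' n om)\<^sup>2) \<and> (LINT om|M. (S' n om)\<^sup>2) = \<sigma>\<^sup>2 * (\<Sum>i<2^n. h n * g R (?g n i))" for n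
    proof -
      have p: "0 < (2::nat) ^ n" by simp
      have m1: "has_bochner_integral gauss1 (\<lambda>z. sqrt ((r - t) / real (2 ^ n)) * z) 0"
        using has_bochner_integral_mult_right[OF gauss1_moments(1), of "sqrt ((r - t) / real (2 ^ n))"] by simp
      have m2: "has_bochner_integral gauss1 (\<lambda>z. (sqrt ((r - t) / real (2 ^ n)) * z)\<^sup>2) (h n)"
        using has_bochner_integral_mult_right[OF gauss1_moments(2), of "h n"] h0[of n]
        by (simp add: power_mult_distrib h_def)
      have X: "(\<lambda>om. \<sigma> * Z R (?g n i) om) \<in> borel_measurable (F (?g n i))" if "i < 2 ^ n" for i
        using ZF[OF gT[of i n], of R] that by simp
      have X2: "integrable M (\<lambda>om. (\<sigma> * Z R (?g n i) om)\<^sup>2)" if "i < 2 ^ n" for i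
        using Z2i[OF gT[of i n], of R] that by (simp add: power_mult_distrib)
      have "integrable M (\<lambda>om. (S' n om)\<^sup>2) \<and> (LINT om|M. (S' n om)\<^sup>2) = h n * (\<Sum>i<2^n. LINT om|M. (\<sigma> * Z R (?g n i) om)\<^sup>2)"
        unfolding S'_def
        using transform_L2[OF W tr p, of "\<lambda>i om. \<sigma> * Z R (?g n i) om" "\<lambda>x. x" "h n" "2 ^ n", OF X X2 _ m1 m2] by simp
      then show ?thesis by (simp add: power_mult_distrib g_def sum_distrib_left mult_ac)
    qed
    have Slim: "(\<lambda>n. \<Sum>i<2^n. h n * g R (?g n i)) \<longlonglongrightarrow> ?I"
    proof -
      have "(\<lambda>n. LINT om|M. (\<Sum>i<2^n. h n * (Z R (?g n i) om)\<^sup>2)) \<longlonglongrightarrow> (LINT om|M. LINT u|lborel. f R r u om)"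
      proof (rule integral_dominated_convergence[where w="\<lambda>_. (r - t) * R\<^sup>2"])
        show "AE om in M. (\<lambda>n. \<Sum>i<2^n. h n * (Z R (?g n i) om)\<^sup>2) \<longlonglongrightarrow> (LBINT u. f R r u om)"
        proof (rule AE_I2)
          fix om assume w: "om \<in> space M"
          have fm: "(\<lambda>u. f R r u om) \<in> borel_measurable borel"
            using measurable_compose[OF measurable_Pair2'[OF w] f_meas[OF r, of R]] by simp
          have "(\<lambda>n. \<Sum>i<n. (r - t) / real n * (Z R (gp t r n i) om)\<^sup>2) \<longlonglongrightarrow> (LBINT u:{t..r}. f R r u om)"
          proof (rule riemann_limit_step(1)[OF r(1) fm])
            show "\<bar>(Z R (gp t r n i) om)\<^sup>2\<bar> \<le> R\<^sup>2" if "n > 0" "i < n" for n i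
              using Zbd[of "gp t r n i" R om] gp_in[of t r i n] that r by auto
            show "AE u in lborel. u \<in> {t..<r} \<longrightarrow> (\<lambda>n. (Z R (gp t r n (ix t r n u)) om)\<^sup>2) \<longlonglongrightarrow> f R r u om"
              using Zlim[OF w r] by (auto simp: f_def)
          qed
          moreover have "(LBINT u:{t..r}. f R r u om) = (LBINT u. f R r u om)"
            unfolding set_lebesgue_integral_def by (rule Bochner_Integration.integral_cong) (auto simp: f_def indicator_def)
          ultimately show "(\<lambda>n. \<Sum>i<2^n. h n * (Z R (?g n i) om)\<^sup>2) \<longlonglongrightarrow> (LBINT u. f R r u om)"
            unfolding h_def using seq_pow2 by fastforce
        qed
        show "AE om in M. norm (\<Sum>i<2^n. h n * (Z R (?g n i) om)\<^sup>2) \<le> (r - t) * R\<^sup>2" for n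
        proof (rule AE_I2)
          fix om
          have "(\<Sum>i<2^n. h n * (Z R (?g n i) om)\<^sup>2) \<le> (\<Sum>i<(2::nat)^n. h n * R\<^sup>2)"
            by (rule sum_mono) (use Zbd gin h0 in \<open>auto intro!: mult_left_mono simp: less_imp_le\<close>)
          also have "\<dots> = (r - t) * R\<^sup>2" by (simp add: h_def)
          finally show "norm (\<Sum>i<2^n. h n * (Z R (?g n i) om)\<^sup>2) \<le> (r - t) * R\<^sup>2"
            using h0[of n] by (simp add: sum_nonneg less_imp_le)
        qed
        show "(\<lambda>om. LBINT u. f R r u om) \<in> borel_measurable M" using fubini(3)[OF r] by simp
        show "(\<lambda>om. \<Sum>i<2^n. h n * (Z R (?g n i) om)\<^sup>2) \<in> borel_measurable M" for n
          by (intro borel_measurable_sum borel_measurable_times borel_measurable_const Z2M gT) auto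
      qed simp
      moreover have "(LINT om|M. (\<Sum>i<2^n. h n * (Z R (?g n i) om)\<^sup>2)) = (\<Sum>i<2^n. h n * g R (?g n i))" for n
        unfolding g_def by (subst Bochner_Integration.integral_sum) (use Z2i gT in auto)
      ultimately show ?thesis using fubini(1)[OF r, of R] g_eq[OF r, of R] by simp
    qed
    have I0: "0 \<le> ?I" unfolding set_lebesgue_integral_def by (intro integral_nonneg_AE AE_I2) (use g_bd r in \<open>auto simp: indicator_def\<close>)
    \<comment> \<open>\<open>J\<close> is only a limit in probability, so its second moment is
      bounded by Fatou along an almost surely convergent subsequence.\<close>
    obtain k where k: "strict_mono k" "AE om in M. (\<lambda>n. S (k n) om) \<longlonglongrightarrow> J om" using cip_AE_subseq[OF J(1)] by blast
    have "(\<integral>\<^sup>+om. ennreal (indicator (A R r) om * (J om)\<^sup>2) \<partial>M) = (\<integral>\<^sup>+om. liminf (\<lambda>n. ennreal (indicator (A R r) om * (S (k n) om)\<^sup>2)) \<partial>M)"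
    proof (rule nn_integral_cong_AE)
      show "AE om in M. ennreal (indicator (A R r) om * (J om)\<^sup>2) = liminf (\<lambda>n. ennreal (indicator (A R r) om * (S (k n) om)\<^sup>2))"
        using k(2)
      proof eventually_elim
        case (elim om)
        have "(\<lambda>n. ennreal (indicator (A R r) om * (S (k n) om)\<^sup>2)) \<longlonglongrightarrow> ennreal (indicator (A R r) om * (J om)\<^sup>2)"
          by (intro tendsto_intros elim)
        then show ?case by (rule lim_imp_Liminf[OF trivial_limit_sequentially, symmetric])
      qed
    qed
    also have "\<dots> \<le> liminf (\<lambda>n. \<integral>\<^sup>+om. ennreal (indicator (A R r) om * (S (k n) om)\<^sup>2) \<partial>M)"
      by (rule nn_integral_liminf) measurable
    also have "\<dots> \<le> liminf (\<lambda>n. ennreal (\<sigma>\<^sup>2 * (\<Sum>i<2^(k n). h (k n) * g R (?g (k n) i))))"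
    proof (rule Liminf_mono, rule always_eventually, rule allI)
      fix n
      have "(\<integral>\<^sup>+om. ennreal (indicator (A R r) om * (S (k n) om)\<^sup>2) \<partial>M) \<le> (\<integral>\<^sup>+om. ennreal ((S' (k n) om)\<^sup>2) \<partial>M)"
        by (intro nn_integral_mono ennreal_leI) (auto simp: SS' indicator_def)
      also have "\<dots> = ennreal (LINT om|M. (S' (k n) om)\<^sup>2)" by (rule nn_integral_eq_integral) (use S'2 in auto)
      finally show "(\<integral>\<^sup>+om. ennreal (indicator (A R r) om * (S (k n) om)\<^sup>2) \<partial>M) \<le> ennreal (\<sigma>\<^sup>2 * (\<Sum>i<2^(k n). h (k n) * g R (?g (k n) i)))"
        using S'2 by simp
    qed
    also have "\<dots> = ennreal (\<sigma>\<^sup>2 * ?I)"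
    proof (rule lim_imp_Liminf[OF trivial_limit_sequentially])
      have "(\<lambda>n. \<Sum>i<2^(k n). h (k n) * g R (?g (k n) i)) \<longlonglongrightarrow> ?I"
        using LIMSEQ_subseq_LIMSEQ[OF Slim k(1)] by (simp add: comp_def)
      then show "(\<lambda>n. ennreal (\<sigma>\<^sup>2 * (\<Sum>i<2^(k n). h (k n) * g R (?g (k n) i)))) \<longlonglongrightarrow> ennreal (\<sigma>\<^sup>2 * ?I)"
        by (intro tendsto_intros)
    qed
    finally have nnJ: "(\<integral>\<^sup>+om. ennreal (indicator (A R r) om * (J om)\<^sup>2) \<partial>M) \<le> ennreal (\<sigma>\<^sup>2 * ?I)" .
    have Ji: "integrable M (\<lambda>om. indicator (A R r) om * (J om)\<^sup>2)"
      by (rule integrableI_bounded) (use nnJ in \<open>auto simp: abs_mult intro: le_less_trans\<close>)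
    have JI: "(LINT om|M. indicator (A R r) om * (J om)\<^sup>2) \<le> \<sigma>\<^sup>2 * ?I"
    proof -
      have "ennreal (LINT om|M. indicator (A R r) om * (J om)\<^sup>2) \<le> ennreal (\<sigma>\<^sup>2 * ?I)"
        using nnJ nn_integral_eq_integral[OF Ji] by simp
      then show ?thesis using I0 by (simp add: ennreal_le_iff)
    qed
    have fint: "integrable M (\<lambda>om. LBINT u. f R r u om)" by (rule fubini(3)[OF r])
    have "g R r \<le> (LINT om|M. 2 * \<mu>\<^sup>2 * T * (LBINT u. f R r u om) + 2 * (indicator (A R r) om * (J om)\<^sup>2))"
      unfolding g_def
    proof (rule integral_mono_AE)
      show "integrable M (\<lambda>om. (Z R r om)\<^sup>2)" using Z2i r by auto
      show "integrable M (\<lambda>om. 2 * \<mu>\<^sup>2 * T * (LBINT u. f R r u om) + 2 * (indicator (A R r) om * (J om)\<^sup>2))"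
        by (intro Bochner_Integration.integrable_add integrable_mult_right fint Ji)
      show "AE om in M. (Z R r om)\<^sup>2 \<le> 2 * \<mu>\<^sup>2 * T * (LBINT u. f R r u om) + 2 * (indicator (A R r) om * (J om)\<^sup>2)"
        using J(2) AE_space
      proof eventually_elim
        case (elim om)
        have f0: "0 \<le> (LBINT u. f R r u om)" by (intro integral_nonneg_AE AE_I2) (auto simp: f_def)
        show ?case
        proof (cases "om \<in> A R r")
          case True
          have yi: "set_integrable lborel {t..r} (\<lambda>u. Y u om)" "set_integrable lborel {t..r} (\<lambda>u. (Y u om)\<^sup>2)"
            by (intro borel_integrable_atLeastAtMost' continuous_intros Yc'[OF elim(2) r(2)])+
          have "(LBINT u:{t..r}. (Y u om)\<^sup>2) = (LBINT u. f R r u om)"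
          proof -
            have fm: "(\<lambda>u. f R r u om) \<in> borel_measurable borel"
              using measurable_compose[OF measurable_Pair2'[OF elim(2)] f_meas[OF r, of R]] by simp
            have "AE u in lborel. indicator {t..r} u *\<^sub>R (Y u om)\<^sup>2 = f R r u om"
              using AE_lborel_singleton[of r]
            proof eventually_elim
              case (elim u)
              show ?case using elim chi_mono[OF True, of u] by (auto simp: f_def Z_def indicator_def)
            qed
            then show ?thesis unfolding set_lebesgue_integral_def
              by (intro integral_cong_AE) (use yi(2) fm in \<open>auto simp: set_integrable_def\<close>)
          qed
          then have "(LBINT u:{t..r}. Y u om)\<^sup>2 \<le> (r - t) * (LBINT u. f R r u om)"
            using LINT_square_le[OF r(1) yi] by simp
          also have "\<dots> \<le> T * (LBINT u. f R r u om)" using f0 t r by (intro mult_right_mono) auto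
          finally have i2: "\<mu>\<^sup>2 * (LBINT u:{t..r}. Y u om)\<^sup>2 \<le> \<mu>\<^sup>2 * (T * (LBINT u. f R r u om))"
            by (rule mult_left_mono) simp
          have "(Z R r om)\<^sup>2 = (\<mu> * (LBINT u:{t..r}. Y u om) + J om)\<^sup>2" using True elim(1) by (simp add: Z_def)
          also have "\<dots> \<le> 2 * (\<mu> * (LBINT u:{t..r}. Y u om))\<^sup>2 + 2 * (J om)\<^sup>2"
            using sum_squares_bound[of "\<mu> * (LBINT u:{t..r}. Y u om)" "J om"] by (simp add: power2_sum)
          also have "\<dots> \<le> 2 * (\<mu>\<^sup>2 * (T * (LBINT u. f R r u om))) + 2 * (J om)\<^sup>2"
            using i2 by (simp add: power_mult_distrib)
          finally show ?thesis using True by (simp add: mult_ac)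
        next
          case False
          then show ?thesis using f0 T_pos by (simp add: Z_def)
        qed
      qed
    qed
    also have "\<dots> = 2 * \<mu>\<^sup>2 * T * ?I + 2 * (LINT om|M. indicator (A R r) om * (J om)\<^sup>2)"
      using fint Ji fubini(1)[OF r, of R] g_eq[OF r, of R] by simp
    also have "\<dots> \<le> C * ?I" using JI I0 by (simp add: C_def algebra_simps)
    finally show ?thesis by simp
  qed
  have g0: "g R r = 0" if "r \<in> {t..T}" for R r
    using gronwall_bounded[OF C0 order_refl that, where \<phi>="g R" and K="R\<^sup>2"] g_bd g_int[OF t(2) order_refl] key that
    by (force intro: antisym)
  have "AE om in M. Y r om = 0" if r: "r \<in> {t..T}" for r
  proof -
    have "AE om in M. \<forall>R::nat. (Z (real R) r om)\<^sup>2 = 0"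
      unfolding AE_all_countable
    proof
      fix R :: nat
      show "AE om in M. (Z (real R) r om)\<^sup>2 = 0"
        using g0[OF r, of "real R"] integral_nonneg_eq_0_iff_AE[OF Z2i[OF r, of "real R"]] by (simp add: g_def)
    qed
    then show ?thesis using AE_space
    proof eventually_elim
      case (elim om)
      have "r \<le> T" using r by simp
      then obtain B where B: "\<And>u. u \<in> {t..r} \<Longrightarrow> \<bar>Y u om\<bar> \<le> B" using path_bounded[OF Yc'[OF elim(2)]] by blast
      \<comment> \<open>A continuous path is bounded, so some integer level never cuts it
        off.\<close>
      obtain R :: nat where "B \<le> real R" using real_arch_simple by blast
      then have "om \<in> A (real R) r" using B elim(2) by (force simp: A_def)
      then show ?case using spec[OF elim(1), of R] by (simp add: Z_def)
    qed
  qed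
  then show ?thesis
    by (rule AE_all_times) (use Yc in auto)
qed

lemma gbm_unique:
  assumes W: "is_W W" and t: "0 \<le> t" "t < T"
    and A: "\<And>u. u \<in> {t..T} \<Longrightarrow> A u \<in> borel_measurable (F u)"
    and Ac: "\<And>om. om \<in> space M \<Longrightarrow> continuous_on {t..T} (\<lambda>u. A u om)"
    and A0: "\<And>om. om \<in> space M \<Longrightarrow> A t om = a"
    and eq: "\<And>r. t < r \<Longrightarrow> r \<le> T \<Longrightarrow> \<exists>I. cip (\<lambda>n om. \<Sum>i<2^n. (W (gp t r (2^n) (Suc i)) om - W (gp t r (2^n) i) om) * (\<sigma> * A (gp t r (2^n) i) om)) I
        \<and> (AE om in M. A r om = a + \<mu> * (LBINT u:{t..r}. A u om) + I om)"
  shows "AE om in M. \<forall>r\<in>{t..T}. A r om = gbm W \<mu> \<sigma> a t r om"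
proof -
  define G where "G = gbm W \<mu> \<sigma> a t"
  have Gc: "continuous_on {t..T} (\<lambda>u. G u om)" if "om \<in> space M" for om
    unfolding G_def by (rule gbm_cont[OF W t(1) that])
  have "AE om in M. \<forall>r\<in>{t..T}. A r om - G r om = 0"
  proof (rule linear_sde_zero[OF W t, where \<mu>=\<mu> and \<sigma>=\<sigma>])
    show "(\<lambda>om. A u om - G u om) \<in> borel_measurable (F u)" if "u \<in> {t..T}" for u
      using A[OF that] gbm_F[OF W t(1), of u] that unfolding G_def by (intro borel_measurable_diff) auto
    show "continuous_on {t..T} (\<lambda>u. A u om - G u om)" if "om \<in> space M" for om
      by (intro continuous_on_diff Ac Gc that)
    show "A t om - G t om = 0" if "om \<in> space M" for om using A0[OF that] by (simp add: G_def gbm_def)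
    fix r assume r: "t < r" "r \<le> T"
    obtain I where I: "cip (\<lambda>n om. \<Sum>i<2^n. (W (gp t r (2^n) (Suc i)) om - W (gp t r (2^n) i) om) * (\<sigma> * A (gp t r (2^n) i) om)) I"
      "AE om in M. A r om = a + \<mu> * (LBINT u:{t..r}. A u om) + I om" using eq[OF r] by blast
    let ?J = "\<lambda>om. I om - (G r om - a - \<mu> * (LBINT u:{t..r}. G u om))"
    show "\<exists>J. cip (\<lambda>n om. \<Sum>i<2^n. (W (gp t r (2^n) (Suc i)) om - W (gp t r (2^n) i) om) * (\<sigma> * (A (gp t r (2^n) i) om - G (gp t r (2^n) i) om))) J
        \<and> (AE om in M. A r om - G r om = \<mu> * (LBINT u:{t..r}. A u om - G u om) + J om)"
    proof (intro exI[of _ ?J] conjI)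
      show "cip (\<lambda>n om. \<Sum>i<2^n. (W (gp t r (2^n) (Suc i)) om - W (gp t r (2^n) i) om) * (\<sigma> * (A (gp t r (2^n) i) om - G (gp t r (2^n) i) om))) ?J"
        using cip_diff[OF I(1) gbm_ito[OF W t(1) r, of \<sigma> \<mu> a]] unfolding G_def
        by (simp only: right_diff_distrib sum_subtractf)
      show "AE om in M. A r om - G r om = \<mu> * (LBINT u:{t..r}. A u om - G u om) + ?J om"
        using I(2) AE_space
      proof eventually_elim
        case (elim om)
        have sub: "{t..r} \<subseteq> {t..T}" using r by auto
        have L: "(LBINT u:{t..r}. A u om - G u om) = (LBINT u:{t..r}. A u om) - (LBINT u:{t..r}. G u om)"
          by (intro set_integral_diff(2) borel_integrable_atLeastAtMost' continuous_on_subset[OF Ac sub] continuous_on_subset[OF Gc sub] elim(2))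
        show ?case unfolding L right_diff_distrib using elim(1) by linarith
      qed
    qed
  qed
  then show ?thesis unfolding G_def by simp
qed

end

section \<open>Dynkin's formula for stopped test functions\<close>

text \<open>One stage with a fixed test function. The log-price is explicit, while \<epsilon> and
  the inventory are abstract processes whose finite variation parts have rates \<open>b\<close> and
  \<open>- c\<close>. An adapted decreasing 0-1 weight \<open>lam\<close> stands for the stopping
  time, and \<open>dom\<close> supplies the majorant of the drift sums.\<close>

locale dynkin_setup = bm2 M W1 W2 T + test_fun t r qb K f ft fy fe fq fyy fye fee
  for M :: "'w measure" and W1 W2 T t r qb K f ft fy fe fq fyy fye fee +
  fixes y0 m s1 s2 \<rho> :: real and E Q lam b c :: "real \<Rightarrow> 'w \<Rightarrow> real"
  assumes t0: "0 \<le> t" and rT: "r \<le> T" and \<rho>: "\<rho>\<^sup>2 \<le> 1"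
    and E: "\<And>u. u \<in> {t..r} \<Longrightarrow> E u \<in> borel_measurable (nat_filt M W1 W2 u)"
    and Ec: "\<And>om. om \<in> space M \<Longrightarrow> continuous_on {t..r} (\<lambda>u. E u om)"
    and Q: "\<And>u. u \<in> {t..r} \<Longrightarrow> Q u \<in> borel_measurable (nat_filt M W1 W2 u)"
    and Qc: "\<And>om. om \<in> space M \<Longrightarrow> continuous_on {t..r} (\<lambda>u. Q u om)"
    and Qb: "\<And>u om. u \<in> {t..r} \<Longrightarrow> Q u om \<in> {0..qb}"
    and lam: "\<And>u. u \<in> {t..r} \<Longrightarrow> lam u \<in> borel_measurable (nat_filt M W1 W2 u)"
    and lam01: "\<And>u om. u \<in> {t..r} \<Longrightarrow> lam u om \<in> {0, 1}"
    and lam_anti: "\<And>u v om. om \<in> space M \<Longrightarrow> t \<le> u \<Longrightarrow> u \<le> v \<Longrightarrow> v \<le> r \<Longrightarrow> lam v om \<le> lam u om"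
    and lam_joint: "jointly M (\<lambda>u om. indicator {t..<r} u * lam u om)"
    and b_joint: "jointly M b"
    and c_joint: "jointly M c"
    and bi: "AE om in M. set_integrable lborel {t..r} (\<lambda>u. b u om)"
    and ci: "AE om in M. set_integrable lborel {t..r} (\<lambda>u. c u om)"
    and dom: "integrable M (\<lambda>om. LBINT u:{t..r}. K * (1 + \<bar>m\<bar> + \<bar>b u om\<bar> + \<bar>c u om\<bar>))"
    and Eb: "AE om in M. \<forall>u v. t \<le> u \<longrightarrow> u \<le> v \<longrightarrow> v \<le> r \<longrightarrow> E v om - E u om = (LBINT x:{u..v}. b x om)
        + s2 * (\<rho> * (W1 v om - W1 u om) + sqrt (1 - \<rho>\<^sup>2) * (W2 v om - W2 u om))"
    and Qc': "AE om in M. \<forall>u v. t \<le> u \<longrightarrow> u \<le> v \<longrightarrow> v \<le> r \<longrightarrow> Q v om - Q u om = - (LBINT x:{u..v}. c x om)"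
begin

definition Y :: "real \<Rightarrow> 'w \<Rightarrow> real" where "Y u om = y0 + m * (u - t) + s1 * (W1 u om - W1 t om)"

text \<open>\<epsilon> without its noise; almost surely its increments are integrals of
  \<open>b\<close>. Subtracting them from an increment of \<epsilon> leaves a Gaussian move that is
  independent of the past.\<close>

definition U :: "real \<Rightarrow> 'w \<Rightarrow> real" where
  "U u om = E u om - s2 * (\<rho> * (W1 u om - W1 t om) + sqrt (1 - \<rho>\<^sup>2) * (W2 u om - W2 t om))"

definition HH :: "real \<Rightarrow> 'w \<Rightarrow> real" where "HH u om = f u (Y u om) (E u om) (Q u om)"

definition gen_drift :: "real \<Rightarrow> 'w \<Rightarrow> real" where
  "gen_drift u om = ft u (Y u om) (E u om) (Q u om) + m * fy u (Y u om) (E u om) (Q u om)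
                + b u om * fe u (Y u om) (E u om) (Q u om) - c u om * fq u (Y u om) (E u om) (Q u om)"

definition gen_noise :: "real \<Rightarrow> 'w \<Rightarrow> real" where
  "gen_noise u om = (s1\<^sup>2 * fyy u (Y u om) (E u om) (Q u om) + s1 * (s2 * \<rho>) * fye u (Y u om) (E u om) (Q u om)
                + s2\<^sup>2 * fee u (Y u om) (E u om) (Q u om)) / 2"

lemma Wc: "is_W W \<Longrightarrow> om \<in> space M \<Longrightarrow> continuous_on {t..r} (\<lambda>u. W u om)"
  by (rule continuous_on_subset[OF W_cont]) (use t0 rT in auto)

lemma Yc: "om \<in> space M \<Longrightarrow> continuous_on {t..r} (\<lambda>u. Y u om)"
  unfolding Y_def by (intro continuous_intros Wc[OF is_W(1)])

lemma Uc: "om \<in> space M \<Longrightarrow> continuous_on {t..r} (\<lambda>u. U u om)"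
  unfolding U_def by (intro continuous_intros Ec Wc[OF is_W(1)] Wc[OF is_W(2)])

lemma HHc: "om \<in> space M \<Longrightarrow> continuous_on {t..r} (\<lambda>u. HH u om)"
  unfolding HH_def
  using test_continuous[where g=f and S="{t..r}" and u="\<lambda>u. u" and y="\<lambda>u. Y u om" and e="\<lambda>u. E u om" and q="\<lambda>u. Q u om"]
    continuous_on_id[of "{t..r}"] Yc[of om] Ec[of om] Qc[of om] by simp

lemma YF: "u \<in> {t..r} \<Longrightarrow> Y u \<in> borel_measurable (F u)"
proof -
  assume u: "u \<in> {t..r}"
  have [measurable]: "W1 u \<in> borel_measurable (F u)" "W1 t \<in> borel_measurable (F u)" using W_F[of W1] u t0 by auto
  show ?thesis unfolding Y_def by measurable
qed

lemma to_M: "u \<in> {t..r} \<Longrightarrow> X \<in> borel_measurable (F u) \<Longrightarrow> X \<in> borel_measurable M"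
  by (rule F_measurable_M[of u X borel]) (use rT in auto)

lemma gin: "i \<le> n \<Longrightarrow> gp t r n i \<in> {t..r}" using gp_in tr by auto

lemma joint:
  shows "jointly M (\<lambda>u om. indicator {t..<r} u * (lam u om * gen_drift u om))"
    and "jointly M (\<lambda>u om. indicator {t..<r} u * (lam u om * gen_noise u om))"
proof -
  let ?N = "borel \<Otimes>\<^sub>M M :: (real \<times> 'w) measure"
  let ?J = "\<lambda>X x. indicator {t..<r} (fst x) * X (fst x) (snd x) :: real"
  have J: "?J X \<in> borel_measurable ?N" if "\<And>u. u \<in> {t..r} \<Longrightarrow> X u \<in> borel_measurable (F u)"
    "\<And>om. om \<in> space M \<Longrightarrow> continuous_on {t..r} (\<lambda>u. X u om)" for X
  proof -
    have "(\<lambda>(u, om). indicator {t..<r} u * X u om :: real) \<in> borel_measurable ?N"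
      by (rule joint_measurable_continuous[OF tr to_M[OF _ that(1)] that(2)])
    then show ?thesis by (simp add: split_def)
  qed
  have [measurable]: "?J Y \<in> borel_measurable ?N" "?J E \<in> borel_measurable ?N" "?J Q \<in> borel_measurable ?N"
    using J[OF YF Yc] J[OF E Ec] J[OF Q Qc] by auto
  have [measurable]: "?J lam \<in> borel_measurable ?N" "(\<lambda>x. b (fst x) (snd x)) \<in> borel_measurable ?N"
    "(\<lambda>x. c (fst x) (snd x)) \<in> borel_measurable ?N"
    using lam_joint b_joint c_joint by (simp_all add: split_def)
  have [measurable]: "(\<lambda>x. g (fst x) (?J Y x) (?J E x) (?J Q x)) \<in> borel_measurable ?N"
    if "g \<in> {f, ft, fy, fe, fq, fyy, fye, fee}" for g
    by (rule test_measurable[OF that]) measurable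
  note gm = this[of ft] this[of fy] this[of fe] this[of fq] this[of fyy] this[of fye] this[of fee]
  have [measurable]: "(\<lambda>x. ft (fst x) (?J Y x) (?J E x) (?J Q x)) \<in> borel_measurable ?N"
    "(\<lambda>x. fy (fst x) (?J Y x) (?J E x) (?J Q x)) \<in> borel_measurable ?N"
    "(\<lambda>x. fe (fst x) (?J Y x) (?J E x) (?J Q x)) \<in> borel_measurable ?N"
    "(\<lambda>x. fq (fst x) (?J Y x) (?J E x) (?J Q x)) \<in> borel_measurable ?N"
    "(\<lambda>x. fyy (fst x) (?J Y x) (?J E x) (?J Q x)) \<in> borel_measurable ?N"
    "(\<lambda>x. fye (fst x) (?J Y x) (?J E x) (?J Q x)) \<in> borel_measurable ?N"
    "(\<lambda>x. fee (fst x) (?J Y x) (?J E x) (?J Q x)) \<in> borel_measurable ?N"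
    using gm by simp_all
  have "(\<lambda>x. ?J lam x * (ft (fst x) (?J Y x) (?J E x) (?J Q x) + m * fy (fst x) (?J Y x) (?J E x) (?J Q x)
       + b (fst x) (snd x) * fe (fst x) (?J Y x) (?J E x) (?J Q x) - c (fst x) (snd x) * fq (fst x) (?J Y x) (?J E x) (?J Q x))) \<in> borel_measurable ?N"
    by measurable
  also have "(\<lambda>x. ?J lam x * (ft (fst x) (?J Y x) (?J E x) (?J Q x) + m * fy (fst x) (?J Y x) (?J E x) (?J Q x)
       + b (fst x) (snd x) * fe (fst x) (?J Y x) (?J E x) (?J Q x) - c (fst x) (snd x) * fq (fst x) (?J Y x) (?J E x) (?J Q x)))
    = (\<lambda>(u, om). indicator {t..<r} u * (lam u om * gen_drift u om))"
    by (auto simp: fun_eq_iff gen_drift_def indicator_def)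
  finally show "(\<lambda>(u, om). indicator {t..<r} u * (lam u om * gen_drift u om)) \<in> borel_measurable ?N" .
  have "(\<lambda>x. ?J lam x * ((s1\<^sup>2 * fyy (fst x) (?J Y x) (?J E x) (?J Q x) + s1 * (s2 * \<rho>) * fye (fst x) (?J Y x) (?J E x) (?J Q x)
       + s2\<^sup>2 * fee (fst x) (?J Y x) (?J E x) (?J Q x)) / 2)) \<in> borel_measurable ?N"
    by measurable
  also have "(\<lambda>x. ?J lam x * ((s1\<^sup>2 * fyy (fst x) (?J Y x) (?J E x) (?J Q x) + s1 * (s2 * \<rho>) * fye (fst x) (?J Y x) (?J E x) (?J Q x)
       + s2\<^sup>2 * fee (fst x) (?J Y x) (?J E x) (?J Q x)) / 2))
    = (\<lambda>(u, om). indicator {t..<r} u * (lam u om * gen_noise u om))"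
    by (auto simp: fun_eq_iff gen_noise_def indicator_def)
  finally show "(\<lambda>(u, om). indicator {t..<r} u * (lam u om * gen_noise u om)) \<in> borel_measurable ?N" .
qed

lemma weight: "om \<in> space M \<Longrightarrow> \<exists>\<tau>. stop_weight t r (\<lambda>u. lam u om) \<tau>"
  by (rule antimono_stop_weight) (use tr lam01 lam_anti in auto)

abbreviation \<alpha> :: "real \<times> real \<Rightarrow> real" where "\<alpha> z \<equiv> s1 * fst z + 0 * snd z"
abbreviation \<beta> :: "real \<times> real \<Rightarrow> real" where "\<beta> z \<equiv> (s2 * \<rho>) * fst z + (s2 * sqrt (1 - \<rho>\<^sup>2)) * snd z"

text \<open>\<open>XX\<close> is the stopped total change, \<open>AA\<close> its part from the point
  reached by the noise move to the end of each cell, and \<open>BB\<close> the averaged noise part.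
  The pathwise noise part \<open>XX - AA\<close> agrees with \<open>BB\<close> in expectation
  only.\<close>

definition XX :: "nat \<Rightarrow> 'w \<Rightarrow> real" where
  "XX n om = (\<Sum>i<n. lam (gp t r n i) om * (HH (gp t r n (Suc i)) om - HH (gp t r n i) om))"

definition AA :: "nat \<Rightarrow> 'w \<Rightarrow> real" where
  "AA n om = (\<Sum>i<n. lam (gp t r n i) om *
       (f (gp t r n (Suc i)) (Y (gp t r n (Suc i)) om) (E (gp t r n (Suc i)) om) (Q (gp t r n (Suc i)) om)
        - f (gp t r n i) (Y (gp t r n (Suc i)) om - m * ((r - t) / real n))
            (E (gp t r n (Suc i)) om - (U (gp t r n (Suc i)) om - U (gp t r n i) om)) (Q (gp t r n i) om)))"

definition BB :: "nat \<Rightarrow> 'w \<Rightarrow> real" where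
  "BB n om = (\<Sum>i<n. (r - t) / real n * (lam (gp t r n i) om *
      noise_gen f \<alpha> \<beta> ((r - t) / real n) (gp t r n i) (Y (gp t r n i) om) (E (gp t r n i) om) (Q (gp t r n i) om)))"

lemma tested_M:
  assumes "g \<in> {f, ft, fy, fe, fq, fyy, fye, fee}" and [measurable]: "y \<in> borel_measurable M" "e \<in> borel_measurable M" "q \<in> borel_measurable M"
  shows "(\<lambda>om. g u (y om) (e om) (q om)) \<in> borel_measurable M"
  by (rule test_measurable[OF assms(1)]) measurable

lemma path_M:
  assumes "u \<in> {t..r}"
  shows "Y u \<in> borel_measurable M" "E u \<in> borel_measurable M" "Q u \<in> borel_measurable M" "lam u \<in> borel_measurable M"
    "U u \<in> borel_measurable M" "HH u \<in> borel_measurable M"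
proof -
  show m: "Y u \<in> borel_measurable M" "E u \<in> borel_measurable M" "Q u \<in> borel_measurable M" "lam u \<in> borel_measurable M"
    by (rule to_M[OF assms YF[OF assms]] to_M[OF assms E[OF assms]] to_M[OF assms Q[OF assms]] to_M[OF assms lam[OF assms]])+
  have "W u \<in> borel_measurable M" "W t \<in> borel_measurable M" if "is_W W" for W
    using W_meas[OF that] assms t0 rT tr by auto
  note this[OF is_W(1), measurable] this[OF is_W(2), measurable]
  show "U u \<in> borel_measurable M" unfolding U_def using m(2) by measurable
  show "HH u \<in> borel_measurable M" unfolding HH_def by (rule tested_M[where g=f]) (use m in auto)
qed

lemma XX_M: "XX n \<in> borel_measurable M"
  unfolding XX_def
  by (intro borel_measurable_sum borel_measurable_times borel_measurable_diff path_M gin) auto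

lemma AA_M: "AA n \<in> borel_measurable M"
  unfolding AA_def
proof (intro borel_measurable_sum borel_measurable_times borel_measurable_diff)
  fix i assume "i \<in> {..<n}"
  then have i: "gp t r n i \<in> {t..r}" "gp t r n (Suc i) \<in> {t..r}" using gin by auto
  note [measurable] = path_M[OF i(1)] path_M[OF i(2)]
  show "lam (gp t r n i) \<in> borel_measurable M" by measurable
  show "(\<lambda>om. f (gp t r n (Suc i)) (Y (gp t r n (Suc i)) om) (E (gp t r n (Suc i)) om) (Q (gp t r n (Suc i)) om)) \<in> borel_measurable M"
    by (rule tested_M[where g=f]) (simp, measurable)
  show "(\<lambda>om. f (gp t r n i) (Y (gp t r n (Suc i)) om - m * ((r - t) / real n))
            (E (gp t r n (Suc i)) om - (U (gp t r n (Suc i)) om - U (gp t r n i) om)) (Q (gp t r n i) om)) \<in> borel_measurable M"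
    by (rule tested_M[where g=f]) (simp, measurable)
qed

lemma noise_gen_M: "(\<lambda>om. noise_gen f \<alpha> \<beta> h u (y om) (e om) (q om)) \<in> borel_measurable M"
  if [measurable]: "y \<in> borel_measurable M" "e \<in> borel_measurable M" "q \<in> borel_measurable M"
proof -
  let ?N = "M \<Otimes>\<^sub>M (borel \<Otimes>\<^sub>M borel) :: ('w \<times> (real \<times> real)) measure"
  have 1: "(\<lambda>x. f u (y (fst x) + sqrt h * \<alpha> (snd x)) (e (fst x) + sqrt h * \<beta> (snd x)) (q (fst x))) \<in> borel_measurable ?N"
    by (rule test_measurable[of f]) (simp, measurable)
  have 2: "(\<lambda>x. f u (y (fst x)) (e (fst x)) (q (fst x))) \<in> borel_measurable ?N"
    by (rule test_measurable[of f]) (simp, measurable)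
  have "(\<lambda>x. f u (y (fst x) + sqrt h * \<alpha> (snd x)) (e (fst x) + sqrt h * \<beta> (snd x)) (q (fst x)) - f u (y (fst x)) (e (fst x)) (q (fst x)))
     \<in> borel_measurable ?N" by (rule borel_measurable_diff[OF 1 2])
  then have "(\<lambda>(om, z). f u (y om + sqrt h * \<alpha> z) (e om + sqrt h * \<beta> z) (q om) - f u (y om) (e om) (q om)) \<in> borel_measurable (M \<Otimes>\<^sub>M gauss2)"
    by (simp add: split_def)
  from gauss2.borel_measurable_lebesgue_integral[OF this] show ?thesis
    unfolding noise_gen_def by measurable
qed

lemma BB_M: "BB n \<in> borel_measurable M"
  unfolding BB_def
  by (intro borel_measurable_sum borel_measurable_times borel_measurable_const noise_gen_M path_M gin) auto

text \<open>The increments of the noise are independent of the past, so the change of \<open>f\<close> that is due to the noise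
  may be averaged over the Gaussian law step by step.\<close>

lemma expectation_noise: "(LINT om|M. XX n om - AA n om) = (LINT om|M. BB n om)"
proof (cases "n = 0")
  case True
  then show ?thesis by (simp add: XX_def AA_def BB_def)
next
  case False
  then have n: "n > 0" by simp
  let ?h = "(r - t) / real n"
  let ?G = "\<lambda>i om. lam (gp t r n i) om * noise_gen f \<alpha> \<beta> ?h (gp t r n i) (Y (gp t r n i) om) (E (gp t r n i) om) (Q (gp t r n i) om)"
  have h: "?h > 0" using tr n by simp
  \<comment> \<open>Clamps the weight so that \<psi> is bounded on the whole product space, as
    \<open>noise_expectation\<close> demands; it does nothing to the values 0 and 1.\<close>
  define cl where "cl l = max 0 (min 1 l)" for l :: real
  have cl: "cl l = l" if "l \<in> {0, 1}" for l using that by (auto simp: cl_def)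
  define \<psi> where "\<psi> u = (\<lambda>((l, y, e, q), z). cl l * (f u (y + sqrt ?h * \<alpha> z) (e + sqrt ?h * \<beta> z) q - f u y e q))" for u
  have \<psi>m: "\<psi> u \<in> borel_measurable ((borel \<Otimes>\<^sub>M borel \<Otimes>\<^sub>M borel \<Otimes>\<^sub>M borel) \<Otimes>\<^sub>M (borel \<Otimes>\<^sub>M borel))" for u
  proof -
    let ?N = "(borel \<Otimes>\<^sub>M borel \<Otimes>\<^sub>M borel \<Otimes>\<^sub>M borel) \<Otimes>\<^sub>M (borel \<Otimes>\<^sub>M borel) :: ((real \<times> real \<times> real \<times> real) \<times> (real \<times> real)) measure"
    have 1: "(\<lambda>x. f u (fst (snd (fst x)) + sqrt ?h * \<alpha> (snd x)) (fst (snd (snd (fst x))) + sqrt ?h * \<beta> (snd x)) (snd (snd (snd (fst x))))) \<in> borel_measurable ?N"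
      by (rule test_measurable[of f]) (simp, measurable)
    have 2: "(\<lambda>x. f u (fst (snd (fst x))) (fst (snd (snd (fst x)))) (snd (snd (snd (fst x))))) \<in> borel_measurable ?N"
      by (rule test_measurable[of f]) (simp, measurable)
    have 3: "(\<lambda>x. cl (fst (fst x))) \<in> borel_measurable ?N" unfolding cl_def by measurable
    show ?thesis unfolding \<psi>_def split_def using borel_measurable_times[OF 3 borel_measurable_diff[OF 1 2]] .
  qed
  have \<psi>b: "\<bar>\<psi> u (x, z)\<bar> \<le> 2 * K" for u x z
  proof -
    obtain l y e q where x: "x = (l, y, e, q)" by (cases x)
    let ?d = "f u (y + sqrt ?h * \<alpha> z) (e + sqrt ?h * \<beta> z) q - f u y e q"
    have "\<bar>?d\<bar> \<le> 2 * K" using test_bounds(1)[of u "y + sqrt ?h * \<alpha> z" "e + sqrt ?h * \<beta> z" q] test_bounds(1)[of u y e q] by linarith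
    moreover have "\<bar>cl l\<bar> \<le> 1" by (auto simp: cl_def)
    ultimately have "\<bar>cl l\<bar> * \<bar>?d\<bar> \<le> 1 * (2 * K)" by (intro mult_mono) auto
    then show ?thesis by (simp add: x \<psi>_def abs_mult)
  qed
  define V where "V i om = (lam (gp t r n i) om, Y (gp t r n i) om, E (gp t r n i) om, Q (gp t r n i) om)" for i om
  have VF: "V i \<in> F (gp t r n i) \<rightarrow>\<^sub>M (borel \<Otimes>\<^sub>M borel \<Otimes>\<^sub>M borel \<Otimes>\<^sub>M borel)" if "i \<le> n" for i
    unfolding V_def using lam[OF gin[OF that]] YF[OF gin[OF that]] E[OF gin[OF that]] Q[OF gin[OF that]] by measurable
  define \<zeta> where "\<zeta> i = noise (gp t r n i) (gp t r n (Suc i))" for i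
  have st: "0 \<le> gp t r n i" "gp t r n i < gp t r n (Suc i)" "gp t r n (Suc i) \<le> T" if "i < n" for i
    using gin[of i n] gin[of "Suc i" n] that t0 rT h by (auto simp: gp_Suc)
  have \<psi>V: "\<psi> (gp t r n i) (V i om, z) = lam (gp t r n i) om * (f (gp t r n i) (Y (gp t r n i) om + sqrt ?h * \<alpha> z) (E (gp t r n i) om + sqrt ?h * \<beta> z) (Q (gp t r n i) om)
        - f (gp t r n i) (Y (gp t r n i) om) (E (gp t r n i) om) (Q (gp t r n i) om))" if "i < n" for i om z
    using cl[OF lam01[OF gin[of i n]], of om] that by (simp add: \<psi>_def V_def)
  have diff: "XX n om - AA n om = (\<Sum>i<n. \<psi> (gp t r n i) (V i om, \<zeta> i om))" for om
    unfolding XX_def AA_def sum_subtractf[symmetric]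
  proof (rule sum.cong)
    fix i assume "i \<in> {..<n}"
    then have i: "i < n" by simp
    let ?s = "gp t r n i" and ?u = "gp t r n (Suc i)"
    have us: "?u - ?s = ?h" by (simp add: gp_Suc)
    have d1: "sqrt ?h * fst (\<zeta> i om) = W1 ?u om - W1 ?s om" "sqrt ?h * snd (\<zeta> i om) = W2 ?u om - W2 ?s om"
    proof -
      have "sqrt ?h \<noteq> 0" using h by (metis less_irrefl real_sqrt_eq_0_iff)
      moreover have c: "a * (x / a) = x" if "a \<noteq> 0" for a x :: real using that by simp
      ultimately show "sqrt ?h * fst (\<zeta> i om) = W1 ?u om - W1 ?s om" "sqrt ?h * snd (\<zeta> i om) = W2 ?u om - W2 ?s om"
        unfolding \<zeta>_def noise_def us fst_conv snd_conv by blast+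
    qed
    \<comment> \<open>Removing the drift of the cell from its right state leaves the left state plus
      the Gaussian move; \<open>e2\<close> is the same for \<epsilon>.\<close>
    have e1: "Y ?u om - m * ?h = Y ?s om + sqrt ?h * \<alpha> (\<zeta> i om)"
    proof -
      have "sqrt ?h * \<alpha> (\<zeta> i om) = s1 * (sqrt ?h * fst (\<zeta> i om))" by simp
      then have "sqrt ?h * \<alpha> (\<zeta> i om) = s1 * (W1 ?u om - W1 ?s om)" unfolding d1 .
      moreover have "m * (?u - t) - m * ?h = m * (?s - t)" unfolding us[symmetric] by (simp add: algebra_simps)
      ultimately show ?thesis unfolding Y_def right_diff_distrib by linarith
    qed
    have e2: "E ?u om - (U ?u om - U ?s om) = E ?s om + sqrt ?h * \<beta> (\<zeta> i om)"
    proof -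
      have "sqrt ?h * \<beta> (\<zeta> i om) = s2 * \<rho> * (sqrt ?h * fst (\<zeta> i om)) + s2 * sqrt (1 - \<rho>\<^sup>2) * (sqrt ?h * snd (\<zeta> i om))"
        by (simp add: distrib_left mult.left_commute)
      then show ?thesis unfolding d1 U_def by (simp add: algebra_simps)
    qed
    show "lam ?s om * (HH ?u om - HH ?s om) - lam ?s om * (f ?u (Y ?u om) (E ?u om) (Q ?u om)
        - f ?s (Y ?u om - m * ?h) (E ?u om - (U ?u om - U ?s om)) (Q ?s om)) = \<psi> ?s (V i om, \<zeta> i om)"
      unfolding \<psi>V[OF i] e1 e2 HH_def right_diff_distrib by linarith
  qed simp
  have step: "(LINT om|M. \<psi> (gp t r n i) (V i om, \<zeta> i om)) = (LINT om|M. ?h * ?G i om)" if i: "i < n" for i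
  proof -
    have "(LINT om|M. \<psi> (gp t r n i) (V i om, \<zeta> i om)) = (LINT om|M. LINT z|gauss2. \<psi> (gp t r n i) (V i om, z))"
      unfolding \<zeta>_def by (rule noise_expectation[OF st[OF i] VF \<psi>m \<psi>b]) (use i in simp)
    also have "\<dots> = (LINT om|M. ?h * ?G i om)"
    proof (rule Bochner_Integration.integral_cong[OF refl])
      fix om
      show "(LINT z|gauss2. \<psi> (gp t r n i) (V i om, z)) = ?h * ?G i om"
        unfolding \<psi>V[OF i] noise_gen_def integral_mult_right_zero using n tr by simp
    qed
    finally show ?thesis .
  qed
  have VM: "V i \<in> M \<rightarrow>\<^sub>M (borel \<Otimes>\<^sub>M borel \<Otimes>\<^sub>M borel \<Otimes>\<^sub>M borel)" if "i < n" for i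
    using F_measurable_M[OF _ VF[of i]] gin[of i n] rT that by auto
  have \<psi>i: "integrable M (\<lambda>om. \<psi> (gp t r n i) (V i om, \<zeta> i om))" if "i < n" for i
  proof (rule integrable_const_bound[where B="2 * K"])
    have "(\<lambda>om. (V i om, \<zeta> i om)) \<in> M \<rightarrow>\<^sub>M (borel \<Otimes>\<^sub>M borel \<Otimes>\<^sub>M borel \<Otimes>\<^sub>M borel) \<Otimes>\<^sub>M (borel \<Otimes>\<^sub>M borel)"
      unfolding \<zeta>_def by (rule measurable_Pair[OF VM[OF that] noise_measurable[OF st[OF that]]])
    from measurable_compose[OF this \<psi>m[of "gp t r n i"]]
    show "(\<lambda>om. \<psi> (gp t r n i) (V i om, \<zeta> i om)) \<in> borel_measurable M" .
  qed (use \<psi>b in auto)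
  have Bi: "integrable M (\<lambda>om. ?h * ?G i om)" if i: "i < n" for i
  proof (intro integrable_mult_right, rule integrable_const_bound)
    have i': "gp t r n i \<in> {t..r}" using gin[of i n] i by simp
    show "(\<lambda>om. ?G i om) \<in> borel_measurable M"
      by (intro borel_measurable_times noise_gen_M path_M i')
    show "AE om in M. norm (?G i om)
      \<le> (LINT z|gauss2. noise_bd s1 0 (s2 * \<rho>) (s2 * sqrt (1 - \<rho>\<^sup>2)) z)"
    proof (rule AE_I2)
      fix om
      have "\<bar>lam (gp t r n i) om\<bar> \<le> 1" using lam01[OF i', of om] by auto
      from mult_mono[OF this noise_gen_bound[OF i' Qb[OF i'] h, of s1 0 "s2 * \<rho>" "s2 * sqrt (1 - \<rho>\<^sup>2)"]]
      show "norm (?G i om)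
        \<le> (LINT z|gauss2. noise_bd s1 0 (s2 * \<rho>) (s2 * sqrt (1 - \<rho>\<^sup>2)) z)"
        by (simp add: abs_mult)
    qed
  qed
  show ?thesis unfolding diff BB_def
    by (subst (1 2) Bochner_Integration.integral_sum) (use \<psi>i Bi step in auto)
qed

end

context dynkin_setup
begin

text \<open>Pathwise this is the change of \<open>HH\<close> up to the stopping time. As a limit it
  inherits measurability from the sums instead of from the stopping time.\<close>

definition Lim :: "'w \<Rightarrow> real" where "Lim om = lim (\<lambda>n. XX n om)"

lemma XX_tendsto:
  assumes w: "om \<in> space M"
  shows "(\<lambda>n. XX n om) \<longlonglongrightarrow> Lim om"
    and "\<exists>\<tau>. stop_weight t r (\<lambda>u. lam u om) \<tau> \<and> Lim om = HH \<tau> om - HH t om"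
    and "\<bar>XX n om\<bar> \<le> 2 * K"
proof -
  obtain \<tau> where \<tau>: "stop_weight t r (\<lambda>u. lam u om) \<tau>" using weight[OF w] by blast
  note s = stop_weight_sum[OF \<tau> tr HHc[OF w], folded XX_def]
  have "Lim om = HH \<tau> om - HH t om" unfolding Lim_def using s(1) by (rule limI)
  then show "(\<lambda>n. XX n om) \<longlonglongrightarrow> Lim om"
    and "\<exists>\<tau>. stop_weight t r (\<lambda>u. lam u om) \<tau> \<and> Lim om = HH \<tau> om - HH t om" using s(1) \<tau> by auto
  obtain v where "XX n om = HH v om - HH t om" using s(2) by blast
  moreover have "\<bar>HH v om\<bar> \<le> K" "\<bar>HH t om\<bar> \<le> K" unfolding HH_def by (rule test_bounds)+
  ultimately show "\<bar>XX n om\<bar> \<le> 2 * K" by linarith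
qed

lemma section_measurable:
  assumes "jointly M g" "om \<in> space M"
  shows "(\<lambda>u. g u om) \<in> borel_measurable borel"
  using measurable_compose[OF measurable_Pair2'[OF assms(2)] assms(1)] by simp

lemma LINT_ind: "(LBINT u:{t..r}. indicator {t..<r} u * g u) = (LBINT u. indicator {t..<r} u * (g u :: real))"
  unfolding set_lebesgue_integral_def by (rule Bochner_Integration.integral_cong) (auto simp: indicator_def)

lemma int_ind: "set_integrable lborel {t..r} (\<lambda>u. indicator {t..<r} u * g u) \<Longrightarrow> integrable lborel (\<lambda>u. indicator {t..<r} u * (g u :: real))"
proof -
  have "(\<lambda>u. indicator {t..r} u *\<^sub>R (indicator {t..<r} u * g u)) = (\<lambda>u. indicator {t..<r} u * g u)"
    by (auto simp: fun_eq_iff indicator_def)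
  then show "set_integrable lborel {t..r} (\<lambda>u. indicator {t..<r} u * g u) \<Longrightarrow> integrable lborel (\<lambda>u. indicator {t..<r} u * (g u :: real))"
    unfolding set_integrable_def by (simp only:)
qed

lemma AA_tendsto:
  "AE om in M. (\<lambda>n. AA n om) \<longlonglongrightarrow> (LBINT u. indicator {t..<r} u * (lam u om * gen_drift u om)) \<and>
     integrable lborel (\<lambda>u. indicator {t..<r} u * (lam u om * gen_drift u om)) \<and>
     (\<forall>n. \<bar>AA n om\<bar> \<le> (LBINT u:{t..r}. K * (1 + \<bar>m\<bar> + \<bar>b u om\<bar> + \<bar>c u om\<bar>)))"
  using bi ci Eb Qc' AE_space
proof eventually_elim
  case (elim om)
  note w = elim(5)
  obtain \<tau> where \<tau>: "stop_weight t r (\<lambda>u. lam u om) \<tau>" using weight[OF w] by blast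
  let ?G = "\<lambda>u. indicator {t..<r} u * (lam u om * gen_drift u om)"
  have U: "U v om - U u om = (LBINT x:{u..v}. b x om)" if "t \<le> u" "u \<le> v" "v \<le> r" for u v
  proof -
    have "E v om - E u om = (LBINT x:{u..v}. b x om)
        + s2 * (\<rho> * (W1 v om - W1 u om) + sqrt (1 - \<rho>\<^sup>2) * (W2 v om - W2 u om))" using elim(3) that by blast
    then show ?thesis unfolding U_def by (simp add: algebra_simps)
  qed
  have Q': "Q v om - Q u om = - (LBINT x:{u..v}. c x om)" if "t \<le> u" "u \<le> v" "v \<le> r" for u v using elim(4) that by blast
  have G: "?G u = lam u om * (ft u (Y u om) (E u om) (Q u om) + m * fy u (Y u om) (E u om) (Q u om)
                + b u om * fe u (Y u om) (E u om) (Q u om) - c u om * fq u (Y u om) (E u om) (Q u om))" if "u \<in> {t..<r}" for u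
    using that by (simp add: gen_drift_def)
  note D = drift_sum[OF Yc[OF w] Ec[OF w] Qc[OF w] Uc[OF w] Qb section_measurable[OF b_joint w] section_measurable[OF c_joint w]
     section_measurable[OF joint(1) w] elim(1) elim(2) U Q' \<tau> G AA_def]
  show ?case using D(1) int_ind[OF D(2)] D(3) unfolding LINT_ind by blast
qed

lemma BB_tendsto:
  assumes w: "om \<in> space M"
  shows "(\<lambda>n. BB n om) \<longlonglongrightarrow> (LBINT u. indicator {t..<r} u * (lam u om * gen_noise u om))"
    and "integrable lborel (\<lambda>u. indicator {t..<r} u * (lam u om * gen_noise u om))"
    and "\<And>n. \<bar>BB n om\<bar> \<le> (r - t) * (LINT z|gauss2. noise_bd s1 0 (s2 * \<rho>) (s2 * sqrt (1 - \<rho>\<^sup>2)) z)"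
proof -
  let ?K = "LINT z|gauss2. noise_bd s1 0 (s2 * \<rho>) (s2 * sqrt (1 - \<rho>\<^sup>2)) z"
  define \<phi> where "\<phi> n i = lam (gp t r n i) om *
      noise_gen f \<alpha> \<beta> ((r - t) / real n) (gp t r n i) (Y (gp t r n i) om) (E (gp t r n i) om) (Q (gp t r n i) om)" for n i
  let ?G = "\<lambda>u. indicator {t..<r} u * (lam u om * gen_noise u om)"
  obtain \<tau> where \<tau>: "stop_weight t r (\<lambda>u. lam u om) \<tau>" using weight[OF w] by blast
  have bound: "\<bar>\<phi> n i\<bar> \<le> ?K" if n: "n > 0" "i < n" for n i
  proof -
    have h: "(r - t) / real n > 0" using tr n by simp
    have i': "gp t r n i \<in> {t..r}" using gin[of i n] n by simp
    have "\<bar>lam (gp t r n i) om\<bar> \<le> 1" using lam01[OF i', of om] by auto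
    from mult_mono[OF this noise_gen_bound[OF i' Qb[OF i'] h, of s1 0 "s2 * \<rho>" "s2 * sqrt (1 - \<rho>\<^sup>2)"]]
    show ?thesis by (simp add: abs_mult \<phi>_def)
  qed
  have conv: "AE u in lborel. u \<in> {t..<r} \<longrightarrow> (\<lambda>n. \<phi> n (ix t r n u)) \<longlonglongrightarrow> ?G u"
    using AE_lborel_singleton[of \<tau>]
  proof eventually_elim
    case (elim u)
    show ?case
    proof
      assume u: "u \<in> {t..<r}"
      \<comment> \<open>Shifted to \<open>Suc n\<close> so that every step width is positive, as
        \<open>noise_gen_tendsto\<close> requires.\<close>
      let ?k = "\<lambda>n. gp t r (Suc n) (ix t r (Suc n) u)"
      have k: "?k n \<in> {t..r}" for n using ix_cell(1)[OF tr _ u, of "Suc n"] gin by (simp add: less_imp_le)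
      have lim: "(\<lambda>n. z (?k n)) \<longlonglongrightarrow> z u" if "continuous_on {t..r} z" for z :: "real \<Rightarrow> real"
        using LIMSEQ_Suc[OF grid_left_tendsto[OF tr that u]] .
      have h: "(\<lambda>n. (r - t) / real (Suc n)) \<longlonglongrightarrow> 0" "(r - t) / real (Suc n) > 0" for n
        using LIMSEQ_Suc[OF step_tendsto] tr by simp_all
      have l: "(\<lambda>n. lam (?k n) om) \<longlonglongrightarrow> lam u om" using LIMSEQ_Suc[OF stop_weight_tendsto[OF \<tau> tr u elim]] .
      have r2: "0 \<le> 1 - \<rho>\<^sup>2" using \<rho> by simp
      have "(\<lambda>n. noise_gen f \<alpha> \<beta> ((r - t) / real (Suc n)) (?k n) (Y (?k n) om) (E (?k n) om) (Q (?k n) om)) \<longlonglongrightarrow>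
         ((s1\<^sup>2 + 0\<^sup>2) * fyy u (Y u om) (E u om) (Q u om) + (s1 * (s2 * \<rho>) + 0 * (s2 * sqrt (1 - \<rho>\<^sup>2))) * fye u (Y u om) (E u om) (Q u om)
          + ((s2 * \<rho>)\<^sup>2 + (s2 * sqrt (1 - \<rho>\<^sup>2))\<^sup>2) * fee u (Y u om) (E u om) (Q u om)) / 2"
        by (rule noise_gen_tendsto[OF k Qb[OF k] h(2) h(1) lim[OF continuous_on_id] lim[OF Yc[OF w]] lim[OF Ec[OF w]] lim[OF Qc[OF w]]])
      also have "((s1\<^sup>2 + 0\<^sup>2) * fyy u (Y u om) (E u om) (Q u om) + (s1 * (s2 * \<rho>) + 0 * (s2 * sqrt (1 - \<rho>\<^sup>2))) * fye u (Y u om) (E u om) (Q u om)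
          + ((s2 * \<rho>)\<^sup>2 + (s2 * sqrt (1 - \<rho>\<^sup>2))\<^sup>2) * fee u (Y u om) (E u om) (Q u om)) / 2 = gen_noise u om"
      proof -
        have "(s2 * \<rho>)\<^sup>2 + (s2 * sqrt (1 - \<rho>\<^sup>2))\<^sup>2 = s2\<^sup>2" using r2 by (simp add: power_mult_distrib algebra_simps)
        then show ?thesis by (simp add: gen_noise_def)
      qed
      finally have "(\<lambda>n. \<phi> (Suc n) (ix t r (Suc n) u)) \<longlonglongrightarrow> ?G u"
        unfolding \<phi>_def using u by (simp add: tendsto_mult[OF l])
      then show "(\<lambda>n. \<phi> n (ix t r n u)) \<longlonglongrightarrow> ?G u" by (rule LIMSEQ_imp_Suc)
    qed
  qed
  note R = riemann_limit_step[OF tr section_measurable[OF joint(2) w] bound conv]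
  have BB: "BB n om = (\<Sum>i<n. (r - t) / real n * \<phi> n i)" for n by (simp add: BB_def \<phi>_def)
  show "(\<lambda>n. BB n om) \<longlonglongrightarrow> (LBINT u. ?G u)" using R(1) unfolding BB LINT_ind .
  show "integrable lborel ?G" by (rule int_ind[OF R(2)])
  show "\<bar>BB n om\<bar> \<le> (r - t) * ?K" for n
  proof (cases "n = 0")
    case True
    have "0 \<le> \<bar>\<phi> 1 0\<bar>" by simp
    also have "\<dots> \<le> ?K" by (rule bound) simp_all
    finally show ?thesis using True tr by (simp add: BB_def)
  qed (use R(3)[of n] BB in simp)
qed

text \<open>On every grid the expected total change is the expected drift sum plus the expected
  averaged noise sum. The three limits are taken separately, dominated by \<open>2 * K\<close>, by
  \<open>dom\<close> and by a constant, and are then recombined under one integral.\<close>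

theorem dynkin:
  shows "integrable M Lim"
    and "integrable M (\<lambda>om. LBINT u. indicator {t..<r} u * (lam u om * (gen_drift u om + gen_noise u om)))"
    and "AE om in M. integrable lborel (\<lambda>u. indicator {t..<r} u * (lam u om * (gen_drift u om + gen_noise u om)))"
    and "(LINT om|M. Lim om) = (LINT om|M. LINT u|lborel. indicator {t..<r} u * (lam u om * (gen_drift u om + gen_noise u om)))"
proof -
  let ?gd = "\<lambda>om u. indicator {t..<r} u * (lam u om * gen_drift u om)"
  let ?gn = "\<lambda>om u. indicator {t..<r} u * (lam u om * gen_noise u om)"
  let ?D = "\<lambda>om. LBINT u:{t..r}. K * (1 + \<bar>m\<bar> + \<bar>b u om\<bar> + \<bar>c u om\<bar>)"
  have LM: "Lim \<in> borel_measurable M" by (rule borel_measurable_LIMSEQ_real[OF XX_tendsto(1) XX_M])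
  have X1: "integrable M (XX n)" for n
    by (rule integrable_const_bound[where B="2 * K"]) (use XX_tendsto(3) XX_M in auto)
  show Li: "integrable M Lim"
    by (rule integrable_dominated_convergence[where s=XX and w="\<lambda>_. 2 * K", OF LM XX_M]) (use XX_tendsto in auto)
  have X: "(\<lambda>n. LINT om|M. XX n om) \<longlonglongrightarrow> (LINT om|M. Lim om)"
    by (rule integral_dominated_convergence[where s=XX and w="\<lambda>_. 2 * K", OF LM XX_M]) (use XX_tendsto in auto)
  have sw: "(\<lambda>om. LBINT u. g u om) \<in> borel_measurable M"
    if "jointly M g" for g :: "real \<Rightarrow> 'w \<Rightarrow> real"
  proof -
    have "(\<lambda>(om, u). g u om) \<in> borel_measurable (M \<Otimes>\<^sub>M lborel)"
      using measurable_compose[OF measurable_pair_swap' that] by (simp add: split_def measurable_cong_sets[OF sets_pair_measure_cong[OF refl sets_lborel] refl])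
    then show ?thesis by (rule lborel.borel_measurable_lebesgue_integral)
  qed
  note dM = sw[OF joint(1)] and nM = sw[OF joint(2)]
  have Ab: "AE om in M. norm (AA n om) \<le> ?D om" for n using AA_tendsto by eventually_elim auto
  have Al: "AE om in M. (\<lambda>n. AA n om) \<longlonglongrightarrow> (LBINT u. ?gd om u)" using AA_tendsto by eventually_elim auto
  have A1: "integrable M (AA n)" for n
    by (rule Bochner_Integration.integrable_bound[OF dom AA_M]) (use Ab[of n] in eventually_elim, auto)
  have Ai: "integrable M (\<lambda>om. LBINT u. ?gd om u)"
    by (rule integrable_dominated_convergence[OF dM AA_M dom Al Ab])
  have A: "(\<lambda>n. LINT om|M. AA n om) \<longlonglongrightarrow> (LINT om|M. LINT u|lborel. ?gd om u)"
    by (rule integral_dominated_convergence[OF dM AA_M dom Al Ab])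
  let ?B = "(r - t) * (LINT z|gauss2. noise_bd s1 0 (s2 * \<rho>) (s2 * sqrt (1 - \<rho>\<^sup>2)) z)"
  have Bi: "integrable M (\<lambda>om. LBINT u. ?gn om u)"
    by (rule integrable_dominated_convergence[where s=BB and w="\<lambda>_. ?B", OF nM BB_M]) (use BB_tendsto in auto)
  have B: "(\<lambda>n. LINT om|M. BB n om) \<longlonglongrightarrow> (LINT om|M. LINT u|lborel. ?gn om u)"
    by (rule integral_dominated_convergence[where s=BB and w="\<lambda>_. ?B", OF nM BB_M]) (use BB_tendsto in auto)
  have eq: "(LINT om|M. XX n om) = (LINT om|M. AA n om) + (LINT om|M. BB n om)" for n
    using expectation_noise[of n] X1 A1 by simp
  have lim: "(LINT om|M. Lim om) = (LINT om|M. LINT u|lborel. ?gd om u) + (LINT om|M. LINT u|lborel. ?gn om u)"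
    by (rule LIMSEQ_unique[OF X]) (unfold eq, rule tendsto_add[OF A B])
  have ai: "AE om in M. integrable lborel (?gd om) \<and> integrable lborel (?gn om)"
    using AA_tendsto AE_space by eventually_elim (use BB_tendsto(2) in auto)
  have split: "indicator {t..<r} u * (lam u om * (gen_drift u om + gen_noise u om)) = ?gd om u + ?gn om u" for u om
    by (simp add: algebra_simps)
  show "AE om in M. integrable lborel (\<lambda>u. indicator {t..<r} u * (lam u om * (gen_drift u om + gen_noise u om)))"
    unfolding split using ai by eventually_elim auto
  have M: "(\<lambda>om. LBINT u. ?gd om u + ?gn om u) \<in> borel_measurable M"
  proof (rule sw)
    show "jointly M (\<lambda>u om. ?gd om u + ?gn om u)"
      using borel_measurable_add[OF joint] by (simp add: split_def)
  qed
  have ae: "AE om in M. (LBINT u. ?gd om u) + (LBINT u. ?gn om u) = (LBINT u. ?gd om u + ?gn om u)"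
    using ai by eventually_elim auto
  show "integrable M (\<lambda>om. LBINT u. indicator {t..<r} u * (lam u om * (gen_drift u om + gen_noise u om)))"
    unfolding split by (rule integrable_cong_AE_imp[OF Bochner_Integration.integrable_add[OF Ai Bi] M]) (use ae in \<open>auto elim: eventually_mono\<close>)
  have "(LINT om|M. LINT u|lborel. ?gd om u + ?gn om u) = (LINT om|M. (LBINT u. ?gd om u) + (LBINT u. ?gn om u))"
    by (rule integral_cong_AE) (use M dM nM ae in \<open>auto elim: eventually_mono\<close>)
  also have "\<dots> = (LINT om|M. Lim om)" unfolding lim by (rule Bochner_Integration.integral_add[OF Ai Bi])
  finally show "(LINT om|M. Lim om) = (LINT om|M. LINT u|lborel. indicator {t..<r} u * (lam u om * (gen_drift u om + gen_noise u om)))"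
    unfolding split ..
qed

end

section \<open>Truncating the candidate value function\<close>

locale c12_fun =
  fixes T Qbar :: real and w wt :: "real \<Rightarrow> state \<Rightarrow> real"
    and Dw :: "real \<Rightarrow> state \<Rightarrow> state \<Rightarrow>\<^sub>L real"
    and D2w :: "real \<Rightarrow> state \<Rightarrow> state \<Rightarrow>\<^sub>L (state \<Rightarrow>\<^sub>L real)"
  assumes C12: "C12_on {0..<T} (stateO Qbar) w wt Dw D2w"
    and cont: "continuous_on ({0..T} \<times> stateO_cl Qbar) (\<lambda>(t,x). w t x)"
begin

lemma C12_D:
  assumes "u \<in> {0..<T}" "x \<in> stateO Qbar"
  shows "((\<lambda>s. w s x) has_real_derivative wt u x) (at u within {0..<T})"
    and "(w u has_derivative blinfun_apply (Dw u x)) (at x within stateO Qbar)"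
    and "(Dw u has_derivative blinfun_apply (D2w u x)) (at x within stateO Qbar)"
  using C12 assms unfolding C12_on_def by blast+

lemma C12_cont:
  "continuous_on ({0..<T} \<times> stateO Qbar) (\<lambda>(t,x). w t x)"
  "continuous_on ({0..<T} \<times> stateO Qbar) (\<lambda>(t,x). wt t x)"
  "continuous_on ({0..<T} \<times> stateO Qbar) (\<lambda>(t,x). Dw t x)"
  "continuous_on ({0..<T} \<times> stateO Qbar) (\<lambda>(t,x). D2w t x)"
  using C12 unfolding C12_on_def
  by (auto intro!: continuous_on_subset[OF cont] simp: stateO_def stateO_cl_def)

text \<open>Two-sided derivatives exist on the open part \<open>q > 0\<close>. The generator is only
  compared there, since the weight is 0 once the inventory is exhausted.\<close>

lemma D2w_symmetric:
  assumes u: "u \<in> {0..<T}" and x: "x \<in> {0<..} \<times> UNIV \<times> {0<..<Qbar}"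
  shows "D2w u x v v' = D2w u x v' v"
proof (rule second_derivative_symmetric[where f="w u" and D="Dw u" and S="{0<..} \<times> UNIV \<times> {0<..<Qbar}"])
  let ?S = "{0<..} \<times> UNIV \<times> {0<..<Qbar} :: state set"
  show o: "open ?S" by (intro open_Times) auto
  have sub: "?S \<subseteq> stateO Qbar" by (auto simp: stateO_def)
  fix y assume y: "y \<in> ?S"
  have "at y within stateO Qbar = at y"
    using o sub y by (meson at_within_interior interior_maximal subsetD)
  then show "(w u has_derivative blinfun_apply (Dw u y)) (at y)" "(Dw u has_derivative blinfun_apply (D2w u y)) (at y)"
    using C12_D(2,3)[OF u, of y] y sub by auto
next
  show "continuous_on ({0<..} \<times> UNIV \<times> {0<..<Qbar}) (D2w u)"
  proof -
    have "continuous_on ({0<..} \<times> UNIV \<times> {0<..<Qbar}) (\<lambda>x. (\<lambda>(t,x). D2w t x) (u, x))"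
      by (rule continuous_on_compose2[OF C12_cont(4)]) (use u in \<open>auto intro!: continuous_intros simp: stateO_def\<close>)
    then show ?thesis by simp
  qed
qed (rule x)

section \<open>The truncated test function\<close>

context
  fixes t r qb N :: real
  assumes t0: "0 \<le> t" and tr: "t < r" and rT: "r < T" and qb: "0 \<le> qb" "qb < Qbar" and N: "N \<ge> 1"
begin

text \<open>\<open>cu\<close> and \<open>pt\<close> clamp time and inventory and truncate log-price
  and \<epsilon>, so that every argument lands in one compact subset of the domain of
  \<open>w\<close>. Staying before \<open>T\<close> and below \<open>Qbar\<close> is what makes the
  derivatives bounded there.\<close>

definition cu :: "real \<Rightarrow> real" where "cu u = max t (min r u)"
definition pt :: "real \<Rightarrow> real \<Rightarrow> real \<Rightarrow> state" where
  "pt y e q = (exp (trunc N y), trunc N e, max 0 (min qb q))"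
text \<open>\<open>vy\<close> and \<open>ve\<close> are the first derivatives of the point
  \<open>pt\<close> in log-price and \<epsilon>; \<open>vyy\<close> and \<open>vee\<close> are the
  second ones.\<close>

definition vy :: "real \<Rightarrow> state" where "vy y = (exp (trunc N y) * trunc' N y, 0, 0)"
definition ve :: "real \<Rightarrow> state" where "ve e = (0, trunc' N e, 0)"
definition vyy :: "real \<Rightarrow> state" where "vyy y = (exp (trunc N y) * ((trunc' N y)\<^sup>2 + trunc'' N y), 0, 0)"
definition vee :: "real \<Rightarrow> state" where "vee e = (0, trunc'' N e, 0)"

definition "tf u y e q = w (cu u) (pt y e q)"
definition "tft u y e q = wt (cu u) (pt y e q)"
definition "tfy u y e q = Dw (cu u) (pt y e q) (vy y)"
definition "tfe u y e q = Dw (cu u) (pt y e q) (ve e)"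
definition "tfq u y e q = Dw (cu u) (pt y e q) eq"
definition "tfyy u y e q = D2w (cu u) (pt y e q) (vy y) (vy y) + Dw (cu u) (pt y e q) (vyy y)"
definition "tfye u y e q = D2w (cu u) (pt y e q) (vy y) (ve e) + D2w (cu u) (pt y e q) (ve e) (vy y)"
definition "tfee u y e q = D2w (cu u) (pt y e q) (ve e) (ve e) + Dw (cu u) (pt y e q) (vee e)"

lemma cu_in: "cu u \<in> {t..r}" using tr by (auto simp: cu_def)

lemma cu_in': "cu u \<in> {0..<T}" using cu_in[of u] t0 rT by auto

lemma pt_in: "pt y e q \<in> {exp (- (N + 1))..exp (N + 1)} \<times> {- (N + 1)..N + 1} \<times> {0..qb}"
  using trunc_bound(1)[of N y] trunc_bound(1)[of N e] N qb by (auto simp: pt_def abs_le_iff)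

lemma pt_in': "pt y e q \<in> stateO Qbar"
  using pt_in[of y e q] qb by (auto simp: stateO_def pt_def)

lemma trunc_continuous [continuous_intros]:
  assumes "continuous_on S g"
  shows "continuous_on S (\<lambda>x. trunc N (g x))" "continuous_on S (\<lambda>x. trunc' N (g x))" "continuous_on S (\<lambda>x. trunc'' N (g x))"
  by (rule continuous_on_compose2[OF trunc_cont(1) assms] continuous_on_compose2[OF trunc_cont(2) assms]
      continuous_on_compose2[OF trunc_cont(3) assms]; simp)+

lemma comp_cont:
  assumes "continuous_on ({0..<T} \<times> stateO Qbar) (\<lambda>(t,x). g t x)"
  shows "continuous_on UNIV (\<lambda>z. g (cu (fst z)) (pt (fst (snd z)) (fst (snd (snd z))) (snd (snd (snd z)))))"
proof -
  have "continuous_on UNIV (\<lambda>z. (cu (fst z), pt (fst (snd z)) (fst (snd (snd z))) (snd (snd (snd z)))))"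
    unfolding cu_def pt_def by (intro continuous_intros)
  moreover have sub: "range (\<lambda>z. (cu (fst z), pt (fst (snd z)) (fst (snd (snd z))) (snd (snd (snd z))))) \<subseteq> {0..<T} \<times> stateO Qbar"
    using cu_in' pt_in' by blast
  ultimately have "continuous_on UNIV (\<lambda>z. (\<lambda>(t,x). g t x) (cu (fst z), pt (fst (snd z)) (fst (snd (snd z))) (snd (snd (snd z)))))"
    by (intro continuous_on_compose2[OF assms])
  then show ?thesis unfolding prod.case .
qed

lemma vec_cont: "continuous_on UNIV vy" "continuous_on UNIV ve" "continuous_on UNIV vyy" "continuous_on UNIV vee"
  unfolding vy_def ve_def vyy_def vee_def by (intro continuous_intros)+

lemma tf_cont:
  assumes "g \<in> {tf, tft, tfy, tfe, tfq, tfyy, tfye, tfee}"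
  shows "continuous_on UNIV (\<lambda>(u, y, e, q). g u y e q)"
proof -
  note c = comp_cont[OF C12_cont(1)] comp_cont[OF C12_cont(2)] comp_cont[OF C12_cont(3)] comp_cont[OF C12_cont(4)]
  have v: "continuous_on UNIV (\<lambda>z :: real \<times> real \<times> real \<times> real. vy (fst (snd z)))"
    "continuous_on UNIV (\<lambda>z :: real \<times> real \<times> real \<times> real. vyy (fst (snd z)))"
    "continuous_on UNIV (\<lambda>z :: real \<times> real \<times> real \<times> real. ve (fst (snd (snd z))))"
    "continuous_on UNIV (\<lambda>z :: real \<times> real \<times> real \<times> real. vee (fst (snd (snd z))))"
    by (auto intro!: continuous_on_compose2[OF vec_cont(1)] continuous_on_compose2[OF vec_cont(3)]
         continuous_on_compose2[OF vec_cont(2)] continuous_on_compose2[OF vec_cont(4)] continuous_intros)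
  note b = blinfun.continuous_on
  have "continuous_on UNIV (\<lambda>(u, y, e, q). tf u y e q)" "continuous_on UNIV (\<lambda>(u, y, e, q). tft u y e q)"
    unfolding tf_def tft_def split_def by (rule c)+
  moreover have "continuous_on UNIV (\<lambda>(u, y, e, q). tfy u y e q)" unfolding tfy_def split_def by (rule b[OF c(3) v(1)])
  moreover have "continuous_on UNIV (\<lambda>(u, y, e, q). tfe u y e q)" unfolding tfe_def split_def by (rule b[OF c(3) v(3)])
  moreover have "continuous_on UNIV (\<lambda>(u, y, e, q). tfq u y e q)" unfolding tfq_def split_def by (rule b[OF c(3) continuous_on_const])
  moreover have "continuous_on UNIV (\<lambda>(u, y, e, q). tfyy u y e q)" unfolding tfyy_def split_def
    by (rule continuous_on_add[OF b[OF b[OF c(4) v(1)] v(1)] b[OF c(3) v(2)]])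
  moreover have "continuous_on UNIV (\<lambda>(u, y, e, q). tfye u y e q)" unfolding tfye_def split_def
    by (rule continuous_on_add[OF b[OF b[OF c(4) v(1)] v(3)] b[OF b[OF c(4) v(3)] v(1)]])
  moreover have "continuous_on UNIV (\<lambda>(u, y, e, q). tfee u y e q)" unfolding tfee_def split_def
    by (rule continuous_on_add[OF b[OF b[OF c(4) v(3)] v(3)] b[OF c(3) v(4)]])
  ultimately show ?thesis using assms by auto
qed

lemma comp_bound:
  fixes g :: "real \<Rightarrow> state \<Rightarrow> 'b::real_normed_vector"
  assumes "continuous_on ({0..<T} \<times> stateO Qbar) (\<lambda>(t,x). g t x)"
  shows "\<exists>B\<ge>0. \<forall>u y e q. norm (g (cu u) (pt y e q)) \<le> B"
proof -
  let ?C = "{t..r} \<times> ({exp (- (N + 1))..exp (N + 1)} \<times> {- (N + 1)..N + 1} \<times> {0..qb})"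
  have "compact ?C" by (intro compact_Times compact_Icc)
  have e: "0 < exp (- (N + 1))" by simp
  have sub: "?C \<subseteq> {0..<T} \<times> stateO Qbar"
    using t0 rT qb by (auto simp: stateO_def intro: less_le_trans[OF e])
  have "compact ((\<lambda>(t,x). g t x) ` ?C)"
    by (rule compact_continuous_image[OF continuous_on_subset[OF assms sub] \<open>compact ?C\<close>])
  then obtain B where B: "\<And>x. x \<in> ?C \<Longrightarrow> norm ((\<lambda>(t,x). g t x) x) \<le> B"
    using compact_imp_bounded bounded_iff by (metis imageI)
  have "norm (g (cu u) (pt y e q)) \<le> max 0 B" for u y e q
    using B[of "(cu u, pt y e q)"] cu_in[of u] pt_in[of y e q] by (auto simp: mem_Times_iff)
  then show ?thesis by (intro exI[of _ "max 0 B"]) auto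
qed

lemma tf_bound: "\<exists>K. \<forall>g \<in> {tf, tft, tfy, tfe, tfq, tfyy, tfye, tfee}. \<forall>u y e q. \<bar>g u y e q\<bar> \<le> K"
proof -
  obtain B0 where B0: "B0 \<ge> 0" "\<And>u y e q. norm (w (cu u) (pt y e q)) \<le> B0" using comp_bound[OF C12_cont(1)] by blast
  obtain B1 where B1: "B1 \<ge> 0" "\<And>u y e q. norm (wt (cu u) (pt y e q)) \<le> B1" using comp_bound[OF C12_cont(2)] by blast
  obtain B2 where B2: "B2 \<ge> 0" "\<And>u y e q. norm (Dw (cu u) (pt y e q)) \<le> B2" using comp_bound[OF C12_cont(3)] by blast
  obtain B3 where B3: "B3 \<ge> 0" "\<And>u y e q. norm (D2w (cu u) (pt y e q)) \<le> B3" using comp_bound[OF C12_cont(4)] by blast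
  \<comment> \<open>Bounds all direction vectors; the 2 is for \<open>vyy\<close>, where the squared
    first derivative of \<open>trunc\<close> plus its second derivative is at most 2.\<close>
  define \<kappa> where "\<kappa> = 2 * exp (N + 1)"
  have k1: "1 \<le> exp (N + 1)" using N by simp
  have k: "\<kappa> \<ge> 1" using k1 unfolding \<kappa>_def by linarith
  have tb: "\<bar>trunc N x\<bar> \<le> N + 1" "\<bar>trunc' N x\<bar> \<le> 1" "\<bar>trunc'' N x\<bar> \<le> 1" for x using trunc_bound N by auto
  have ex: "exp (trunc N y) \<le> exp (N + 1)" for y using tb(1)[of y] by (simp add: abs_le_iff)
  have v: "norm (vy y) \<le> \<kappa>" "norm (ve e) \<le> \<kappa>" "norm (vyy y) \<le> \<kappa>" "norm (vee e) \<le> \<kappa>" "norm eq \<le> \<kappa>" for y e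
  proof -
    have "exp (trunc N y) * \<bar>trunc' N y\<bar> \<le> exp (N + 1) * 1" by (intro mult_mono ex tb) auto
    then have "exp (trunc N y) * \<bar>trunc' N y\<bar> \<le> \<kappa>" using k1 unfolding \<kappa>_def by linarith
    then show "norm (vy y) \<le> \<kappa>" by (simp add: vy_def norm_Pair abs_mult)
    have "(trunc' N y)\<^sup>2 \<le> 1" using tb(2)[of y] by (simp add: abs_square_le_1)
    then have "\<bar>(trunc' N y)\<^sup>2 + trunc'' N y\<bar> \<le> 2" using tb(3)[of y] zero_le_power2[of "trunc' N y"] by linarith
    then have "exp (trunc N y) * \<bar>(trunc' N y)\<^sup>2 + trunc'' N y\<bar> \<le> exp (N + 1) * 2" by (intro mult_mono ex) auto
    then show "norm (vyy y) \<le> \<kappa>" by (simp add: vyy_def norm_Pair abs_mult \<kappa>_def)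
    show "norm (ve e) \<le> \<kappa>" "norm (vee e) \<le> \<kappa>" "norm eq \<le> \<kappa>"
      using tb[of e] k by (auto simp: ve_def vee_def eq_def norm_Pair)
  qed
  have D1: "\<bar>Dw (cu u) (pt y e q) x\<bar> \<le> B2 * \<kappa>" if "norm x \<le> \<kappa>" for u y e q x
  proof -
    have "\<bar>Dw (cu u) (pt y e q) x\<bar> \<le> norm (Dw (cu u) (pt y e q)) * norm x" using norm_blinfun[of "Dw (cu u) (pt y e q)" x] by simp
    also have "\<dots> \<le> B2 * \<kappa>" by (intro mult_mono B2 that) simp
    finally show ?thesis .
  qed
  have D2: "\<bar>D2w (cu u) (pt y e q) x x'\<bar> \<le> B3 * \<kappa> * \<kappa>" if "norm x \<le> \<kappa>" "norm x' \<le> \<kappa>" for u y e q x x'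
  proof -
    have "\<bar>D2w (cu u) (pt y e q) x x'\<bar> \<le> norm (D2w (cu u) (pt y e q) x) * norm x'" using norm_blinfun[of "D2w (cu u) (pt y e q) x" x'] by simp
    also have "\<dots> \<le> (norm (D2w (cu u) (pt y e q)) * norm x) * norm x'" by (intro mult_right_mono norm_blinfun) simp
    also have "\<dots> \<le> (B3 * \<kappa>) * \<kappa>" using that B3 k by (intro mult_mono B3 that mult_nonneg_nonneg) auto
    finally show ?thesis .
  qed
  define K where "K = B0 + B1 + B2 * \<kappa> + 2 * (B3 * \<kappa> * \<kappa>)"
  have n: "0 \<le> B2 * \<kappa>" "0 \<le> B3 * \<kappa> * \<kappa>" using B2(1) B3(1) k by simp_all
  have "\<bar>tf u y e q\<bar> \<le> K" "\<bar>tft u y e q\<bar> \<le> K" for u y e q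
    using B0(2)[of u y e q] B1(2)[of u y e q] B0(1) B1(1) n by (auto simp: tf_def tft_def K_def)
  moreover have "\<bar>tfy u y e q\<bar> \<le> K" "\<bar>tfe u y e q\<bar> \<le> K" "\<bar>tfq u y e q\<bar> \<le> K" for u y e q
    using D1[OF v(1), of u y e q y] D1[OF v(2), of u y e q e] D1[OF v(5), of u y e q] B0(1) B1(1) n
    unfolding tfy_def tfe_def tfq_def K_def by linarith+
  moreover have "\<bar>tfyy u y e q\<bar> \<le> K" "\<bar>tfye u y e q\<bar> \<le> K" "\<bar>tfee u y e q\<bar> \<le> K" for u y e q
    using D2[OF v(1) v(1), of u y e q y y] D2[OF v(1) v(2), of u y e q y e] D2[OF v(2) v(1), of u y e q e y] D2[OF v(2) v(2), of u y e q e e]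
      D1[OF v(3), of u y e q y] D1[OF v(4), of u y e q e] B0(1) B1(1) n
    unfolding tfyy_def tfye_def tfee_def K_def by linarith+
  ultimately show ?thesis by (intro exI[of _ K]) auto
qed

text \<open>Within the set where the inventory stays in \<open>{0..qb}\<close> its clamp is the
  identity, so the kinks of \<open>max\<close> and \<open>min\<close> are invisible to the
  derivative.\<close>

lemma pt_deriv:
  fixes q \<gamma> s :: real
  defines "S \<equiv> {s. q + s * \<gamma> \<in> {0..qb}}"
  assumes s: "s \<in> S"
  shows "((\<lambda>s. pt (y + s * \<alpha>) (e + s * \<beta>) (q + s * \<gamma>)) has_derivative
     (\<lambda>k. k *\<^sub>R (\<alpha> *\<^sub>R vy (y + s * \<alpha>) + \<beta> *\<^sub>R ve (e + s * \<beta>) + \<gamma> *\<^sub>R eq))) (at s within S)"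
proof -
  have 1: "((\<lambda>s. (exp (trunc N (y + s * \<alpha>)), trunc N (e + s * \<beta>), q + s * \<gamma>)) has_derivative
     (\<lambda>k. (k * (exp (trunc N (y + s * \<alpha>)) * (trunc' N (y + s * \<alpha>) * \<alpha>)), k * (trunc' N (e + s * \<beta>) * \<beta>), k * \<gamma>))) (at s within S)"
  proof (intro has_derivative_Pair)
    have "((\<lambda>s. exp (trunc N (y + s * \<alpha>))) has_real_derivative exp (trunc N (y + s * \<alpha>)) * (trunc' N (y + s * \<alpha>) * \<alpha>)) (at s within S)"
      by (auto intro!: derivative_eq_intros DERIV_chain2[OF trunc_DERIV])
    then show "((\<lambda>s. exp (trunc N (y + s * \<alpha>))) has_derivative (\<lambda>k. k * (exp (trunc N (y + s * \<alpha>)) * (trunc' N (y + s * \<alpha>) * \<alpha>)))) (at s within S)"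
      by (simp only: has_field_derivative_def mult_commute_abs)
    have "((\<lambda>s. trunc N (e + s * \<beta>)) has_real_derivative trunc' N (e + s * \<beta>) * \<beta>) (at s within S)"
      by (auto intro!: derivative_eq_intros DERIV_chain2[OF trunc_DERIV])
    then show "((\<lambda>s. trunc N (e + s * \<beta>)) has_derivative (\<lambda>k. k * (trunc' N (e + s * \<beta>) * \<beta>))) (at s within S)"
      by (simp add: has_field_derivative_def mult_commute_abs)
    show "((\<lambda>s. q + s * \<gamma>) has_derivative (\<lambda>k. k * \<gamma>)) (at s within S)" by (auto intro!: derivative_eq_intros)
  qed
  have 2: "(\<lambda>k. (k * (exp (trunc N (y + s * \<alpha>)) * (trunc' N (y + s * \<alpha>) * \<alpha>)), k * (trunc' N (e + s * \<beta>) * \<beta>), k * \<gamma>))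
     = (\<lambda>k. k *\<^sub>R (\<alpha> *\<^sub>R vy (y + s * \<alpha>) + \<beta> *\<^sub>R ve (e + s * \<beta>) + \<gamma> *\<^sub>R eq))"
    by (auto simp: vy_def ve_def eq_def fun_eq_iff)
  show ?thesis unfolding 2[symmetric]
    by (rule has_derivative_transform[OF s _ 1]) (auto simp: pt_def S_def)
qed

lemma tf_d_x:
  assumes u: "u \<in> {t..r}" and s: "q + s * \<gamma> \<in> {0..qb}"
  shows "((\<lambda>s. tf u (y + s * \<alpha>) (e + s * \<beta>) (q + s * \<gamma>)) has_real_derivative
          \<alpha> * tfy u (y + s * \<alpha>) (e + s * \<beta>) (q + s * \<gamma>) + \<beta> * tfe u (y + s * \<alpha>) (e + s * \<beta>) (q + s * \<gamma>)
          + \<gamma> * tfq u (y + s * \<alpha>) (e + s * \<beta>) (q + s * \<gamma>)) (at s within {s. q + s * \<gamma> \<in> {0..qb}})"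
proof -
  let ?p = "\<lambda>s. pt (y + s * \<alpha>) (e + s * \<beta>) (q + s * \<gamma>)"
  let ?S = "{s. q + s * \<gamma> \<in> {0..qb}}"
  have d: "(w (cu u) has_derivative blinfun_apply (Dw (cu u) (?p s))) (at (?p s) within ?p ` ?S)"
    by (rule has_derivative_subset[OF C12_D(2)[OF cu_in' pt_in']]) (use pt_in' in auto)
  have p: "(?p has_derivative (\<lambda>k. k *\<^sub>R (\<alpha> *\<^sub>R vy (y + s * \<alpha>) + \<beta> *\<^sub>R ve (e + s * \<beta>) + \<gamma> *\<^sub>R eq))) (at s within ?S)"
    using pt_deriv[of s q \<gamma> y \<alpha> e \<beta>] s by simp
  have "((\<lambda>s. w (cu u) (?p s)) has_derivative
      (\<lambda>k. Dw (cu u) (?p s) (k *\<^sub>R (\<alpha> *\<^sub>R vy (y + s * \<alpha>) + \<beta> *\<^sub>R ve (e + s * \<beta>) + \<gamma> *\<^sub>R eq)))) (at s within ?S)"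
    by (rule has_derivative_in_compose[OF p d])
  also have "(\<lambda>k. Dw (cu u) (?p s) (k *\<^sub>R (\<alpha> *\<^sub>R vy (y + s * \<alpha>) + \<beta> *\<^sub>R ve (e + s * \<beta>) + \<gamma> *\<^sub>R eq)))
    = (*) (\<alpha> * tfy u (y + s * \<alpha>) (e + s * \<beta>) (q + s * \<gamma>) + \<beta> * tfe u (y + s * \<alpha>) (e + s * \<beta>) (q + s * \<gamma>)
          + \<gamma> * tfq u (y + s * \<alpha>) (e + s * \<beta>) (q + s * \<gamma>))"
    unfolding tfy_def tfe_def tfq_def
    by (rule ext) (simp only: blinfun.scaleR_right blinfun.add_right real_scaleR_def mult.commute)
  finally show ?thesis unfolding tf_def has_field_derivative_def .
qed

text \<open>Product rule for \<open>Dw\<close> applied to a direction that moves along the curve: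
  besides the Hessian terms there is \<open>Dw\<close> of the second derivative of
  \<open>pt\<close>. Hence the two summands in \<open>tfyy\<close> and \<open>tfee\<close>.\<close>

lemma tf_d_xx:
  assumes u: "u \<in> {t..r}" and q: "q \<in> {0..qb}"
  shows "((\<lambda>s. \<alpha> * tfy u (y + s * \<alpha>) (e + s * \<beta>) q + \<beta> * tfe u (y + s * \<alpha>) (e + s * \<beta>) q) has_real_derivative
          \<alpha>\<^sup>2 * tfyy u (y + s * \<alpha>) (e + s * \<beta>) q + \<alpha> * \<beta> * tfye u (y + s * \<alpha>) (e + s * \<beta>) q
          + \<beta>\<^sup>2 * tfee u (y + s * \<alpha>) (e + s * \<beta>) q) (at s)"
proof -
  let ?p = "\<lambda>s. pt (y + s * \<alpha>) (e + s * \<beta>) q"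
  let ?v = "\<lambda>s. \<alpha> *\<^sub>R vy (y + s * \<alpha>) + \<beta> *\<^sub>R ve (e + s * \<beta>)"
  let ?v' = "\<lambda>s. \<alpha>\<^sup>2 *\<^sub>R vyy (y + s * \<alpha>) + \<beta>\<^sup>2 *\<^sub>R vee (e + s * \<beta>)"
  have U: "{s. q + s * 0 \<in> {0..qb}} = (UNIV :: real set)" using q by auto
  have p: "(?p has_derivative (\<lambda>k. k *\<^sub>R ?v s)) (at s)"
    using pt_deriv[of s q 0 y \<alpha> e \<beta>] q unfolding U by simp
  have "(Dw (cu u) has_derivative blinfun_apply (D2w (cu u) (?p s))) (at (?p s) within range ?p)"
    by (rule has_derivative_subset[OF C12_D(3)[OF cu_in' pt_in']]) (use pt_in' in auto)
  from has_derivative_in_compose[OF p this]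
  have D: "((\<lambda>s. Dw (cu u) (?p s)) has_derivative (\<lambda>k. D2w (cu u) (?p s) (k *\<^sub>R ?v s))) (at s)" .
  have v: "(?v has_derivative (\<lambda>k. k *\<^sub>R ?v' s)) (at s)"
  proof -
    have vf: "?v = (\<lambda>s. (\<alpha> * (exp (trunc N (y + s * \<alpha>)) * trunc' N (y + s * \<alpha>)), \<beta> * trunc' N (e + s * \<beta>), 0))"
      by (auto simp: fun_eq_iff vy_def ve_def)
    have 1: "((\<lambda>s. \<alpha> * (exp (trunc N (y + s * \<alpha>)) * trunc' N (y + s * \<alpha>))) has_real_derivative
        \<alpha>\<^sup>2 * (exp (trunc N (y + s * \<alpha>)) * ((trunc' N (y + s * \<alpha>))\<^sup>2 + trunc'' N (y + s * \<alpha>)))) (at s)"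
      by (auto intro!: derivative_eq_intros DERIV_chain2[OF trunc_DERIV] DERIV_chain2[OF trunc'_DERIV] simp: power2_eq_square algebra_simps)
    have 2: "((\<lambda>s. \<beta> * trunc' N (e + s * \<beta>)) has_real_derivative \<beta>\<^sup>2 * trunc'' N (e + s * \<beta>)) (at s)"
      by (auto intro!: derivative_eq_intros DERIV_chain2[OF trunc'_DERIV] simp: power2_eq_square algebra_simps)
    have "(?v has_derivative (\<lambda>k. (\<alpha>\<^sup>2 * (exp (trunc N (y + s * \<alpha>)) * ((trunc' N (y + s * \<alpha>))\<^sup>2 + trunc'' N (y + s * \<alpha>))) * k,
         \<beta>\<^sup>2 * trunc'' N (e + s * \<beta>) * k, 0))) (at s)"
      unfolding vf using 1 2 by (intro has_derivative_Pair) (simp_all add: has_field_derivative_def)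
    also have "(\<lambda>k. (\<alpha>\<^sup>2 * (exp (trunc N (y + s * \<alpha>)) * ((trunc' N (y + s * \<alpha>))\<^sup>2 + trunc'' N (y + s * \<alpha>))) * k,
         \<beta>\<^sup>2 * trunc'' N (e + s * \<beta>) * k, 0)) = (\<lambda>k. k *\<^sub>R ?v' s)"
      by (auto simp: fun_eq_iff vyy_def vee_def)
    finally show ?thesis .
  qed
  have "((\<lambda>s. Dw (cu u) (?p s) (?v s)) has_derivative
      (\<lambda>k. Dw (cu u) (?p s) (k *\<^sub>R ?v' s) + D2w (cu u) (?p s) (k *\<^sub>R ?v s) (?v s))) (at s)"
    by (rule bounded_bilinear.FDERIV[OF bounded_bilinear_blinfun_apply D v])
  also have "(\<lambda>k. Dw (cu u) (?p s) (k *\<^sub>R ?v' s) + D2w (cu u) (?p s) (k *\<^sub>R ?v s) (?v s))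
     = (*) (\<alpha>\<^sup>2 * tfyy u (y + s * \<alpha>) (e + s * \<beta>) q + \<alpha> * \<beta> * tfye u (y + s * \<alpha>) (e + s * \<beta>) q
          + \<beta>\<^sup>2 * tfee u (y + s * \<alpha>) (e + s * \<beta>) q)"
    unfolding tfyy_def tfye_def tfee_def
    by (simp add: fun_eq_iff blinfun.scaleR_right blinfun.scaleR_left blinfun.add_right blinfun.add_left power2_eq_square algebra_simps)
  finally show ?thesis
    unfolding has_field_derivative_def tfy_def tfe_def
    by (simp add: blinfun.scaleR_right blinfun.add_right)
qed

lemma tf_test_fun: "\<exists>K. test_fun t r qb K tf tft tfy tfe tfq tfyy tfye tfee"
proof -
  obtain K where K: "\<forall>g \<in> {tf, tft, tfy, tfe, tfq, tfyy, tfye, tfee}. \<forall>u y e q. \<bar>g u y e q\<bar> \<le> K" using tf_bound by blast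
  have "test_fun t r qb K tf tft tfy tfe tfq tfyy tfye tfee"
  proof (rule test_fun.intro)
    show "t < r" by (rule tr)
    show "continuous_on UNIV (\<lambda>(u, y, e, q). g u y e q)" if "g \<in> {tf, tft, tfy, tfe, tfq, tfyy, tfye, tfee}" for g
      by (rule tf_cont[OF that])
    show "\<bar>g u y e q\<bar> \<le> K" if "g \<in> {tf, tft, tfy, tfe, tfq, tfyy, tfye, tfee}" for g u y e q
      using K that by blast
    fix u y e q :: real assume u: "u \<in> {t..r}" and q: "q \<in> {0..qb}"
    have cu: "cu s = s" if "s \<in> {t..r}" for s using that by (auto simp: cu_def)
    have "((\<lambda>s. w s (pt y e q)) has_real_derivative wt u (pt y e q)) (at u within {t..r})"
      by (rule has_field_derivative_subset[OF C12_D(1)[OF _ pt_in']]) (use u t0 rT in auto)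
    then have "((\<lambda>s. w s (pt y e q)) has_real_derivative tft u y e q) (at u within {t..r})"
      using cu[OF u] by (simp add: tft_def)
    then show "((\<lambda>s. tf s y e q) has_real_derivative tft u y e q) (at u within {t..r})"
      by (rule has_field_derivative_transform_within[OF _ zero_less_one u]) (simp add: tf_def cu)
  next
    fix u y e q s \<alpha> \<beta> :: real assume u: "u \<in> {t..r}"
    show "((\<lambda>s. tf u (y + s * \<alpha>) (e + s * \<beta>) (q + s * \<gamma>)) has_real_derivative
          \<alpha> * tfy u (y + s * \<alpha>) (e + s * \<beta>) (q + s * \<gamma>) + \<beta> * tfe u (y + s * \<alpha>) (e + s * \<beta>) (q + s * \<gamma>)
          + \<gamma> * tfq u (y + s * \<alpha>) (e + s * \<beta>) (q + s * \<gamma>)) (at s within {s. q + s * \<gamma> \<in> {0..qb}})"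
      if "q + s * \<gamma> \<in> {0..qb}" for \<gamma> by (rule tf_d_x[OF u that])
    show "((\<lambda>s. \<alpha> * tfy u (y + s * \<alpha>) (e + s * \<beta>) q + \<beta> * tfe u (y + s * \<alpha>) (e + s * \<beta>) q) has_real_derivative
          \<alpha>\<^sup>2 * tfyy u (y + s * \<alpha>) (e + s * \<beta>) q + \<alpha> * \<beta> * tfye u (y + s * \<alpha>) (e + s * \<beta>) q
          + \<beta>\<^sup>2 * tfee u (y + s * \<alpha>) (e + s * \<beta>) q) (at s)" if "q \<in> {0..qb}"
      by (rule tf_d_xx[OF u that])
  qed
  then show ?thesis by blast
qed

end

end

section \<open>The verification argument\<close>

definition pos_ind :: "real \<Rightarrow> (real \<Rightarrow> 'a \<Rightarrow> real) \<Rightarrow> real \<Rightarrow> 'a \<Rightarrow> real" where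
  "pos_ind t V u om = (if \<forall>s\<in>{t..u}. V s om > 0 then 1 else 0)"

lemma run_ind_joint:
  assumes tr: "t < r" and V: "\<And>u. u \<in> {t..r} \<Longrightarrow> V u \<in> borel_measurable M"
    and c: "\<And>om. om \<in> space M \<Longrightarrow> continuous_on {t..r} (\<lambda>u. V u om)"
  shows "jointly M (\<lambda>u om. indicator {t..<r} u * run_ind t V R u om)"
proof (rule joint_measurable[OF tr])
  show "run_ind t V R u \<in> borel_measurable M" if "u \<in> {t..r}" for u
  proof (rule run_ind_measurable)
    show "continuous_on {t..u} (\<lambda>s. V s om)" if "om \<in> space M" for om
      by (rule continuous_on_subset[OF c[OF that]]) (use \<open>u \<in> {t..r}\<close> in auto)
  qed (use that V in auto)
  show "(\<lambda>n. run_ind t V R (gp t r n (ix t r n u)) om) \<longlonglongrightarrow> run_ind t V R u om" if "u \<in> {t..<r}" "om \<in> space M" for u om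
    by (rule run_ind_left[where V=V, OF tr c[OF that(2)] that(1)])
qed

text \<open>By compactness a positive continuous path on \<open>[t, u]\<close> is bounded below by some \<open>1 / (j + 1)\<close>.\<close>

lemma pos_ind_tendsto:
  assumes tu: "t \<le> u" and c: "continuous_on {t..u} (\<lambda>s. V s om)" and V: "\<And>s. s \<in> {t..u} \<Longrightarrow> V s om \<in> {0..q}"
  shows "(\<lambda>j. run_ind t (\<lambda>s om. q - V s om) (q - 1 / real (Suc j)) u om) \<longlonglongrightarrow> pos_ind t V u om"
proof (rule tendsto_eventually)
  \<comment> \<open>For values in \<open>[0, q]\<close>, staying at or above \<open>d\<close> is a
    bound on \<open>q - V\<close>, so positivity becomes a limit of running bounds.\<close>
  have iff: "\<bar>q - V s om\<bar> \<le> q - d \<longleftrightarrow> d \<le> V s om" if "s \<in> {t..u}" for s d using V[OF that] by auto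
  show "\<forall>\<^sub>F j in sequentially. run_ind t (\<lambda>s om. q - V s om) (q - 1 / real (Suc j)) u om = pos_ind t V u om"
  proof (cases "\<forall>s\<in>{t..u}. V s om > 0")
    case True
    obtain s0 where s0: "s0 \<in> {t..u}" "\<And>s. s \<in> {t..u} \<Longrightarrow> V s0 om \<le> V s om"
      using continuous_attains_inf[OF _ _ c] tu by auto
    have "(\<lambda>j. 1 / real (Suc j)) \<longlonglongrightarrow> 0" using LIMSEQ_Suc[OF lim_1_over_n] by simp
    then have "\<forall>\<^sub>F j in sequentially. 1 / real (Suc j) < V s0 om" using True s0 by (auto dest: order_tendstoD(2))
    then show ?thesis
    proof eventually_elim
      case (elim j)
      have "\<forall>s\<in>{t..u}. \<bar>q - V s om\<bar> \<le> q - 1 / real (Suc j)"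
        using s0(2) elim by (subst ball_cong[OF refl iff]) (auto intro: less_imp_le order_trans)
      then show ?case using True unfolding run_ind_def pos_ind_def by simp
    qed
  next
    case False
    then obtain s where s: "s \<in> {t..u}" "V s om \<le> 0" by (auto simp: not_less)
    have "\<not> \<bar>q - V s om\<bar> \<le> q - 1 / real (Suc j)" for j
    proof -
      have "0 < 1 / real (Suc j)" by simp
      then show ?thesis using iff[OF s(1)] s(2) by (auto simp only: not_le intro: le_less_trans)
    qed
    then have "\<not> (\<forall>s\<in>{t..u}. \<bar>q - V s om\<bar> \<le> q - 1 / real (Suc j))" for j using s(1) by blast
    then show ?thesis using False unfolding run_ind_def pos_ind_def by simp
  qed
qed

lemma pos_ind_measurable:
  assumes tu: "t \<le> u" and V: "\<And>s. s \<in> {t..u} \<Longrightarrow> V s \<in> borel_measurable N" and c: "\<And>om. om \<in> space N \<Longrightarrow> continuous_on {t..u} (\<lambda>s. V s om)"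
    and b: "\<And>s om. s \<in> {t..u} \<Longrightarrow> V s om \<in> {0..q}"
  shows "pos_ind t V u \<in> borel_measurable N"
proof (rule borel_measurable_LIMSEQ_real[OF pos_ind_tendsto[OF tu c b]])
  show "run_ind t (\<lambda>s om. q - V s om) (q - 1 / real (Suc j)) u \<in> borel_measurable N" for j
    by (rule run_ind_measurable[OF tu]) (auto intro!: borel_measurable_diff V continuous_intros c)
qed

lemma pos_ind_joint:
  assumes tr: "t < r" and V: "\<And>u. u \<in> {t..r} \<Longrightarrow> V u \<in> borel_measurable M"
    and c: "\<And>om. om \<in> space M \<Longrightarrow> continuous_on {t..r} (\<lambda>u. V u om)"
    and b: "\<And>s om. s \<in> {t..r} \<Longrightarrow> V s om \<in> {0..q}"
  shows "jointly M (\<lambda>u om. indicator {t..<r} u * pos_ind t V u om)"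
proof (rule borel_measurable_LIMSEQ_real)
  let ?f = "\<lambda>j (u, om). indicator {t..<r} u * run_ind t (\<lambda>s om. q - V s om) (q - 1 / real (Suc j)) u om"
  show "?f j \<in> borel_measurable (borel \<Otimes>\<^sub>M M)" for j
    by (rule run_ind_joint[OF tr]) (auto intro!: borel_measurable_diff V continuous_intros c)
  fix x :: "real \<times> 'a" assume x: "x \<in> space (borel \<Otimes>\<^sub>M M)"
  obtain u om where u: "x = (u, om)" by (cases x)
  then have w: "om \<in> space M" using x by (simp add: space_pair_measure)
  show "(\<lambda>j. ?f j x) \<longlonglongrightarrow> (case x of (u, om) \<Rightarrow> indicator {t..<r} u * pos_ind t V u om)"
  proof (cases "u \<in> {t..<r}")
    case True
    have "(\<lambda>j. run_ind t (\<lambda>s om. q - V s om) (q - 1 / real (Suc j)) u om) \<longlonglongrightarrow> pos_ind t V u om"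
      by (rule pos_ind_tendsto) (use True b continuous_on_subset[OF c[OF w], of "{t..u}"] in auto)
    then show ?thesis using True u by simp
  qed (use u in simp)
qed

lemma (in bm2) time_integral_measurable:
  assumes "jointly M g"
  shows "(\<lambda>om. LBINT u. (g u om :: real)) \<in> borel_measurable M"
proof -
  have "(\<lambda>(om, u). g u om) \<in> borel_measurable (M \<Otimes>\<^sub>M lborel)"
    using measurable_compose[OF measurable_pair_swap' assms] by (simp add: split_def measurable_cong_sets[OF sets_pair_measure_cong[OF refl sets_lborel] refl])
  then show ?thesis by (rule lborel.borel_measurable_lebesgue_integral)
qed

lemma (in bm2) section_measurable':
  assumes "jointly M g" "om \<in> space M"
  shows "(\<lambda>u. g u om :: real) \<in> borel_measurable borel"
  using measurable_compose[OF measurable_Pair2'[OF assms(2)] assms(1)] by simp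

text \<open>The inventory is already confined to \<open>[0, q]\<close> and the control nonnegative
  everywhere, so the state never leaves the domain of \<open>w\<close>. A genuine solution is turned
  into such data where this locale is instantiated.\<close>

locale verification = bm2 M W1 W2 T + c12_fun T Qbar w wt Dw D2w
  for M :: "'w measure" and W1 W2 T Qbar w wt Dw D2w +
  fixes mu1 sig1 k sig2 rho eta chi phi1 phi2 phi3 C p1 p2 t a e0 q :: real
    and E Q c :: "real \<Rightarrow> 'w \<Rightarrow> real"
  assumes t0: "0 \<le> t" and tT: "t < T" and a: "a > 0" and q: "0 \<le> q" "q < Qbar"
    and k: "k > 0" and rho: "rho\<^sup>2 \<le> 1" and pos: "p1 > 0" "p2 > 0" "C > 0"
    and growth: "\<And>s a e q. s \<in> {0..T} \<Longrightarrow> (a, e, q) \<in> stateO Qbar \<Longrightarrow>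
        \<bar>w s (a, e, q)\<bar> \<le> C * (1 + q\<^sup>2) * (1 + a powr p1) * (1 + exp (p2 * e))"
    and boundary: "\<And>s a e. s \<in> {0..T} \<Longrightarrow> a > 0 \<Longrightarrow> w s (a, e, 0) = 0"
    and E: "\<And>u. u \<in> {t..T} \<Longrightarrow> E u \<in> borel_measurable (nat_filt M W1 W2 u)"
    and Ec: "\<And>om. om \<in> space M \<Longrightarrow> continuous_on {t..T} (\<lambda>u. E u om)"
    and E_t: "\<And>om. om \<in> space M \<Longrightarrow> E t om = e0"
    and Q: "\<And>u. u \<in> {t..T} \<Longrightarrow> Q u \<in> borel_measurable (nat_filt M W1 W2 u)"
    and Qc: "\<And>om. om \<in> space M \<Longrightarrow> continuous_on {t..T} (\<lambda>u. Q u om)"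
    and Qb: "\<And>u om. Q u om \<in> {0..q}"
    and Q_t: "\<And>om. om \<in> space M \<Longrightarrow> Q t om = q"
    and c_joint: "jointly M c"
    and c_nonneg: "\<And>u om. 0 \<le> c u om"
    and c2: "AE om in M. set_integrable lborel {t..T} (\<lambda>u. (c u om)\<^sup>2)"
    and c2i: "integrable M (\<lambda>om. LBINT u:{t..T}. (c u om)\<^sup>2)"
    and Eb: "AE om in M. \<forall>u v. t \<le> u \<longrightarrow> u \<le> v \<longrightarrow> v \<le> T \<longrightarrow> E v om - E u om = (LBINT x:{u..v}. - k * E x om)
        + sig2 * (rho * (W1 v om - W1 u om) + sqrt (1 - rho\<^sup>2) * (W2 v om - W2 u om))"
    and Qc': "AE om in M. \<forall>u v. t \<le> u \<longrightarrow> u \<le> v \<longrightarrow> v \<le> T \<longrightarrow> Q v om - Q u om = - (LBINT x:{u..v}. c x om)"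
begin

definition m where "m = mu1 - sig1\<^sup>2 / 2"
definition Y where "Y u om = ln a + m * (u - t) + sig1 * (W1 u om - W1 t om)"
definition A where "A u om = exp (Y u om)"
definition X where "X u om = (A u om, E u om, Q u om)"
text \<open>Running reward per unit of time. Being 0 after depletion, it may be integrated up to
  \<open>T\<close> in place of the depletion time.\<close>

definition ell where "ell u om = (if Q u om > 0 then c u om * (A u om * exp (E u om) - eta * c u om)
   - phi1 * (Q u om)\<^sup>2 - phi2 * (A u om * exp (E u om) * Q u om) - phi3 * (A u om * Q u om) else 0)"
definition gen where "gen u om = wt u (X u om) + op_L mu1 sig1 k sig2 rho (Dw u (X u om)) (D2w u (X u om)) (X u om)
   - c u om * d1 (Dw u (X u om)) eq"
text \<open>The 1 lets constants be absorbed, so that every pathwise bound is linear in one variable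
  that has all exponential moments.\<close>

definition R1 where "R1 om = 1 + supW W1 om + supW W2 om"

lemma Wcont: "is_W W \<Longrightarrow> om \<in> space M \<Longrightarrow> continuous_on {t..T} (\<lambda>u. W u om)"
  by (rule continuous_on_subset[OF W_cont]) (use t0 in auto)

lemma Yc: "om \<in> space M \<Longrightarrow> continuous_on {t..T} (\<lambda>u. Y u om)"
  unfolding Y_def by (intro continuous_intros Wcont[OF is_W(1)])

lemma YF: "u \<in> {t..T} \<Longrightarrow> Y u \<in> borel_measurable (F u)"
proof -
  assume u: "u \<in> {t..T}"
  have [measurable]: "W1 u \<in> borel_measurable (F u)" "W1 t \<in> borel_measurable (F u)" using W_F[of W1] u t0 by auto
  show ?thesis unfolding Y_def by measurable
qed

lemma to_M: "u \<in> {t..T} \<Longrightarrow> V \<in> borel_measurable (F u) \<Longrightarrow> V \<in> borel_measurable M"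
  by (rule F_measurable_M[of u V borel]) auto

lemma R1_pos: "om \<in> space M \<Longrightarrow> 1 \<le> R1 om"
  using supW_nonneg[OF is_W(1)] supW_nonneg[OF is_W(2)] by (simp add: R1_def add_increasing)

lemma R1_M [measurable]: "R1 \<in> borel_measurable M"
  unfolding R1_def using supW_measurable[OF is_W(1)] supW_measurable[OF is_W(2)] by measurable

lemma R1_exp: "integrable M (\<lambda>om. exp (l * R1 om))"
proof -
  note [measurable] = supW_measurable[OF is_W(1)] supW_measurable[OF is_W(2)]
  have sq: "(exp (l * x))\<^sup>2 = exp ((2 * l) * x)" for x :: real by (simp add: exp_double[symmetric] mult.assoc)
  have "integrable M (\<lambda>om. exp (l * supW W1 om) * exp (l * supW W2 om))"
    by (rule integrable_mult_L2) (auto simp: sq intro!: supW_exp_integrable)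
  from integrable_mult_right[OF this, of "exp l"]
  show ?thesis by (simp add: R1_def exp_add[symmetric] distrib_left add.assoc)
qed

lemma noise_bound:
  assumes w: "om \<in> space M" and W: "is_W W" and u: "u \<in> {t..T}"
  shows "\<bar>W u om - W t om\<bar> \<le> 2 * R1 om"
proof -
  have "\<bar>W u om\<bar> \<le> supW W om" "\<bar>W t om\<bar> \<le> supW W om" using supW_ge[OF W w] u t0 tT by auto
  moreover have "supW W om \<le> R1 om" using W supW_nonneg[OF is_W(1) w] supW_nonneg[OF is_W(2) w] by (auto simp: is_W_def R1_def)
  ultimately show ?thesis by linarith
qed

text \<open>One constant for both \<open>Y\<close> and \<epsilon>. The last summand is the Gronwall
  bound for \<epsilon>, with its two factors 2; the 4 counts two noises, each at most
  \<open>2 * R1\<close>.\<close>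

definition BY where "BY = \<bar>ln a\<bar> + \<bar>m\<bar> * T + 2 * \<bar>sig1\<bar> + 2 * (\<bar>e0\<bar> + 4 * \<bar>sig2\<bar>) * exp (2 * k * T)"

lemma Y_bound: "om \<in> space M \<Longrightarrow> u \<in> {t..T} \<Longrightarrow> \<bar>Y u om\<bar> \<le> BY * R1 om"
proof -
  assume w: "om \<in> space M" and u: "u \<in> {t..T}"
  have "\<bar>Y u om\<bar> \<le> \<bar>ln a\<bar> + \<bar>m * (u - t)\<bar> + \<bar>sig1 * (W1 u om - W1 t om)\<bar>" unfolding Y_def by linarith
  also have "\<dots> \<le> \<bar>ln a\<bar> + \<bar>m\<bar> * T + \<bar>sig1\<bar> * (2 * R1 om)"
    unfolding abs_mult using u t0 noise_bound[OF w is_W(1) u] by (intro add_mono mult_left_mono) auto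
  also have "\<dots> \<le> (\<bar>ln a\<bar> + \<bar>m\<bar> * T) * R1 om + 2 * \<bar>sig1\<bar> * R1 om"
  proof -
    have "(\<bar>ln a\<bar> + \<bar>m\<bar> * T) * 1 \<le> (\<bar>ln a\<bar> + \<bar>m\<bar> * T) * R1 om" using R1_pos[OF w] T_pos by (intro mult_left_mono) auto
    then show ?thesis by simp
  qed
  also have "\<dots> \<le> BY * R1 om"
  proof -
    have "(\<bar>ln a\<bar> + \<bar>m\<bar> * T + 2 * \<bar>sig1\<bar>) * R1 om \<le> BY * R1 om"
      unfolding BY_def using R1_pos[OF w] by (intro mult_right_mono) auto
    then show ?thesis by (simp add: distrib_right)
  qed
  finally show "\<bar>Y u om\<bar> \<le> BY * R1 om" .
qed

text \<open>Pathwise Gronwall with the noise as forcing term; the mean reversion enters through the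
  integral of \<open>\<bar>E x om\<bar>\<close> only.\<close>

lemma E_bound: "AE om in M. \<forall>u\<in>{t..T}. \<bar>E u om\<bar> \<le> BY * R1 om"
  using Eb AE_space
proof eventually_elim
  case (elim om)
  note w = elim(2)
  let ?al = "\<bar>e0\<bar> + \<bar>sig2\<bar> * (4 * R1 om)"
  have R1: "1 \<le> R1 om" by (rule R1_pos[OF w])
  have Ei: "set_integrable lborel {t..u} (\<lambda>x. E x om)" if "u \<le> T" for u
    by (rule borel_integrable_atLeastAtMost', rule continuous_on_subset[OF Ec[OF w]]) (use that in auto)
  obtain B where B: "\<And>u. u \<in> {t..T} \<Longrightarrow> \<bar>E u om\<bar> \<le> B" by (rule path_bounded[OF Ec[OF w]]) blast
  have ineq: "\<bar>E u om\<bar> \<le> ?al + k * (LBINT x:{t..u}. \<bar>E x om\<bar>)" if u: "u \<in> {t..T}" for u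
  proof -
    have "E u om - E t om = (LBINT x:{t..u}. - k * E x om)
        + sig2 * (rho * (W1 u om - W1 t om) + sqrt (1 - rho\<^sup>2) * (W2 u om - W2 t om))" using elim(1) u by auto
    moreover have "(LBINT x:{t..u}. - k * E x om) = - k * (LBINT x:{t..u}. E x om)" by (rule set_integral_mult_right)
    moreover have "\<bar>LBINT x:{t..u}. E x om\<bar> \<le> (LBINT x:{t..u}. \<bar>E x om\<bar>)"
    proof -
      have "\<bar>LBINT x:{t..u}. E x om\<bar> \<le> (LBINT x. norm (indicator {t..u} x *\<^sub>R E x om))"
        unfolding set_lebesgue_integral_def real_norm_def[symmetric] by (rule integral_norm_bound)
      also have "\<dots> = (LBINT x:{t..u}. \<bar>E x om\<bar>)"
        unfolding set_lebesgue_integral_def by (rule Bochner_Integration.integral_cong) (auto simp: abs_mult)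
      finally show ?thesis .
    qed
    moreover have "\<bar>sig2 * (rho * (W1 u om - W1 t om) + sqrt (1 - rho\<^sup>2) * (W2 u om - W2 t om))\<bar> \<le> \<bar>sig2\<bar> * (4 * R1 om)"
    proof -
      have r1: "\<bar>rho\<bar> \<le> 1" using rho by (simp add: abs_square_le_1)
      have r2: "\<bar>sqrt (1 - rho\<^sup>2)\<bar> \<le> 1" using rho by (simp add: real_sqrt_le_1_iff)
      have "\<bar>rho * (W1 u om - W1 t om)\<bar> \<le> 1 * (2 * R1 om)" unfolding abs_mult by (intro mult_mono r1 noise_bound[OF w is_W(1) u]) auto
      moreover have "\<bar>sqrt (1 - rho\<^sup>2) * (W2 u om - W2 t om)\<bar> \<le> 1 * (2 * R1 om)" unfolding abs_mult by (intro mult_mono r2 noise_bound[OF w is_W(2) u]) auto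
      ultimately have "\<bar>rho * (W1 u om - W1 t om) + sqrt (1 - rho\<^sup>2) * (W2 u om - W2 t om)\<bar> \<le> 4 * R1 om" by linarith
      then show ?thesis unfolding abs_mult by (rule mult_left_mono) simp
    qed
    moreover have "\<bar>k * (LBINT x:{t..u}. E x om)\<bar> = k * \<bar>LBINT x:{t..u}. E x om\<bar>" using k by (simp add: abs_mult)
    ultimately show ?thesis using E_t[OF w] k mult_left_mono[of "\<bar>LBINT x:{t..u}. E x om\<bar>" "LBINT x:{t..u}. \<bar>E x om\<bar>" k]
      by linarith
  qed
  show ?case
  proof
    fix u assume u: "u \<in> {t..T}"
    have "\<bar>E u om\<bar> \<le> 2 * ?al * exp (2 * k * (u - t))"
      by (rule gronwall_bounded[OF k _ u, where K=B]) (use R1 B ineq Ei[of T] in \<open>auto intro!: set_integrable_abs\<close>)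
    also have "\<dots> \<le> 2 * ?al * exp (2 * k * T)" using R1 u t0 k by (intro mult_left_mono) auto
    also have "\<dots> \<le> 2 * ((\<bar>e0\<bar> + 4 * \<bar>sig2\<bar>) * R1 om) * exp (2 * k * T)"
    proof -
      have "\<bar>e0\<bar> * 1 \<le> \<bar>e0\<bar> * R1 om" using R1 by (intro mult_left_mono) auto
      then have "?al \<le> (\<bar>e0\<bar> + 4 * \<bar>sig2\<bar>) * R1 om" by (simp add: algebra_simps)
      then show ?thesis by (intro mult_right_mono mult_left_mono) auto
    qed
    also have "\<dots> = (2 * (\<bar>e0\<bar> + 4 * \<bar>sig2\<bar>) * exp (2 * k * T)) * R1 om" by (simp add: mult_ac)
    also have "\<dots> \<le> BY * R1 om" unfolding BY_def using R1 T_pos by (intro mult_right_mono) auto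
    finally show "\<bar>E u om\<bar> \<le> BY * R1 om" .
  qed
qed

lemma BY_nonneg: "0 \<le> BY" using T_pos by (simp add: BY_def)

lemma Q_antimono: "AE om in M. \<forall>u v. t \<le> u \<longrightarrow> u \<le> v \<longrightarrow> v \<le> T \<longrightarrow> Q v om \<le> Q u om"
  using Qc'
proof eventually_elim
  case (elim om)
  have "0 \<le> (LBINT x:{u..v}. c x om)" for u v
    unfolding set_lebesgue_integral_def by (intro integral_nonneg_AE AE_I2) (simp add: c_nonneg)
  note pos = this
  show ?case
  proof (intro allI impI)
    fix u v assume "t \<le> u" "u \<le> v" "v \<le> T"
    then have "Q v om - Q u om = - (LBINT x:{u..v}. c x om)" using elim by blast
    then show "Q v om \<le> Q u om" using pos[of u v] by linarith
  qed
qed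

end

section \<open>Integrable majorants, localised stages and the passage to the limit\<close>

context verification
begin

lemma sub_cont:
  assumes "om \<in> space M" "r \<le> T"
  shows "continuous_on {t..r} (\<lambda>u. Y u om)" "continuous_on {t..r} (\<lambda>u. E u om)" "continuous_on {t..r} (\<lambda>u. Q u om)"
  using assms by (auto intro!: continuous_on_subset[OF Yc] continuous_on_subset[OF Ec] continuous_on_subset[OF Qc])

lemma joint_T:
  assumes "\<And>u. u \<in> {t..T} \<Longrightarrow> V u \<in> borel_measurable (F u)" "\<And>om. om \<in> space M \<Longrightarrow> continuous_on {t..T} (\<lambda>u. V u om)"
  shows "(\<lambda>x. indicator {t..<T} (fst x) * (V (fst x) (snd x) :: real)) \<in> borel_measurable (borel \<Otimes>\<^sub>M M)"
proof -
  have "jointly M (\<lambda>u om. indicator {t..<T} u * V u om)"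
    by (rule joint_measurable_continuous[OF tT to_M[OF _ assms(1)] assms(2)])
  then show ?thesis by (simp add: split_def)
qed

lemma ell_joint: "jointly M (\<lambda>u om. indicator {t..<T} u * ell u om)"
proof -
  let ?J = "\<lambda>V x. indicator {t..<T} (fst x) * V (fst x) (snd x) :: real"
  note [measurable] = joint_T[OF YF Yc] joint_T[OF E Ec] joint_T[OF Q Qc]
  have [measurable]: "(\<lambda>x. c (fst x) (snd x)) \<in> borel_measurable (borel \<Otimes>\<^sub>M M)" using c_joint by (simp add: split_def)
  have "(\<lambda>x. indicator {t..<T} (fst x) * (if ?J Q x > 0 then c (fst x) (snd x) * (exp (?J Y x) * exp (?J E x) - eta * c (fst x) (snd x))
     - phi1 * (?J Q x)\<^sup>2 - phi2 * (exp (?J Y x) * exp (?J E x) * ?J Q x) - phi3 * (exp (?J Y x) * ?J Q x) else 0)) \<in> borel_measurable (borel \<Otimes>\<^sub>M M)"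
    by measurable
  also have "(\<lambda>x. indicator {t..<T} (fst x) * (if ?J Q x > 0 then c (fst x) (snd x) * (exp (?J Y x) * exp (?J E x) - eta * c (fst x) (snd x))
     - phi1 * (?J Q x)\<^sup>2 - phi2 * (exp (?J Y x) * exp (?J E x) * ?J Q x) - phi3 * (exp (?J Y x) * ?J Q x) else 0))
    = (\<lambda>(u, om). indicator {t..<T} u * ell u om)"
    by (auto simp: fun_eq_iff ell_def A_def indicator_def)
  finally show ?thesis .
qed

definition CE where "CE = 1 + \<bar>eta\<bar>"
definition CP where "CP = 1 + \<bar>phi1\<bar> * q\<^sup>2 + \<bar>phi2\<bar> * q + \<bar>phi3\<bar> * q"

lemma CE_CP: "0 \<le> CE" "0 \<le> CP" using q by (simp_all add: CE_def CP_def)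

text \<open>Controls are integrable in the square, so the product of control and price is split by
  \<open>2 * c * S \<le> c\<^sup>2 + S\<^sup>2\<close>. Log-price plus \<epsilon> is at most
  \<open>2 * BY * R1\<close>, which puts the squared price below
  \<open>exp (4 * BY * R1)\<close>.\<close>

lemma ell_bound:
  "AE om in M. \<forall>u\<in>{t..T}. \<bar>ell u om\<bar> \<le> CE * (c u om)\<^sup>2 + CP * exp (4 * BY * R1 om)"
  using E_bound AE_space
proof eventually_elim
  case (elim om)
  note w = elim(2)
  show ?case
  proof
    fix u assume u: "u \<in> {t..T}"
    define S where "S = A u om * exp (E u om)"
    define P where "P = exp (2 * BY * R1 om)"
    have R1: "1 \<le> R1 om" by (rule R1_pos[OF w])
    have BR: "0 \<le> BY * R1 om" using BY_nonneg R1 by simp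
    have "0 \<le> 2 * BY * R1 om" using BR by linarith
    then have P1: "1 \<le> P" by (simp add: P_def)
    have PP: "P\<^sup>2 = exp (4 * BY * R1 om)" by (simp add: P_def exp_double[symmetric] mult.assoc)
    have y: "Y u om \<le> BY * R1 om" "E u om \<le> BY * R1 om" using Y_bound[OF w u] elim(1) u by (auto simp: abs_le_iff)
    have "Y u om \<le> 2 * BY * R1 om" using y(1) BR by linarith
    then have A: "0 < A u om" "A u om \<le> P" by (simp_all add: A_def P_def)
    have S: "0 < S" "S \<le> P" using y A(1) unfolding S_def A_def P_def exp_add[symmetric] by auto
    have PP1: "P \<le> P\<^sup>2" using P1 by (simp add: power2_eq_square)
    have Qq: "0 \<le> Q u om" "Q u om \<le> q" using Qb[of u om] by auto
    have S2: "S\<^sup>2 \<le> P\<^sup>2" using S by (intro power_mono) auto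
    have "c u om * S \<le> (c u om)\<^sup>2 + P\<^sup>2"
      using sum_squares_bound[of "c u om" S] S2 mult_nonneg_nonneg[OF c_nonneg[of u om], of S] S(1) by linarith
    moreover have "\<bar>eta * (c u om)\<^sup>2\<bar> \<le> \<bar>eta\<bar> * (c u om)\<^sup>2" by (simp add: abs_mult)
    moreover have "\<bar>phi1 * (Q u om)\<^sup>2\<bar> \<le> \<bar>phi1\<bar> * q\<^sup>2 * P\<^sup>2"
    proof -
      have "(Q u om)\<^sup>2 \<le> q\<^sup>2" using Qq by (intro power_mono)
      also have "\<dots> \<le> q\<^sup>2 * P\<^sup>2" using mult_left_mono[of 1 "P\<^sup>2" "q\<^sup>2"] P1 PP1 by simp
      finally have "\<bar>phi1\<bar> * (Q u om)\<^sup>2 \<le> \<bar>phi1\<bar> * (q\<^sup>2 * P\<^sup>2)" by (rule mult_left_mono) simp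
      then show ?thesis by (simp add: abs_mult mult.assoc)
    qed
    moreover have "\<bar>phi2 * (S * Q u om)\<bar> \<le> \<bar>phi2\<bar> * q * P\<^sup>2"
    proof -
      have "S * Q u om \<le> P\<^sup>2 * q" using S Qq PP1 by (intro mult_mono) auto
      then have "\<bar>phi2\<bar> * (S * Q u om) \<le> \<bar>phi2\<bar> * (P\<^sup>2 * q)" by (rule mult_left_mono) simp
      then show ?thesis using S Qq by (simp add: abs_mult mult_ac)
    qed
    moreover have "\<bar>phi3 * (A u om * Q u om)\<bar> \<le> \<bar>phi3\<bar> * q * P\<^sup>2"
    proof -
      have "A u om * Q u om \<le> P\<^sup>2 * q" using A Qq PP1 by (intro mult_mono) auto
      then have "\<bar>phi3\<bar> * (A u om * Q u om) \<le> \<bar>phi3\<bar> * (P\<^sup>2 * q)" by (rule mult_left_mono) simp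
      then show ?thesis using A Qq by (simp add: abs_mult mult_ac)
    qed
    moreover have "0 \<le> c u om * S" using S c_nonneg by simp
    moreover have "CE * (c u om)\<^sup>2 + CP * P\<^sup>2 = (c u om)\<^sup>2 + \<bar>eta\<bar> * (c u om)\<^sup>2 + P\<^sup>2 + \<bar>phi1\<bar> * q\<^sup>2 * P\<^sup>2 + \<bar>phi2\<bar> * q * P\<^sup>2 + \<bar>phi3\<bar> * q * P\<^sup>2"
      by (simp add: CE_def CP_def distrib_right)
    ultimately have "\<bar>c u om * S - eta * (c u om)\<^sup>2 - phi1 * (Q u om)\<^sup>2 - phi2 * (S * Q u om) - phi3 * (A u om * Q u om)\<bar> \<le> CE * (c u om)\<^sup>2 + CP * P\<^sup>2"
      by (simp only: abs_le_iff) linarith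
    moreover have "ell u om = (if Q u om > 0 then c u om * S - eta * (c u om)\<^sup>2 - phi1 * (Q u om)\<^sup>2 - phi2 * (S * Q u om) - phi3 * (A u om * Q u om) else 0)"
      by (simp add: ell_def S_def power2_eq_square algebra_simps)
    moreover have "0 \<le> CE * (c u om)\<^sup>2 + CP * P\<^sup>2" using CE_CP by simp
    ultimately show "\<bar>ell u om\<bar> \<le> CE * (c u om)\<^sup>2 + CP * exp (4 * BY * R1 om)" unfolding PP by simp
  qed
qed

definition DL where "DL om = CE * (LBINT u:{t..T}. (c u om)\<^sup>2) + (T - t) * (CP * exp (4 * BY * R1 om))"

lemma DL_integrable: "integrable M DL"
  unfolding DL_def by (intro Bochner_Integration.integrable_add integrable_mult_right c2i R1_exp)

lemma dominating:
  assumes c2: "set_integrable lborel {t..T} (\<lambda>u. (c u om)\<^sup>2)"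
  shows "integrable lborel (\<lambda>u. indicator {t..T} u * (CE * (c u om)\<^sup>2 + CP * exp (4 * BY * R1 om)))"
    and "(LBINT u. indicator {t..T} u * (CE * (c u om)\<^sup>2 + CP * exp (4 * BY * R1 om))) = DL om"
proof -
  let ?p = "CP * exp (4 * BY * R1 om)"
  have 1: "set_integrable lborel {t..T} (\<lambda>u. CE * (c u om)\<^sup>2)" by (rule set_integrable_mult_right) (use c2 in simp)
  have 2: "set_integrable lborel {t..T} (\<lambda>u. ?p)" by (rule borel_integrable_atLeastAtMost') simp
  have 3: "(LBINT u:{t..T}. ?p) = (T - t) * ?p" using tT by (simp add: set_lebesgue_integral_def)
  show "integrable lborel (\<lambda>u. indicator {t..T} u * (CE * (c u om)\<^sup>2 + ?p))"
    using set_integral_add(1)[OF 1 2] by (simp add: set_integrable_def)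
  show "(LBINT u. indicator {t..T} u * (CE * (c u om)\<^sup>2 + ?p)) = DL om"
    using set_integral_add(2)[OF 1 2] tT unfolding 3 DL_def set_integral_mult_right by (simp add: set_lebesgue_integral_def)
qed

text \<open>Each of the two factors \<open>1 + x\<close> in the growth condition is at most twice
  its exponential bound, whence the 4.\<close>

definition D0 where "D0 om = C * (1 + q\<^sup>2) * (4 * exp ((p1 + p2) * BY * R1 om))"

lemma D0_integrable: "integrable M D0"
  unfolding D0_def by (intro integrable_mult_right R1_exp)

lemma w_bound:
  assumes u: "u \<in> {0..T}" and y: "\<bar>y\<bar> \<le> BY * R1 om" and e: "\<bar>e\<bar> \<le> BY * R1 om" and qq: "q' \<in> {0..q}"
  shows "\<bar>w u (exp y, e, q')\<bar> \<le> D0 om"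
proof -
  let ?b = "BY * R1 om"
  have b: "0 \<le> ?b" using y by linarith
  have "(exp y, e, q') \<in> stateO Qbar" using qq q by (auto simp: stateO_def)
  from growth[OF u this] have "\<bar>w u (exp y, e, q')\<bar> \<le> C * (1 + q'\<^sup>2) * (1 + exp y powr p1) * (1 + exp (p2 * e))" .
  also have "exp y powr p1 = exp (p1 * y)" by (simp add: powr_def)
  also have "C * (1 + q'\<^sup>2) * (1 + exp (p1 * y)) * (1 + exp (p2 * e)) \<le> C * (1 + q\<^sup>2) * (2 * exp (p1 * ?b)) * (2 * exp (p2 * ?b))"
  proof -
    have "p1 * y \<le> p1 * ?b" "p2 * e \<le> p2 * ?b" using pos y e by (auto intro!: mult_left_mono simp: abs_le_iff)
    then have 1: "exp (p1 * y) \<le> exp (p1 * ?b)" "exp (p2 * e) \<le> exp (p2 * ?b)" by simp_all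
    have 2: "1 \<le> exp (p1 * ?b)" "1 \<le> exp (p2 * ?b)" using pos b by simp_all
    have 3: "1 + exp (p1 * y) \<le> 2 * exp (p1 * ?b)" "1 + exp (p2 * e) \<le> 2 * exp (p2 * ?b)" using 1 2 by linarith+
    have 4: "q'\<^sup>2 \<le> q\<^sup>2" using qq by (intro power_mono) auto
    show ?thesis using 3 4 pos by (intro mult_mono mult_left_mono mult_nonneg_nonneg add_nonneg_nonneg) auto
  qed
  also have "\<dots> = D0 om" by (simp add: D0_def exp_add[symmetric] algebra_simps)
  finally show ?thesis .
qed

definition lam where "lam N u om = run_ind t Y N u om * run_ind t E N u om * pos_ind t Q u om"
definition HN where "HN N u om = w u (exp (trunc N (Y u om)), trunc N (E u om), Q u om)"

text \<open>Passage to log-price: the second derivative in log-price brings an extra first-order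
  term with coefficient \<open>sig1\<^sup>2 / 2\<close>, which the Ito correction in
  \<open>m\<close> cancels, so that the drift \<open>mu1\<close> reappears. Positive inventory gives
  access to the symmetry of \<open>D2w\<close>.\<close>

lemma gen_eq:
  assumes u: "u \<in> {t..<T}" and Qp: "Q u om > 0"
  shows "gen u om = wt u (X u om) + m * Dw u (X u om) (A u om, 0, 0) + (- k * E u om) * Dw u (X u om) (0, 1, 0)
    - c u om * Dw u (X u om) eq
    + (sig1\<^sup>2 * (D2w u (X u om) (A u om, 0, 0) (A u om, 0, 0) + Dw u (X u om) (A u om, 0, 0))
       + sig1 * (sig2 * rho) * (D2w u (X u om) (A u om, 0, 0) (0, 1, 0) + D2w u (X u om) (0, 1, 0) (A u om, 0, 0))
       + sig2\<^sup>2 * D2w u (X u om) (0, 1, 0) (0, 1, 0)) / 2"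
proof -
  have A: "(A u om, 0, 0) = A u om *\<^sub>R ea" "(0, 1, 0) = ee" by (simp_all add: ea_def ee_def)
  have "X u om \<in> {0<..} \<times> UNIV \<times> {0<..<Qbar}" using Qp Qb[of u om] q by (auto simp: X_def A_def)
  then have sym: "D2w u (X u om) ee ea = D2w u (X u om) ea ee" by (intro D2w_symmetric) (use u t0 in auto)
  have op: "op_L mu1 sig1 k sig2 rho D D2 (X u om) = sig1\<^sup>2 / 2 * (A u om)\<^sup>2 * d2 D2 ea ea + rho * sig1 * sig2 * A u om * d2 D2 ea ee
      + sig2\<^sup>2 / 2 * d2 D2 ee ee + mu1 * A u om * d1 D ea - k * E u om * d1 D ee" for D D2
    by (simp add: op_L_def X_def)
  show ?thesis
    unfolding gen_def op A d1_def d2_def blinfun.scaleR_right blinfun.scaleR_left real_scaleR_def sym m_def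
    by (simp add: power2_eq_square field_simps)
qed

lemma lam_joint:
  assumes r: "t < r" "r < T"
  shows "jointly M (\<lambda>u om. indicator {t..<r} u * lam N u om)"
proof -
  have rT: "r \<le> T" and tr: "t < r" using r by simp_all
  note cc = sub_cont[OF _ rT]
  have VM: "V u \<in> borel_measurable M" if "\<And>u. u \<in> {t..T} \<Longrightarrow> V u \<in> borel_measurable (F u)" "u \<in> {t..r}" for V :: "real \<Rightarrow> 'w \<Rightarrow> real" and u
    using to_M[OF _ that(1)] that(2) r by fastforce
  have "(\<lambda>x. (case x of (u, om) \<Rightarrow> indicator {t..<r} u * run_ind t Y N u om) * (case x of (u, om) \<Rightarrow> indicator {t..<r} u * run_ind t E N u om)
     * (case x of (u, om) \<Rightarrow> indicator {t..<r} u * pos_ind t Q u om)) \<in> borel_measurable (borel \<Otimes>\<^sub>M M)"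
    by (intro borel_measurable_times run_ind_joint[OF tr VM[OF YF] cc(1)] run_ind_joint[OF tr VM[OF E] cc(2)]
         pos_ind_joint[OF tr VM[OF Q] cc(3) Qb])
  also have "(\<lambda>x. (case x of (u, om) \<Rightarrow> indicator {t..<r} u * run_ind t Y N u om) * (case x of (u, om) \<Rightarrow> indicator {t..<r} u * run_ind t E N u om)
     * (case x of (u, om) \<Rightarrow> indicator {t..<r} u * pos_ind t Q u om)) = (\<lambda>(u, om). indicator {t..<r} u * lam N u om)"
    by (auto simp: fun_eq_iff lam_def indicator_def)
  finally show ?thesis .
qed

text \<open>Dynkin's formula at truncation level \<open>N\<close> and horizon \<open>r < T\<close>.
  Wherever the weight is not 0, log-price and \<epsilon> lie where truncation is the identity, so
  the generator of the truncated function is \<open>gen\<close> itself.\<close>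

lemma stage:
  fixes r N :: real
  assumes r: "t < r" "r < T" and N: "N \<ge> 1"
  shows "\<exists>L. integrable M L \<and>
      (\<forall>om\<in>space M. \<exists>\<tau>. stop_weight t r (\<lambda>u. lam N u om) \<tau> \<and> L om = HN N \<tau> om - HN N t om) \<and>
      integrable M (\<lambda>om. LBINT u. indicator {t..<r} u * (lam N u om * gen u om)) \<and>
      (AE om in M. integrable lborel (\<lambda>u. indicator {t..<r} u * (lam N u om * gen u om))) \<and>
      (LINT om|M. L om) = (LINT om|M. LINT u|lborel. indicator {t..<r} u * (lam N u om * gen u om))"
proof -
  obtain K where K: "test_fun t r q K (tf t r q N) (tft t r q N) (tfy t r q N) (tfe t r q N) (tfq t r q N) (tfyy t r q N) (tfye t r q N) (tfee t r q N)"
    using tf_test_fun[OF t0 r q N] by blast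
  have rT: "r \<le> T" and tr: "t < r" using r by simp_all
  have sub: "{t..r} \<subseteq> {t..T}" using r by auto
  note cc = sub_cont[OF _ rT]
  have K0: "0 \<le> K" using test_fun.K_nonneg[OF K] .
  have lin: "\<bar>x\<bar> \<le> 1 + x\<^sup>2" for x :: real
    using sum_squares_bound[of "\<bar>x\<bar>" 1] by simp
  have c1: "AE om in M. set_integrable lborel {t..T} (\<lambda>u. c u om) \<and> (LBINT u:{t..T}. \<bar>c u om\<bar>) \<le> T + (LBINT u:{t..T}. (c u om)\<^sup>2)"
    using c2 AE_space
  proof eventually_elim
    case (elim om)
    have cm[measurable]: "(\<lambda>u. c u om) \<in> borel_measurable borel" by (rule section_measurable'[OF c_joint elim(2)])
    have one: "set_integrable lborel {t..T} (\<lambda>u. 1::real)" by (rule borel_integrable_atLeastAtMost') simp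
    have i: "set_integrable lborel {t..T} (\<lambda>u. c u om)"
      by (rule set_integrable_bound[OF set_integral_add(1)[OF one elim(1)]])
         (use lin in \<open>auto simp: set_borel_measurable_def intro!: AE_I2\<close>)
    have "(LBINT u:{t..T}. \<bar>c u om\<bar>) \<le> (LBINT u:{t..T}. 1 + (c u om)\<^sup>2)"
      by (rule set_integral_mono[OF set_integrable_abs[OF i] set_integral_add(1)[OF one elim(1)]]) (rule lin)
    also have "\<dots> = (T - t) + (LBINT u:{t..T}. (c u om)\<^sup>2)"
      using set_integral_add(2)[OF one elim(1)] tT by (simp add: set_lebesgue_integral_def)
    finally show ?case using i t0 by simp
  qed
  have Ej: "jointly M (\<lambda>u om. indicator {t..<T} u * E u om)"
    using joint_T[OF E Ec] by (simp add: split_def)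
  \<comment> \<open>Cut to \<open>{t..<T}\<close> so as to be jointly measurable on the whole time
    axis; on \<open>{t..r}\<close> it is the mean reversion, since \<open>r < T\<close>.\<close>
  define b where "b u om = - k * (indicator {t..<T} u * E u om)" for u om
  have b_joint: "jointly M b"
    unfolding b_def split_def by (rule borel_measurable_times[OF borel_measurable_const Ej[unfolded split_def]])
  have b_eq: "b u om = - k * E u om" if "u \<in> {t..r}" for u om using that r by (simp add: b_def)
  have bI: "set_integrable lborel {u..v} (\<lambda>x. b x om)" "(LBINT x:{u..v}. b x om) = (LBINT x:{u..v}. - k * E x om)"
    if "om \<in> space M" "t \<le> u" "v \<le> r" for u v om
  proof -
    have "set_integrable lborel {u..v} (\<lambda>x. - k * E x om)"
      by (intro borel_integrable_atLeastAtMost' continuous_intros continuous_on_subset[OF Ec[OF that(1)]]) (use that r in auto)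
    moreover have eq: "b x om = - k * E x om" if "x \<in> {u..v}" for x using b_eq that \<open>t \<le> u\<close> \<open>v \<le> r\<close> by auto
    ultimately show "set_integrable lborel {u..v} (\<lambda>x. b x om)" by (subst set_integrable_cong[OF refl refl eq])
    show "(LBINT x:{u..v}. b x om) = (LBINT x:{u..v}. - k * E x om)"
      by (rule set_lebesgue_integral_cong) (use eq in auto)
  qed
  interpret D: dynkin_setup M W1 W2 T t r q K "tf t r q N" "tft t r q N" "tfy t r q N" "tfe t r q N" "tfq t r q N" "tfyy t r q N" "tfye t r q N" "tfee t r q N"
     "ln a" m sig1 sig2 rho E Q "lam N" b c
  proof (rule dynkin_setup.intro[OF bm2_axioms K], rule dynkin_setup_axioms.intro)
    show "0 \<le> t" "r \<le> T" "rho\<^sup>2 \<le> 1" by (fact t0 rT rho)+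
    show "E u \<in> borel_measurable (F u)" "Q u \<in> borel_measurable (F u)" if "u \<in> {t..r}" for u using E Q that sub by auto
    show "continuous_on {t..r} (\<lambda>u. E u om)" "continuous_on {t..r} (\<lambda>u. Q u om)" if "om \<in> space M" for om using cc that by auto
    show "Q u om \<in> {0..q}" for u om by (rule Qb)
    show "lam N u \<in> borel_measurable (F u)" if u: "u \<in> {t..r}" for u
    proof -
      have V: "V s \<in> borel_measurable (F u)" if "\<And>u. u \<in> {t..T} \<Longrightarrow> V u \<in> borel_measurable (F u)" "s \<in> {t..u}" for V :: "real \<Rightarrow> 'w \<Rightarrow> real" and s
        using F_measurable_mono[OF _ that(1), of s u] that(2) u r by auto
      have c: "continuous_on {t..u} (\<lambda>s. Y s om)" "continuous_on {t..u} (\<lambda>s. E s om)" "continuous_on {t..u} (\<lambda>s. Q s om)" if "om \<in> space M" for om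
        using sub_cont[OF that, of u] u r by auto
      show ?thesis unfolding lam_def
        by (intro borel_measurable_times run_ind_measurable pos_ind_measurable[where q=q] V YF E Q Qb)
           (use u c in auto)
    qed
    show "lam N u om \<in> {0, 1}" for u om by (auto simp: lam_def run_ind_def pos_ind_def)
    show "lam N v om \<le> lam N u om" if "u \<le> v" for u v om
    proof -
      have "run_ind t V R v om \<le> run_ind t V R u om" for V :: "real \<Rightarrow> 'w \<Rightarrow> real" and R using that by (auto simp: run_ind_def)
      moreover have "pos_ind t Q v om \<le> pos_ind t Q u om" using that by (auto simp: pos_ind_def)
      moreover have "0 \<le> run_ind t V R s om" "0 \<le> pos_ind t Q s om" for V :: "real \<Rightarrow> 'w \<Rightarrow> real" and R s by (auto simp: run_ind_def pos_ind_def)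
      ultimately show ?thesis unfolding lam_def by (intro mult_mono mult_nonneg_nonneg)
    qed
    show "jointly M (\<lambda>u om. indicator {t..<r} u * lam N u om)"
      by (rule lam_joint[OF r])
    show "jointly M b" "jointly M c"
      by (fact b_joint c_joint)+
    show "AE om in M. set_integrable lborel {t..r} (\<lambda>u. b u om)" by (rule AE_I2) (rule bI(1), auto)
    show "AE om in M. set_integrable lborel {t..r} (\<lambda>u. c u om)"
      using c1 by eventually_elim (use sub in \<open>auto intro: set_integrable_subset\<close>)
    show "AE om in M. \<forall>u v. t \<le> u \<longrightarrow> u \<le> v \<longrightarrow> v \<le> r \<longrightarrow> E v om - E u om = (LBINT x:{u..v}. b x om)
        + sig2 * (rho * (W1 v om - W1 u om) + sqrt (1 - rho\<^sup>2) * (W2 v om - W2 u om))"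
      using Eb AE_space by eventually_elim (use bI(2) rT in auto)
    show "AE om in M. \<forall>u v. t \<le> u \<longrightarrow> u \<le> v \<longrightarrow> v \<le> r \<longrightarrow> Q v om - Q u om = - (LBINT x:{u..v}. c x om)"
      using Qc' by eventually_elim (use rT in auto)
    show "integrable M (\<lambda>om. LBINT u:{t..r}. K * (1 + \<bar>m\<bar> + \<bar>b u om\<bar> + \<bar>c u om\<bar>))"
    proof (rule Bochner_Integration.integrable_bound)
      let ?B = "\<lambda>om. K * (T * (1 + \<bar>m\<bar> + k * (BY * exp (1 * R1 om))) + (T + (LBINT u:{t..T}. (c u om)\<^sup>2)))"
      show "integrable M ?B" by (intro integrable_mult_right Bochner_Integration.integrable_add integrable_const R1_exp c2i)
      have "jointly M (\<lambda>u om. indicator {t..r} u * (K * (1 + \<bar>m\<bar> + \<bar>b u om\<bar> + \<bar>c u om\<bar>)))"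
        using b_joint c_joint unfolding split_def by measurable
      from time_integral_measurable[OF this]
      show "(\<lambda>om. LBINT u:{t..r}. K * (1 + \<bar>m\<bar> + \<bar>b u om\<bar> + \<bar>c u om\<bar>)) \<in> borel_measurable M"
        unfolding set_lebesgue_integral_def real_scaleR_def .
      show "AE om in M. norm (LBINT u:{t..r}. K * (1 + \<bar>m\<bar> + \<bar>b u om\<bar> + \<bar>c u om\<bar>)) \<le> norm (?B om)"
        using c1 E_bound AE_space
      proof eventually_elim
        case (elim om)
        let ?c = "1 + \<bar>m\<bar> + k * (BY * exp (R1 om))"
        \<comment> \<open>Integrability of multiples of \<open>R1\<close> is obtained through its
          exponential.\<close>
        have R: "R1 om \<le> exp (R1 om)" using exp_ge_add_one_self[of "R1 om"] by linarith
        have b0: "\<bar>b u om\<bar> \<le> k * (BY * exp (R1 om))" if "u \<in> {t..r}" for u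
        proof -
          have "\<bar>b u om\<bar> = k * \<bar>E u om\<bar>" using b_eq[OF that] k by (simp add: abs_mult)
          also have "\<dots> \<le> k * (BY * R1 om)" using elim(2) that sub k by (intro mult_left_mono) auto
          also have "\<dots> \<le> k * (BY * exp (R1 om))" using k BY_nonneg R by (intro mult_left_mono) auto
          finally show ?thesis .
        qed
        have ciT: "set_integrable lborel {t..T} (\<lambda>u. \<bar>c u om\<bar>)" by (rule set_integrable_abs[OF conjunct1[OF elim(1)]])
        have ci: "set_integrable lborel {t..r} (\<lambda>u. \<bar>c u om\<bar>)" using elim(1) sub by (auto intro!: set_integrable_abs intro: set_integrable_subset)
        have cst: "set_integrable lborel {t..r} (\<lambda>u. ?c)" by (rule borel_integrable_atLeastAtMost') simp
        have cst1: "set_integrable lborel {t..r} (\<lambda>u. 1 + \<bar>m\<bar>)" by (rule borel_integrable_atLeastAtMost') simp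
        have i1: "set_integrable lborel {t..r} (\<lambda>u. 1 + \<bar>m\<bar> + \<bar>b u om\<bar> + \<bar>c u om\<bar>)"
          using set_integral_add(1)[OF set_integral_add(1)[OF cst1 set_integrable_abs[OF bI(1)[OF elim(3) order_refl order_refl]]] ci] .
        have "(LBINT u:{t..r}. 1 + \<bar>m\<bar> + \<bar>b u om\<bar> + \<bar>c u om\<bar>) \<le> (LBINT u:{t..r}. ?c + \<bar>c u om\<bar>)"
          by (rule set_integral_mono[OF i1 set_integral_add(1)[OF cst ci]]) (use b0 in auto)
        also have "\<dots> = (r - t) * ?c + (LBINT u:{t..r}. \<bar>c u om\<bar>)"
          using set_integral_add(2)[OF cst ci] tr by (simp add: set_lebesgue_integral_def)
        also have "\<dots> \<le> T * ?c + (T + (LBINT u:{t..T}. (c u om)\<^sup>2))"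
        proof (rule add_mono)
          show "(r - t) * ?c \<le> T * ?c" using t0 rT k BY_nonneg by (intro mult_right_mono add_nonneg_nonneg mult_nonneg_nonneg) auto
          have "(LBINT u:{t..r}. \<bar>c u om\<bar>) \<le> (LBINT u:{t..T}. \<bar>c u om\<bar>)"
            unfolding set_lebesgue_integral_def
            by (rule integral_mono[OF ci[unfolded set_integrable_def] ciT[unfolded set_integrable_def]])
               (use r in \<open>auto simp: indicator_def\<close>)
          then show "(LBINT u:{t..r}. \<bar>c u om\<bar>) \<le> T + (LBINT u:{t..T}. (c u om)\<^sup>2)" using elim(1) by linarith
        qed
        finally have le: "(LBINT u:{t..r}. 1 + \<bar>m\<bar> + \<bar>b u om\<bar> + \<bar>c u om\<bar>) \<le> T * ?c + (T + (LBINT u:{t..T}. (c u om)\<^sup>2))" .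
        have ge: "0 \<le> (LBINT u:{t..r}. 1 + \<bar>m\<bar> + \<bar>b u om\<bar> + \<bar>c u om\<bar>)"
          unfolding set_lebesgue_integral_def by (intro integral_nonneg_AE AE_I2) auto
        have "(LBINT u:{t..r}. K * (1 + \<bar>m\<bar> + \<bar>b u om\<bar> + \<bar>c u om\<bar>)) = K * (LBINT u:{t..r}. 1 + \<bar>m\<bar> + \<bar>b u om\<bar> + \<bar>c u om\<bar>)"
          by (rule set_integral_mult_right)
        then show ?case using mult_left_mono[OF le K0] mult_nonneg_nonneg[OF K0 ge] by simp
      qed
    qed
  qed
  note cu_D = cu_def[OF t0 r q N] and pt_D = pt_def[OF t0 r q N] and tf_D = tf_def[OF t0 r q N] and tft_D = tft_def[OF t0 r q N] and tfy_D = tfy_def[OF t0 r q N] and tfe_D = tfe_def[OF t0 r q N] and tfq_D = tfq_def[OF t0 r q N] and tfyy_D = tfyy_def[OF t0 r q N] and tfye_D = tfye_def[OF t0 r q N] and tfee_D = tfee_def[OF t0 r q N] and vy_D = vy_def[OF t0 r q N] and vyy_D = vyy_def[OF t0 r q N] and ve_D = ve_def[OF t0 r q N] and vee_D = vee_def[OF t0 r q N]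
  have cu: "cu t r u = u" if "u \<in> {t..r}" for u using that by (auto simp: cu_D)
  have pt: "pt q N (Y u om) (E u om) (Q u om) = (exp (trunc N (Y u om)), trunc N (E u om), Q u om)" for u om
    using Qb[of u om] by (auto simp: pt_D)
  have YD: "D.Y = Y" by (auto simp: fun_eq_iff D.Y_def Y_def)
  have HH: "D.HH u om = HN N u om" if "u \<in> {t..r}" for u om
    unfolding D.HH_def YD HN_def tf_D pt cu[OF that] ..
  have gen: "indicator {t..<r} u * (lam N u om * (D.gen_drift u om + D.gen_noise u om)) = indicator {t..<r} u * (lam N u om * gen u om)" for u om
  proof (cases "u \<in> {t..<r} \<and> lam N u om \<noteq> 0")
    case True
    then have u: "u \<in> {t..r}" "u \<in> {t..<T}" using r by auto
    have N': "\<bar>Y u om\<bar> \<le> N" "\<bar>E u om\<bar> \<le> N" and Qp: "Q u om > 0" using True u(1) by (auto simp: lam_def run_ind_def pos_ind_def split: if_splits)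
    note tr_id = trunc_id[OF N'(1)] trunc_id[OF N'(2)]
    have ptX: "pt q N (Y u om) (E u om) (Q u om) = X u om" by (simp add: pt tr_id X_def A_def)
    have v: "vy N (Y u om) = (A u om, 0, 0)" "vyy N (Y u om) = (A u om, 0, 0)" "ve N (E u om) = (0, 1, 0)" "vee N (E u om) = 0"
      by (simp_all add: vy_D vyy_D ve_D vee_D tr_id A_def zero_prod_def)
    have "D.gen_drift u om + D.gen_noise u om = gen u om"
      unfolding D.gen_drift_def D.gen_noise_def YD gen_eq[OF u(2) Qp] tft_D tfy_D tfe_D tfq_D tfyy_D tfye_D tfee_D
        cu[OF u(1)] ptX v b_eq[OF u(1)] blinfun.zero_right by simp
    then show ?thesis by simp
  qed auto
  have tau: "\<exists>\<tau>. stop_weight t r (\<lambda>u. lam N u om) \<tau> \<and> D.Lim om = HN N \<tau> om - HN N t om" if w: "om \<in> space M" for om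
  proof -
    obtain \<tau> where \<tau>: "stop_weight t r (\<lambda>u. lam N u om) \<tau>" "D.Lim om = D.HH \<tau> om - D.HH t om" using D.XX_tendsto(2)[OF w] by blast
    moreover have "\<tau> \<in> {t..r}" "t \<in> {t..r}" using \<tau>(1) tr by (auto simp: stop_weight_def)
    ultimately show ?thesis using HH by auto
  qed
  show ?thesis
    by (rule exI[of _ D.Lim]) (use D.dynkin[unfolded gen] tau in blast)
qed

text \<open>Levels and horizons grow together with one index; the \<open>real n + 2\<close> in
  \<open>rn\<close> keeps it strictly between \<open>t\<close> and \<open>T\<close> already for
  \<open>n = 0\<close>.\<close>

definition Nn :: "nat \<Rightarrow> real" where "Nn n = real n + 1"
definition rn :: "nat \<Rightarrow> real" where "rn n = T - (T - t) / (real n + 2)"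

lemma rn: "t < rn n" "rn n < T" and Nn: "Nn n \<ge> 1"
proof -
  have "(T - t) / (real n + 2) < T - t" using tT by (simp add: divide_less_eq)
  then show "t < rn n" by (simp add: rn_def)
  show "rn n < T" using tT by (simp add: rn_def)
  show "Nn n \<ge> 1" by (simp add: Nn_def)
qed

lemma rn_tendsto: "rn \<longlonglongrightarrow> T"
proof -
  have "(\<lambda>n. (T - t) / (real n + 2)) \<longlonglongrightarrow> 0" by real_asymp
  from tendsto_diff[OF tendsto_const this] show ?thesis by (simp add: rn_def[abs_def])
qed

lemma Nn_eventually: "\<forall>\<^sub>F n in sequentially. b \<le> Nn n"
proof -
  have "filterlim Nn at_top sequentially" unfolding Nn_def[abs_def] by real_asymp
  then show ?thesis by (simp add: filterlim_at_top)
qed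

lemma X_in: "X u om \<in> stateO Qbar"
  using Qb[of u om] q by (auto simp: X_def A_def stateO_def)

lemma w_path_cont: "om \<in> space M \<Longrightarrow> continuous_on {t..T} (\<lambda>u. w u (X u om))"
proof -
  assume w: "om \<in> space M"
  have "continuous_on {t..T} (\<lambda>u. (u, X u om))" unfolding X_def A_def by (intro continuous_intros Yc[OF w] Ec[OF w] Qc[OF w])
  moreover have "(\<lambda>u. (u, X u om)) ` {t..T} \<subseteq> {0..T} \<times> stateO_cl Qbar"
  proof -
    have "X u om \<in> stateO_cl Qbar" for u using X_in[of u om] by (auto simp: stateO_def stateO_cl_def)
    then show ?thesis using t0 by auto
  qed
  ultimately have "continuous_on {t..T} (\<lambda>u. (\<lambda>(t, x). w t x) (u, X u om))" by (rule continuous_on_compose2[OF cont])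
  then show ?thesis by simp
qed

text \<open>By \<open>trunc_abs_le\<close> the truncated state obeys the same bounds as the path, so
  the growth condition gives one majorant for all levels \<open>N\<close>.\<close>

lemma HN_bound: "AE om in M. \<forall>u\<in>{t..T}. \<forall>N\<ge>1. \<bar>HN N u om\<bar> \<le> D0 om"
  using E_bound AE_space
proof eventually_elim
  case (elim om)
  show ?case
  proof (intro ballI allI impI)
    fix u N :: real assume u: "u \<in> {t..T}" and N: "1 \<le> N"
    show "\<bar>HN N u om\<bar> \<le> D0 om" unfolding HN_def
    proof (rule w_bound)
      show "\<bar>trunc N (Y u om)\<bar> \<le> BY * R1 om" using order_trans[OF trunc_abs_le[OF N] Y_bound[OF elim(2) u]] .
      show "\<bar>trunc N (E u om)\<bar> \<le> BY * R1 om" using order_trans[OF trunc_abs_le[OF N]] elim(1) u by auto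
    qed (use u t0 Qb in auto)
  qed
qed

lemma HN_X: "\<bar>Y u om\<bar> \<le> N \<Longrightarrow> \<bar>E u om\<bar> \<le> N \<Longrightarrow> HN N u om = w u (X u om)"
  by (simp add: HN_def X_def A_def trunc_id)

lemma X_t: "om \<in> space M \<Longrightarrow> X t om = (a, e0, q)"
  using a by (simp add: X_def A_def Y_def E_t Q_t)

text \<open>Once the inventory is exhausted before \<open>r\<close>, both \<open>w\<close> at the stopping time and \<open>w\<close> at \<open>r\<close> vanish.\<close>

lemma stopped_value:
  assumes w: "om \<in> space M" and r: "t < r" "r < T"
    and anti: "\<And>u v. t \<le> u \<Longrightarrow> u \<le> v \<Longrightarrow> v \<le> T \<Longrightarrow> Q v om \<le> Q u om"
    and N: "\<And>u. u \<in> {t..T} \<Longrightarrow> \<bar>Y u om\<bar> \<le> N \<and> \<bar>E u om\<bar> \<le> N"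
    and s: "stop_weight t r (\<lambda>u. lam N u om) \<tau>"
  shows "HN N \<tau> om = w r (X r om)"
proof -
  have \<tau>: "\<tau> \<in> {t..r}" using s by (simp add: stop_weight_def)
  have lam1: "lam N u om = 1" if "u \<in> {t..r}" "Q u om > 0" for u
  proof -
    have "Q s om > 0" if "s \<in> {t..u}" for s using anti[of s u] that \<open>u \<in> {t..r}\<close> \<open>Q u om > 0\<close> r by fastforce
    then show ?thesis using N that r by (auto simp: lam_def run_ind_def pos_ind_def)
  qed
  have H: "HN N \<tau> om = w \<tau> (X \<tau> om)" using N \<tau> r by (intro HN_X) auto
  show ?thesis
  proof (cases "Q r om > 0")
    case True
    have "\<tau> = r"
    proof (rule ccontr)
      assume "\<tau> \<noteq> r"
      then have "lam N r om = 0" using s \<tau> r by (auto simp: stop_weight_def)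
      then show False using lam1[of r] True r by simp
    qed
    then show ?thesis using H by simp
  next
    case False
    then have Qr: "Q r om = 0" using Qb[of r om] by auto
    have Qt: "Q \<tau> om = 0"
    proof (rule ccontr)
      assume "Q \<tau> om \<noteq> 0"
      then have pos: "Q \<tau> om > 0" using Qb[of \<tau> om] by auto
      then have lt: "\<tau> < r" using Qr \<tau> by (cases "\<tau> = r") auto
      have "continuous_on {t..r} (\<lambda>u. Q u om)" using sub_cont(3)[OF w] r by simp
      then have "((\<lambda>u. Q u om) \<longlongrightarrow> Q \<tau> om) (at \<tau> within {t..r})" using \<tau> by (auto simp: continuous_on_def)
      then have "\<forall>\<^sub>F u in at \<tau> within {t..r}. Q u om > 0" using pos by (auto dest: order_tendstoD(1))
      then obtain d where d: "d > 0" "\<And>u. u \<in> {t..r} \<Longrightarrow> u \<noteq> \<tau> \<Longrightarrow> dist u \<tau> < d \<Longrightarrow> Q u om > 0"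
        by (auto simp: eventually_at)
      define e where "e = min (d / 2) ((r - \<tau>) / 2)"
      define u where "u = \<tau> + e"
      have e1: "0 < e" using d(1) lt by (simp add: e_def)
      have e: "0 < e" "e \<le> d / 2" "e \<le> (r - \<tau>) / 2" by (rule e1, simp only: e_def min.cobounded1, simp only: e_def min.cobounded2)
      have "u \<le> r" using e(3) lt unfolding u_def by (simp add: field_simps)
      moreover have "dist u \<tau> = e" using e(1) by (simp add: u_def dist_real_def)
      ultimately have u: "\<tau> < u" "u \<in> {t..r}" "dist u \<tau> < d" using e \<tau> d(1) by (auto simp: u_def)
      then have "lam N u om = 1" using lam1 d(2) by auto
      moreover have "lam N u om = 0" using s u by (auto simp: stop_weight_def)
      ultimately show False by simp
    qed
    have "w \<tau> (X \<tau> om) = 0" using boundary[of \<tau> "A \<tau> om" "E \<tau> om"] Qt \<tau> r t0 by (simp add: X_def A_def)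
    moreover have "w r (X r om) = 0" using boundary[of r "A r om" "E r om"] Qr r t0 by (simp add: X_def A_def)
    ultimately show ?thesis using H by simp
  qed
qed

text \<open>A fixed path is eventually within the truncation range, so only depletion or the horizon
  stops it and \<open>stopped_value\<close> applies; continuity of \<open>w\<close> up to
  \<open>T\<close> gives the limit. The statement ranges over all choices of stopping times because
  these are known to exist path by path only.\<close>

lemma L_limit:
  "AE om in M. \<forall>\<tau>. (\<forall>n. stop_weight t (rn n) (\<lambda>u. lam (Nn n) u om) (\<tau> n)) \<longrightarrow>
     (\<lambda>n. HN (Nn n) (\<tau> n) om - HN (Nn n) t om) \<longlonglongrightarrow> w T (X T om) - w t (a, e0, q)"
  using E_bound Q_antimono AE_space
proof eventually_elim
  case (elim om)
  note w = elim(3)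
  show ?case
  proof (intro allI impI)
    fix \<tau> assume s: "\<forall>n. stop_weight t (rn n) (\<lambda>u. lam (Nn n) u om) (\<tau> n)"
    have "(\<lambda>n. w (rn n) (X (rn n) om)) \<longlonglongrightarrow> w T (X T om)"
      by (rule continuous_on_tendsto_compose[OF w_path_cont[OF w] rn_tendsto])
         (use rn tT in \<open>auto intro!: always_eventually less_imp_le\<close>)
    then have lim: "(\<lambda>n. w (rn n) (X (rn n) om) - w t (a, e0, q)) \<longlonglongrightarrow> w T (X T om) - w t (a, e0, q)" by (intro tendsto_intros)
    show "(\<lambda>n. HN (Nn n) (\<tau> n) om - HN (Nn n) t om) \<longlonglongrightarrow> w T (X T om) - w t (a, e0, q)"
    proof (rule Lim_transform_eventually[OF lim])
      show "\<forall>\<^sub>F n in sequentially. w (rn n) (X (rn n) om) - w t (a, e0, q) = HN (Nn n) (\<tau> n) om - HN (Nn n) t om"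
        using Nn_eventually[of "BY * R1 om"]
      proof eventually_elim
        case (elim n)
        have N: "\<bar>Y u om\<bar> \<le> Nn n \<and> \<bar>E u om\<bar> \<le> Nn n" if "u \<in> {t..T}" for u
          using order_trans[OF Y_bound[OF w that] elim] \<open>\<forall>u\<in>{t..T}. \<bar>E u om\<bar> \<le> BY * R1 om\<close> that elim by fastforce
        have "HN (Nn n) (\<tau> n) om = w (rn n) (X (rn n) om)"
          by (rule stopped_value[OF w rn _ N]) (use s \<open>\<forall>u v. t \<le> u \<longrightarrow> u \<le> v \<longrightarrow> v \<le> T \<longrightarrow> Q v om \<le> Q u om\<close> in auto)
        moreover have "HN (Nn n) t om = w t (X t om)" using N[of t] tT by (intro HN_X) auto
        ultimately show ?case by (simp add: X_t[OF w])
      qed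
    qed
  qed
qed

definition ellN where "ellN n u om = indicator {t..<rn n} u * (lam (Nn n) u om * ell u om)"

lemma ellN_joint: "jointly M (\<lambda>u om. ellN n u om)"
proof -
  have "(\<lambda>x. (case x of (u, om) \<Rightarrow> indicator {t..<rn n} u * lam (Nn n) u om) * (case x of (u, om) \<Rightarrow> indicator {t..<T} u * ell u om)) \<in> borel_measurable (borel \<Otimes>\<^sub>M M)"
    by (intro borel_measurable_times lam_joint[OF rn] ell_joint)
  also have "(\<lambda>x. (case x of (u, om) \<Rightarrow> indicator {t..<rn n} u * lam (Nn n) u om) * (case x of (u, om) \<Rightarrow> indicator {t..<T} u * ell u om))
     = (\<lambda>(u, om). ellN n u om)"
    using rn(2)[of n] by (auto simp: fun_eq_iff ellN_def indicator_def)
  finally show ?thesis .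
qed

lemma lam01: "lam N u om \<in> {0, 1}" "0 \<le> lam N u om" "lam N u om \<le> 1"
  by (auto simp: lam_def run_ind_def pos_ind_def)

definition EL where "EL om = (LBINT u. indicator {t..<T} u * ell u om)"

text \<open>At a time with positive inventory the weight is eventually 1, since earlier inventories
  are at least as large and the level exceeds the path. Where the inventory is 0, all terms
  vanish.\<close>

lemma ellN_limit:
  "AE om in M. (\<lambda>n. LBINT u. ellN n u om) \<longlonglongrightarrow> EL om \<and> (\<forall>n. integrable lborel (\<lambda>u. ellN n u om) \<and> \<bar>LBINT u. ellN n u om\<bar> \<le> DL om)"
  using ell_bound c2 Q_antimono E_bound AE_space
proof eventually_elim
  case (elim om)
  note w = elim(5)
  let ?W = "\<lambda>u. indicator {t..T} u * (CE * (c u om)\<^sup>2 + CP * exp (4 * BY * R1 om))"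
  note W = dominating[OF elim(2)]
  have m1: "(\<lambda>u. ellN n u om) \<in> borel_measurable lborel" for n using section_measurable'[OF ellN_joint w] by simp
  have m2: "(\<lambda>u. indicator {t..<T} u * ell u om) \<in> borel_measurable lborel" using section_measurable'[OF ell_joint w] by simp
  have bd: "\<bar>ellN n u om\<bar> \<le> ?W u" for n u
  proof (cases "u \<in> {t..<rn n}")
    case True
    then have u: "u \<in> {t..T}" using rn(2)[of n] by auto
    have "\<bar>lam (Nn n) u om\<bar> * \<bar>ell u om\<bar> \<le> 1 * (CE * (c u om)\<^sup>2 + CP * exp (4 * BY * R1 om))"
      using elim(1) u lam01[of "Nn n" u om] by (intro mult_mono) auto
    then show ?thesis using True u by (simp add: ellN_def abs_mult)
  next
    case False
    then show ?thesis using CE_CP by (simp add: ellN_def indicator_def)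
  qed
  have i: "integrable lborel (\<lambda>u. ellN n u om)" for n
    by (rule Bochner_Integration.integrable_bound[OF W(1) m1]) (use bd in \<open>auto intro!: AE_I2 order_trans[OF _ abs_ge_self]\<close>)
  have "\<bar>LBINT u. ellN n u om\<bar> \<le> DL om" for n
  proof -
    have "\<bar>LBINT u. ellN n u om\<bar> \<le> (LBINT u. \<bar>ellN n u om\<bar>)"
      using integral_norm_bound[of lborel "\<lambda>u. ellN n u om"] by simp
    also have "\<dots> \<le> (LBINT u. ?W u)" by (rule integral_mono) (use i W(1) bd in auto)
    finally show ?thesis unfolding W(2) .
  qed
  moreover have "(\<lambda>n. LBINT u. ellN n u om) \<longlonglongrightarrow> EL om"
    unfolding EL_def
  proof (rule integral_dominated_convergence[OF m2 m1 W(1)])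
    show "AE u in lborel. (\<lambda>n. ellN n u om) \<longlonglongrightarrow> indicator {t..<T} u * ell u om"
    proof (rule AE_I2)
      fix u
      show "(\<lambda>n. ellN n u om) \<longlonglongrightarrow> indicator {t..<T} u * ell u om"
      proof (cases "u \<in> {t..<T} \<and> Q u om > 0")
        case True
        then have u: "t \<le> u" "u < T" by auto
        have "\<forall>\<^sub>F n in sequentially. u < rn n" using rn_tendsto u(2) by (rule order_tendstoD(1))
        then have "\<forall>\<^sub>F n in sequentially. ellN n u om = indicator {t..<T} u * ell u om"
          using Nn_eventually[of "BY * R1 om"]
        proof eventually_elim
          case (elim n)
          have "\<bar>Y s om\<bar> \<le> Nn n" "\<bar>E s om\<bar> \<le> Nn n" "Q s om > 0" if "s \<in> {t..u}" for s
          proof -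
            have sT: "s \<in> {t..T}" using that u by auto
            show "\<bar>Y s om\<bar> \<le> Nn n" using order_trans[OF Y_bound[OF w sT] elim(2)] .
            show "\<bar>E s om\<bar> \<le> Nn n" using order_trans[OF bspec[OF \<open>\<forall>u\<in>{t..T}. \<bar>E u om\<bar> \<le> BY * R1 om\<close> sT] elim(2)] .
            have "Q u om \<le> Q s om" using \<open>\<forall>u v. t \<le> u \<longrightarrow> u \<le> v \<longrightarrow> v \<le> T \<longrightarrow> Q v om \<le> Q u om\<close> that u by auto
            then show "Q s om > 0" using True by linarith
          qed
          then have "lam (Nn n) u om = 1" by (simp add: lam_def run_ind_def pos_ind_def)
          then show ?case using elim(1) u by (simp add: ellN_def)
        qed
        then show ?thesis by (rule tendsto_eventually)
      next
        case False
        then have z: "ellN n u om = 0" "indicator {t..<T} u * ell u om = 0" for n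
          using rn(2)[of n] by (auto simp: ellN_def ell_def indicator_def)
        show ?thesis unfolding z by (rule tendsto_const)
      qed
    qed
    show "AE u in lborel. norm (ellN n u om) \<le> ?W u" for n using bd by simp
  qed
  ultimately show ?case using i by blast
qed

lemma EL_integrable: "integrable M EL"
  and ellN_integrable: "\<And>n. integrable M (\<lambda>om. LBINT u. ellN n u om)"
  and ellN_expectation: "(\<lambda>n. LINT om|M. LINT u|lborel. ellN n u om) \<longlonglongrightarrow> (LINT om|M. EL om)"
proof -
  have m1: "(\<lambda>om. LBINT u. ellN n u om) \<in> borel_measurable M" for n by (rule time_integral_measurable[OF ellN_joint])
  have m2: "EL \<in> borel_measurable M" unfolding EL_def by (rule time_integral_measurable[OF ell_joint])
  have l: "AE om in M. (\<lambda>n. LBINT u. ellN n u om) \<longlonglongrightarrow> EL om" using ellN_limit by eventually_elim auto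
  have b: "AE om in M. norm (LBINT u. ellN n u om) \<le> DL om" for n using ellN_limit by eventually_elim auto
  show "integrable M EL" by (rule integrable_dominated_convergence[OF m2 m1 DL_integrable l b])
  show "(\<lambda>n. LINT om|M. LINT u|lborel. ellN n u om) \<longlonglongrightarrow> (LINT om|M. EL om)"
    by (rule integral_dominated_convergence[OF m2 m1 DL_integrable l b])
  show "integrable M (\<lambda>om. LBINT u. ellN n u om)" for n
    by (rule integrable_dominated_convergence2[OF m2 m1 DL_integrable l b])
qed

lemma wT_measurable: "(\<lambda>om. w T (X T om)) \<in> borel_measurable M"
proof -
  let ?h = "\<lambda>x :: real \<times> real \<times> real. (T, exp (fst x), fst (snd x), max 0 (min q (snd (snd x))))"
  have "continuous_on UNIV ?h" by (intro continuous_intros)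
  moreover have "range ?h \<subseteq> {0..T} \<times> stateO_cl Qbar" using q T_pos by (auto simp: stateO_cl_def)
  ultimately have "continuous_on UNIV (\<lambda>x. (\<lambda>(t, x). w t x) (?h x))" by (rule continuous_on_compose2[OF cont])
  then have "(\<lambda>x. (\<lambda>(t, x). w t x) (?h x)) \<in> borel_measurable borel" by (rule borel_measurable_continuous_onI)
  moreover have "(\<lambda>om. (Y T om, E T om, Q T om)) \<in> M \<rightarrow>\<^sub>M borel"
  proof -
    have T: "T \<in> {t..T}" using tT by simp
    show ?thesis
      by (rule borel_measurable_Pair[OF to_M[OF T YF[OF T]] borel_measurable_Pair[OF to_M[OF T E[OF T]] to_M[OF T Q[OF T]]]])
  qed
  ultimately have "(\<lambda>om. (\<lambda>(t, x). w t x) (?h (Y T om, E T om, Q T om))) \<in> borel_measurable M"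
    by (rule measurable_compose[rotated])
  moreover have "max 0 (min q (Q T om)) = Q T om" for om using Qb[of T om] by auto
  ultimately show ?thesis by (simp add: X_def A_def)
qed

text \<open>\<open>gen\<close> is compared with \<open>- ell\<close> only where the weight is 1,
  hence while the inventory is positive. Along growing stages the inequality for a general control,
  or the equality for the optimal one, becomes a statement on the total reward.\<close>

lemma verification_limit:
  shows "integrable M (\<lambda>om. w T (X T om))"
    and "(AE om in M. \<forall>u\<in>{t..<T}. Q u om > 0 \<longrightarrow> gen u om \<le> - ell u om) \<Longrightarrow>
       (LINT om|M. EL om + w T (X T om)) \<le> w t (a, e0, q)"
    and "(AE om in M. \<forall>u\<in>{t..<T}. Q u om > 0 \<longrightarrow> gen u om = - ell u om) \<Longrightarrow>
       (LINT om|M. EL om + w T (X T om)) = w t (a, e0, q)"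
proof -
  let ?G = "\<lambda>n u om. indicator {t..<rn n} u * (lam (Nn n) u om * gen u om)"
  have "\<forall>n. \<exists>L. integrable M L \<and>
      (\<forall>om\<in>space M. \<exists>\<tau>. stop_weight t (rn n) (\<lambda>u. lam (Nn n) u om) \<tau> \<and> L om = HN (Nn n) \<tau> om - HN (Nn n) t om) \<and>
      integrable M (\<lambda>om. LBINT u. ?G n u om) \<and> (AE om in M. integrable lborel (\<lambda>u. ?G n u om)) \<and>
      (LINT om|M. L om) = (LINT om|M. LINT u|lborel. ?G n u om)"
    using stage[OF rn Nn] by blast
  from choice[OF this] obtain L where L': "\<forall>n. integrable M (L n) \<and>
      (\<forall>om\<in>space M. \<exists>\<tau>. stop_weight t (rn n) (\<lambda>u. lam (Nn n) u om) \<tau> \<and> L n om = HN (Nn n) \<tau> om - HN (Nn n) t om) \<and>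
      integrable M (\<lambda>om. LBINT u. ?G n u om) \<and> (AE om in M. integrable lborel (\<lambda>u. ?G n u om)) \<and>
      (LINT om|M. L n om) = (LINT om|M. LINT u|lborel. ?G n u om)" by (elim exE)
  note Ln = L'[THEN spec, THEN conjunct2]
  note L = L'[THEN spec, THEN conjunct1] Ln[THEN conjunct1, THEN bspec] Ln[THEN conjunct2, THEN conjunct1]
    Ln[THEN conjunct2, THEN conjunct2, THEN conjunct1] Ln[THEN conjunct2, THEN conjunct2, THEN conjunct2]
  have lim: "AE om in M. (\<lambda>n. L n om) \<longlonglongrightarrow> w T (X T om) - w t (a, e0, q)"
    using L_limit AE_space
  proof eventually_elim
    case (elim om)
    have "\<forall>n. \<exists>\<tau>. stop_weight t (rn n) (\<lambda>u. lam (Nn n) u om) \<tau> \<and> L n om = HN (Nn n) \<tau> om - HN (Nn n) t om" using L(2)[OF elim(2)] by blast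
    then obtain \<tau> where \<tau>: "\<And>n. stop_weight t (rn n) (\<lambda>u. lam (Nn n) u om) (\<tau> n)" "\<And>n. L n om = HN (Nn n) (\<tau> n) om - HN (Nn n) t om" by metis
    show ?case unfolding \<tau>(2) using elim(1) \<tau>(1) by blast
  qed
  have bd: "AE om in M. norm (L n om) \<le> 2 * D0 om" for n
    using HN_bound AE_space
  proof eventually_elim
    case (elim om)
    obtain \<tau> where \<tau>: "stop_weight t (rn n) (\<lambda>u. lam (Nn n) u om) \<tau>" "L n om = HN (Nn n) \<tau> om - HN (Nn n) t om" using L(2)[OF elim(2)] by blast
    have "\<tau> \<in> {t..T}" "t \<in> {t..T}" using \<tau>(1) rn(2)[of n] tT by (auto simp: stop_weight_def)
    then have "\<bar>HN (Nn n) \<tau> om\<bar> \<le> D0 om" "\<bar>HN (Nn n) t om\<bar> \<le> D0 om" using elim(1) Nn[of n] by auto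
    then show ?case unfolding \<tau>(2) by simp
  qed
  have m: "(\<lambda>om. w T (X T om) - w t (a, e0, q)) \<in> borel_measurable M" using wT_measurable by simp
  have D2: "integrable M (\<lambda>om. 2 * D0 om)" using D0_integrable by simp
  have Lm: "L n \<in> borel_measurable M" for n using L(1) by simp
  have "integrable M (\<lambda>om. w T (X T om) - w t (a, e0, q))"
    by (rule integrable_dominated_convergence[OF m Lm D2 lim bd])
  then have "integrable M (\<lambda>om. (w T (X T om) - w t (a, e0, q)) + w t (a, e0, q))" by (intro Bochner_Integration.integrable_add) auto
  then show wi: "integrable M (\<lambda>om. w T (X T om))" by simp
  have EL: "(\<lambda>n. LINT om|M. L n om) \<longlonglongrightarrow> (LINT om|M. w T (X T om)) - w t (a, e0, q)"
    using integral_dominated_convergence[OF m Lm D2 lim bd] wi by (simp add: prob_space)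
  have Eneg: "(\<lambda>n. - (LINT om|M. LINT u|lborel. ellN n u om)) \<longlonglongrightarrow> - (LINT om|M. EL om)"
    by (rule tendsto_minus[OF ellN_expectation])
  have ei: "AE om in M. integrable lborel (\<lambda>u. ellN n u om)" for n using ellN_limit by eventually_elim auto
  have tot: "(LINT om|M. EL om + w T (X T om)) = (LINT om|M. EL om) + (LINT om|M. w T (X T om))"
    by (rule Bochner_Integration.integral_add[OF EL_integrable wi])
  { assume rel: "AE om in M. \<forall>u\<in>{t..<T}. Q u om > 0 \<longrightarrow> gen u om \<le> - ell u om"
    have "(LINT om|M. L n om) \<le> - (LINT om|M. LINT u|lborel. ellN n u om)" for n
    proof -
      have "(LINT om|M. LINT u|lborel. ?G n u om) \<le> (LINT om|M. - (LBINT u. ellN n u om))"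
      proof (rule integral_mono_AE[OF L(3)])
        show "integrable M (\<lambda>om. - (LBINT u. ellN n u om))" using ellN_integrable by simp
        show "AE om in M. (LBINT u. ?G n u om) \<le> - (LBINT u. ellN n u om)"
          using rel L(4)[of n] ei[of n]
        proof eventually_elim
          case (elim om)
          have "(LBINT u. ?G n u om) \<le> (LBINT u. - ellN n u om)"
          proof (rule integral_mono[OF elim(2)])
            fix u
            show "?G n u om \<le> - ellN n u om"
            proof (cases "u \<in> {t..<rn n} \<and> lam (Nn n) u om \<noteq> 0")
              case True
              then have "lam (Nn n) u om = 1" using lam01(1)[of "Nn n" u om] by auto
              moreover have "Q u om > 0" using True by (auto simp: lam_def pos_ind_def split: if_splits)
              moreover have "u \<in> {t..<T}" using True rn(2)[of n] by auto
              ultimately show ?thesis using elim(1) True by (simp add: ellN_def)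
            qed (auto simp: ellN_def)
          qed (use elim(3) in simp)
          then show ?case by simp
        qed
      qed
      then show ?thesis using L(5)[of n] by simp
    qed
    then have "(LINT om|M. w T (X T om)) - w t (a, e0, q) \<le> - (LINT om|M. EL om)"
      by (intro LIMSEQ_le[OF EL Eneg]) auto
    then show "(LINT om|M. EL om + w T (X T om)) \<le> w t (a, e0, q)" unfolding tot by simp }
  { assume rel: "AE om in M. \<forall>u\<in>{t..<T}. Q u om > 0 \<longrightarrow> gen u om = - ell u om"
    have "(LINT om|M. L n om) = - (LINT om|M. LINT u|lborel. ellN n u om)" for n
    proof -
      have "(LINT om|M. LINT u|lborel. ?G n u om) = (LINT om|M. - (LBINT u. ellN n u om))"
      proof (rule integral_cong_AE)
        show "AE om in M. (LBINT u. ?G n u om) = - (LBINT u. ellN n u om)"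
          using rel
        proof eventually_elim
          case (elim om)
          have "?G n u om = - ellN n u om" for u
          proof (cases "u \<in> {t..<rn n} \<and> lam (Nn n) u om \<noteq> 0")
            case True
            then have "Q u om > 0" by (auto simp: lam_def pos_ind_def split: if_splits)
            moreover have "u \<in> {t..<T}" using True rn(2)[of n] by auto
            ultimately show ?thesis using elim True by (simp add: ellN_def)
          qed (auto simp: ellN_def)
          then show ?case by simp
        qed
      qed (use L(3) ellN_integrable in auto)
      then show ?thesis using L(5)[of n] by simp
    qed
    then have "(LINT om|M. w T (X T om)) - w t (a, e0, q) = - (LINT om|M. EL om)"
      using LIMSEQ_unique[OF EL] Eneg by simp
    then show "(LINT om|M. EL om + w T (X T om)) = w t (a, e0, q)" unfolding tot by simp }
qed

end

section \<open>Controlled state equations\<close>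

context bm2
begin

text \<open>A linear functional that does not exceed the norm does not increase distances, so
  convergence in probability passes from the vector sums to their components.\<close>

lemma ito_projection:
  fixes H :: "real \<Rightarrow> 'w \<Rightarrow> state"
  assumes I: "ito_integral M H W t r I" and W: "is_W W" and t: "0 \<le> t" "t \<le> r" "r \<le> T"
    and H: "\<And>u. u \<in> {t..r} \<Longrightarrow> H u \<in> borel_measurable M"
    and f: "bounded_linear f" and f1: "\<And>x. \<bar>f x\<bar> \<le> norm x"
  shows "cip (\<lambda>n om. \<Sum>i<2^n. (W (gp t r (2^n) (Suc i)) om - W (gp t r (2^n) i) om) * f (H (gp t r (2^n) i) om)) (\<lambda>om. f (I om))"
proof -
  interpret f: bounded_linear f by (rule f)
  have fm [measurable]: "f \<in> borel_measurable borel" by (rule borel_measurable_continuous_onI[OF linear_continuous_on[OF f]])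
  have Im [measurable]: "I \<in> borel_measurable M" using I by (simp add: ito_integral_def)
  have g: "gp t r (2^n) i \<in> {t..r}" "gp t r (2^n) (Suc i) \<in> {0..T}" "gp t r (2^n) i \<in> {0..T}" if "i < 2^n" for n i
    using gp_in[OF t(2), of i "2^n"] gp_in[OF t(2), of "Suc i" "2^n"] that t by auto
  have R: "riemann_sum H W t r n om = (\<Sum>i<2^n. (W (gp t r (2^n) (Suc i)) om - W (gp t r (2^n) i) om) *\<^sub>R H (gp t r (2^n) i) om)" for n om
    by (simp add: riemann_sum_def gp_def)
  have Rm [measurable]: "riemann_sum H W t r n \<in> borel_measurable M" for n
    unfolding R[abs_def] by (intro borel_measurable_sum borel_measurable_scaleR borel_measurable_diff W_meas[OF W] H g) auto
  have fR: "(\<Sum>i<2^n. (W (gp t r (2^n) (Suc i)) om - W (gp t r (2^n) i) om) * f (H (gp t r (2^n) i) om)) = f (riemann_sum H W t r n om)" for n om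
    unfolding R by (simp add: f.sum f.scaleR)
  show ?thesis unfolding fR cip_def
  proof (intro conjI allI impI)
    show "(\<lambda>om. f (riemann_sum H W t r n om)) \<in> borel_measurable M" for n by measurable
    show "(\<lambda>om. f (I om)) \<in> borel_measurable M" by measurable
    fix e :: real assume "e > 0"
    then have lim: "(\<lambda>n. prob {om\<in>space M. e < norm (riemann_sum H W t r n om - I om)}) \<longlonglongrightarrow> 0" using I by (simp add: ito_integral_def)
    have "prob {om\<in>space M. e < \<bar>f (riemann_sum H W t r n om) - f (I om)\<bar>} \<le> prob {om\<in>space M. e < norm (riemann_sum H W t r n om - I om)}" for n
    proof (rule finite_measure_mono)
      show "{om\<in>space M. e < \<bar>f (riemann_sum H W t r n om) - f (I om)\<bar>} \<subseteq> {om\<in>space M. e < norm (riemann_sum H W t r n om - I om)}"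
        using f1 by (auto simp: f.diff[symmetric] intro: less_le_trans[OF _ f1])
    qed measurable
    then show "(\<lambda>n. prob {om\<in>space M. e < \<bar>f (riemann_sum H W t r n om) - f (I om)\<bar>}) \<longlonglongrightarrow> 0"
      by (intro tendsto_sandwich[OF _ _ tendsto_const lim]) auto
  qed
qed

text \<open>For a constant integrand the sums telescope to the same variable on every grid, and
  limits in probability are unique.\<close>

lemma ito_const:
  fixes H :: "real \<Rightarrow> 'w \<Rightarrow> state"
  assumes I: "ito_integral M H W t r I" and W: "is_W W" and t: "0 \<le> t" "t \<le> r" "r \<le> T"
    and H: "\<And>u. u \<in> {t..r} \<Longrightarrow> H u \<in> borel_measurable M"
    and f: "bounded_linear f" and f1: "\<And>x. \<bar>f x\<bar> \<le> norm x" and c: "\<And>u om. f (H u om) = \<kappa>"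
  shows "AE om in M. f (I om) = \<kappa> * (W r om - W t om)"
proof (rule cip_unique[OF ito_projection[OF I W t H f f1]])
  have m: "(\<lambda>om. \<kappa> * (W r om - W t om)) \<in> borel_measurable M" using W_meas[OF W, of r] W_meas[OF W, of t] t by auto
  have "(\<Sum>i<2^n. (W (gp t r (2^n) (Suc i)) om - W (gp t r (2^n) i) om) * f (H (gp t r (2^n) i) om)) = \<kappa> * (W r om - W t om)" for n om
    unfolding c sum_distrib_right[symmetric] sum_lessThan_telescope[of "\<lambda>i. W (gp t r (2^n) i) om"] by (simp add: gp_n mult.commute)
  then show "cip (\<lambda>n om. \<Sum>i<2^n. (W (gp t r (2^n) (Suc i)) om - W (gp t r (2^n) i) om) * f (H (gp t r (2^n) i) om)) (\<lambda>om. \<kappa> * (W r om - W t om))"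
    using cip_AE[OF m m] by simp
qed

text \<open>Clamping time into \<open>{t..s}\<close> extends the process to the whole line while
  using only what is known at time \<open>s\<close>.\<close>

lemma progressive_clamp:
  fixes c :: "real \<Rightarrow> 'w \<Rightarrow> real"
  assumes c: "progressive F t T c" and s: "s \<in> {t..T}"
  shows "(\<lambda>x. c (max t (min s (fst x))) (snd x)) \<in> borel_measurable (borel \<Otimes>\<^sub>M F s)"
proof -
  have "(\<lambda>x :: real \<times> 'w. (max t (min s (fst x)), snd x)) \<in> borel \<Otimes>\<^sub>M F s \<rightarrow>\<^sub>M restrict_space borel {t..s} \<Otimes>\<^sub>M F s"
    by (intro measurable_Pair measurable_restrict_space2) (use s in auto)
  moreover have "(\<lambda>(r, om). c r om) \<in> borel_measurable (restrict_space borel {t..s} \<Otimes>\<^sub>M F s)" using c s by (simp add: progressive_def)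
  ultimately show ?thesis using measurable_compose by fastforce
qed

end

locale controls = bm2 M W1 W2 T for M :: "'w measure" and W1 W2 T +
  fixes t :: real
  assumes t0: "0 \<le> t" and t_le: "t \<le> T"
begin

text \<open>A version of \<open>c\<close> that is nonnegative and jointly measurable on all of \<open>\<real> \<times> \<Omega>\<close>.\<close>

definition cx :: "(real \<Rightarrow> 'w \<Rightarrow> real) \<Rightarrow> real \<Rightarrow> 'w \<Rightarrow> real" where
  "cx c u om = indicator {t..T} u * max 0 (c (max t (min T u)) om)"

lemma cx_nonneg [simp]: "0 \<le> cx c u om" by (simp add: cx_def)

context
  fixes c assumes adm: "admissible M W1 W2 T t c"
begin

lemma cx_eq: "u \<in> {t..T} \<Longrightarrow> om \<in> space M \<Longrightarrow> cx c u om = c u om"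
  using adm by (auto simp: cx_def admissible_def)

lemma cx_joint: "jointly M (\<lambda>u om. cx c u om)"
proof -
  have "(\<lambda>x. x) \<in> M \<rightarrow>\<^sub>M F T" by (rule F_measurable_M[OF order_refl]) simp
  then have "(\<lambda>x. (fst x, snd x)) \<in> (borel :: real measure) \<Otimes>\<^sub>M M \<rightarrow>\<^sub>M borel \<Otimes>\<^sub>M F T"
    by (intro measurable_Pair measurable_compose[OF measurable_snd]) auto
  moreover have "(\<lambda>x. c (max t (min T (fst x))) (snd x)) \<in> borel_measurable (borel \<Otimes>\<^sub>M F T)"
    by (rule progressive_clamp) (use adm t_le in \<open>auto simp: admissible_def\<close>)
  ultimately have [measurable]: "(\<lambda>x. c (max t (min T (fst x))) (snd x)) \<in> borel_measurable (borel \<Otimes>\<^sub>M M)"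
    by (auto dest: measurable_compose)
  show ?thesis unfolding cx_def split_def by measurable
qed

lemma cx_section: "om \<in> space M \<Longrightarrow> (\<lambda>u. cx c u om) \<in> borel_measurable borel"
  by (rule section_measurable'[OF cx_joint])

lemma cx_square_finite: "(\<integral>\<^sup>+om. (\<integral>\<^sup>+u. ennreal ((cx c u om)\<^sup>2) \<partial>lborel) \<partial>M) < \<infinity>"
proof -
  have "(\<integral>\<^sup>+om. (\<integral>\<^sup>+u. ennreal ((cx c u om)\<^sup>2) \<partial>lborel) \<partial>M) = (\<integral>\<^sup>+om. (\<integral>\<^sup>+r. ennreal ((c r om)\<^sup>2) * indicator {t..T} r \<partial>lborel) \<partial>M)"
  proof (intro nn_integral_cong)
    fix om u assume "om \<in> space M"
    then show "ennreal ((cx c u om)\<^sup>2) = ennreal ((c u om)\<^sup>2) * indicator {t..T} u"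
      by (cases "u \<in> {t..T}") (simp_all add: cx_eq, simp add: cx_def)
  qed
  then show ?thesis using adm by (simp add: admissible_def)
qed

lemma cx_square_AE: "AE om in M. integrable lborel (\<lambda>u. (cx c u om)\<^sup>2)"
  and cx_square_integrable: "integrable M (\<lambda>om. LBINT u. (cx c u om)\<^sup>2)"
proof -
  have j: "jointly M (\<lambda>u om. (cx c u om)\<^sup>2)"
    using borel_measurable_power[OF cx_joint, of 2] by (simp add: split_def)
  have "(\<lambda>x. ennreal ((cx c (snd x) (fst x))\<^sup>2)) \<in> borel_measurable (M \<Otimes>\<^sub>M borel)"
    using measurable_compose[OF measurable_pair_swap' j] by (simp add: split_def)
  then have "(\<lambda>(om, u). ennreal ((cx c u om)\<^sup>2)) \<in> borel_measurable (M \<Otimes>\<^sub>M lborel)"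
    by (simp add: split_def measurable_cong_sets[OF sets_pair_measure_cong[OF refl sets_lborel] refl])
  then have gm: "(\<lambda>om. \<integral>\<^sup>+u. ennreal ((cx c u om)\<^sup>2) \<partial>lborel) \<in> borel_measurable M"
    by (rule lborel.borel_measurable_nn_integral)
  have "AE om in M. (\<integral>\<^sup>+u. ennreal ((cx c u om)\<^sup>2) \<partial>lborel) \<noteq> \<infinity>"
    by (rule nn_integral_PInf_AE[OF gm]) (use cx_square_finite in simp)
  then show i: "AE om in M. integrable lborel (\<lambda>u. (cx c u om)\<^sup>2)"
    using AE_space
  proof eventually_elim
    case (elim om)
    show ?case
    proof (rule integrableI_nonneg)
      show "(\<lambda>u. (cx c u om)\<^sup>2) \<in> borel_measurable lborel" using cx_section[OF elim(2)] by simp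
    qed (use elim(1) in \<open>auto simp: top.not_eq_extremum\<close>)
  qed
  show "integrable M (\<lambda>om. LBINT u. (cx c u om)\<^sup>2)"
  proof (rule integrableI_nonneg)
    show "(\<lambda>om. LBINT u. (cx c u om)\<^sup>2) \<in> borel_measurable M" by (rule time_integral_measurable[OF j])
    have "(\<integral>\<^sup>+om. ennreal (LBINT u. (cx c u om)\<^sup>2) \<partial>M) = (\<integral>\<^sup>+om. (\<integral>\<^sup>+u. ennreal ((cx c u om)\<^sup>2) \<partial>lborel) \<partial>M)"
    proof (rule nn_integral_cong_AE)
      show "AE om in M. ennreal (LBINT u. (cx c u om)\<^sup>2) = (\<integral>\<^sup>+u. ennreal ((cx c u om)\<^sup>2) \<partial>lborel)"
        using i by eventually_elim (simp add: nn_integral_eq_integral)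
    qed
    then show "(\<integral>\<^sup>+om. ennreal (LBINT u. (cx c u om)\<^sup>2) \<partial>M) < \<infinity>" using cx_square_finite by simp
  qed simp
qed

lemma cx_integrable:
  assumes w: "om \<in> space M" and i: "integrable lborel (\<lambda>u. (cx c u om)\<^sup>2)"
  shows "integrable lborel (\<lambda>u. cx c u om)"
proof (rule Bochner_Integration.integrable_bound)
  show "integrable lborel (\<lambda>u. indicator {t..T} u + (cx c u om)\<^sup>2)"
    by (intro Bochner_Integration.integrable_add i) (use borel_integrable_atLeastAtMost'[of t T "\<lambda>_. 1 :: real"] in \<open>simp add: set_integrable_def\<close>)
  have "\<bar>cx c u om\<bar> \<le> indicator {t..T} u + (cx c u om)\<^sup>2" for u
  proof (cases "u \<in> {t..T}")
    case True
    have "2 * cx c u om \<le> 1 + (cx c u om)\<^sup>2" using sum_squares_bound[of 1 "cx c u om"] by simp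
    then have "cx c u om \<le> 1 + (cx c u om)\<^sup>2" using cx_nonneg[of c u om] by linarith
    then show ?thesis using True by simp
  qed (simp add: cx_def)
  then show "AE u in lborel. norm (cx c u om) \<le> norm (indicator {t..T} u + (cx c u om)\<^sup>2)" by (auto intro: order_trans[OF _ abs_ge_self])
  show "(\<lambda>u. cx c u om) \<in> borel_measurable lborel" using cx_section[OF w] by simp
qed

lemma cx_AE: "AE om in M. integrable lborel (\<lambda>u. cx c u om)"
  using cx_square_AE AE_space by eventually_elim (rule cx_integrable)

lemma LINT_cx: "om \<in> space M \<Longrightarrow> r \<le> T \<Longrightarrow> (LBINT u:{t..r}. cx c u om) = (LBINT u:{t..r}. c u om)"
  by (rule set_lebesgue_integral_cong) (auto simp: cx_eq)

end

end

lemma state_comp_measurable [measurable]: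
  "(fst :: state \<Rightarrow> real) \<in> borel_measurable borel" "(\<lambda>x :: state. fst (snd x)) \<in> borel_measurable borel" "(\<lambda>x :: state. snd (snd x)) \<in> borel_measurable borel"
  by (intro borel_measurable_continuous_onI continuous_intros)+

lemma state_comp_linear:
  "bounded_linear (\<lambda>x :: state. fst x)" "bounded_linear (\<lambda>x :: state. fst (snd x))" "bounded_linear (\<lambda>x :: state. snd (snd x))"
  by (intro bounded_linear_fst bounded_linear_compose[OF bounded_linear_fst bounded_linear_snd] bounded_linear_compose[OF bounded_linear_snd bounded_linear_snd])+

lemma state_comp_le:
  fixes x :: state shows "\<bar>fst x\<bar> \<le> norm x" "\<bar>fst (snd x)\<bar> \<le> norm x" "\<bar>snd (snd x)\<bar> \<le> norm x"
  using norm_fst_le[of "fst x" "snd x"] norm_snd_le[of "snd x" "fst x"] norm_fst_le[of "fst (snd x)" "snd (snd x)"] norm_snd_le[of "snd (snd x)" "fst (snd x)"]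
  by auto

locale sde_model = controls M W1 W2 T t for M :: "'w measure" and W1 W2 T t +
  fixes mu1 sig1 k sig2 rho :: real
  assumes k: "k > 0"
begin

abbreviation sol :: "(real \<Rightarrow> 'w \<Rightarrow> real) \<Rightarrow> state \<Rightarrow> (real \<Rightarrow> 'w \<Rightarrow> state) \<Rightarrow> bool" where
  "sol c x X \<equiv> sde_sol M W1 W2 T mu1 sig1 k sig2 rho c t x X"

abbreviation adm :: "(real \<Rightarrow> 'w \<Rightarrow> real) \<Rightarrow> bool" where "adm c \<equiv> admissible M W1 W2 T t c"

definition Z :: "real \<Rightarrow> 'w \<Rightarrow> real" where
  "Z r om = sig2 * (rho * (W1 r om - W1 t om) + sqrt (1 - rho\<^sup>2) * (W2 r om - W2 t om))"

lemma Wcont: "is_W W \<Longrightarrow> om \<in> space M \<Longrightarrow> continuous_on {t..T} (\<lambda>u. W u om)"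
  by (rule continuous_on_subset[OF W_cont]) (use t0 in auto)

lemma Z_cont: "om \<in> space M \<Longrightarrow> continuous_on {t..T} (\<lambda>u. Z u om)"
  unfolding Z_def by (intro continuous_intros Wcont[OF is_W(1)] Wcont[OF is_W(2)])

text \<open>Only the first component of the diffusion depends on the state. The other components are
  constant, so their integrals are explicit, and what remains is the integral in the equation for
  \<open>A\<close>.\<close>

lemma noise_parts:
  assumes X: "\<forall>u\<in>{t..T}. X u \<in> borel_measurable (F u)" and r: "r \<in> {t..T}"
    and I1: "ito_integral M (\<lambda>u om. diff1 sig1 sig2 rho (X u om)) W1 t r I1"
    and I2: "ito_integral M (\<lambda>u om. diff2 sig2 rho (X u om)) W2 t r I2"
  shows "AE om in M. fst (I2 om) = 0 \<and> fst (snd (I1 om)) + fst (snd (I2 om)) = Z r om \<and> snd (snd (I1 om)) = 0 \<and> snd (snd (I2 om)) = 0"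
    and "cip (\<lambda>n om. \<Sum>i<2^n. (W1 (gp t r (2^n) (Suc i)) om - W1 (gp t r (2^n) i) om) * (sig1 * fst (X (gp t r (2^n) i) om))) (\<lambda>om. fst (I1 om))"
proof -
  have tr: "t \<le> r" "r \<le> T" using r by auto
  have XM: "X u \<in> borel_measurable M" if "u \<in> {t..r}" for u
    by (rule F_measurable_M[OF _ bspec[OF X]]) (use that r in auto)
  have H1: "(\<lambda>om. diff1 sig1 sig2 rho (X u om)) \<in> borel_measurable M" if "u \<in> {t..r}" for u
    unfolding diff1_def split_beta by (intro borel_measurable_Pair borel_measurable_times borel_measurable_const measurable_compose[OF XM[OF that] state_comp_measurable(1)])
  have H2: "(\<lambda>om. diff2 sig2 rho (X u om)) \<in> borel_measurable M" for u by (simp add: diff2_def)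
  have "AE om in M. fst (I2 om) = 0 * (W2 r om - W2 t om)"
    by (rule ito_const[OF I2 is_W(2) t0 tr H2 state_comp_linear(1) state_comp_le(1)]) (simp_all add: diff2_def)
  moreover have "AE om in M. fst (snd (I1 om)) = sig2 * rho * (W1 r om - W1 t om)"
    by (rule ito_const[OF I1 is_W(1) t0 tr H1 state_comp_linear(2) state_comp_le(2)]) (simp_all add: diff1_def split_beta)
  moreover have "AE om in M. fst (snd (I2 om)) = sig2 * sqrt (1 - rho\<^sup>2) * (W2 r om - W2 t om)"
    by (rule ito_const[OF I2 is_W(2) t0 tr H2 state_comp_linear(2) state_comp_le(2)]) (simp_all add: diff2_def)
  moreover have "AE om in M. snd (snd (I1 om)) = 0 * (W1 r om - W1 t om)"
    by (rule ito_const[OF I1 is_W(1) t0 tr H1 state_comp_linear(3) state_comp_le(3)]) (simp_all add: diff1_def split_beta)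
  moreover have "AE om in M. snd (snd (I2 om)) = 0 * (W2 r om - W2 t om)"
    by (rule ito_const[OF I2 is_W(2) t0 tr H2 state_comp_linear(3) state_comp_le(3)]) (simp_all add: diff2_def)
  ultimately show "AE om in M. fst (I2 om) = 0 \<and> fst (snd (I1 om)) + fst (snd (I2 om)) = Z r om \<and> snd (snd (I1 om)) = 0 \<and> snd (snd (I2 om)) = 0"
    by eventually_elim (simp add: Z_def algebra_simps)
  have d: "fst (diff1 sig1 sig2 rho (X u om)) = sig1 * fst (X u om)" for u om by (simp add: diff1_def split_beta)
  show "cip (\<lambda>n om. \<Sum>i<2^n. (W1 (gp t r (2^n) (Suc i)) om - W1 (gp t r (2^n) i) om) * (sig1 * fst (X (gp t r (2^n) i) om))) (\<lambda>om. fst (I1 om))"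
    using ito_projection[OF I1 is_W(1) t0 tr H1 state_comp_linear(1) state_comp_le(1)] unfolding d .
qed

lemma sol_F: "sol c x X \<Longrightarrow> u \<in> {t..T} \<Longrightarrow> X u \<in> borel_measurable (F u)"
  and sol_cont: "sol c x X \<Longrightarrow> om \<in> space M \<Longrightarrow> continuous_on {t..T} (\<lambda>u. X u om)"
  and sol_init: "sol c x X \<Longrightarrow> om \<in> space M \<Longrightarrow> X t om = x"
  by (simp_all add: sde_sol_def)

text \<open>A vector integral splits into components when all of them are integrable. Were
  \<open>c\<close> not integrable, the integral would take its default value 0 in all three
  components at once.\<close>

lemma drift_integral:
  fixes X :: "real \<Rightarrow> state"
  assumes X: "continuous_on {t..r} X" and c: "set_integrable lborel {t..r} c"
  shows "(LBINT u:{t..r}. drift mu1 k (X u) (c u)) =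
    (mu1 * (LBINT u:{t..r}. fst (X u)), - k * (LBINT u:{t..r}. fst (snd (X u))), - (LBINT u:{t..r}. c u))"
proof -
  have A: "set_integrable lborel {t..r} (\<lambda>u. fst (X u))" and E: "set_integrable lborel {t..r} (\<lambda>u. fst (snd (X u)))"
    by (intro borel_integrable_atLeastAtMost' continuous_intros X)+
  let ?i = "\<lambda>u. indicator {t..r} u :: real"
  have d: "?i u *\<^sub>R drift mu1 k (X u) (c u) = (?i u *\<^sub>R fst (X u)) *\<^sub>R (mu1, 0, 0) + ((?i u *\<^sub>R fst (snd (X u))) *\<^sub>R (0, - k, 0) + (?i u *\<^sub>R c u) *\<^sub>R (0, 0, - 1))" for u
    by (simp add: drift_def split_beta mult.commute)
  have sum3: "(LBINT u. f u *\<^sub>R v1 + (g u *\<^sub>R v2 + h u *\<^sub>R v3)) = (LBINT u. f u) *\<^sub>R v1 + ((LBINT u. g u) *\<^sub>R v2 + (LBINT u. h u) *\<^sub>R v3)"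
    if "integrable lborel f" "integrable lborel g" "integrable lborel h" for f g h :: "real \<Rightarrow> real" and v1 v2 v3 :: state
    using that by simp
  show ?thesis unfolding set_lebesgue_integral_def d sum3[OF A[unfolded set_integrable_def] E[unfolded set_integrable_def] c[unfolded set_integrable_def]]
    by simp
qed

lemma sol_components:
  assumes c: "adm c" and X: "sol c (a, e0, q) X" and r: "r \<in> {t..T}"
  shows "\<exists>I. cip (\<lambda>n om. \<Sum>i<2^n. (W1 (gp t r (2^n) (Suc i)) om - W1 (gp t r (2^n) i) om) * (sig1 * fst (X (gp t r (2^n) i) om))) I
        \<and> (AE om in M. fst (X r om) = a + mu1 * (LBINT u:{t..r}. fst (X u om)) + I om)"
    and "AE om in M. fst (snd (X r om)) = e0 - k * (LBINT u:{t..r}. fst (snd (X u om))) + Z r om"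
    and "AE om in M. snd (snd (X r om)) = q - (LBINT u:{t..r}. cx c u om)"
proof -
  obtain I1 I2 where I1: "ito_integral M (\<lambda>u om. diff1 sig1 sig2 rho (X u om)) W1 t r I1"
    and I2: "ito_integral M (\<lambda>u om. diff2 sig2 rho (X u om)) W2 t r I2"
    and eq: "AE om in M. X r om = (a, e0, q) + (LBINT u:{t..r}. drift mu1 k (X u om) (c u om)) + I1 om + I2 om"
    using X r unfolding sde_sol_def by blast
  have XF: "\<forall>u\<in>{t..T}. X u \<in> borel_measurable (F u)" using sol_F[OF X] by blast
  note n = noise_parts[OF XF r I1 I2]
  have all: "AE om in M. fst (X r om) = a + mu1 * (LBINT u:{t..r}. fst (X u om)) + fst (I1 om)
      \<and> fst (snd (X r om)) = e0 - k * (LBINT u:{t..r}. fst (snd (X u om))) + Z r om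
      \<and> snd (snd (X r om)) = q - (LBINT u:{t..r}. cx c u om)"
    using eq n(1) cx_AE[OF c] AE_space
  proof eventually_elim
    case (elim om)
    have "set_integrable lborel {t..r} (\<lambda>u. cx c u om)" using elim(3) by (rule integrable_restrict) simp
    then have ci: "set_integrable lborel {t..r} (\<lambda>u. c u om)"
      by (rule set_integrable_cong[THEN iffD1, rotated -1]) (use cx_eq[OF c _ elim(4)] r in auto)
    have Xc: "continuous_on {t..r} (\<lambda>u. X u om)" by (rule continuous_on_subset[OF sol_cont[OF X elim(4)]]) (use r in auto)
    have "(LBINT u:{t..r}. cx c u om) = (LBINT u:{t..r}. c u om)" by (rule LINT_cx[OF c elim(4)]) (use r in simp)
    then show ?case using elim(1,2) unfolding drift_integral[OF Xc ci] by (auto simp: algebra_simps)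
  qed
  then show "AE om in M. fst (snd (X r om)) = e0 - k * (LBINT u:{t..r}. fst (snd (X u om))) + Z r om"
    and "AE om in M. snd (snd (X r om)) = q - (LBINT u:{t..r}. cx c u om)" by (auto elim: eventually_mono)
  have "AE om in M. fst (X r om) = a + mu1 * (LBINT u:{t..r}. fst (X u om)) + fst (I1 om)" using all by (auto elim: eventually_mono)
  with n(2) show "\<exists>I. cip (\<lambda>n om. \<Sum>i<2^n. (W1 (gp t r (2^n) (Suc i)) om - W1 (gp t r (2^n) i) om) * (sig1 * fst (X (gp t r (2^n) i) om))) I
        \<and> (AE om in M. fst (X r om) = a + mu1 * (LBINT u:{t..r}. fst (X u om)) + I om)" by blast
qed

context
  fixes c a e0 q X
  assumes c: "adm c" and X: "sol c (a, e0, q) X"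
begin

lemma sol_A: "t < T \<Longrightarrow> AE om in M. \<forall>r\<in>{t..T}. fst (X r om) = gbm W1 mu1 sig1 a t r om"
proof (rule gbm_unique[OF is_W(1) t0])
  show "(\<lambda>om. fst (X u om)) \<in> borel_measurable (F u)" if "u \<in> {t..T}" for u
    by (rule measurable_compose[OF sol_F[OF X that] state_comp_measurable(1)])
  show "continuous_on {t..T} (\<lambda>u. fst (X u om))" if "om \<in> space M" for om by (intro continuous_intros sol_cont[OF X that])
  show "fst (X t om) = a" if "om \<in> space M" for om by (simp add: sol_init[OF X that])
  show "\<exists>I. cip (\<lambda>n om. \<Sum>i<2^n. (W1 (gp t r (2^n) (Suc i)) om - W1 (gp t r (2^n) i) om) * (sig1 * fst (X (gp t r (2^n) i) om))) I
        \<and> (AE om in M. fst (X r om) = a + mu1 * (LBINT u:{t..r}. fst (X u om)) + I om)" if "t < r" "r \<le> T" for r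
    by (rule sol_components(1)[OF c X]) (use that in auto)
qed

lemma sol_E: "AE om in M. \<forall>r\<in>{t..T}. fst (snd (X r om)) = e0 - k * (LBINT u:{t..r}. fst (snd (X u om))) + Z r om"
proof (rule AE_all_times[OF sol_components(2)[OF c X]])
  show "AE om in M. continuous_on {t..T} (\<lambda>r. fst (snd (X r om)))"
    by (rule AE_I2) (intro continuous_intros sol_cont[OF X])
  show "AE om in M. continuous_on {t..T} (\<lambda>r. e0 - k * (LBINT u:{t..r}. fst (snd (X u om))) + Z r om)"
    by (rule AE_I2) (intro continuous_intros LINT_continuous borel_integrable_atLeastAtMost' sol_cont[OF X] Z_cont)
qed

lemma sol_Q: "AE om in M. \<forall>r\<in>{t..T}. snd (snd (X r om)) = q - (LBINT u:{t..r}. cx c u om)"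
proof (rule AE_all_times[OF sol_components(3)[OF c X]])
  show "AE om in M. continuous_on {t..T} (\<lambda>r. snd (snd (X r om)))"
    by (rule AE_I2) (intro continuous_intros sol_cont[OF X])
  show "AE om in M. continuous_on {t..T} (\<lambda>r. q - (LBINT u:{t..r}. cx c u om))"
    using cx_AE[OF c]
  proof eventually_elim
    case (elim om)
    have "set_integrable lborel {t..T} (\<lambda>u. cx c u om)" using elim by (rule integrable_restrict) simp
    then show ?case by (intro continuous_intros LINT_continuous)
  qed
qed

end

text \<open>\<open>A\<close> is an explicit process and \<open>Q\<close> an explicit integral; the
  difference of two candidates for \<epsilon> obeys a homogeneous Gronwall inequality path by path.
  This identifies a solution picked by \<open>SOME\<close> with a known one.\<close>

lemma sol_unique:
  assumes c: "adm c" and X: "sol c (a, e0, q) X" and X': "sol c (a, e0, q) X'" and tT: "t < T"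
  shows "AE om in M. \<forall>r\<in>{t..T}. X r om = X' r om"
  using sol_A[OF c X tT] sol_A[OF c X' tT] sol_E[OF c X] sol_E[OF c X'] sol_Q[OF c X] sol_Q[OF c X'] AE_space
proof eventually_elim
  case (elim om)
  let ?D = "\<lambda>u. fst (snd (X u om)) - fst (snd (X' u om))"
  have Ec: "continuous_on {t..T} (\<lambda>u. fst (snd (X u om)))" "continuous_on {t..T} (\<lambda>u. fst (snd (X' u om)))"
    by (intro continuous_intros sol_cont[OF X elim(7)] sol_cont[OF X' elim(7)])+
  have Dc: "continuous_on {t..T} ?D" by (rule continuous_on_diff[OF Ec])
  have si: "set_integrable lborel {t..r} f" if "continuous_on {t..T} f" "r \<in> {t..T}" for f :: "real \<Rightarrow> real" and r
    by (rule borel_integrable_atLeastAtMost', rule continuous_on_subset[OF that(1)]) (use that(2) in auto)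
  obtain B where B: "\<And>u. u \<in> {t..T} \<Longrightarrow> \<bar>?D u\<bar> \<le> B" by (rule path_bounded[OF Dc]) blast
  have ineq: "\<bar>?D r\<bar> \<le> 0 + k * (LBINT u:{t..r}. \<bar>?D u\<bar>)" if r: "r \<in> {t..T}" for r
  proof -
    have "(LBINT u:{t..r}. ?D u) = (LBINT u:{t..r}. fst (snd (X u om))) - (LBINT u:{t..r}. fst (snd (X' u om)))"
      by (rule set_integral_diff(2)[OF si[OF Ec(1) r] si[OF Ec(2) r]])
    then have D: "?D r = - k * (LBINT u:{t..r}. ?D u)" using bspec[OF elim(3) r] bspec[OF elim(4) r] by (simp only: right_diff_distrib)
    have "\<bar>LBINT u:{t..r}. ?D u\<bar> \<le> (LBINT x. norm (indicator {t..r} x *\<^sub>R ?D x))"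
      unfolding set_lebesgue_integral_def real_norm_def[symmetric] by (rule integral_norm_bound)
    also have "\<dots> = (LBINT u:{t..r}. \<bar>?D u\<bar>)"
      unfolding set_lebesgue_integral_def by (rule Bochner_Integration.integral_cong) (auto simp: abs_mult)
    finally have "k * \<bar>LBINT u:{t..r}. ?D u\<bar> \<le> k * (LBINT u:{t..r}. \<bar>?D u\<bar>)" using k by simp
    moreover have "\<bar>?D r\<bar> = k * \<bar>LBINT u:{t..r}. ?D u\<bar>" unfolding D abs_mult using k by simp
    ultimately show ?thesis by simp
  qed
  show ?case
  proof
    fix r assume r: "r \<in> {t..T}"
    have "\<bar>?D r\<bar> \<le> 2 * 0 * exp (2 * k * (r - t))"
      by (rule gronwall_bounded[OF k order_refl r, where K=B])
         (use B ineq si[OF continuous_on_rabs[OF Dc], of T] t_le in auto)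
    then have "fst (snd (X r om)) = fst (snd (X' r om))" by simp
    then show "X r om = X' r om"
      using bspec[OF elim(1) r] bspec[OF elim(2) r] bspec[OF elim(5) r] bspec[OF elim(6) r] by (simp add: prod_eq_iff)
  qed
qed

text \<open>The noise does not act on the inventory, so a solution for one control yields one for every other control.\<close>

lemma sol_exists:
  assumes c0: "adm c0" and X0: "sol c0 (a, e0, q) X0" and c: "adm c"
  shows "\<exists>X. sol c (a, e0, q) X"
proof -
  \<comment> \<open>On the null set where the control is not integrable the inventory is frozen at
    \<open>q\<close>, which keeps every path continuous. The filtration contains the null sets, so
    the process stays adapted.\<close>
  obtain N0 where N0: "N0 \<in> null_sets M" "\<And>om. om \<in> space M \<Longrightarrow> om \<notin> N0 \<Longrightarrow> integrable lborel (\<lambda>u. cx c u om)"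
    using cx_AE[OF c] by (auto elim!: AE_E3)
  \<comment> \<open>Time is clamped at \<open>r\<close> and not at \<open>T\<close>, so that
    progressive measurability makes \<open>K r\<close> measurable at time \<open>r\<close>.\<close>
  define K where "K r om = (LBINT u. indicator {t..r} u * max 0 (c (max t (min r u)) om))" for r om
  define X where "X r om = (fst (X0 r om), fst (snd (X0 r om)), q - indicator (- N0) om * K r om)" for r om
  have K: "K r om = (LBINT u:{t..r}. cx c u om)" if "r \<in> {t..T}" for r om
    unfolding K_def set_lebesgue_integral_def cx_def
    by (rule Bochner_Integration.integral_cong) (use that in \<open>auto simp: indicator_def\<close>)
  have si: "set_integrable lborel {t..r} (\<lambda>u. cx c u om)" if "om \<in> space M" "om \<notin> N0" for r om
    using N0(2)[OF that] by (rule integrable_restrict) simp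
  have XF: "X r \<in> borel_measurable (F r)" if r: "r \<in> {t..T}" for r
  proof -
    have [measurable]: "(\<lambda>x. c (max t (min r (fst x))) (snd x)) \<in> borel_measurable (borel \<Otimes>\<^sub>M F r)"
      by (rule progressive_clamp[OF _ r]) (use c in \<open>simp add: admissible_def\<close>)
    have j: "(\<lambda>x. indicator {t..r} (fst x) * max 0 (c (max t (min r (fst x))) (snd x))) \<in> borel_measurable (borel \<Otimes>\<^sub>M F r)"
      by measurable
    have "(\<lambda>(om, u). indicator {t..r} u * max 0 (c (max t (min r u)) om)) \<in> borel_measurable (F r \<Otimes>\<^sub>M lborel)"
      using measurable_compose[OF measurable_pair_swap' j] by (simp add: split_def measurable_cong_sets[OF sets_pair_measure_cong[OF refl sets_lborel] refl])
    then have Km: "K r \<in> borel_measurable (F r)" unfolding K_def by (rule lborel.borel_measurable_lebesgue_integral)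
    have "N0 \<in> sets (F r)" by (rule null_F[OF N0(1)])
    then have "indicator (- N0) \<in> borel_measurable (F r)" by (intro borel_measurable_indicator') (auto simp: Compl_eq_Diff_UNIV Int_Diff Int_commute simp flip: space_F)
    then show ?thesis unfolding X_def using Km
      by (intro borel_measurable_Pair borel_measurable_diff borel_measurable_times borel_measurable_const
          measurable_compose[OF sol_F[OF X0 r] state_comp_measurable(1)] measurable_compose[OF sol_F[OF X0 r] state_comp_measurable(2)])
  qed
  have Xc: "continuous_on {t..T} (\<lambda>r. X r om)" if w: "om \<in> space M" for om
  proof -
    have i: "continuous_on {t..T} (\<lambda>r. indicator (- N0) om * K r om)"
    proof (cases "om \<in> N0")
      case False
      have "continuous_on {t..T} (\<lambda>r. LBINT u:{t..r}. cx c u om)" by (rule LINT_continuous[OF si[OF w False]])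
      then have "continuous_on {t..T} (\<lambda>r. K r om)" by (rule continuous_on_cong[THEN iffD1, OF refl, rotated]) (simp add: K)
      then show ?thesis by (intro continuous_intros)
    qed simp
    show ?thesis unfolding X_def by (intro continuous_on_Pair continuous_on_fst continuous_on_snd continuous_on_diff[OF continuous_on_const i] sol_cont[OF X0 w])
  qed
  have X_t: "X t om = (a, e0, q)" if "om \<in> space M" for om
  proof -
    have "K t om = integral\<^sup>L lborel (\<lambda>_ :: real. 0)"
      unfolding K_def
    proof (rule integral_cong_AE)
      show "(\<lambda>u. indicator {t..t} u * max 0 (c (max t (min t u)) om)) \<in> borel_measurable lborel" by (simp add: max_absorb1)
      show "AE u in lborel. indicator {t..t} u * max 0 (c (max t (min t u)) om) = 0"
        using AE_lborel_singleton[of t] by eventually_elim simp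
    qed simp
    then show ?thesis by (simp add: X_def sol_init[OF X0 that])
  qed
  have dX: "diff1 sig1 sig2 rho (X u om) = diff1 sig1 sig2 rho (X0 u om)" "diff2 sig2 rho (X u om) = diff2 sig2 rho (X0 u om)" for u om
    by (simp_all add: X_def diff1_def diff2_def split_beta)
  have "\<exists>I1 I2. ito_integral M (\<lambda>u om. diff1 sig1 sig2 rho (X u om)) W1 t r I1 \<and> ito_integral M (\<lambda>u om. diff2 sig2 rho (X u om)) W2 t r I2 \<and>
      (AE om in M. X r om = (a, e0, q) + (LBINT u:{t..r}. drift mu1 k (X u om) (c u om)) + I1 om + I2 om)" if r: "r \<in> {t..T}" for r
  proof -
    obtain I1 I2 where I1: "ito_integral M (\<lambda>u om. diff1 sig1 sig2 rho (X0 u om)) W1 t r I1"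
      and I2: "ito_integral M (\<lambda>u om. diff2 sig2 rho (X0 u om)) W2 t r I2"
      and eq: "AE om in M. X0 r om = (a, e0, q) + (LBINT u:{t..r}. drift mu1 k (X0 u om) (c0 u om)) + I1 om + I2 om"
      using X0 r unfolding sde_sol_def by blast
    have X0F: "\<forall>u\<in>{t..T}. X0 u \<in> borel_measurable (F u)" using sol_F[OF X0] by blast
    have "AE om in M. om \<notin> N0" by (rule AE_not_in[OF N0(1)])
    with eq noise_parts(1)[OF X0F r I1 I2] cx_AE[OF c0] AE_space
    have "AE om in M. X r om = (a, e0, q) + (LBINT u:{t..r}. drift mu1 k (X u om) (c u om)) + I1 om + I2 om"
    proof eventually_elim
      case (elim om)
      note w = elim(4)
      have sub: "{t..r} \<subseteq> {t..T}" using r by auto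
      have "set_integrable lborel {t..r} (\<lambda>u. cx c0 u om)" using elim(3) by (rule integrable_restrict) simp
      then have c0i: "set_integrable lborel {t..r} (\<lambda>u. c0 u om)"
        by (rule set_integrable_cong[THEN iffD1, rotated -1]) (use cx_eq[OF c0 _ w] r in auto)
      have ci: "set_integrable lborel {t..r} (\<lambda>u. c u om)"
        by (rule set_integrable_cong[THEN iffD1, rotated -1, OF si[OF w elim(5)]]) (use cx_eq[OF c _ w] r in auto)
      have L: "K r om = (LBINT u:{t..r}. c u om)" unfolding K[OF r] by (rule LINT_cx[OF c w]) (use r in simp)
      have fX: "fst (X u om) = fst (X0 u om)" "fst (snd (X u om)) = fst (snd (X0 u om))" for u by (simp_all add: X_def)
      have "snd (snd (X r om)) = q - K r om" using elim(5) by (simp add: X_def)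
      then show ?case using elim(1,2)
        unfolding drift_integral[OF continuous_on_subset[OF sol_cont[OF X0 w] sub] c0i] drift_integral[OF continuous_on_subset[OF Xc[OF w] sub] ci] fX
        by (simp add: prod_eq_iff fX L)
    qed
    with I1 I2 show ?thesis unfolding dX by blast
  qed
  then have "sol c (a, e0, q) X" unfolding sde_sol_def using XF Xc X_t by blast
  then show ?thesis by blast
qed

end

section \<open>Depletion and payoff along one path\<close>

lemma first_zero:
  fixes f :: "real \<Rightarrow> real"
  assumes c: "continuous_on {u..v} f" and z: "s \<in> {u..v}" "f s = 0"
  shows "Inf {r\<in>{u..v}. f r = 0} \<in> {r\<in>{u..v}. f r = 0}" and "\<And>r. r \<in> {u..<Inf {r\<in>{u..v}. f r = 0}} \<Longrightarrow> f r \<noteq> 0"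
proof -
  let ?S = "{r\<in>{u..v}. f r = 0}"
  have bb: "bdd_below ?S" by (rule bdd_belowI[of _ u]) auto
  have "closed ?S" using continuous_closed_preimage[OF c closed_real_atLeastAtMost, of "{0}"] by (simp add: vimage_def Int_def)
  then show *: "Inf ?S \<in> ?S" using z by (intro closed_contains_Inf[OF _ bb]) auto
  show "f r \<noteq> 0" if "r \<in> {u..<Inf ?S}" for r
  proof
    assume "f r = 0"
    then have "r \<in> ?S" using that * by auto
    then have "Inf ?S \<le> r" by (rule cInf_lower[OF _ bb])
    then show False using that by simp
  qed
qed

lemma LINT_eq_except_point:
  fixes f g :: "real \<Rightarrow> real"
  assumes [measurable]: "g \<in> borel_measurable borel" and eq: "\<And>u. u \<noteq> x \<Longrightarrow> f u = g u"
  shows "(LBINT u. f u) = (LBINT u. g u)"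
proof (rule integral_cong_AE)
  have "f = (\<lambda>u. if u = x then f x else g u)" using eq by auto
  moreover have "(\<lambda>u. if u = x then f x else g u) \<in> borel_measurable lborel" by measurable
  ultimately show "f \<in> borel_measurable lborel" by simp
  show "AE u in lborel. f u = g u" using AE_lborel_singleton[of x] by eventually_elim (rule eq)
qed simp

text \<open>The positive part of the inventory is itself driven by a control, namely the given one
  switched off after depletion. This brings paths with negative inventory within reach of the
  verification argument. The condition \<open>x < T\<close> removes a null set and matches the
  definition of \<open>cp\<close>.\<close>

lemma depletion:
  fixes g Q :: "real \<Rightarrow> real"
  assumes g: "set_integrable lborel {t..T} g" "\<And>x. 0 \<le> g x" and Q: "\<And>r. r \<in> {t..T} \<Longrightarrow> Q r = q - (LBINT u:{t..r}. g u)"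
  shows "\<lbrakk>t \<le> u; u \<le> v; v \<le> T\<rbrakk> \<Longrightarrow> Q v \<le> Q u"
    and "\<lbrakk>t \<le> u; u \<le> v; v \<le> T\<rbrakk> \<Longrightarrow>
      max 0 (Q v) - max 0 (Q u) = - (LBINT x:{u..v}. if x < T \<and> Q x > 0 then g x else 0)"
proof -
  have sub: "set_integrable lborel {u..v} g" if "t \<le> u" "v \<le> T" for u v by (rule set_integrable_subset[OF g(1)]) (use that in auto)
  have inc: "Q v = Q u - (LBINT x:{u..v}. g x)" if "t \<le> u" "u \<le> v" "v \<le> T" for u v
    using Q[of u] Q[of v] LINT_Icc_split[OF sub[of t v] that(1,2)] that by simp
  have pos: "0 \<le> (LBINT x:{u..v}. g x)" for u v
    unfolding set_lebesgue_integral_def by (rule Bochner_Integration.integral_nonneg) (simp add: g(2))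
  show mono: "Q v \<le> Q u" if "t \<le> u" "u \<le> v" "v \<le> T" for u v using inc[OF that] pos[of u v] by linarith
  let ?h = "\<lambda>x. if x < T \<and> Q x > 0 then g x else 0"
  assume uv: "t \<le> u" "u \<le> v" "v \<le> T"
  text \<open>\<open>Q\<close> is positive exactly up to some \<open>s\<close>, at which it has reached its final positive part.\<close>
  have "\<exists>s\<in>{u..v}. (\<forall>x\<in>{u..<s}. Q x > 0) \<and> (\<forall>x\<in>{s<..v}. Q x \<le> 0) \<and> max 0 (Q v) - max 0 (Q u) = Q s - Q u"
  proof -
    consider "Q v > 0" | "Q u \<le> 0" | "Q v \<le> 0" "Q u > 0" by linarith
    then show ?thesis
    proof cases
      case 1
      have "Q x > 0" if "x \<in> {u..v}" for x using mono[of x v] that uv 1 by auto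
      moreover have "max 0 (Q v) - max 0 (Q u) = Q v - Q u" using calculation[of u] 1 uv by simp
      ultimately show ?thesis using uv by (intro bexI[of _ v]) auto
    next
      case 2
      have "Q x \<le> 0" if "x \<in> {u..v}" for x using mono[of u x] that uv 2 by auto
      moreover have "max 0 (Q v) - max 0 (Q u) = Q u - Q u" using calculation[of v] 2 uv by simp
      ultimately show ?thesis using uv by (intro bexI[of _ u]) auto
    next
      case 3
      have "continuous_on {t..T} Q"
        by (rule continuous_on_cong[THEN iffD1, OF refl _ continuous_on_diff[OF continuous_on_const[of _ q] LINT_continuous[OF g(1)]]]) (simp add: Q)
      then have c: "continuous_on {u..v} Q" by (rule continuous_on_subset) (use uv in auto)
      obtain s0 where s0: "s0 \<in> {u..v}" "Q s0 = 0" using IVT2'[of Q v 0 u] 3 uv c by auto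
      define s where "s = Inf {r\<in>{u..v}. Q r = 0}"
      have s: "s \<in> {u..v}" "Q s = 0" using first_zero(1)[OF c s0] unfolding s_def by blast+
      have "Q x > 0" if "x \<in> {u..<s}" for x
      proof -
        have "Q x \<noteq> 0" using first_zero(2)[OF c s0, of x] that unfolding s_def by blast
        moreover have "Q s \<le> Q x" using mono[of x s] s that uv by auto
        ultimately show ?thesis using s(2) by linarith
      qed
      moreover have "Q x \<le> 0" if "x \<in> {s<..v}" for x using mono[of s x] s that uv by auto
      moreover have "max 0 (Q v) - max 0 (Q u) = Q s - Q u" using 3 s by simp
      ultimately show ?thesis using s(1) by blast
    qed
  qed
  then obtain s where s: "s \<in> {u..v}" "\<And>x. x \<in> {u..<s} \<Longrightarrow> Q x > 0" "\<And>x. x \<in> {s<..v} \<Longrightarrow> Q x \<le> 0"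
    "max 0 (Q v) - max 0 (Q u) = Q s - Q u" by blast
  have gm: "(\<lambda>x. indicator {u..s} x * g x) \<in> borel_measurable borel"
    using sub[of u s] uv s(1) borel_measurable_integrable unfolding set_integrable_def by fastforce
  have "(LBINT x:{u..v}. ?h x) = (LBINT x:{u..s}. g x)"
    unfolding set_lebesgue_integral_def real_scaleR_def
  proof (rule LINT_eq_except_point[OF gm, of s])
    fix x assume "x \<noteq> s"
    then consider "x < u" | "x \<in> {u..<s}" | "x \<in> {s<..v}" | "v < x" using s(1) by fastforce
    then show "indicator {u..v} x * ?h x = indicator {u..s} x * g x"
      by cases (use s(1) s(2)[of x] s(3)[of x] uv in \<open>simp_all add: not_less[symmetric]\<close>)
  qed
  also have "\<dots> = Q u - Q s" using inc[of u s] s(1) uv by simp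
  finally show "max 0 (Q v) - max 0 (Q u) = - (LBINT x:{u..v}. ?h x)" using s(4) by simp
qed

lemma hit_time:
  assumes c: "continuous_on {t..T} (\<lambda>u. Q u om)" and tT: "t \<le> T"
  defines "\<tau> \<equiv> hit_time T t Q om"
  shows "\<tau> \<in> {t..T}" "\<And>s. s \<in> {t..<\<tau>} \<Longrightarrow> Q s om \<noteq> 0" "Q \<tau> om \<noteq> 0 \<Longrightarrow> \<tau> = T"
proof -
  have "\<tau> \<in> {t..T} \<and> (\<forall>s\<in>{t..<\<tau>}. Q s om \<noteq> 0) \<and> (Q \<tau> om \<noteq> 0 \<longrightarrow> \<tau> = T)"
  proof (cases "\<exists>r\<in>{t..T}. Q r om = 0")
    case True
    then obtain r where "r \<in> {t..T}" "Q r om = 0" by blast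
    note z = first_zero[OF c this]
    have "\<tau> = Inf {r\<in>{t..T}. Q r om = 0}" using True by (simp add: \<tau>_def hit_time_def)
    then have "\<tau> \<in> {r\<in>{t..T}. Q r om = 0}" "\<forall>s\<in>{t..<\<tau>}. Q s om \<noteq> 0" using z by blast+
    then show ?thesis by blast
  next
    case False
    then show ?thesis using tT by (auto simp: \<tau>_def hit_time_def)
  qed
  then show "\<tau> \<in> {t..T}" "\<And>s. s \<in> {t..<\<tau>} \<Longrightarrow> Q s om \<noteq> 0" "Q \<tau> om \<noteq> 0 \<Longrightarrow> \<tau> = T" by blast+
qed

text \<open>The integrand of \<open>perf\<close> with the solution as an argument, so that it can be
  studied for any solution before \<open>SOME\<close> is inserted.\<close>

definition payoff :: "real \<Rightarrow> real \<Rightarrow> real \<Rightarrow> real \<Rightarrow> real \<Rightarrow> real \<Rightarrow> real \<Rightarrow> (real \<Rightarrow> 'w \<Rightarrow> real) \<Rightarrow> (real \<Rightarrow> 'w \<Rightarrow> state) \<Rightarrow> 'w \<Rightarrow> real" where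
  "payoff eta chi phi1 phi2 phi3 T t c X om =
     (let A = (\<lambda>r. fst (X r om)); Q = (\<lambda>r. snd (snd (X r om))); S = (\<lambda>r. A r * exp (fst (snd (X r om))));
          \<tau> = hit_time T t (\<lambda>r om. snd (snd (X r om))) om
      in (LBINT u:{t..\<tau>}. c u om * (S u - eta * c u om)) + Q \<tau> * (S \<tau> - chi * Q \<tau>)
         - phi1 * (LBINT u:{t..\<tau>}. (Q u)\<^sup>2) - phi2 * (LBINT u:{t..\<tau>}. S u * Q u) - phi3 * (LBINT u:{t..\<tau>}. A u * Q u))"

lemma perf_payoff:
  "perf M W1 W2 T mu1 sig1 k sig2 rho eta chi phi1 phi2 phi3 c t x =
     (LINT om|M. payoff eta chi phi1 phi2 phi3 T t c (SOME X. sde_sol M W1 W2 T mu1 sig1 k sig2 rho c t x X) om)"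
  by (simp add: perf_def payoff_def Let_def)

text \<open>The supremum in the HJB equation is unfolded into an inequality for each
  \<open>v \<ge> 0\<close> and an equation at \<open>cs\<close>, the two forms that the comparison
  of \<open>gen\<close> with \<open>ell\<close> consumes.\<close>

locale hjb_model = sde_model M W1 W2 T t mu1 sig1 k sig2 rho + c12_fun T Qbar w wt Dw D2w
  for M :: "'w measure" and W1 W2 T t mu1 sig1 k sig2 rho Qbar w wt Dw D2w +
  fixes eta chi phi1 phi2 phi3 C p1 p2 :: real and cs :: "real \<Rightarrow> state \<Rightarrow> real"
  assumes rho: "rho\<^sup>2 \<le> 1" and pos: "p1 > 0" "p2 > 0" "C > 0"
    and growth: "\<And>s a e q. s \<in> {0..T} \<Longrightarrow> (a, e, q) \<in> stateO Qbar \<Longrightarrow>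
        \<bar>w s (a, e, q)\<bar> \<le> C * (1 + q\<^sup>2) * (1 + a powr p1) * (1 + exp (p2 * e))"
    and boundary: "\<And>s a e. s \<in> {0..T} \<Longrightarrow> a > 0 \<Longrightarrow> w s (a, e, 0) = 0"
    and terminal: "\<And>a e q. (a, e, q) \<in> stateO Qbar \<Longrightarrow> w T (a, e, q) = q * (a * exp e - chi * q)"
    and HJB_le: "\<And>s a e q v. s \<in> {0..<T} \<Longrightarrow> (a, e, q) \<in> stateO Qbar \<Longrightarrow> v \<ge> 0 \<Longrightarrow>
        wt s (a, e, q) + op_L mu1 sig1 k sig2 rho (Dw s (a, e, q)) (D2w s (a, e, q)) (a, e, q) - v * d1 (Dw s (a, e, q)) eq
          + a * exp e * v - eta * v\<^sup>2 - (phi1 * q\<^sup>2 + phi2 * q * a * exp e + phi3 * q * a) \<le> 0"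
    and HJB_eq: "\<And>s a e q v. s \<in> {0..<T} \<Longrightarrow> (a, e, q) \<in> stateO Qbar \<Longrightarrow> v = cs s (a, e, q) \<Longrightarrow>
        wt s (a, e, q) + op_L mu1 sig1 k sig2 rho (Dw s (a, e, q)) (D2w s (a, e, q)) (a, e, q) - v * d1 (Dw s (a, e, q)) eq
          + a * exp e * v - eta * v\<^sup>2 - (phi1 * q\<^sup>2 + phi2 * q * a * exp e + phi3 * q * a) = 0"

locale controlled = hjb_model +
  fixes c a e0 q X
  assumes adm: "adm c" and sol: "sol c (a, e0, q) X" and a: "a > 0" and q: "0 \<le> q" "q < Qbar" and tT: "t < T"
begin

definition A where "A u om = fst (X u om)"
definition E where "E u om = fst (snd (X u om))"
definition Q where "Q u om = snd (snd (X u om))"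
text \<open>The outer \<open>min q\<close> is inactive on almost every path; it confines the process
  to \<open>[0, q]\<close> on all of them.\<close>

definition Qp where "Qp u om = min q (max 0 (Q u om))"
text \<open>The condition uses the inventory cut to \<open>{t..<T}\<close>, the form in which it is
  jointly measurable.\<close>

definition cp where "cp u om = (if indicator {t..<T} u * Qp u om > 0 then cx c u om else 0)"

lemma AEQ_F:
  assumes "u \<in> {t..T}"
  shows "A u \<in> borel_measurable (F u)" "E u \<in> borel_measurable (F u)" "Q u \<in> borel_measurable (F u)"
  unfolding A_def E_def Q_def
  by (rule measurable_compose[OF sol_F[OF sol assms] state_comp_measurable(1)] measurable_compose[OF sol_F[OF sol assms] state_comp_measurable(2)]
      measurable_compose[OF sol_F[OF sol assms] state_comp_measurable(3)])+

lemma AEQ_M: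
  assumes "u \<in> {t..T}"
  shows "A u \<in> borel_measurable M" "E u \<in> borel_measurable M" "Q u \<in> borel_measurable M"
  by (rule F_measurable_M[OF _ AEQ_F(1)[OF assms]] F_measurable_M[OF _ AEQ_F(2)[OF assms]] F_measurable_M[OF _ AEQ_F(3)[OF assms]], use assms in simp)+

lemma AEQ_cont:
  assumes "om \<in> space M"
  shows "continuous_on {t..T} (\<lambda>u. A u om)" "continuous_on {t..T} (\<lambda>u. E u om)" "continuous_on {t..T} (\<lambda>u. Q u om)"
  unfolding A_def E_def Q_def by (intro continuous_intros sol_cont[OF sol assms])+

lemma Qp_F: "u \<in> {t..T} \<Longrightarrow> Qp u \<in> borel_measurable (F u)"
  unfolding Qp_def using AEQ_F(3) by (intro borel_measurable_min borel_measurable_max) auto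

lemma Qp_cont: "om \<in> space M \<Longrightarrow> continuous_on {t..T} (\<lambda>u. Qp u om)"
  unfolding Qp_def by (intro continuous_on_min continuous_on_max continuous_on_const AEQ_cont)

lemma joint:
  assumes "\<And>u. u \<in> {t..T} \<Longrightarrow> V u \<in> borel_measurable M" "\<And>om. om \<in> space M \<Longrightarrow> continuous_on {t..T} (\<lambda>u. V u om)"
  shows "(\<lambda>x. indicator {t..<T} (fst x) * (V (fst x) (snd x) :: real)) \<in> borel_measurable (borel \<Otimes>\<^sub>M M)"
  using joint_measurable_continuous[OF tT assms] by (simp add: split_def)

lemma Qp_M: "u \<in> {t..T} \<Longrightarrow> Qp u \<in> borel_measurable M"
  by (rule F_measurable_M[OF _ Qp_F]) auto

lemma cp_joint: "jointly M cp"
proof -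
  note [measurable] = joint[OF Qp_M Qp_cont]
  have [measurable]: "(\<lambda>x. cx c (fst x) (snd x)) \<in> borel_measurable (borel \<Otimes>\<^sub>M M)" using cx_joint[OF adm] by (simp add: split_def)
  show ?thesis unfolding cp_def split_def by measurable
qed

lemma cp_le: "0 \<le> cp u om" "cp u om \<le> cx c u om" by (simp_all add: cp_def)

lemma cp_square_le: "norm ((cp u om)\<^sup>2) \<le> norm ((cx c u om)\<^sup>2)"
  using power_mono[OF cp_le(2) cp_le(1), of u om 2] by simp

lemma cp_square_ind: "indicator {t..T} u *\<^sub>R (cp u om)\<^sup>2 = (cp u om)\<^sup>2"
  by (auto simp: cp_def indicator_def)

lemma cp_section: "om \<in> space M \<Longrightarrow> (\<lambda>u. cp u om) \<in> borel_measurable borel"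
  by (rule section_measurable'[OF cp_joint])

text \<open>The almost sure facts about a path are gathered into one event, so that later arguments
  can be deterministic.\<close>

lemma good_paths: "AE om in M. om \<in> space M \<and> integrable lborel (\<lambda>u. (cx c u om)\<^sup>2) \<and> integrable lborel (\<lambda>u. cx c u om)
    \<and> (\<forall>r\<in>{t..T}. A r om = gbm W1 mu1 sig1 a t r om) \<and> (\<forall>r\<in>{t..T}. Q r om = q - (LBINT u:{t..r}. cx c u om))
    \<and> (\<forall>u v. t \<le> u \<longrightarrow> u \<le> v \<longrightarrow> v \<le> T \<longrightarrow> Q v om \<le> Q u om) \<and> (\<forall>u\<in>{t..T}. Qp u om = max 0 (Q u om))"
  using AE_space cx_square_AE[OF adm] cx_AE[OF adm] sol_A[OF adm sol tT] sol_Q[OF adm sol]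
proof eventually_elim
  case (elim om)
  have Q: "Q r om = q - (LBINT u:{t..r}. cx c u om)" if "r \<in> {t..T}" for r using elim(5) that by (simp add: Q_def)
  have "set_integrable lborel {t..T} (\<lambda>u. cx c u om)" using elim(3) by (rule integrable_restrict) simp
  note d = depletion(1)[OF this cx_nonneg Q]
  have "Qp u om = max 0 (Q u om)" if "u \<in> {t..T}" for u
    using d[of t u] sol_init[OF sol elim(1)] that tT q by (auto simp: Qp_def Q_def min_def)
  then show ?case using elim Q d by (auto simp: A_def)
qed

lemma E_increment: "AE om in M. \<forall>u v. t \<le> u \<longrightarrow> u \<le> v \<longrightarrow> v \<le> T \<longrightarrow> E v om - E u om = (LBINT x:{u..v}. - k * E x om)
        + sig2 * (rho * (W1 v om - W1 u om) + sqrt (1 - rho\<^sup>2) * (W2 v om - W2 u om))"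
  using sol_E[OF adm sol] AE_space
proof eventually_elim
  case (elim om)
  have e: "E r om = e0 - k * (LBINT u:{t..r}. E u om) + Z r om" if "r \<in> {t..T}" for r using elim(1) that by (simp add: E_def)
  show ?case
  proof (intro allI impI)
    fix u v assume uv: "t \<le> u" "u \<le> v" "v \<le> T"
    have "set_integrable lborel {t..v} (\<lambda>x. E x om)"
      by (rule borel_integrable_atLeastAtMost', rule continuous_on_subset[OF AEQ_cont(2)[OF elim(2)]]) (use uv in auto)
    from LINT_Icc_split[OF this uv(1,2)] have I: "(LBINT x:{t..v}. E x om) = (LBINT x:{t..u}. E x om) + (LBINT x:{u..v}. E x om)" .
    have "(LBINT x:{u..v}. - k * E x om) = - k * (LBINT x:{u..v}. E x om)" by (rule set_integral_mult_right)
    then show "E v om - E u om = (LBINT x:{u..v}. - k * E x om) + sig2 * (rho * (W1 v om - W1 u om) + sqrt (1 - rho\<^sup>2) * (W2 v om - W2 u om))"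
      using e[of u] e[of v] I uv by (simp add: Z_def algebra_simps)
  qed
qed

lemma Q_increment: "AE om in M. \<forall>u v. t \<le> u \<longrightarrow> u \<le> v \<longrightarrow> v \<le> T \<longrightarrow> Qp v om - Qp u om = - (LBINT x:{u..v}. cp x om)"
  using good_paths
proof eventually_elim
  case (elim om)
  show ?case
  proof (intro allI impI)
    fix u v assume uv: "t \<le> u" "u \<le> v" "v \<le> T"
    have Q: "Q r om = q - (LBINT u:{t..r}. cx c u om)" if "r \<in> {t..T}" for r using elim that by blast
    have "integrable lborel (\<lambda>u. cx c u om)" using elim by blast
    then have "set_integrable lborel {t..T} (\<lambda>u. cx c u om)" by (rule integrable_restrict) simp
    note d = depletion(2)[OF this cx_nonneg Q uv]
    have "(LBINT x:{u..v}. if x < T \<and> Q x om > 0 then cx c x om else 0) = (LBINT x:{u..v}. cp x om)"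
      by (rule set_lebesgue_integral_cong) (use uv elim in \<open>auto simp: cp_def indicator_def\<close>)
    moreover have "Qp v om = max 0 (Q v om)" "Qp u om = max 0 (Q u om)" using elim uv by auto
    ultimately show "Qp v om - Qp u om = - (LBINT x:{u..v}. cp x om)" using d by simp
  qed
qed

sublocale V: verification M W1 W2 T Qbar w wt Dw D2w mu1 sig1 k sig2 rho eta chi phi1 phi2 phi3 C p1 p2 t a e0 q E Qp cp
proof
  show "0 \<le> t" by (rule t0)
  show "t < T" by (rule tT)
  show "0 < a" by (rule a)
  show "0 \<le> q" "q < Qbar" by (rule q)+
  show "0 < k" by (rule k)
  show "rho\<^sup>2 \<le> 1" by (rule rho)
  show "0 < p1" "0 < p2" "0 < C" by (rule pos)+
  show "\<bar>w s (a, e, q)\<bar> \<le> C * (1 + q\<^sup>2) * (1 + a powr p1) * (1 + exp (p2 * e))" if "s \<in> {0..T}" "(a, e, q) \<in> stateO Qbar" for s a e q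
    by (rule growth[OF that])
  show "w s (a, e, 0) = 0" if "s \<in> {0..T}" "0 < a" for s a e by (rule boundary[OF that])
  show "E u \<in> borel_measurable (F u)" if "u \<in> {t..T}" for u by (rule AEQ_F(2)[OF that])
  show "continuous_on {t..T} (\<lambda>u. E u om)" if "om \<in> space M" for om by (rule AEQ_cont(2)[OF that])
  show "E t om = e0" if "om \<in> space M" for om by (simp add: E_def sol_init[OF sol that])
  show "Qp u \<in> borel_measurable (F u)" if "u \<in> {t..T}" for u by (rule Qp_F[OF that])
  show "continuous_on {t..T} (\<lambda>u. Qp u om)" if "om \<in> space M" for om by (rule Qp_cont[OF that])
  show "Qp u om \<in> {0..q}" for u om using q by (simp add: Qp_def)
  show "Qp t om = q" if "om \<in> space M" for om using q by (simp add: Qp_def Q_def sol_init[OF sol that])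
  show "jointly M cp" by (rule cp_joint)
  show "0 \<le> cp u om" for u om by (rule cp_le(1))
  have i: "AE om in M. integrable lborel (\<lambda>u. (cp u om)\<^sup>2)"
    using cx_square_AE[OF adm] AE_space
  proof eventually_elim
    case (elim om)
    show ?case
      by (rule Bochner_Integration.integrable_bound[OF elim(1)]) (use cp_section[OF elim(2)] cp_square_le in auto)
  qed
  then show "AE om in M. set_integrable lborel {t..T} (\<lambda>u. (cp u om)\<^sup>2)" unfolding set_integrable_def cp_square_ind .
  show "integrable M (\<lambda>om. LBINT u:{t..T}. (cp u om)\<^sup>2)" unfolding set_lebesgue_integral_def cp_square_ind
  proof (rule Bochner_Integration.integrable_bound[OF cx_square_integrable[OF adm]])
    have "jointly M (\<lambda>u om. (cp u om)\<^sup>2)" using borel_measurable_power[OF cp_joint, of 2] by (simp add: split_def)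
    then show "(\<lambda>om. LBINT u. (cp u om)\<^sup>2) \<in> borel_measurable M" by (rule time_integral_measurable)
    show "AE om in M. norm (LBINT u. (cp u om)\<^sup>2) \<le> norm (LBINT u. (cx c u om)\<^sup>2)"
      using i cx_square_AE[OF adm]
    proof eventually_elim
      case (elim om)
      have "(LBINT u. (cp u om)\<^sup>2) \<le> (LBINT u. (cx c u om)\<^sup>2)"
        by (rule integral_mono[OF elim]) (use cp_square_le in simp)
      moreover have "0 \<le> (LBINT u. (cp u om)\<^sup>2)" by simp
      ultimately show ?case by simp
    qed
  qed
  show "AE om in M. \<forall>u v. t \<le> u \<longrightarrow> u \<le> v \<longrightarrow> v \<le> T \<longrightarrow> E v om - E u om = (LBINT x:{u..v}. - k * E x om)
        + sig2 * (rho * (W1 v om - W1 u om) + sqrt (1 - rho\<^sup>2) * (W2 v om - W2 u om))" by (rule E_increment)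
  show "AE om in M. \<forall>u v. t \<le> u \<longrightarrow> u \<le> v \<longrightarrow> v \<le> T \<longrightarrow> Qp v om - Qp u om = - (LBINT x:{u..v}. cp x om)" by (rule Q_increment)
qed

lemma A_V: "\<forall>r\<in>{t..T}. A r om = gbm W1 mu1 sig1 a t r om \<Longrightarrow> u \<in> {t..T} \<Longrightarrow> V.A u om = A u om"
  using a by (simp add: V.A_def V.Y_def V.m_def gbm_def exp_add)

end

context controlled
begin

text \<open>Weight that drops at the first zero of \<open>Q\<close>. The auxiliary
  \<open>min 1 \<bar>Q s om\<bar>\<close> has the zeros of \<open>Q\<close> and values in
  \<open>[0, 1]\<close> on every path, so the results on \<open>pos_ind\<close> apply.\<close>

definition pz where "pz = pos_ind t (\<lambda>s om. min 1 \<bar>Q s om\<bar>)"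

lemma pz_eq: "pz u om = (if \<forall>s\<in>{t..u}. Q s om \<noteq> 0 then 1 else 0)"
  by (simp add: pz_def pos_ind_def)

text \<open>A random upper limit becomes a weight on a fixed interval, and the reward at the hitting
  time becomes a weighted reward at \<open>T\<close>: it is 0 if a zero has occurred, and otherwise
  the hitting time is \<open>T\<close>. Measurability of the payoff then follows from that of the
  weight.\<close>

lemma pz_hit:
  assumes w: "om \<in> space M"
  defines "\<tau> \<equiv> hit_time T t Q om"
  shows "u \<in> {t..<T} \<Longrightarrow> pz u om = (if u < \<tau> then 1 else 0)" and "Q \<tau> om * (A \<tau> om * exp (E \<tau> om) - chi * Q \<tau> om) = pz T om * (Q T om * (A T om * exp (E T om) - chi * Q T om))"
proof -
  note h = hit_time[where Q=Q and om=om, OF AEQ_cont(3)[OF w] less_imp_le[OF tT], folded \<tau>_def]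
  show "pz u om = (if u < \<tau> then 1 else 0)" if u: "u \<in> {t..<T}" for u
  proof (cases "u < \<tau>")
    case True
    then have "\<forall>s\<in>{t..u}. Q s om \<noteq> 0" using h(2) by auto
    then show ?thesis using True by (simp add: pz_eq)
  next
    case False
    then have "Q \<tau> om = 0" using h(3) u by auto
    then have "\<not> (\<forall>s\<in>{t..u}. Q s om \<noteq> 0)" using False h(1) by auto
    then show ?thesis using False by (simp add: pz_eq)
  qed
  show "Q \<tau> om * (A \<tau> om * exp (E \<tau> om) - chi * Q \<tau> om) = pz T om * (Q T om * (A T om * exp (E T om) - chi * Q T om))"
  proof (cases "Q \<tau> om = 0")
    case True
    then have "\<not> (\<forall>s\<in>{t..T}. Q s om \<noteq> 0)" using h(1) by blast
    then have "pz T om = 0" unfolding pz_eq by (rule if_not_P)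
    then show ?thesis using True by simp
  next
    case False
    then have T: "\<tau> = T" by (rule h(3))
    have "Q s om \<noteq> 0" if "s \<in> {t..T}" for s using h(2)[of s] False that T by (cases "s = T") auto
    then show ?thesis using T by (simp add: pz_eq)
  qed
qed

lemma pz_joint: "jointly M (\<lambda>u om. indicator {t..<T} u * pz u om)"
  unfolding pz_def by (rule pos_ind_joint[OF tT, where q=1]) (auto intro!: borel_measurable_min borel_measurable_abs AEQ_M continuous_on_min continuous_on_rabs continuous_on_const AEQ_cont)

lemma pz_T: "pz T \<in> borel_measurable M"
  unfolding pz_def by (rule pos_ind_measurable[OF less_imp_le[OF tT], where q=1]) (auto intro!: borel_measurable_min borel_measurable_abs AEQ_M continuous_on_min continuous_on_rabs continuous_on_const AEQ_cont)

definition before :: "(real \<Rightarrow> 'a \<Rightarrow> real) \<Rightarrow> real \<Rightarrow> 'a \<Rightarrow> real" where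
  "before g u om = indicator {t..<T} u * pz u om * g u om"

lemma before_joint:
  assumes "jointly M g"
  shows "jointly M (\<lambda>u om. before g u om)"
  using borel_measurable_times[OF pz_joint assms] by (simp add: before_def split_def)

lemma stopped_integral:
  assumes g: "jointly M g" and w: "om \<in> space M"
    and f: "\<And>u. u \<in> {t..<T} \<Longrightarrow> f u = g u om"
  shows "(LBINT u:{t..hit_time T t Q om}. f u) = (LBINT u. before g u om)"
  unfolding set_lebesgue_integral_def real_scaleR_def
proof (rule LINT_eq_except_point[where x="hit_time T t Q om"])
  show "(\<lambda>u. before g u om) \<in> borel_measurable borel" by (rule section_measurable'[OF before_joint[OF g] w])
  fix u assume u: "u \<noteq> hit_time T t Q om"
  have h: "hit_time T t Q om \<in> {t..T}" by (rule hit_time(1)[where Q=Q and om=om, OF AEQ_cont(3)[OF w] less_imp_le[OF tT]])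
  show "indicator {t..hit_time T t Q om} u * f u = before g u om"
  proof (cases "u \<in> {t..<T}")
    case True
    then show ?thesis using u by (simp add: before_def pz_hit(1)[OF w True] f[OF True])
  next
    case False
    then show ?thesis using u h by (auto simp: before_def)
  qed
qed

text \<open>Copies cut to \<open>{t..<T}\<close>, where joint measurability is at hand; the single
  time \<open>T\<close> does not affect the integrals.\<close>

definition iA where "iA u om = indicator {t..<T} u * A u om"
definition iE where "iE u om = indicator {t..<T} u * E u om"
definition iQ where "iQ u om = indicator {t..<T} u * Q u om"
definition g1 where "g1 u om = cx c u om * (iA u om * exp (iE u om) - eta * cx c u om)"
definition g2 where "g2 u om = (iQ u om)\<^sup>2"
definition g3 where "g3 u om = iA u om * exp (iE u om) * iQ u om"
definition g4 where "g4 u om = iA u om * iQ u om"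

lemma g_joint:
  "jointly M g1" "jointly M g2"
  "jointly M g3" "jointly M g4"
proof -
  have [measurable]: "(\<lambda>x. iA (fst x) (snd x)) \<in> borel_measurable (borel \<Otimes>\<^sub>M M)" unfolding iA_def by (rule joint[OF AEQ_M(1) AEQ_cont(1)])
  have [measurable]: "(\<lambda>x. iE (fst x) (snd x)) \<in> borel_measurable (borel \<Otimes>\<^sub>M M)" unfolding iE_def by (rule joint[OF AEQ_M(2) AEQ_cont(2)])
  have [measurable]: "(\<lambda>x. iQ (fst x) (snd x)) \<in> borel_measurable (borel \<Otimes>\<^sub>M M)" unfolding iQ_def by (rule joint[OF AEQ_M(3) AEQ_cont(3)])
  have [measurable]: "(\<lambda>x. cx c (fst x) (snd x)) \<in> borel_measurable (borel \<Otimes>\<^sub>M M)" using cx_joint[OF adm] by (simp add: split_def)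
  show "jointly M g1" "jointly M g2"
    "jointly M g3" "jointly M g4"
    unfolding g1_def g2_def g3_def g4_def split_def by measurable
qed

abbreviation "pay \<equiv> payoff eta chi phi1 phi2 phi3 T t c X"

lemma pay_eq:
  assumes w: "om \<in> space M"
  shows "pay om = (LBINT u. before g1 u om) + pz T om * (Q T om * (A T om * exp (E T om) - chi * Q T om))
    - phi1 * (LBINT u. before g2 u om) - phi2 * (LBINT u. before g3 u om) - phi3 * (LBINT u. before g4 u om)"
proof -
  note i = stopped_integral[OF g_joint(1) w, symmetric, of "\<lambda>u. c u om * (A u om * exp (E u om) - eta * c u om)"]
    stopped_integral[OF g_joint(2) w, symmetric, of "\<lambda>u. (Q u om)\<^sup>2"]
    stopped_integral[OF g_joint(3) w, symmetric, of "\<lambda>u. A u om * exp (E u om) * Q u om"]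
    stopped_integral[OF g_joint(4) w, symmetric, of "\<lambda>u. A u om * Q u om"]
  have Q: "(\<lambda>r om. snd (snd (X r om))) = Q" by (simp add: Q_def fun_eq_iff)
  have p: "pay om = (LBINT u:{t..hit_time T t Q om}. c u om * (A u om * exp (E u om) - eta * c u om))
    + Q (hit_time T t Q om) om * (A (hit_time T t Q om) om * exp (E (hit_time T t Q om) om) - chi * Q (hit_time T t Q om) om)
    - phi1 * (LBINT u:{t..hit_time T t Q om}. (Q u om)\<^sup>2) - phi2 * (LBINT u:{t..hit_time T t Q om}. A u om * exp (E u om) * Q u om)
    - phi3 * (LBINT u:{t..hit_time T t Q om}. A u om * Q u om)"
    unfolding payoff_def Let_def Q by (simp add: A_def E_def Q_def)
  have s: "u \<in> {t..T}" if "u \<in> {t..<T}" for u using that by simp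
  show ?thesis unfolding p pz_hit(2)[OF w]
    by (subst i, simp add: g1_def iA_def iE_def cx_eq[OF adm s w], subst i(2), simp add: g2_def iQ_def,
        subst i(3), simp add: g3_def iA_def iE_def iQ_def, subst i(4), simp add: g4_def iA_def iQ_def) (rule refl)
qed

lemma pay_measurable: "pay \<in> borel_measurable M"
proof -
  have T: "T \<in> {t..T}" using tT by simp
  note [measurable] = time_integral_measurable[OF before_joint[OF g_joint(1)]] time_integral_measurable[OF before_joint[OF g_joint(2)]]
    time_integral_measurable[OF before_joint[OF g_joint(3)]] time_integral_measurable[OF before_joint[OF g_joint(4)]] pz_T AEQ_M[OF T]
  show ?thesis by (subst measurable_cong[OF pay_eq]) measurable
qed

lemma before_integrable:
  assumes g: "jointly M g" and w: "om \<in> space M"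
    and h: "integrable lborel h" and gh: "\<And>u. u \<in> {t..<T} \<Longrightarrow> \<bar>g u om\<bar> \<le> h u" "\<And>u. 0 \<le> h u"
  shows "integrable lborel (\<lambda>u. before g u om)"
proof (rule Bochner_Integration.integrable_bound[OF h])
  show "(\<lambda>u. before g u om) \<in> borel_measurable lborel" using section_measurable'[OF before_joint[OF g] w] by simp
  have "\<bar>before g u om\<bar> \<le> h u" for u
    using gh(1)[of u] gh(2)[of u] by (auto simp: before_def pz_eq indicator_def)
  then show "AE u in lborel. norm (before g u om) \<le> norm (h u)" by (auto intro: order_trans[OF _ abs_ge_self])
qed

lemma bounded_before_integrable:
  assumes g: "jointly M g" and w: "om \<in> space M"
    and f: "continuous_on {t..T} f" and gf: "\<And>u. u \<in> {t..<T} \<Longrightarrow> g u om = f u"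
  shows "integrable lborel (\<lambda>u. before g u om)"
proof -
  obtain B where B: "0 \<le> B" "\<And>u. u \<in> {t..T} \<Longrightarrow> \<bar>f u\<bar> \<le> B" by (rule path_bounded[OF f]) blast
  have "integrable lborel (\<lambda>u. indicator {t..T} u * B)"
    using borel_integrable_atLeastAtMost'[OF continuous_on_const[of "{t..T}" B]] by (simp add: set_integrable_def)
  from before_integrable[OF g w this] show ?thesis using B gf by auto
qed

text \<open>Up to depletion the true and the clipped path coincide, and afterwards neither earns a
  reward. At \<open>T\<close> the terminal condition applies if inventory is left; otherwise the
  boundary condition makes \<open>w\<close> vanish, as the payoff does.\<close>

lemma pay_AE: "AE om in M. pay om = V.EL om + w T (V.X T om)"
  using good_paths
proof eventually_elim
  case (elim om)
  then have w: "om \<in> space M" and cx2: "integrable lborel (\<lambda>u. (cx c u om)\<^sup>2)" and cx1: "integrable lborel (\<lambda>u. cx c u om)"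
    and gbm: "\<forall>r\<in>{t..T}. A r om = gbm W1 mu1 sig1 a t r om"
    and anti': "\<forall>u v. t \<le> u \<longrightarrow> u \<le> v \<longrightarrow> v \<le> T \<longrightarrow> Q v om \<le> Q u om" and Qp': "\<forall>u\<in>{t..T}. Qp u om = max 0 (Q u om)"
    by - (elim conjE, assumption)+
  note anti = anti'[rule_format] and Qp = Qp'[rule_format]
  note Qc = AEQ_cont[OF w] and AV = A_V[OF gbm]
  \<comment> \<open>The inventory decreases from \<open>q \<ge> 0\<close>, so by the intermediate
    value theorem it is nonpositive exactly when a zero has occurred; this includes
    \<open>q = 0\<close>.\<close>
  have pz: "pz u om = (if Qp u om > 0 then 1 else 0)" if u: "u \<in> {t..T}" for u
  proof (cases "Qp u om > 0")
    case True
    then have "Q u om > 0" using Qp[OF u] by auto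
    then have "Q s om \<noteq> 0" if "s \<in> {t..u}" for s using anti[of s u] that u by force
    then show ?thesis using True by (simp add: pz_eq)
  next
    case False
    then have "Q u om \<le> 0" using Qp[OF u] by auto
    moreover have "0 \<le> Q t om" using q(1) by (simp add: Q_def sol_init[OF sol w])
    moreover have "continuous_on {t..u} (\<lambda>s. Q s om)" by (rule continuous_on_subset[OF Qc(3)]) (use u in auto)
    ultimately have "\<exists>s. t \<le> s \<and> s \<le> u \<and> Q s om = 0" using u by (intro IVT2') auto
    then show ?thesis using False by (auto simp: pz_eq)
  qed
  have i1: "integrable lborel (\<lambda>u. before g1 u om)"
  proof -
    have "continuous_on {t..T} (\<lambda>u. A u om * exp (E u om))" by (intro continuous_intros Qc)
    then obtain B where B: "0 \<le> B" "\<And>u. u \<in> {t..T} \<Longrightarrow> \<bar>A u om * exp (E u om)\<bar> \<le> B" by (rule path_bounded) blast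
    show ?thesis
    proof (rule before_integrable[OF g_joint(1) w])
      show "integrable lborel (\<lambda>u. cx c u om * B + \<bar>eta\<bar> * (cx c u om)\<^sup>2)" using cx1 cx2 by simp
      show "0 \<le> cx c u om * B + \<bar>eta\<bar> * (cx c u om)\<^sup>2" for u using B(1) by simp
      fix u assume u: "u \<in> {t..<T}"
      have "\<bar>g1 u om\<bar> = cx c u om * \<bar>A u om * exp (E u om) - eta * cx c u om\<bar>" using u by (simp add: g1_def iA_def iE_def abs_mult)
      also have "\<dots> \<le> cx c u om * (B + \<bar>eta\<bar> * cx c u om)"
      proof (rule mult_left_mono)
        have "\<bar>eta * cx c u om\<bar> = \<bar>eta\<bar> * cx c u om" by (simp add: abs_mult)
        then show "\<bar>A u om * exp (E u om) - eta * cx c u om\<bar> \<le> B + \<bar>eta\<bar> * cx c u om" using B(2)[of u] u abs_triangle_ineq4[of "A u om * exp (E u om)" "eta * cx c u om"] by auto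
      qed simp
      finally show "\<bar>g1 u om\<bar> \<le> cx c u om * B + \<bar>eta\<bar> * (cx c u om)\<^sup>2" by (simp add: power2_eq_square algebra_simps)
    qed
  qed
  have i2: "integrable lborel (\<lambda>u. before g2 u om)"
    by (rule bounded_before_integrable[OF g_joint(2) w, of "\<lambda>u. (Q u om)\<^sup>2"]) (auto simp: g2_def iQ_def intro!: continuous_intros Qc)
  have i3: "integrable lborel (\<lambda>u. before g3 u om)"
    by (rule bounded_before_integrable[OF g_joint(3) w, of "\<lambda>u. A u om * exp (E u om) * Q u om"]) (auto simp: g3_def iA_def iE_def iQ_def intro!: continuous_intros Qc)
  have i4: "integrable lborel (\<lambda>u. before g4 u om)"
    by (rule bounded_before_integrable[OF g_joint(4) w, of "\<lambda>u. A u om * Q u om"]) (auto simp: g4_def iA_def iQ_def intro!: continuous_intros Qc)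
  have ell: "indicator {t..<T} u * V.ell u om = before g1 u om - phi1 * before g2 u om - phi2 * before g3 u om - phi3 * before g4 u om" for u
  proof (cases "u \<in> {t..<T} \<and> Qp u om > 0")
    case True
    then have u: "u \<in> {t..<T}" "u \<in> {t..T}" and Qpos: "Qp u om > 0" by auto
    have "Q u om = Qp u om" using Qp[OF u(2)] Qpos by (auto simp: max_def split: if_splits)
    then show ?thesis using u Qpos pz[OF u(2)] AV[OF u(2)]
      by (simp add: V.ell_def before_def g1_def g2_def g3_def g4_def iA_def iE_def iQ_def cp_def)
  next
    case False
    then show ?thesis using pz[of u] by (auto simp: V.ell_def before_def indicator_def)
  qed
  have EL: "V.EL om = (LBINT u. before g1 u om) - phi1 * (LBINT u. before g2 u om) - phi2 * (LBINT u. before g3 u om) - phi3 * (LBINT u. before g4 u om)"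
    unfolding V.EL_def ell using i1 i2 i3 i4 by simp
  have T: "T \<in> {t..T}" using tT by simp
  have "pz T om * (Q T om * (A T om * exp (E T om) - chi * Q T om)) = w T (V.X T om)"
  proof (cases "Qp T om > 0")
    case True
    then have "Q T om = Qp T om" using Qp[OF T] by (auto simp: max_def split: if_splits)
    moreover have "w T (V.X T om) = Qp T om * (V.A T om * exp (E T om) - chi * Qp T om)"
      using terminal[of "V.A T om" "E T om" "Qp T om"] V.X_in[of T om] by (simp add: V.X_def)
    ultimately show ?thesis using True pz[OF T] AV[OF T] by simp
  next
    case False
    then have "Qp T om = 0" using Qp[OF T] by auto
    then have "w T (V.X T om) = 0" using boundary[of T "V.A T om" "E T om"] T_pos by (simp add: V.X_def V.A_def)
    then show ?thesis using False pz[OF T] by simp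
  qed
  then show ?case unfolding pay_eq[OF w] EL by simp
qed

lemma pay_expectation: "(LINT om|M. pay om) = (LINT om|M. V.EL om + w T (V.X T om))"
  using V.EL_integrable V.verification_limit(1) by (intro integral_cong_AE pay_measurable pay_AE) auto

lemma pay_le: "(LINT om|M. pay om) \<le> w t (a, e0, q)"
  unfolding pay_expectation
proof (rule V.verification_limit(2), rule AE_I2, intro ballI impI)
  fix om u assume u: "u \<in> {t..<T}" and Q: "Qp u om > 0"
  have "V.X u om = (V.A u om, E u om, Qp u om)" by (simp add: V.X_def)
  then show "V.gen u om \<le> - V.ell u om"
    using HJB_le[of u "V.A u om" "E u om" "Qp u om" "cp u om"] V.X_in[of u om] u t0 Q cp_le(1)[of u om]
    by (simp add: V.gen_def V.ell_def algebra_simps power2_eq_square)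
qed

text \<open>The feedback law is evaluated at the true state, which agrees with the clipped one as
  long as the inventory is positive. There \<open>cp\<close> is the feedback control, and the HJB
  equation holds with equality.\<close>

lemma pay_eq_w:
  assumes "AE om in M. \<forall>u\<in>{t..T}. c u om = cs u (X u om)"
  shows "(LINT om|M. pay om) = w t (a, e0, q)"
  unfolding pay_expectation
proof (rule V.verification_limit(3))
  show "AE om in M. \<forall>u\<in>{t..<T}. Qp u om > 0 \<longrightarrow> V.gen u om = - V.ell u om"
    using assms good_paths
  proof eventually_elim
    case (elim om)
    show ?case
    proof (intro ballI impI)
      fix u assume u: "u \<in> {t..<T}" and Q: "Qp u om > 0"
      have uT: "u \<in> {t..T}" using u by simp
      have "Qp u om = Q u om" using elim(2) uT Q by (auto simp: max_def split: if_splits)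
      moreover have gbm: "\<forall>r\<in>{t..T}. A r om = gbm W1 mu1 sig1 a t r om" using elim(2) by blast
      note A_V[OF gbm uT]
      ultimately have VX: "V.X u om = X u om" by (simp add: V.X_def A_def E_def Q_def)
      have "cp u om = c u om" using u Q cx_eq[OF adm uT, of om] elim(2) by (simp add: cp_def)
      then have "cp u om = cs u (V.X u om)" using elim(1) uT VX by simp
      moreover have "V.X u om = (V.A u om, E u om, Qp u om)" by (simp add: V.X_def)
      ultimately show "V.gen u om = - V.ell u om"
        using HJB_eq[of u "V.A u om" "E u om" "Qp u om" "cp u om"] V.X_in[of u om] u t0 Q
        by (simp add: V.gen_def V.ell_def algebra_simps power2_eq_square)
    qed
  qed
qed

end

section \<open>The terminal time and the conclusion\<close>

lemma LINT_singleton: "(LBINT u:{T}. f u :: real) = 0" for T :: real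
  using LINT_eq_except_point[of "\<lambda>_. 0" T "\<lambda>u. indicator {T} u * f u"] by (auto simp: set_lebesgue_integral_def)

lemma payoff_terminal:
  assumes "X T om = (a, e0, q)"
  shows "payoff eta chi phi1 phi2 phi3 T T c X om = q * (a * exp e0 - chi * q)"
proof -
  have "hit_time T T (\<lambda>r om. snd (snd (X r om))) om = T"
    using hit_time(1)[where Q="\<lambda>r om. snd (snd (X r om))" and om=om and t=T and T=T] by auto
  then show ?thesis unfolding payoff_def Let_def by (simp add: LINT_singleton assms)
qed

theorem theorem2p1:
  fixes M :: "'w measure" and W1 W2 :: "real \<Rightarrow> 'w \<Rightarrow> real"
    and T mu1 sig1 k sig2 rho eta chi phi1 phi2 phi3 q0 Qbar :: real
    and w wt :: "real \<Rightarrow> state \<Rightarrow> real"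
    and Dw :: "real \<Rightarrow> state \<Rightarrow> state \<Rightarrow>\<^sub>L real"
    and D2w :: "real \<Rightarrow> state \<Rightarrow> state \<Rightarrow>\<^sub>L (state \<Rightarrow>\<^sub>L real)"
    and cs :: "real \<Rightarrow> state \<Rightarrow> real"
    and C p1 p2 :: real
  assumes M: "prob_space M"
    and BM1: "is_std_BM M T W1" and BM2: "is_std_BM M T W2"
    and indepW: "prob_space.indep_var M (PiM {0..T} (\<lambda>_. borel)) (\<lambda>\<omega>. restrict (\<lambda>u. W1 u \<omega>) {0..T})
                   (PiM {0..T} (\<lambda>_. borel)) (\<lambda>\<omega>. restrict (\<lambda>u. W2 u \<omega>) {0..T})"
    and T: "T > 0" and mu1: "mu1 > 0" and sig1: "sig1 > 0" and k: "k > 0" and sig2: "sig2 > 0"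
    and rho: "-1 \<le> rho" "rho \<le> 1" and eta: "eta \<ge> 0"
    and q0: "0 < q0" "q0 < Qbar"
    and C12: "C12_on {0..<T} (stateO Qbar) w wt Dw D2w"
    and cont: "continuous_on ({0..T} \<times> stateO_cl Qbar) (\<lambda>(t,x). w t x)"
    and pos: "p1 > 0" "p2 > 0" "C > 0"
    and growth: "\<forall>t\<in>{0..T}. \<forall>a e q. (a, e, q) \<in> stateO Qbar \<longrightarrow>
                   \<bar>w t (a, e, q)\<bar> \<le> C * (1 + q\<^sup>2) * (1 + a powr p1) * (1 + exp (p2 * e))"
    and cs_meas: "(\<lambda>(t,x). cs t x) \<in> measurable (restrict_space borel ({0..<T} \<times> stateO Qbar)) borel"
    and HJB: "\<forall>t\<in>{0..<T}. \<forall>a e q. (a, e, q) \<in> stateO Qbar \<longrightarrow>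
        (let x = (a, e, q); wq = d1 (Dw t x) eq; c0 = cs t x;
             Lw = op_L mu1 sig1 k sig2 rho (Dw t x) (D2w t x) x;
             R = phi1 * q\<^sup>2 + phi2 * q * a * exp e + phi3 * q * a
         in ereal (wt t x + Lw - R)
              + (SUP c\<in>{0..}. ereal (- c * wq + a * exp e * c - eta * c\<^sup>2))
            = ereal (wt t x + Lw - c0 * wq + a * exp e * c0 - eta * c0\<^sup>2 - R)
          \<and> wt t x + Lw - c0 * wq + a * exp e * c0 - eta * c0\<^sup>2 - R = 0)"
    and terminal: "\<forall>a e q. (a, e, q) \<in> stateO Qbar \<longrightarrow> w T (a, e, q) = q * (a * exp e - chi * q)"
    and boundary: "\<forall>t\<in>{0..T}. \<forall>a e. a > 0 \<longrightarrow> w t (a, e, 0) = 0"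
    and closed_loop: "\<forall>t\<in>{0..T}. \<forall>x\<in>stateO Qbar.
        (\<exists>X. sde_sol M W1 W2 T mu1 sig1 k sig2 rho (\<lambda>u \<omega>. cs u (X u \<omega>)) t x X) \<and>
        (\<forall>X Y. sde_sol M W1 W2 T mu1 sig1 k sig2 rho (\<lambda>u \<omega>. cs u (X u \<omega>)) t x X \<longrightarrow>
               sde_sol M W1 W2 T mu1 sig1 k sig2 rho (\<lambda>u \<omega>. cs u (Y u \<omega>)) t x Y \<longrightarrow>
               (AE \<omega> in M. \<forall>r\<in>{t..T}. X r \<omega> = Y r \<omega>)) \<and>
        (\<forall>X. sde_sol M W1 W2 T mu1 sig1 k sig2 rho (\<lambda>u \<omega>. cs u (X u \<omega>)) t x X \<longrightarrow>
               admissible M W1 W2 T t (\<lambda>u \<omega>. cs u (X u \<omega>)))"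
  shows "\<forall>t\<in>{0..T}. \<forall>x\<in>stateO Qbar.
           ereal (w t x) = value_fn M W1 W2 T mu1 sig1 k sig2 rho eta chi phi1 phi2 phi3 t x"
proof (intro ballI)
  fix t x assume tT: "t \<in> {0..T}" and x: "x \<in> stateO Qbar"
  obtain a e0 q where x_eq: "x = (a, e0, q)" by (cases x)
  have aq: "a > 0" "0 \<le> q" "q < Qbar" using x by (auto simp: x_eq stateO_def)
  let ?perf = "\<lambda>c. perf M W1 W2 T mu1 sig1 k sig2 rho eta chi phi1 phi2 phi3 c t x"
  interpret sde_model M W1 W2 T t mu1 sig1 k sig2 rho
    by (intro sde_model.intro controls.intro bm2.intro bm2_axioms.intro controls_axioms.intro sde_model_axioms.intro)
       (use M BM1 BM2 indepW T k tT in auto)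
  have HJB_sup: "wt s (a, e, q) + op_L mu1 sig1 k sig2 rho (Dw s (a, e, q)) (D2w s (a, e, q)) (a, e, q) - v * d1 (Dw s (a, e, q)) eq
          + a * exp e * v - eta * v\<^sup>2 - (phi1 * q\<^sup>2 + phi2 * q * a * exp e + phi3 * q * a) \<le> 0"
    if s: "s \<in> {0..<T}" "(a, e, q) \<in> stateO Qbar" and v: "v \<ge> 0" for s a e q v
  proof -
    let ?K = "wt s (a, e, q) + op_L mu1 sig1 k sig2 rho (Dw s (a, e, q)) (D2w s (a, e, q)) (a, e, q) - (phi1 * q\<^sup>2 + phi2 * q * a * exp e + phi3 * q * a)"
    let ?h = "\<lambda>c. ereal (- c * d1 (Dw s (a, e, q)) eq + a * exp e * c - eta * c\<^sup>2)"
    \<comment> \<open>The extended sum is the finite number 0, so each single value below the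
      supremum can be compared with it directly.\<close>
    have z: "ereal ?K + (SUP c\<in>{0..}. ?h c) = ereal 0"
      using HJB[rule_format, OF s] unfolding Let_def by metis
    have "ereal ?K + ?h v \<le> ereal ?K + (SUP c\<in>{0..}. ?h c)" using v by (intro add_left_mono SUP_upper) simp
    then show ?thesis unfolding z by (simp add: algebra_simps)
  qed
  interpret hjb_model M W1 W2 T t mu1 sig1 k sig2 rho Qbar w wt Dw D2w eta chi phi1 phi2 phi3 C p1 p2 cs
  proof
    show "C12_on {0..<T} (stateO Qbar) w wt Dw D2w" by (rule C12)
    show "continuous_on ({0..T} \<times> stateO_cl Qbar) (\<lambda>(t, x). w t x)" by (rule cont)
    show "rho\<^sup>2 \<le> 1" using rho by (simp add: abs_square_le_1)
    show "p1 > 0" "p2 > 0" "C > 0" by (rule pos)+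
    show "\<bar>w s (a, e, q)\<bar> \<le> C * (1 + q\<^sup>2) * (1 + a powr p1) * (1 + exp (p2 * e))" if "s \<in> {0..T}" "(a, e, q) \<in> stateO Qbar" for s a e q
      using growth that by blast
    show "w s (a, e, 0) = 0" if "s \<in> {0..T}" "a > 0" for s a e using boundary that by blast
    show "w T (a, e, q) = q * (a * exp e - chi * q)" if "(a, e, q) \<in> stateO Qbar" for a e q using terminal that by blast
  qed (use HJB_sup HJB in \<open>auto simp: Let_def algebra_simps\<close>)
  obtain X0 where X0: "sol (\<lambda>u om. cs u (X0 u om)) x X0" and adm0: "adm (\<lambda>u om. cs u (X0 u om))"
    using closed_loop tT x by blast
  \<comment> \<open>\<open>perf\<close> evaluates whatever \<open>SOME\<close> returns, so existence
    for the control at hand has to come first.\<close>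
  have some: "sol c (a, e0, q) (SOME X. sol c x X)" if "adm c" for c
    using someI_ex[OF sol_exists[OF adm0 X0[unfolded x_eq] that]] by (simp add: x_eq)
  \<comment> \<open>The stages need \<open>t < T\<close>; at \<open>t = T\<close> the time integrals
    vanish and the payoff is the terminal reward.\<close>
  have at_T: "?perf c = w t x" if c: "adm c" and "\<not> t < T" for c
  proof -
    have T: "t = T" using that(2) tT by simp
    have "?perf c = (LINT om|M. q * (a * exp e0 - chi * q))"
      unfolding perf_payoff
    proof (rule Bochner_Integration.integral_cong[OF refl])
      fix om assume "om \<in> space M"
      from sol_init[OF some[OF c] this]
      show "payoff eta chi phi1 phi2 phi3 T t c (SOME X. sol c x X) om = q * (a * exp e0 - chi * q)" unfolding T by (rule payoff_terminal)
    qed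
    also have "\<dots> = w t x" using terminal x by (simp add: T x_eq prob_space)
    finally show ?thesis .
  qed
  have le: "?perf c \<le> w t x" if c: "adm c" for c
  proof (cases "t < T")
    case True
    interpret controlled M W1 W2 T t mu1 sig1 k sig2 rho Qbar w wt Dw D2w eta chi phi1 phi2 phi3 C p1 p2 cs c a e0 q "SOME X. sol c x X"
      by unfold_locales (use c some[OF c] aq True in auto)
    show ?thesis using pay_le by (simp add: perf_payoff x_eq)
  qed (use at_T[OF c] in simp)
  have ge: "w t x \<le> ?perf (\<lambda>u om. cs u (X0 u om))"
  proof (cases "t < T")
    case True
    interpret controlled M W1 W2 T t mu1 sig1 k sig2 rho Qbar w wt Dw D2w eta chi phi1 phi2 phi3 C p1 p2 cs
        "\<lambda>u om. cs u (X0 u om)" a e0 q "SOME X. sol (\<lambda>u om. cs u (X0 u om)) x X"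
      by unfold_locales (use adm0 some[OF adm0] aq True in auto)
    \<comment> \<open>The control was built from \<open>X0\<close>, but \<open>perf\<close> follows
      the solution picked by \<open>SOME\<close>; uniqueness makes the control a feedback along that
      solution as well.\<close>
    have "AE om in M. \<forall>u\<in>{t..T}. cs u (X0 u om) = cs u ((SOME X. sol (\<lambda>u om. cs u (X0 u om)) x X) u om)"
      using sol_unique[OF adm0 X0[unfolded x_eq] some[OF adm0] True] by eventually_elim simp
    from pay_eq_w[OF this] show ?thesis by (simp add: perf_payoff x_eq)
  qed (use at_T[OF adm0] in simp)
  show "ereal (w t x) = value_fn M W1 W2 T mu1 sig1 k sig2 rho eta chi phi1 phi2 phi3 t x"
    unfolding value_fn_def
  proof (rule antisym)
    show "ereal (w t x) \<le> (SUP c\<in>{c. adm c}. ereal (?perf c))" using ge adm0 by (intro SUP_upper2[of "\<lambda>u om. cs u (X0 u om)"]) auto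
    show "(SUP c\<in>{c. adm c}. ereal (?perf c)) \<le> ereal (w t x)" using le by (intro SUP_least) auto
  qed
qed

end
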